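(* Let $\Omega\subset\mathbb{R}^2$ be a bounded Lipschitz domain, $V\in L^\infty(\Omega)$, $\eta\in L^\infty(\partial\Omega)$ (possibly complex-valued), $q:=1+V$, $k\in\mathbb{R}_+$, and let $v\in H^2(\Omega)$ and $w\in H^1(\Omega)$ be nontrivial solutions (conductive transmission eigenfunctions) of $$\Delta w+k^2(1+V)w=0 \text{ in }\Omega,\qquad \Delta v+k^2v=0\text{ in }\Omega,\qquad w=v,\ \ \partial_\nu v+\eta v=\partial_\nu w\ \text{ on }\partial\Omega .$$ Assume that $\Omega$ contains a corner with vertex $0\in\partial\Omega$, i.e. $\Omega\cap B_h=W\cap B_h=S_h$ for a sufficiently small $h\in\mathbb{R}_+$, and that for this $h$ and some $0<\alpha<1$ one has $qw\in C^\alpha(\overline{S_h})$, $\eta\in C^\alpha(\overline{\Gamma_h^\pm})$ and $v-w\in H^2(\Sigma_{\Lambda_h})$. Assume further that (a) $\eta(0)\neq0$; (b) $-\pi<\theta_m<\theta_M<\pi$ and $\theta_M-\theta_m\neq\pi$. Then $v(0)=w(0)=0$.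
   Context: $\nu$ is the exterior unit normal to $\partial\Omega$. For $h>0$, $B_h$ is the open disc of radius $h$ centered at $0$ in $\mathbb{R}^2$. The sector is $W=\{x\in\mathbb{R}^2: x\neq0,\ \theta_m<\arg(x_1+ix_2)<\theta_M\}$ with $-\pi<\theta_m<\theta_M<\pi$; its boundary rays are $\Gamma^+$ (polar angle $\theta_M$) and $\Gamma^-$ (polar angle $\theta_m$). Set $S_h=W\cap B_h$, $\Gamma_h^\pm=\Gamma^\pm\cap B_h$, $\Lambda_h=W\cap\partial B_h$, $\Sigma_{\Lambda_h}=S_h\setminus S_{h/2}$. *)

theory Defs
  imports "HOL-Analysis.Analysis"
begin

section \<open>Smooth functions and Sobolev spaces\<close>

definition partial :: "2 \<Rightarrow> (real^2 \<Rightarrow> complex) \<Rightarrow> real^2 \<Rightarrow> complex" where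
  "partial i f x = frechet_derivative f (at x) (axis i 1)"

definition laplacian :: "(real^2 \<Rightarrow> complex) \<Rightarrow> real^2 \<Rightarrow> complex" where
  "laplacian f x = (\<Sum>i\<in>UNIV. partial i (partial i f) x)"

primrec Ck :: "nat \<Rightarrow> (real^2 \<Rightarrow> complex) \<Rightarrow> bool" where
  "Ck 0 f \<longleftrightarrow> continuous_on UNIV f"
| "Ck (Suc n) f \<longleftrightarrow> (\<forall>x. f differentiable (at x)) \<and> (\<forall>i. Ck n (partial i f))"

definition smooth :: "(real^2 \<Rightarrow> complex) \<Rightarrow> bool" where
  "smooth f \<longleftrightarrow> (\<forall>n. Ck n f)"

definition test_function :: "(real^2) set \<Rightarrow> (real^2 \<Rightarrow> complex) \<Rightarrow> bool" where
  "test_function \<Omega> \<phi> \<longleftrightarrow>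
     smooth \<phi> \<and> compact (closure {x. \<phi> x \<noteq> 0}) \<and> closure {x. \<phi> x \<noteq> 0} \<subseteq> \<Omega>"

definition locally_integrable :: "(real^2) set \<Rightarrow> (real^2 \<Rightarrow> complex) \<Rightarrow> bool" where
  "locally_integrable \<Omega> u \<longleftrightarrow> (\<forall>K. compact K \<and> K \<subseteq> \<Omega> \<longrightarrow> integrable (lebesgue_on K) u)"

definition square_integrable :: "(real^2) set \<Rightarrow> (real^2 \<Rightarrow> complex) \<Rightarrow> bool" where
  "square_integrable \<Omega> u \<longleftrightarrow>
     u \<in> borel_measurable (lebesgue_on \<Omega>) \<and> integrable (lebesgue_on \<Omega>) (\<lambda>x. (norm (u x))\<^sup>2)"

definition weak_partial ::
    "(real^2) set \<Rightarrow> 2 \<Rightarrow> (real^2 \<Rightarrow> complex) \<Rightarrow> (real^2 \<Rightarrow> complex) \<Rightarrow> bool" where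
  "weak_partial \<Omega> i u d \<longleftrightarrow> locally_integrable \<Omega> u \<and> locally_integrable \<Omega> d \<and>
     (\<forall>\<phi>. test_function \<Omega> \<phi> \<longrightarrow>
        integral\<^sup>L (lebesgue_on \<Omega>) (\<lambda>x. u x * partial i \<phi> x) =
        - integral\<^sup>L (lebesgue_on \<Omega>) (\<lambda>x. d x * \<phi> x))"

definition weak_laplacian ::
    "(real^2) set \<Rightarrow> (real^2 \<Rightarrow> complex) \<Rightarrow> (real^2 \<Rightarrow> complex) \<Rightarrow> bool" where
  "weak_laplacian \<Omega> u f \<longleftrightarrow> locally_integrable \<Omega> u \<and> locally_integrable \<Omega> f \<and>
     (\<forall>\<phi>. test_function \<Omega> \<phi> \<longrightarrow>
        integral\<^sup>L (lebesgue_on \<Omega>) (\<lambda>x. u x * laplacian \<phi> x) =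
        integral\<^sup>L (lebesgue_on \<Omega>) (\<lambda>x. f x * \<phi> x))"

text \<open>\<open>sobolev m \<Omega> u\<close> expresses that \<open>u\<close> represents an element of \<open>H\<^sup>m(\<Omega>) = W\<^sup>m\<^sup>,\<^sup>2(\<Omega>)\<close>, for open
  \<open>\<Omega>\<close>.  Functions are total; their values outside \<open>\<Omega>\<close> and on null sets are irrelevant.\<close>

primrec sobolev :: "nat \<Rightarrow> (real^2) set \<Rightarrow> (real^2 \<Rightarrow> complex) \<Rightarrow> bool" where
  "sobolev 0 \<Omega> u \<longleftrightarrow> square_integrable \<Omega> u"
| "sobolev (Suc m) \<Omega> u \<longleftrightarrow>
     square_integrable \<Omega> u \<and> (\<forall>i. \<exists>d. weak_partial \<Omega> i u d \<and> sobolev m \<Omega> d)"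

definition essentially_bounded :: "'a measure \<Rightarrow> ('a \<Rightarrow> complex) \<Rightarrow> bool" where
  "essentially_bounded M f \<longleftrightarrow> f \<in> borel_measurable M \<and> (\<exists>C. AE x in M. norm (f x) \<le> C)"

definition holder_on :: "real \<Rightarrow> (real^2) set \<Rightarrow> (real^2 \<Rightarrow> complex) \<Rightarrow> bool" where
  "holder_on \<alpha> S f \<longleftrightarrow> (\<exists>C. \<forall>x\<in>S. \<forall>y\<in>S. norm (f x - f y) \<le> C * dist x y powr \<alpha>)"

text \<open>The value at \<open>x\<^sub>0 \<in> closure \<Omega>\<close> of an almost-everywhere class on \<open>\<Omega>\<close>: the value of a
  representative that is continuous at \<open>x\<^sub>0\<close>.  It is unique if \<open>\<Omega>\<close> is open.\<close>

definition point_value :: "(real^2) set \<Rightarrow> (real^2 \<Rightarrow> complex) \<Rightarrow> real^2 \<Rightarrow> complex \<Rightarrow> bool" where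
  "point_value \<Omega> u x\<^sub>0 c \<longleftrightarrow>
     (\<exists>u'. (AE x in lebesgue_on \<Omega>. u' x = u x) \<and> continuous (at x\<^sub>0 within insert x\<^sub>0 \<Omega>) u' \<and> u' x\<^sub>0 = c)"

section \<open>Lipschitz domains, surface measure, boundary values\<close>

definition bounded_lipschitz_domain :: "(real^2) set \<Rightarrow> bool" where
  "bounded_lipschitz_domain \<Omega> \<longleftrightarrow> open \<Omega> \<and> connected \<Omega> \<and> \<Omega> \<noteq> {} \<and> bounded \<Omega> \<and>
     (\<forall>p\<in>frontier \<Omega>. \<exists>R g L r. orthogonal_transformation (R :: real^2 \<Rightarrow> real^2) \<and>
        L-lipschitz_on UNIV (g :: real \<Rightarrow> real) \<and> r > 0 \<and>
        \<Omega> \<inter> ball p r = {x \<in> ball p r. R (x - p) $ 2 > g (R (x - p) $ 1)})"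

text \<open>One-dimensional Hausdorff measure.  The diameter of an unbounded set is unspecified, hence
  the restriction to bounded covering sets.\<close>

definition hausdorff_pre :: "real \<Rightarrow> (real^2) set \<Rightarrow> ennreal" where
  "hausdorff_pre \<delta> A =
     (INF C \<in> {C :: nat \<Rightarrow> (real^2) set. A \<subseteq> (\<Union>i. C i) \<and> (\<forall>i. bounded (C i) \<and> diameter (C i) \<le> \<delta>)}.
        \<Sum>i. ennreal (diameter (C i)))"

definition hausdorff_outer :: "(real^2) set \<Rightarrow> ennreal" where
  "hausdorff_outer A = (SUP \<delta>\<in>{0<..}. hausdorff_pre \<delta> A)"

definition hausdorff_measure :: "(real^2) measure" where
  "hausdorff_measure = measure_of UNIV (sets borel) hausdorff_outer"

text \<open>\<open>hausdorff_outer\<close> is countably additive on the Borel sets, so the measure above is not the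
  null measure to which \<open>measure_of\<close> defaults.\<close>

lemma hausdorff_pre_mono: "A \<subseteq> B \<Longrightarrow> hausdorff_pre \<delta> A \<le> hausdorff_pre \<delta> B"
  unfolding hausdorff_pre_def by (rule INF_superset_mono) auto

lemma hausdorff_pre_antimono: "\<delta> \<le> \<epsilon> \<Longrightarrow> hausdorff_pre \<epsilon> A \<le> hausdorff_pre \<delta> A"
  unfolding hausdorff_pre_def by (rule INF_superset_mono) (auto intro: order_trans)

lemma hausdorff_pre_empty: "\<delta> > 0 \<Longrightarrow> hausdorff_pre \<delta> {} = 0"
  unfolding hausdorff_pre_def
  by (intro antisym INF_lower2[where i="\<lambda>_. {}"]) auto

lemma hausdorff_pre_subadditive:
  "hausdorff_pre \<delta> (\<Union>i. A i) \<le> (\<Sum>i. hausdorff_pre \<delta> (A i))"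
proof (rule ennreal_le_epsilon)
  fix e :: real
  assume fin: "(\<Sum>i. hausdorff_pre \<delta> (A i)) < top" and e: "0 < e"
  define ek where "ek n = ennreal (e * (1/2) ^ Suc n)" for n
  have ek: "ek n > 0" "(\<Sum>n. ek n) = ennreal e" for n
  proof -
    show "ek n > 0" using e by (simp add: ek_def)
    have "(\<lambda>n. e * (1/2) ^ Suc n) sums (e * 1)"
      by (intro sums_mult power_half_series)
    then show "(\<Sum>n. ek n) = ennreal e"
      unfolding ek_def using e by (subst suminf_ennreal2) (auto simp: sums_iff)
  qed
  have "\<exists>C. A n \<subseteq> (\<Union>i. C i) \<and> (\<forall>i. bounded (C i) \<and> diameter (C i) \<le> \<delta>) \<and>
      (\<Sum>i. ennreal (diameter (C i))) < hausdorff_pre \<delta> (A n) + ek n" for n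
  proof -
    have "hausdorff_pre \<delta> (A n) < top"
      using fin by (metis ennreal_suminf_lessD)
    then have "hausdorff_pre \<delta> (A n) < hausdorff_pre \<delta> (A n) + ek n"
      using e by (cases "hausdorff_pre \<delta> (A n)")
        (simp_all add: ek_def ennreal_less_iff flip: ennreal_plus)
    then show ?thesis
      by (subst (asm) hausdorff_pre_def) (auto simp: INF_less_iff)
  qed
  then obtain C where C: "\<And>n. A n \<subseteq> (\<Union>i. C n i)"
      "\<And>n i. bounded (C n i) \<and> diameter (C n i) \<le> \<delta>"
      "\<And>n. (\<Sum>i. ennreal (diameter (C n i))) < hausdorff_pre \<delta> (A n) + ek n"
    by metis
  define D where "D m = (case prod_decode m of (n, i) \<Rightarrow> C n i)" for m
  have "(\<Union>i. A i) \<subseteq> (\<Union>m. D m)"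
  proof
    fix x assume "x \<in> (\<Union>i. A i)"
    then obtain n i where "x \<in> C n i" using C(1) by blast
    then have "x \<in> D (prod_encode (n, i))" by (simp add: D_def)
    then show "x \<in> (\<Union>m. D m)" by blast
  qed
  moreover have "bounded (D m) \<and> diameter (D m) \<le> \<delta>" for m
    using C(2) by (auto simp: D_def split: prod.split)
  ultimately have "hausdorff_pre \<delta> (\<Union>i. A i) \<le> (\<Sum>m. ennreal (diameter (D m)))"
    unfolding hausdorff_pre_def by (intro INF_lower) auto
  also have "\<dots> = (\<Sum>m. (\<lambda>(n,i). ennreal (diameter (C n i))) (prod_decode m))"
    by (simp add: D_def case_prod_unfold)
  also have "\<dots> = (\<Sum>n. \<Sum>i. ennreal (diameter (C n i)))"
    using suminf_ennreal_2dimen[of "\<lambda>n. \<Sum>i. ennreal (diameter (C n i))"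
       "\<lambda>(n,i). ennreal (diameter (C n i))"] by (simp add: comp_def)
  also have "\<dots> \<le> (\<Sum>n. hausdorff_pre \<delta> (A n) + ek n)"
    using C(3) by (intro suminf_le) (auto intro: less_imp_le)
  also have "\<dots> = (\<Sum>n. hausdorff_pre \<delta> (A n)) + ennreal e"
    by (subst suminf_add[symmetric]) (auto simp: ek)
  finally show "hausdorff_pre \<delta> (\<Union>i. A i) \<le> (\<Sum>i. hausdorff_pre \<delta> (A i)) + ennreal e" .
qed

lemma hausdorff_outer_mono: "A \<subseteq> B \<Longrightarrow> hausdorff_outer A \<le> hausdorff_outer B"
  unfolding hausdorff_outer_def by (intro SUP_mono) (use hausdorff_pre_mono in blast)

lemma hausdorff_outer_empty [simp]: "hausdorff_outer {} = 0"
  by (simp add: hausdorff_outer_def hausdorff_pre_empty cong: SUP_cong_simp)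

lemma hausdorff_outer_subadditive:
  "hausdorff_outer (\<Union>i. A i) \<le> (\<Sum>i. hausdorff_outer (A i))"
  unfolding hausdorff_outer_def[of "\<Union>i. A i"]
proof (rule SUP_least)
  fix \<delta> :: real assume d: "\<delta> \<in> {0<..}"
  have "hausdorff_pre \<delta> (\<Union>i. A i) \<le> (\<Sum>i. hausdorff_pre \<delta> (A i))"
    by (rule hausdorff_pre_subadditive)
  also have "\<dots> \<le> (\<Sum>i. hausdorff_outer (A i))"
    unfolding hausdorff_outer_def using d by (intro suminf_le SUP_upper) auto
  finally show "hausdorff_pre \<delta> (\<Union>i. A i) \<le> (\<Sum>i. hausdorff_outer (A i))" .
qed

lemma outer_measure_space_hausdorff: "outer_measure_space (Pow UNIV) hausdorff_outer"
  unfolding outer_measure_space_def positive_def increasing_def countably_subadditive_def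
  using hausdorff_outer_mono hausdorff_outer_subadditive by auto

lemma hausdorff_outer_Un_le: "hausdorff_outer (A \<union> B) \<le> hausdorff_outer A + hausdorff_outer B"
proof -
  have "hausdorff_outer (A \<union> B) = hausdorff_outer (\<Union>i. binaryset A B i)"
    by (simp add: UN_binaryset_eq)
  also have "\<dots> \<le> (\<Sum>i. hausdorff_outer (binaryset A B i))"
    by (rule hausdorff_outer_subadditive)
  also have "\<dots> = hausdorff_outer A + hausdorff_outer B"
    by (rule suminf_binaryset_eq) simp
  finally show ?thesis .
qed

lemma hausdorff_outer_separated:
  assumes e: "\<epsilon> > 0" and sep: "\<And>x y. x \<in> A \<Longrightarrow> y \<in> B \<Longrightarrow> \<epsilon> \<le> dist x y"
  shows "hausdorff_outer A + hausdorff_outer B \<le> hausdorff_outer (A \<union> B)"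
proof -
  have *: "hausdorff_pre \<delta> A + hausdorff_pre \<delta> B \<le> hausdorff_pre \<delta> (A \<union> B)"
    if d: "0 < \<delta>" "\<delta> < \<epsilon>" for \<delta>
    unfolding hausdorff_pre_def[of \<delta> "A \<union> B"]
  proof (rule INF_greatest, clarify)
    fix C :: "nat \<Rightarrow> (real^2) set"
    assume C: "A \<union> B \<subseteq> (\<Union>i. C i)" "\<forall>i. bounded (C i) \<and> diameter (C i) \<le> \<delta>"
    define CA where "CA i = (if C i \<inter> A = {} then {} else C i)" for i
    define CB where "CB i = (if C i \<inter> A = {} then C i else {})" for i
    have "hausdorff_pre \<delta> A \<le> (\<Sum>i. ennreal (diameter (CA i)))"
      unfolding hausdorff_pre_def using C d(1) by (intro INF_lower) (auto simp: CA_def, blast)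
    moreover have "hausdorff_pre \<delta> B \<le> (\<Sum>i. ennreal (diameter (CB i)))"
      unfolding hausdorff_pre_def
    proof (rule INF_lower, clarify, intro conjI allI)
      show "B \<subseteq> (\<Union>i. CB i)"
      proof
        fix y assume y: "y \<in> B"
        then obtain i where i: "y \<in> C i" using C(1) by blast
        have "C i \<inter> A = {}"
        proof (rule ccontr)
          assume "C i \<inter> A \<noteq> {}"
          then obtain x where x: "x \<in> C i" "x \<in> A" by blast
          have "dist x y \<le> diameter (C i)"
            using C(2) x i by (intro diameter_bounded_bound) auto
          also have "\<dots> < \<epsilon>" using C(2) d(2) by (meson le_less_trans)
          finally show False using sep[OF x(2) y] by simp
        qed
        then show "y \<in> (\<Union>i. CB i)" using i by (auto simp: CB_def)
      qed
      show "bounded (CB i)" "diameter (CB i) \<le> \<delta>" for i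
        using C(2) d(1) by (auto simp: CB_def)
    qed
    ultimately have "hausdorff_pre \<delta> A + hausdorff_pre \<delta> B \<le>
        (\<Sum>i. ennreal (diameter (CA i))) + (\<Sum>i. ennreal (diameter (CB i)))"
      by (rule add_mono)
    also have "\<dots> = (\<Sum>i. ennreal (diameter (CA i)) + ennreal (diameter (CB i)))"
      by (rule suminf_add) auto
    also have "\<dots> = (\<Sum>i. ennreal (diameter (C i)))"
      by (rule arg_cong[where f=suminf]) (auto simp: CA_def CB_def)
    finally show "hausdorff_pre \<delta> A + hausdorff_pre \<delta> B \<le> (\<Sum>i. ennreal (diameter (C i)))" .
  qed
  have "hausdorff_outer A + hausdorff_outer B =
      (SUP \<delta>\<in>{0<..}. hausdorff_pre \<delta> A + hausdorff_pre \<delta> B)"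
    unfolding hausdorff_outer_def
  proof (rule SUP_add_directed_ennreal[symmetric])
    fix i j :: real assume ij: "i \<in> {0<..}" "j \<in> {0<..}"
    show "\<exists>k\<in>{0<..}. hausdorff_pre i A + hausdorff_pre j B \<le> hausdorff_pre k A + hausdorff_pre k B"
      using ij by (intro bexI[of _ "min i j"] add_mono hausdorff_pre_antimono) auto
  qed
  also have "\<dots> \<le> hausdorff_outer (A \<union> B)"
  proof (rule SUP_least)
    fix \<delta> :: real assume d: "\<delta> \<in> {0<..}"
    define \<delta>' where "\<delta>' = min \<delta> (\<epsilon> / 2)"
    have d': "0 < \<delta>'" "\<delta>' < \<epsilon>" "\<delta>' \<le> \<delta>" using d e by (auto simp: \<delta>'_def)
    have "hausdorff_pre \<delta> A + hausdorff_pre \<delta> B \<le> hausdorff_pre \<delta>' A + hausdorff_pre \<delta>' B"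
      using d' by (intro add_mono hausdorff_pre_antimono)
    also have "\<dots> \<le> hausdorff_pre \<delta>' (A \<union> B)" using d' by (intro *)
    also have "\<dots> \<le> hausdorff_outer (A \<union> B)"
      unfolding hausdorff_outer_def using d' by (intro SUP_upper) auto
    finally show "hausdorff_pre \<delta> A + hausdorff_pre \<delta> B \<le> hausdorff_outer (A \<union> B)" .
  qed
  finally show ?thesis .
qed

lemma hausdorff_outer_separated_sum:
  assumes "\<And>i j x y. i < j \<Longrightarrow> x \<in> B i \<Longrightarrow> y \<in> B j \<Longrightarrow> \<epsilon> j \<le> dist x y" and "\<And>j. \<epsilon> j > 0"
  shows "(\<Sum>i<n::nat. hausdorff_outer (B i)) \<le> hausdorff_outer (\<Union>i<n. B i)"
proof (induction n)
  case (Suc n)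
  have "(\<Sum>i<Suc n. hausdorff_outer (B i)) \<le> hausdorff_outer (\<Union>i<n. B i) + hausdorff_outer (B n)"
    using Suc by (simp add: add_right_mono)
  also have "\<dots> \<le> hausdorff_outer ((\<Union>i<n. B i) \<union> B n)"
    using assms by (intro hausdorff_outer_separated[of "\<epsilon> n"]) auto
  also have "(\<Union>i<n. B i) \<union> B n = (\<Union>i<Suc n. B i)"
    by (auto simp: lessThan_Suc)
  finally show ?case .
qed simp

lemma hausdorff_caratheodory_closed:
  assumes F: "closed F"
  shows "hausdorff_outer (A \<inter> F) + hausdorff_outer (A - F) \<le> hausdorff_outer A"
proof (cases "hausdorff_outer A = top \<or> F = {}")
  case True
  then show ?thesis by auto
next
  case False
  then have fin: "hausdorff_outer A \<noteq> top" and ne: "F \<noteq> {}" by auto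
  define T where "T n = {x \<in> A. infdist x F \<ge> 1 / Suc n}" for n :: nat
  define B where "B n = T (Suc n) - T n" for n
  have lip: "infdist x F \<le> infdist y F + dist x y" for x y :: "real^2"
    by (rule infdist_triangle)
  have sepT: "dist x y \<ge> 1 / Suc n - 1 / Suc (Suc n)" if "x \<in> T n" "y \<notin> T (Suc n)" "y \<in> A" for x y n
    using lip[of x y] that by (auto simp: T_def)
  have pos: "1 / Suc n - 1 / Suc (Suc n) > (0::real)" for n :: nat
    by (simp add: frac_less2)
  have Tmono: "T m \<subseteq> T n" if "m \<le> n" for m n
  proof -
    have "1 / real (Suc n) \<le> 1 / real (Suc m)" using that by (simp add: frac_le)
    then show ?thesis by (fastforce simp: T_def)
  qed
  have sub: "(\<Sum>n<N. hausdorff_outer (B (2*n + p))) \<le> hausdorff_outer A" for N p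
  proof -
    have "(\<Sum>n<N. hausdorff_outer (B (2*n + p))) \<le> hausdorff_outer (\<Union>n<N. B (2*n+p))"
    proof (rule hausdorff_outer_separated_sum[where \<epsilon> = "\<lambda>j. 1 / Suc (2*j+p-1) - 1 / Suc (Suc (2*j+p-1))"])
      fix i j :: nat and x y assume ij: "i < j" and x: "x \<in> B (2*i+p)" and y: "y \<in> B (2*j+p)"
      have "x \<in> T (2*j+p-1)" proof -
        have "Suc (2*i+p) \<le> 2*j+p-1" using ij by linarith
        then show ?thesis using x Tmono[of "Suc (2*i+p)" "2*j+p-1"] by (auto simp: B_def)
      qed
      moreover have "y \<notin> T (Suc (2*j+p-1))" using y ij by (auto simp: B_def)
      moreover have "y \<in> A" using y by (auto simp: B_def T_def)
      ultimately show "1 / Suc (2*j+p-1) - 1 / Suc (Suc (2*j+p-1)) \<le> dist x y"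
        by (rule sepT)
    qed (rule pos)
    also have "\<dots> \<le> hausdorff_outer A"
      by (intro hausdorff_outer_mono) (auto simp: B_def T_def)
    finally show ?thesis .
  qed
  have sum2: "(\<Sum>n<2*N. f n) = (\<Sum>n<N. f (2*n)) + (\<Sum>n<N. f (2*n+1))" for f :: "nat \<Rightarrow> ennreal" and N
    by (induction N) (auto simp: add_ac)
  have "(\<Sum>n. hausdorff_outer (B n)) \<le> hausdorff_outer A + hausdorff_outer A"
  proof (rule suminf_le_const[OF summableI])
    fix N
    have "(\<Sum>n<N. hausdorff_outer (B n)) \<le> (\<Sum>n<2*N. hausdorff_outer (B n))"
      by (rule sum_mono2) auto
    also have "\<dots> \<le> hausdorff_outer A + hausdorff_outer A"
      unfolding sum2 using sub[of 0 N] sub[of 1 N] by (intro add_mono) auto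
    finally show "(\<Sum>n<N. hausdorff_outer (B n)) \<le> hausdorff_outer A + hausdorff_outer A" .
  qed
  then have finB: "(\<Sum>n. hausdorff_outer (B n)) \<noteq> top"
    using fin by (auto simp: top_unique)
  have tail: "(\<lambda>n. \<Sum>i. hausdorff_outer (B (i + n))) \<longlonglongrightarrow> 0"
  proof -
    define b where "b n = enn2real (hausdorff_outer (B n))" for n
    have "hausdorff_outer (B n) \<noteq> top" for n
      using finB by (metis ennreal_suminf_lessD less_top)
    then have b: "hausdorff_outer (B n) = ennreal (b n)" "b n \<ge> 0" for n
      by (auto simp: b_def less_top)
    then have sb: "summable b"
      using finB by (intro summable_suminf_not_top) auto
    have "(\<lambda>n. ennreal (\<Sum>i. b (i + n))) \<longlonglongrightarrow> ennreal 0"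
      using suminf_exist_split2[OF sb] by (intro tendsto_ennrealI)
    moreover have "(\<Sum>i. hausdorff_outer (B (i + n))) = ennreal (\<Sum>i. b (i + n))" for n
      unfolding b using sb b by (intro suminf_ennreal2) (auto simp: summable_iff_shift)
    ultimately show ?thesis by simp
  qed
  have cover: "A - F \<subseteq> T n \<union> (\<Union>i. B (i + n))" for n
  proof
    fix x assume x: "x \<in> A - F"
    have "infdist x F > 0"
      using x F ne by (simp add: infdist_pos_not_in_closed)
    then obtain m where "1 / Suc m < infdist x F"
      by (rule nat_approx_posE)
    then have xm: "x \<in> T m" using x by (auto simp: T_def)
    show "x \<in> T n \<union> (\<Union>i. B (i + n))"
    proof (cases "x \<in> T n")
      case False
      define l where "l = (LEAST l. x \<in> T l)"
      have l: "x \<in> T l" unfolding l_def using xm by (rule LeastI)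
      have "l > n" using l False Tmono[of l n] by (cases "l \<le> n") auto
      then obtain i where i: "l = Suc (i + n)" by (metis less_imp_Suc_add add.commute)
      have "x \<notin> T (i + n)" using not_less_Least[of "i+n" "\<lambda>l. x \<in> T l"] i by (simp add: l_def)
      then show ?thesis using l i by (auto simp: B_def)
    qed auto
  qed
  have bound: "hausdorff_outer (A \<inter> F) + hausdorff_outer (A - F) \<le>
      hausdorff_outer A + (\<Sum>i. hausdorff_outer (B (i + n)))" for n
  proof -
    have "hausdorff_outer (A - F) \<le> hausdorff_outer (T n \<union> (\<Union>i. B (i + n)))"
      by (rule hausdorff_outer_mono[OF cover])
    also have "\<dots> \<le> hausdorff_outer (T n) + hausdorff_outer (\<Union>i. B (i + n))"
      by (rule hausdorff_outer_Un_le)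
    also have "\<dots> \<le> hausdorff_outer (T n) + (\<Sum>i. hausdorff_outer (B (i + n)))"
      by (intro add_left_mono hausdorff_outer_subadditive)
    finally have "hausdorff_outer (A \<inter> F) + hausdorff_outer (A - F) \<le>
        (hausdorff_outer (A \<inter> F) + hausdorff_outer (T n)) + (\<Sum>i. hausdorff_outer (B (i + n)))"
      by (simp add: add_left_mono add.assoc)
    moreover have "hausdorff_outer (A \<inter> F) + hausdorff_outer (T n) \<le> hausdorff_outer (A \<inter> F \<union> T n)"
    proof (rule hausdorff_outer_separated[of "1 / Suc n"])
      fix x y assume "x \<in> A \<inter> F" "y \<in> T n"
      then show "1 / Suc n \<le> dist x y"
        using infdist_le[of x F y] by (auto simp: T_def dist_commute)
    qed simp
    moreover have "hausdorff_outer (A \<inter> F \<union> T n) \<le> hausdorff_outer A"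
      by (rule hausdorff_outer_mono) (auto simp: T_def)
    ultimately show ?thesis by (meson add_right_mono order_trans)
  qed
  have "(\<lambda>n. hausdorff_outer A + (\<Sum>i. hausdorff_outer (B (i + n)))) \<longlonglongrightarrow> hausdorff_outer A + 0"
    by (intro tendsto_add tail tendsto_const)
  then have "hausdorff_outer (A \<inter> F) + hausdorff_outer (A - F) \<le> hausdorff_outer A + 0"
    by (rule LIMSEQ_le_const) (use bound in blast)
  then show ?thesis by simp
qed

lemma measure_space_hausdorff: "measure_space UNIV (sets borel) hausdorff_outer"
proof -
  let ?L = "lambda_system UNIV (Pow UNIV) hausdorff_outer"
  have ms: "measure_space UNIV ?L hausdorff_outer"
    using sigma_algebra.caratheodory_lemma[OF sigma_algebra_Pow outer_measure_space_hausdorff] .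
  have closed_in: "F \<in> ?L" if "closed F" for F
  proof -
    have "hausdorff_outer (F \<inter> A) + hausdorff_outer ((UNIV - F) \<inter> A) = hausdorff_outer A" for A
    proof -
      have sets: "F \<inter> A = A \<inter> F" "(UNIV - F) \<inter> A = A - F" "A \<inter> F \<union> (A - F) = A" by auto
      have "hausdorff_outer A \<le> hausdorff_outer (A \<inter> F) + hausdorff_outer (A - F)"
        using hausdorff_outer_Un_le[of "A \<inter> F" "A - F"] unfolding sets(3) .
      then show ?thesis
        unfolding sets(1,2) using hausdorff_caratheodory_closed[OF that, of A] by (rule antisym[rotated])
    qed
    then show ?thesis by (simp add: lambda_system_def)
  qed
  have sub: "sets borel \<subseteq> ?L"
  proof -
    have "sigma_algebra UNIV ?L" using ms by (simp add: measure_space_def)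
    then have "sigma_sets UNIV {F. closed F} \<subseteq> ?L"
      using closed_in by (intro sigma_algebra.sigma_sets_subset) auto
    then show ?thesis by (simp add: borel_eq_closed)
  qed
  have "sigma_algebra UNIV (sets (borel :: (real^2) measure))"
    using sets.sigma_algebra_axioms[of "borel :: (real^2) measure"] by simp
  then show ?thesis by (rule measure_down[OF ms _ sub])
qed

lemma sets_hausdorff_measure [measurable_cong]: "sets hausdorff_measure = sets borel"
  unfolding hausdorff_measure_def
  by (subst sets_measure_of) (use sets.sigma_sets_eq[of borel] in auto)

lemma emeasure_hausdorff_measure:
  assumes "A \<in> sets borel"
  shows "emeasure hausdorff_measure A = hausdorff_outer A"
  unfolding hausdorff_measure_def using measure_space_hausdorff assms
  by (intro emeasure_measure_of_sigma) (auto simp: measure_space_def)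

definition surface_measure :: "(real^2) set \<Rightarrow> (real^2) measure" where
  "surface_measure \<Omega> = restrict_space hausdorff_measure (frontier \<Omega>)"

text \<open>\<open>g\<close> is the trace on \<open>\<partial>\<Omega>\<close> of \<open>u \<in> H\<^sup>1(\<Omega>)\<close>: the trace operator is the continuous extension
  to \<open>H\<^sup>1(\<Omega>)\<close> of the restriction to \<open>\<partial>\<Omega>\<close> of functions smooth up to the boundary.\<close>

definition has_trace :: "(real^2) set \<Rightarrow> (real^2 \<Rightarrow> complex) \<Rightarrow> (real^2 \<Rightarrow> complex) \<Rightarrow> bool" where
  "has_trace \<Omega> u g \<longleftrightarrow> g \<in> borel_measurable (surface_measure \<Omega>) \<and>
     (\<exists>\<psi> :: nat \<Rightarrow> real^2 \<Rightarrow> complex. (\<forall>n. smooth (\<psi> n)) \<and>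
        (\<lambda>n. \<integral>\<^sup>+x. ennreal ((norm (\<psi> n x - u x))\<^sup>2) \<partial>lebesgue_on \<Omega>) \<longlonglongrightarrow> 0 \<and>
        (\<forall>i. \<exists>d. weak_partial \<Omega> i u d \<and> square_integrable \<Omega> d \<and>
           (\<lambda>n. \<integral>\<^sup>+x. ennreal ((norm (partial i (\<psi> n) x - d x))\<^sup>2) \<partial>lebesgue_on \<Omega>) \<longlonglongrightarrow> 0) \<and>
        (\<lambda>n. \<integral>\<^sup>+x. ennreal ((norm (\<psi> n x - g x))\<^sup>2) \<partial>surface_measure \<Omega>) \<longlonglongrightarrow> 0)"

text \<open>For \<open>u \<in> H\<^sup>1(\<Omega>)\<close> with \<open>\<Delta>u \<in> L\<^sup>2(\<Omega>)\<close> the exterior normal derivative \<open>\<partial>\<^sub>\<nu>u\<close> is the element of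
  \<open>H\<^sup>-\<^sup>1\<^sup>/\<^sup>2(\<partial>\<Omega>)\<close> defined by Green's formula
  \<open>\<langle>\<partial>\<^sub>\<nu>u, \<phi>\<rangle> = \<integral>\<^sub>\<Omega> \<nabla>u \<cdot> \<nabla>\<phi> + (\<Delta>u) \<phi>\<close>, where \<open>\<langle>\<cdot>,\<cdot>\<rangle>\<close> is bilinear and extends
  \<open>\<integral> f \<phi> d\<sigma>\<close> over \<open>\<partial>\<Omega>\<close>.  It suffices to pair with functions \<open>\<phi>\<close> smooth on the plane, since their
  restrictions are dense in \<open>H\<^sup>1(\<Omega>)\<close>.  If \<open>u \<in> H\<^sup>2(\<Omega>)\<close>, this is integration against
  \<open>\<nu> \<cdot> \<nabla>u\<close>.\<close>

definition has_normal_derivative ::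
    "(real^2) set \<Rightarrow> (real^2 \<Rightarrow> complex) \<Rightarrow> ((real^2 \<Rightarrow> complex) \<Rightarrow> complex) \<Rightarrow> bool" where
  "has_normal_derivative \<Omega> u N \<longleftrightarrow>
     (\<exists>D f. (\<forall>i. weak_partial \<Omega> i u (D i) \<and> square_integrable \<Omega> (D i)) \<and>
        weak_laplacian \<Omega> u f \<and> square_integrable \<Omega> f \<and>
        (\<forall>\<phi>. smooth \<phi> \<longrightarrow>
           N \<phi> = integral\<^sup>L (lebesgue_on \<Omega>)
                   (\<lambda>x. (\<Sum>i\<in>UNIV. D i x * partial i \<phi> x) + f x * \<phi> x)))"

section \<open>Conductive transmission eigenfunctions\<close>

definition conductive_transmission_eigenfunctions ::
    "(real^2) set \<Rightarrow> real \<Rightarrow> (real^2 \<Rightarrow> complex) \<Rightarrow> (real^2 \<Rightarrow> complex) \<Rightarrow>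
      (real^2 \<Rightarrow> complex) \<Rightarrow> (real^2 \<Rightarrow> complex) \<Rightarrow> bool" where
  "conductive_transmission_eigenfunctions \<Omega> k V \<eta> v w \<longleftrightarrow>
     sobolev 1 \<Omega> v \<and> sobolev 1 \<Omega> w \<and>
     \<not> ((AE x in lebesgue_on \<Omega>. v x = 0) \<and> (AE x in lebesgue_on \<Omega>. w x = 0)) \<and>
     weak_laplacian \<Omega> w (\<lambda>x. - ((of_real k)\<^sup>2) * (1 + V x) * w x) \<and>
     weak_laplacian \<Omega> v (\<lambda>x. - ((of_real k)\<^sup>2) * v x) \<and>
     (\<exists>g N\<^sub>v N\<^sub>w. has_trace \<Omega> v g \<and> has_trace \<Omega> w g \<and>
        has_normal_derivative \<Omega> v N\<^sub>v \<and> has_normal_derivative \<Omega> w N\<^sub>w \<and>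
        (\<forall>\<phi>. smooth \<phi> \<longrightarrow>
           N\<^sub>v \<phi> + integral\<^sup>L (surface_measure \<Omega>) (\<lambda>x. \<eta> x * g x * \<phi> x) = N\<^sub>w \<phi>))"

section \<open>Sectors\<close>

definition polar_angle :: "real^2 \<Rightarrow> real" where
  "polar_angle x = Arg (Complex (x $ 1) (x $ 2))"

definition sector :: "real \<Rightarrow> real \<Rightarrow> (real^2) set" where
  "sector \<theta>\<^sub>m \<theta>\<^sub>M = {x. x \<noteq> 0 \<and> \<theta>\<^sub>m < polar_angle x \<and> polar_angle x < \<theta>\<^sub>M}"

definition ray :: "real \<Rightarrow> (real^2) set" where
  "ray \<theta> = {x. x \<noteq> 0 \<and> polar_angle x = \<theta>}"

definition sector_disc :: "real \<Rightarrow> real \<Rightarrow> real \<Rightarrow> (real^2) set" where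
  "sector_disc \<theta>\<^sub>m \<theta>\<^sub>M h = sector \<theta>\<^sub>m \<theta>\<^sub>M \<inter> ball 0 h"

definition ray_segment :: "real \<Rightarrow> real \<Rightarrow> (real^2) set" where
  "ray_segment \<theta> h = ray \<theta> \<inter> ball 0 h"

definition sector_annulus :: "real \<Rightarrow> real \<Rightarrow> real \<Rightarrow> (real^2) set" where
  "sector_annulus \<theta>\<^sub>m \<theta>\<^sub>M h = sector_disc \<theta>\<^sub>m \<theta>\<^sub>M h - sector_disc \<theta>\<^sub>m \<theta>\<^sub>M (h / 2)"

end

theory Submission imports Defs
begin

text \<open>Let \<open>u = v - w\<close>. Green's formula on the sector turns the transmission conditions into
  \<open>\<integral> u \<Delta>\<phi> = \<integral> F \<phi> + \<integral> \<eta> v \<phi>\<close> for all test functions \<open>\<phi>\<close> supported near the vertex, where \<open>F\<close> is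
  bounded and the last integral runs over the two edges. The function \<open>v \<in> H\<^sup>2\<close> is continuous up to the
  vertex, with value \<open>c\<close> there. Testing with cut-off versions of \<open>(z + \<epsilon> a) powi (-3)\<close>, harmonic with a pole just
  outside the sector on its bisector, and letting \<open>\<epsilon> \<rightarrow> 0\<close> gives a nonzero multiple of \<open>\<eta>(0) c\<close>, because the
  opening angle is not \<open>\<pi>\<close>; hence \<open>c = 0\<close>. Testing with regularised logarithmic kernels represents \<open>u\<close> as a
  potential that is Hoelder continuous with exponent 1/2 and vanishes outside the sector, so \<open>u\<close> also tends
  to 0 at the vertex, and with it \<open>w = v - u\<close>.\<close>

text \<open>The exponent -3 comes from scaling. With the pole at distance \<epsilon> from the
  vertex, an edge integral of the kernel has size \<epsilon>^-2, while the plane integral against a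
  bounded function has only size \<epsilon>^-1. After multiplication by \<epsilon>^2 the edges
  survive alone. The edge at angle \<theta> contributes a fixed factor times exp(-i \<theta>), and
  two such numbers cancel only when their angles differ by an odd multiple of pi. Reflex corners are
  allowed, so the sector is cut along its bisector into two convex cones, each the image of a
  quadrant under an oblique linear map. In these coordinates a cut-off version of v is the double
  integral of its mixed second derivative, which is how two weak derivatives give continuity. The
  function w lies only in H^1, and regularity of q w says nothing about w where q degenerates; so
  the vertex value of w has to come from u. The Hoelder exponent 1/2 is dictated by the edge
  densities: the gradient of the logarithm is not integrable along a line, whereas the inverse
  square root of the distance is.\<close>

abbreviation lborel_nn_integral :: "('a::euclidean_space \<Rightarrow> ennreal) \<Rightarrow> ennreal" (binder "LNN " 10) where
  "lborel_nn_integral f \<equiv> nn_integral lborel f"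

abbreviation (input) "L1 \<equiv> integrable lborel"

abbreviation (input) "BM \<equiv> borel_measurable borel"

abbreviation (input) "ind \<equiv> indicator"

lemmas bochner_cong = Bochner_Integration.integral_cong
lemmas bochner_bound = Bochner_Integration.integrable_bound
lemmas bochner_diff = Bochner_Integration.integrable_diff
lemmas bochner_add = Bochner_Integration.integrable_add

section \<open>Smooth functions on the plane\<close>

lemma partial_eq: "(f has_derivative f') (at x) \<Longrightarrow> partial i f x = f' (axis i 1)"
  unfolding partial_def using frechet_derivative_at by metis

lemma has_derivative_partial:
  assumes "f differentiable (at x)"
  shows "(f has_derivative (\<lambda>h. \<Sum>i\<in>UNIV. of_real (h $ i) * partial i f x)) (at x)"
proof -
  have d: "(f has_derivative frechet_derivative f (at x)) (at x)"
    using assms frechet_derivative_works by blast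
  have lin: "linear (frechet_derivative f (at x))"
    using d has_derivative_bounded_linear bounded_linear.linear by blast
  have "frechet_derivative f (at x) h = (\<Sum>i\<in>UNIV. of_real (h $ i) * partial i f x)" for h
  proof -
    have "frechet_derivative f (at x) h = frechet_derivative f (at x) (\<Sum>i\<in>UNIV. h $ i *\<^sub>R axis i 1)"
      using basis_expansion[of h] by (simp add: scalar_mult_eq_scaleR)
    also have "\<dots> = (\<Sum>i\<in>UNIV. h $ i *\<^sub>R partial i f x)"
      unfolding partial_def by (simp add: linear_sum[OF lin] linear_cmul[OF lin])
    finally show ?thesis by (simp add: scaleR_conv_of_real)
  qed
  then have "frechet_derivative f (at x) = (\<lambda>h. \<Sum>i\<in>UNIV. of_real (h $ i) * partial i f x)" by blast
  with d show ?thesis by simp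
qed

lemma partial_cong_open:
  assumes "open U" "x \<in> U" "\<And>y. y \<in> U \<Longrightarrow> f y = g y"
  shows "partial i f x = partial i g x"
proof -
  have "(f has_derivative f') (at x) \<longleftrightarrow> (g has_derivative f') (at x)" for f'
    using assms has_derivative_transform_within_open[of f f' x UNIV U g]
      has_derivative_transform_within_open[of g f' x UNIV U f] by auto
  then show ?thesis by (simp add: partial_def frechet_derivative_def)
qed

lemma laplacian_cong_open:
  assumes "open U" "x \<in> U" "\<And>y. y \<in> U \<Longrightarrow> f y = g y"
  shows "laplacian f x = laplacian g x"
  unfolding laplacian_def
  by (intro sum.cong refl partial_cong_open[OF assms(1,2)]) (rule partial_cong_open[OF assms(1)], auto intro: assms)

lemma partial_const: "partial i (\<lambda>x. c) = (\<lambda>x. 0)"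
  using partial_eq[OF has_derivative_const] by auto

lemma partial_add:
  assumes "f differentiable (at x)" "g differentiable (at x)"
  shows "partial i (\<lambda>x. f x + g x) x = partial i f x + partial i g x"
  by (rule trans, rule partial_eq, rule has_derivative_add)
     (use assms in \<open>auto simp: frechet_derivative_works partial_def\<close>)

lemma partial_mult:
  assumes "f differentiable (at x)" "g differentiable (at x)"
  shows "partial i (\<lambda>x. f x * g x) x = f x * partial i g x + partial i f x * g x"
  by (rule trans, rule partial_eq, rule has_derivative_mult)
     (use assms in \<open>auto simp: frechet_derivative_works partial_def\<close>)

lemma partial_inverse:
  assumes "f differentiable (at x)" "f x \<noteq> 0"
  shows "partial i (\<lambda>x. inverse (f x)) x = (-1) * (partial i f x * (inverse (f x) * inverse (f x)))"
  using partial_eq[OF Deriv.has_derivative_inverse[where f=f and x=x and S=UNIV, OF assms(2), of "frechet_derivative f (at x)"]] assms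
  by (simp add: frechet_derivative_works partial_def mult_ac)

lemma Ck_0: "Ck n f \<Longrightarrow> continuous_on UNIV f"
  by (cases n) (auto intro!: differentiable_imp_continuous_on simp: differentiable_on_def)

lemma Ck_Suc_D: "Ck (Suc n) f \<Longrightarrow> Ck n f"
proof (induction n arbitrary: f)
  case 0 then show ?case using Ck_0 by (auto simp del: Ck.simps(2))
next
  case (Suc n) then show ?case unfolding Ck.simps(2)[of "Suc n"] Ck.simps(2)[of n f] by blast
qed

lemma Ck_const: "Ck n (\<lambda>x. c)"
  by (induction n arbitrary: c) (auto simp: partial_const)

lemma Ck_add: "Ck n f \<Longrightarrow> Ck n g \<Longrightarrow> Ck n (\<lambda>x. f x + g x)"
proof (induction n arbitrary: f g)
  case (Suc n)
  then have "partial i (\<lambda>x. f x + g x) = (\<lambda>x. partial i f x + partial i g x)" for i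
    by (auto simp: partial_add)
  with Suc show ?case by auto
qed (auto intro: continuous_intros)

lemma Ck_mult: "Ck n f \<Longrightarrow> Ck n g \<Longrightarrow> Ck n (\<lambda>x. f x * g x)"
proof (induction n arbitrary: f g)
  case (Suc n)
  then have *: "partial i (\<lambda>x. f x * g x) = (\<lambda>x. f x * partial i g x + partial i f x * g x)" for i
    by (auto simp: partial_mult)
  have "Ck n f" "Ck n g" using Suc.prems Ck_Suc_D by blast+
  with Suc show ?case by (auto simp: * intro!: Ck_add)
qed (auto intro: continuous_intros)

lemma smooth_diff: "smooth f \<Longrightarrow> f differentiable (at x)"
  unfolding smooth_def by (metis Ck.simps(2))

lemma smooth_partial: "smooth f \<Longrightarrow> smooth (partial i f)"
  unfolding smooth_def by (metis Ck.simps(2))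

lemma smooth_cont: "smooth f \<Longrightarrow> continuous_on UNIV f"
  unfolding smooth_def using Ck_0 by blast

lemma smoothI:
  assumes "\<And>x. f differentiable (at x)" "\<And>i. smooth (partial i f)"
  shows "smooth f"
proof -
  have "Ck n f" for n
    by (cases n) (use assms in \<open>auto simp: smooth_def intro!: differentiable_imp_continuous_on simp: differentiable_on_def\<close>)
  then show ?thesis by (simp add: smooth_def)
qed

lemma smooth_const: "smooth (\<lambda>x. c)"
  by (simp add: smooth_def Ck_const)
lemma smooth_add: "smooth f \<Longrightarrow> smooth g \<Longrightarrow> smooth (\<lambda>x. f x + g x)"
  by (simp add: smooth_def Ck_add)
lemma smooth_mult: "smooth f \<Longrightarrow> smooth g \<Longrightarrow> smooth (\<lambda>x. f x * g x)"
  by (simp add: smooth_def Ck_mult)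
lemma smooth_uminus: "smooth f \<Longrightarrow> smooth (\<lambda>x. - f x)"
  using smooth_mult[OF smooth_const[of "-1"]] by simp
lemma smooth_minus: "smooth f \<Longrightarrow> smooth g \<Longrightarrow> smooth (\<lambda>x. f x - g x)"
  using smooth_add[of f "\<lambda>x. - g x"] by (simp add: smooth_uminus)
lemma smooth_power: "smooth f \<Longrightarrow> smooth (\<lambda>x. f x ^ n)"
  by (induction n) (auto intro: smooth_mult smooth_const)
lemma smooth_sum: "(\<And>i. i \<in> I \<Longrightarrow> smooth (f i)) \<Longrightarrow> smooth (\<lambda>x. \<Sum>i\<in>I. f i x)"
  by (induction I rule: infinite_finite_induct) (auto intro: smooth_add smooth_const)

lemma partial_minus:
  assumes "f differentiable (at x)" "g differentiable (at x)"
  shows "partial i (\<lambda>x. f x - g x) x = partial i f x - partial i g x"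
  by (rule trans, rule partial_eq, rule has_derivative_diff)
     (use assms in \<open>auto simp: frechet_derivative_works partial_def\<close>)

lemma partial_linear:
  fixes f :: "real^2 \<Rightarrow> complex"
  assumes "bounded_linear f" shows "partial i (\<lambda>x. f (x - y)) x = f (axis i 1)"
  using assms by (intro partial_eq[of _ f]) (auto intro!: derivative_eq_intros bounded_linear.has_derivative[OF assms])

lemma smooth_linear:
  assumes "bounded_linear f" shows "smooth (\<lambda>x. f (x - y))"
proof (rule smoothI)
  show "(\<lambda>x. f (x - y)) differentiable at x" for x
    unfolding differentiable_def
    by (rule exI[of _ f]) (auto intro!: derivative_eq_intros bounded_linear.has_derivative[OF assms])
  have "partial i (\<lambda>x. f (x - y)) = (\<lambda>x. f (axis i 1))" for i
    using partial_linear[OF assms] by auto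
  then show "smooth (partial i (\<lambda>x. f (x - y)))" for i by (simp add: smooth_const)
qed

lemma bounded_linear_inner_of_real: "bounded_linear (\<lambda>x. complex_of_real (a \<bullet> x))"
  by (intro bounded_linear_compose[OF bounded_linear_of_real] bounded_linear_inner_right)

lemma smooth_inner: "smooth (\<lambda>x. of_real (a \<bullet> x))"
  using smooth_linear[OF bounded_linear_inner_of_real, of a 0] by simp

lemma partial_inner: "partial i (\<lambda>x. of_real (a \<bullet> x)) x = of_real (a $ i)"
  using partial_linear[OF bounded_linear_inner_of_real, of i a 0] by (simp add: inner_axis)

lemma smooth_nth: "smooth (\<lambda>x. of_real (x $ i))"
  using smooth_inner[of "axis i 1"] by (simp add: inner_axis')

lemma partial_nth: "partial j (\<lambda>x. of_real (x $ i)) x = (if i = j then 1 else 0)"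
  using partial_inner[of j "axis i 1"] by (simp add: inner_axis') (simp add: axis_def)

text \<open>Each partial derivative of 1/f is a product of a partial derivative of f with two copies
  of 1/f, so an induction on the order closes on itself.\<close>

lemma smooth_inverse:
  assumes f: "smooth f" and nz: "\<And>x. f x \<noteq> 0"
  shows "smooth (\<lambda>x. inverse (f x))"
proof -
  have "Ck n (\<lambda>x. inverse (f x))" for n
  proof (induction n)
    case 0
    then show ?case using smooth_cont[OF f] nz by (auto intro!: continuous_on_inverse)
  next
    case (Suc n)
    have *: "partial i (\<lambda>x. inverse (f x)) = (\<lambda>x. (-1) * (partial i f x * (inverse (f x) * inverse (f x))))" for i
      using partial_inverse[OF smooth_diff[OF f] nz] by blast
    have "Ck n (partial i f)" for i using smooth_partial[OF f] by (simp add: smooth_def)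
    moreover have "(\<lambda>x. inverse (f x)) differentiable at x" for x
      using smooth_diff[OF f] nz differentiable_inverse by blast
    ultimately show ?case using Suc unfolding Ck.simps(2) *
      by (intro conjI allI Ck_mult Ck_const) auto
  qed
  then show ?thesis by (simp add: smooth_def)
qed

text \<open>\<open>smooth\<close> and \<open>partial\<close> are available for complex-valued
  functions only, so a real inner function q is carried as \<open>of_real (q x)\<close>. Taking real
  parts recovers the derivative of q, to which the ordinary chain rule applies.\<close>

lemma of_real_comp_has_derivative:
  assumes q: "(\<lambda>x. complex_of_real (q x)) differentiable (at x)"
    and A: "(A has_real_derivative a) (at (q x))"
  shows "((\<lambda>x. complex_of_real (A (q x))) has_derivative
      (\<lambda>h. of_real (a * Re (frechet_derivative (\<lambda>x. of_real (q x)) (at x) h)))) (at x)"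
proof -
  let ?d = "frechet_derivative (\<lambda>x. complex_of_real (q x)) (at x)"
  have d: "((\<lambda>x. complex_of_real (q x)) has_derivative ?d) (at x)"
    using q frechet_derivative_works by blast
  have "((\<lambda>x. Re (complex_of_real (q x))) has_derivative (\<lambda>h. Re (?d h))) (at x)"
    by (rule bounded_linear.has_derivative[OF bounded_linear_Re d])
  then have "(q has_derivative (\<lambda>h. Re (?d h))) (at x)" by simp
  from has_derivative_compose[OF this] A
  have "((\<lambda>x. A (q x)) has_derivative (\<lambda>h. a * Re (?d h))) (at x)"
    by (auto simp: has_field_derivative_def)
  then show ?thesis by (rule bounded_linear.has_derivative[OF bounded_linear_of_real])
qed

lemma frechet_real:
  assumes q: "(\<lambda>x. complex_of_real (q x)) differentiable (at x)"
  shows "of_real (Re (partial i (\<lambda>x. complex_of_real (q x)) x)) = partial i (\<lambda>x. complex_of_real (q x)) x"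
proof -
  have "partial i (\<lambda>x. complex_of_real (q x)) x = of_real (1 * Re (frechet_derivative (\<lambda>x. of_real (q x)) (at x) (axis i 1)))"
    using of_real_comp_has_derivative[OF q, of id 1] by (intro partial_eq) (auto simp: id_def)
  then show ?thesis by simp
qed

lemma partial_comp:
  assumes q: "(\<lambda>x. complex_of_real (q x)) differentiable (at x)"
    and A: "(A has_real_derivative a) (at (q x))"
  shows "partial i (\<lambda>x. complex_of_real (A (q x))) x = of_real a * partial i (\<lambda>x. of_real (q x)) x"
  using partial_eq[OF of_real_comp_has_derivative[OF assms]] frechet_real[OF q, of i]
  by (simp add: partial_def)

lemma diff_comp:
  assumes q: "(\<lambda>x. complex_of_real (q x)) differentiable (at x)"
    and A: "(A has_real_derivative a) (at (q x))"
  shows "(\<lambda>x. complex_of_real (A (q x))) differentiable (at x)"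
  using of_real_comp_has_derivative[OF assms] differentiable_def by blast

lemma smooth_comp:
  assumes q: "smooth (\<lambda>x. complex_of_real (q x))"
    and A: "\<And>x. (A has_real_derivative A' (q x)) (at (q x))"
    and A': "smooth (\<lambda>x. complex_of_real (A' (q x)))"
  shows "smooth (\<lambda>x. complex_of_real (A (q x)))"
proof (rule smoothI)
  show "(\<lambda>x. complex_of_real (A (q x))) differentiable at x" for x
    using diff_comp[OF smooth_diff[OF q] A] .
  have "partial i (\<lambda>x. complex_of_real (A (q x))) = (\<lambda>x. of_real (A' (q x)) * partial i (\<lambda>x. of_real (q x)) x)" for i
    using partial_comp[OF smooth_diff[OF q] A] by blast
  then show "smooth (partial i (\<lambda>x. complex_of_real (A (q x))))" for i
    by (simp add: smooth_mult A' smooth_partial[OF q])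
qed

section \<open>Flat exponential bumps and radial cut-offs\<close>

definition bumpp :: "nat \<Rightarrow> real \<Rightarrow> real" where
  "bumpp p t = (if t \<le> 0 then 0 else exp (- 1 / t) / t ^ p)"

abbreviation "bump \<equiv> bumpp 0"

text \<open>With s = 1/t the limit from the right becomes that of s^p / exp s at infinity.\<close>

lemma bumpp_tendsto: "(bumpp p \<longlongrightarrow> 0) (at 0)"
proof -
  have "((\<lambda>x::real. x ^ p / exp x) \<longlongrightarrow> 0) at_top" by (rule tendsto_power_div_exp_0)
  then have "((\<lambda>t::real. (inverse t) ^ p / exp (inverse t)) \<longlongrightarrow> 0) (at_right 0)"
    using filterlim_compose[OF _ filterlim_inverse_at_top_right] by blast
  moreover have "\<forall>\<^sub>F t in at_right (0::real). (inverse t) ^ p / exp (inverse t) = bumpp p t"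
    using eventually_at_right_less[of 0]
    by eventually_elim (auto simp: bumpp_def exp_minus field_simps)
  ultimately have r: "(bumpp p \<longlongrightarrow> 0) (at_right 0)"
    using tendsto_cong by force
  have "(bumpp p \<longlongrightarrow> 0) (at_left 0)"
    by (rule tendsto_eventually) (auto simp: bumpp_def eventually_at_filter)
  with r show ?thesis using filterlim_split_at by blast
qed

text \<open>The functions exp(-1/t) / t^p span a space closed under differentiation. This is why the
  power p is a parameter: smoothness of the plain bump follows by induction on the order, for all p
  simultaneously.\<close>

lemma bumpp_deriv:
  "(bumpp p has_real_derivative (bumpp (p + 2) t - real p * bumpp (p + 1) t)) (at t)"
proof -
  consider "t < 0" | "t > 0" | "t = 0" by linarith
  then show ?thesis
  proof cases
    case 1
    have "((\<lambda>x. 0) has_real_derivative 0) (at t)" by simp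
    then have "(bumpp p has_real_derivative 0) (at t)"
      by (rule has_field_derivative_transform_within_open[where S="{..<0}"]) (use 1 in \<open>auto simp: bumpp_def\<close>)
    then show ?thesis using 1 by (simp add: bumpp_def)
  next
    case 2
    have "((\<lambda>t. exp (- 1 / t) * inverse (t ^ p)) has_real_derivative
        (exp (- 1 / t) * (1 / t^2)) * inverse (t ^ p) + exp (- 1 / t) * (- (real p * t ^ (p - 1)) / (t ^ p)^2)) (at t)"
      using 2 by (auto intro!: derivative_eq_intros simp: power2_eq_square divide_simps)
    also have "(exp (- 1 / t) * (1 / t^2)) * inverse (t ^ p) + exp (- 1 / t) * (- (real p * t ^ (p - 1)) / (t ^ p)^2)
       = bumpp (p + 2) t - real p * bumpp (p + 1) t"
      using 2 by (cases p) (auto simp: bumpp_def field_simps power2_eq_square)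
    finally have *: "((\<lambda>t. exp (- 1 / t) * inverse (t ^ p)) has_real_derivative bumpp (p + 2) t - real p * bumpp (p + 1) t) (at t)" .
    show ?thesis
      by (rule has_field_derivative_transform_within_open[OF *, where S="{0<..}"])
         (use 2 in \<open>auto simp: bumpp_def field_simps\<close>)
  next
    \<comment> \<open>At 0 the difference quotient of \<open>bumpp p\<close> is
      \<open>bumpp (p + 1)\<close> itself, on both sides, so the limit already proved gives
      derivative 0.\<close>
    case 3
    have "\<forall>\<^sub>F y in at (0::real). bumpp (p+1) y = (bumpp p y - bumpp p 0) / (y - 0)"
      unfolding eventually_at_filter by (auto simp: bumpp_def field_simps)
    then have "((\<lambda>y. (bumpp p y - bumpp p 0) / (y - 0)) \<longlongrightarrow> 0) (at 0)"
      using bumpp_tendsto[of "p+1"] by (simp add: tendsto_cong)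
    then show ?thesis using 3 by (simp add: has_field_derivative_iff bumpp_def)
  qed
qed

lemma smooth_bumpp:
  assumes q: "smooth (\<lambda>x. complex_of_real (q x))"
  shows "smooth (\<lambda>x. complex_of_real (bumpp p (q x)))"
proof -
  have "Ck n (\<lambda>x. complex_of_real (bumpp p (q x)))" for n
  proof (induction n arbitrary: p)
    case 0
    have "smooth (\<lambda>x. complex_of_real (q x)) \<Longrightarrow> (\<lambda>x. complex_of_real (bumpp p (q x))) differentiable at x" for x
      using diff_comp[OF smooth_diff[OF q] bumpp_deriv] .
    with q have "(\<lambda>x. complex_of_real (bumpp p (q x))) differentiable_on UNIV" unfolding differentiable_on_def by blast
    then show ?case unfolding Ck.simps by (rule differentiable_imp_continuous_on)
  next
    case (Suc n)
    have d: "(\<lambda>x. complex_of_real (bumpp p (q x))) differentiable at x" for x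
      using diff_comp[OF smooth_diff[OF q] bumpp_deriv] .
    have "partial i (\<lambda>x. complex_of_real (bumpp p (q x))) =
      (\<lambda>x. (of_real (bumpp (p + 2) (q x)) + (- of_nat p) * of_real (bumpp (p + 1) (q x))) * partial i (\<lambda>x. of_real (q x)) x)" for i
      using partial_comp[OF smooth_diff[OF q] bumpp_deriv] by fastforce
    moreover have "Ck n (partial i (\<lambda>x. complex_of_real (q x)))" for i
      using smooth_partial[OF q] by (simp add: smooth_def)
    ultimately show ?case using d Suc unfolding Ck.simps
      by (simp only: simp_thms) (intro allI Ck_mult Ck_add Ck_const)
  qed
  then show ?thesis by (simp add: smooth_def)
qed

lemma bump_nonneg: "bump t \<ge> 0" and bump_pos_iff: "bump t > 0 \<longleftrightarrow> t > 0"
  and bump_le1: "bump t \<le> 1" and bump_zero_iff: "bump t = 0 \<longleftrightarrow> t \<le> 0"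
  by (auto simp: bumpp_def)

text \<open>For t > 0 the value is exp(-1/(n t)), which tends to 1; for t \<le> 0 it is 0
  throughout. Thus indicators of open intervals are pointwise limits of smooth functions bounded by
  1, which is what dominated convergence asks for.\<close>

lemma bump_scaled_tendsto: "(\<lambda>n. bump (real n * t)) \<longlonglongrightarrow> ind {0<..} t"
proof (cases "t > 0")
  case True
  have "(\<lambda>n. - 1 / t * inverse (real n)) \<longlonglongrightarrow> - 1 / t * 0"
    by (intro tendsto_mult tendsto_const lim_inverse_n)
  then have "(\<lambda>n. exp (- 1 / t * inverse (real n))) \<longlonglongrightarrow> exp 0"
    by (intro tendsto_exp) simp
  moreover have "\<forall>\<^sub>F n in sequentially. exp (- 1 / t * inverse (real n)) = bump (real n * t)"
    using eventually_gt_at_top[of 0]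
    by eventually_elim (use True in \<open>auto simp: bumpp_def field_simps mult_le_0_iff\<close>)
  ultimately show ?thesis using True by (simp add: tendsto_cong)
next
  case False
  then have "bump (real n * t) = 0" for n by (simp add: bump_zero_iff mult_nonneg_nonpos)
  then show ?thesis using False by simp
qed

lemma smooth_norm2: "smooth (\<lambda>x. of_real ((norm (x - y))\<^sup>2))"
proof -
  have "(\<lambda>x. complex_of_real ((norm (x - y))\<^sup>2)) = (\<lambda>x. \<Sum>i\<in>UNIV. (of_real (x $ i) - of_real (y $ i))^2)"
    unfolding power2_norm_eq_inner inner_vec_def by (auto simp: power2_eq_square)
  moreover have "smooth (\<lambda>x. \<Sum>i\<in>UNIV. (of_real (x $ i) - of_real (y $ i))^2)"
    by (intro smooth_sum smooth_power smooth_minus smooth_nth smooth_const)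
  ultimately show ?thesis by simp
qed

lemma partial_norm2: "partial i (\<lambda>x. of_real ((norm (x - y))\<^sup>2)) x = 2 * of_real (x $ i - y $ i)"
proof -
  have "((\<lambda>x. complex_of_real ((norm (x - y))\<^sup>2)) has_derivative (\<lambda>h. of_real (2 * ((x - y) \<bullet> h)))) (at x)"
    unfolding power2_norm_eq_inner
    by (auto intro!: derivative_eq_intros bounded_linear.has_derivative[OF bounded_linear_of_real] simp: inner_commute)
  from partial_eq[OF this] show ?thesis by (simp add: inner_axis)
qed

text \<open>A partition-of-unity quotient: the numerator vanishes for |x| \<ge> R and the second
  summand of the denominator for |x| \<le> r. Since r < R, at least one of the two bumps is positive
  at every point. Squared norms are used because they are polynomials.\<close>

definition cutoff :: "real \<Rightarrow> real \<Rightarrow> real^2 \<Rightarrow> real" where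
  "cutoff r R x = bump (R\<^sup>2 - (norm x)\<^sup>2) / (bump (R\<^sup>2 - (norm x)\<^sup>2) + bump ((norm x)\<^sup>2 - r\<^sup>2))"

lemma cutoff:
  assumes "0 < r" "r < R"
  shows "smooth (\<lambda>x. of_real (cutoff r R x))" "norm x \<le> r \<Longrightarrow> cutoff r R x = 1"
    "norm x \<ge> R \<Longrightarrow> cutoff r R x = 0" "0 \<le> cutoff r R x" "cutoff r R x \<le> 1"
proof -
  have rR: "r\<^sup>2 < R\<^sup>2" using assms by (simp add: power_strict_mono)
  have pos: "bump (R\<^sup>2 - (norm x)\<^sup>2) + bump ((norm x)\<^sup>2 - r\<^sup>2) > 0" for x :: "real^2"
  proof (cases "(norm x)\<^sup>2 < R\<^sup>2")
    case True then show ?thesis using bump_pos_iff bump_nonneg by (simp add: add_pos_nonneg)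
  next
    case False
    then have "(norm x)\<^sup>2 - r\<^sup>2 > 0" using rR by linarith
    then show ?thesis using bump_pos_iff bump_nonneg by (simp add: add_nonneg_pos)
  qed
  have eq: "(\<lambda>x. complex_of_real (cutoff r R x)) = (\<lambda>x. of_real (bump (R\<^sup>2 - (norm x)\<^sup>2)) *
      inverse (of_real (bump (R\<^sup>2 - (norm x)\<^sup>2)) + of_real (bump ((norm x)\<^sup>2 - r\<^sup>2))))"
    by (auto simp: cutoff_def divide_inverse)
  have n2: "smooth (\<lambda>x. of_real ((norm x)\<^sup>2))" using smooth_norm2[of 0] by simp
  have s: "smooth (\<lambda>x. of_real (bump (R\<^sup>2 - (norm x)\<^sup>2)))" "smooth (\<lambda>x. of_real (bump ((norm x)\<^sup>2 - r\<^sup>2)))"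
    using smooth_minus[OF smooth_const[of "of_real (R\<^sup>2)"] n2] smooth_minus[OF n2 smooth_const[of "of_real (r\<^sup>2)"]]
    by (auto intro!: smooth_bumpp simp only: of_real_diff)
  show "smooth (\<lambda>x. of_real (cutoff r R x))"
    unfolding eq
    by (intro smooth_mult smooth_inverse smooth_add s) (metis of_real_add of_real_eq_0_iff pos less_irrefl)
  show "norm x \<le> r \<Longrightarrow> cutoff r R x = 1"
  proof -
    assume "norm x \<le> r"
    then have "bump ((norm x)\<^sup>2 - r\<^sup>2) = 0" by (simp add: bump_zero_iff power_mono)
    with pos[of x] show ?thesis by (simp add: cutoff_def)
  qed
  show "norm x \<ge> R \<Longrightarrow> cutoff r R x = 0"
  proof -
    assume "norm x \<ge> R"
    then have "bump (R\<^sup>2 - (norm x)\<^sup>2) = 0" using assms by (simp add: bump_zero_iff power_mono)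
    then show ?thesis by (simp add: cutoff_def)
  qed
  show "0 \<le> cutoff r R x" "cutoff r R x \<le> 1"
    using pos[of x] bump_nonneg by (auto simp: cutoff_def divide_le_eq)
qed

lemma laplacian_mult:
  assumes f: "smooth f" and g: "smooth g"
  shows "laplacian (\<lambda>x. f x * g x) x =
    f x * laplacian g x + 2 * (\<Sum>i\<in>UNIV. partial i f x * partial i g x) + laplacian f x * g x"
proof -
  have d: "\<And>x. f differentiable at x" "\<And>x. g differentiable at x"
    "\<And>x i. partial i f differentiable at x" "\<And>x i. partial i g differentiable at x"
    using f g by (auto intro!: smooth_diff smooth_partial)
  have 1: "partial i (\<lambda>x. f x * g x) = (\<lambda>x. f x * partial i g x + partial i f x * g x)" for i
    using partial_mult[OF d(1,2)] by blast
  have "partial i (partial i (\<lambda>x. f x * g x)) x =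
     f x * partial i (partial i g) x + 2 * (partial i f x * partial i g x) + partial i (partial i f) x * g x" for i
    unfolding 1 using d by (subst partial_add) (auto simp: partial_mult intro!: derivative_intros)
  then show ?thesis
    unfolding laplacian_def by (simp add: sum.distrib sum_distrib_left sum_distrib_right)
qed

lemma smooth_laplacian: "smooth f \<Longrightarrow> smooth (laplacian f)"
  unfolding laplacian_def[abs_def] by (intro smooth_sum smooth_partial)

text \<open>Derivatives vanish where f vanishes on a neighbourhood, hence the strict inequality.
  This is the origin of radii such as R + 1 further on, wherever a closed condition is wanted for a
  derivative.\<close>

lemma partial_outside:
  assumes "\<And>x. R \<le> norm x \<Longrightarrow> f x = 0" "R < norm x"
  shows "partial i f x = 0" "laplacian f x = 0"
proof -
  have o: "open {x::real^2. R < norm x}" by (intro open_Collect_less continuous_intros)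
  show "partial i f x = 0"
    using partial_cong_open[OF o, of x f "\<lambda>_. 0" i] assms by (simp add: partial_const)
  show "laplacian f x = 0"
    using laplacian_cong_open[OF o, of x f "\<lambda>_. 0"] assms by (simp add: laplacian_def partial_const)
qed

section \<open>The fundamental lemma of the calculus of variations\<close>

text \<open>Open boxes form an intersection-stable generator of the Borel sets, and the sets over
  which f integrates to 0 form a Dynkin system. Complements require the integral over the whole
  space to vanish, which follows by exhausting it with cubes.\<close>

lemma AE_zero_of_box_integrals:
  fixes f :: "'a::euclidean_space \<Rightarrow> complex"
  assumes f: "L1 f"
    and box: "\<And>a b. (LBINT x. ind (box a b) x *\<^sub>R f x) = 0"
  shows "AE x in lborel. f x = 0"
proof (rule sigma_finite_measure.density_zero[OF sigma_finite_lborel f])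
  have [measurable]: "f \<in> BM" using f by auto
  fix A :: "'a set" assume "A \<in> sets lborel"
  let ?E = "range (\<lambda>(a, b). box a b::'a set)"
  have tot: "(LBINT x. f x) = 0"
  proof -
    let ?A = "\<lambda>n::nat. box (- (real n *\<^sub>R One)) (real n *\<^sub>R One) :: 'a set"
    have "(\<lambda>n. LBINT x. ind (?A n) x *\<^sub>R f x) \<longlonglongrightarrow> (LBINT x. f x)"
    proof (rule integral_dominated_convergence[where w="\<lambda>x. norm (f x)"])
      show "AE x in lborel. (\<lambda>n. ind (?A n) x *\<^sub>R f x) \<longlonglongrightarrow> f x"
      proof (rule AE_I2)
        fix x :: 'a
        obtain n where n: "x \<in> ?A n" using UN_box_eq_UNIV by blast
        have "x \<in> ?A m" if "n \<le> m" for m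
        proof -
          have "real n \<le> real m" using that by simp
          moreover have "One \<bullet> i = 1" if "i \<in> Basis" for i :: 'a
            using that by (simp add: inner_sum_left inner_Basis if_distrib)
          ultimately show ?thesis using n unfolding box_def inner_minus_left inner_scaleR_left
            by (fastforce intro: less_le_trans le_less_trans)
        qed
        then have "\<forall>\<^sub>F m in sequentially. ind (?A m) x *\<^sub>R f x = f x"
          by (intro eventually_mono[OF eventually_ge_at_top[of n]]) auto
        then show "(\<lambda>n. ind (?A n) x *\<^sub>R f x) \<longlonglongrightarrow> f x" by (rule tendsto_eventually)
      qed
    qed (use f in \<open>auto simp: indicator_def\<close>)
    then show ?thesis by (simp add: box LIMSEQ_const_iff)
  qed
  have A: "A \<in> sigma_sets UNIV ?E"
    using \<open>A \<in> sets lborel\<close> by (simp add: borel_eq_box)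
  have st: "Int_stable ?E" by (auto simp: Int_stable_def box_Int_box)
  have sub: "?E \<subseteq> Pow UNIV" by simp
  from A show "set_lebesgue_integral lborel A f = 0"
  proof (induction rule: sigma_sets_induct_disjoint[OF st sub, consumes 1, case_names basic empty compl union])
    case (basic A) then show ?case using box by (auto simp: set_lebesgue_integral_def)
  next
    case (compl A)
    have [measurable]: "A \<in> sets borel" using compl by (simp add: borel_eq_box)
    have "set_lebesgue_integral lborel (UNIV - A) f = (LBINT x. f x - ind A x *\<^sub>R f x)"
      unfolding set_lebesgue_integral_def by (intro bochner_cong) (auto simp: indicator_def)
    also have "\<dots> = 0" using compl tot f
      by (subst Bochner_Integration.integral_diff) (auto simp: set_lebesgue_integral_def intro!: integrable_mult_indicator)
    finally show ?case .
  next
    case (union A)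
    have [measurable]: "A i \<in> sets borel" for i using union by (auto simp: borel_eq_box)
    have "set_integrable lborel (\<Union>i. A i) f"
      unfolding set_integrable_def using f by (intro integrable_mult_indicator) auto
    then have "set_lebesgue_integral lborel (\<Union>i. A i) f = (\<Sum>i. set_lebesgue_integral lborel (A i) f)"
      using union by (intro lebesgue_integral_countable_add) (auto simp: disjoint_family_on_def)
    then show ?case using union by simp
  qed (auto simp: set_lebesgue_integral_def)
qed

section \<open>Borel representatives of almost-everywhere classes\<close>

definition rep :: "(real^2) set \<Rightarrow> (real^2 \<Rightarrow> complex) \<Rightarrow> (real^2 \<Rightarrow> complex) \<Rightarrow> bool" where
  "rep \<Omega> f f' \<longleftrightarrow> f' \<in> BM \<and> (\<forall>x. x \<notin> \<Omega> \<longrightarrow> f' x = 0) \<and>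
     (AE x in lborel. x \<in> \<Omega> \<longrightarrow> f x = f' x)"

lemma AE_lebesgue_on_iff:
  assumes "\<Omega> \<in> sets borel"
  shows "(AE x in lebesgue_on \<Omega>. P x) \<longleftrightarrow> (AE x in lborel. x \<in> \<Omega> \<longrightarrow> P x)"
  using assms by (subst AE_restrict_space_iff) (auto simp: AE_completion_iff)

text \<open>The hypotheses concern the completed measure \<open>lebesgue_on \<Omega>\<close>, while
  Fubini, changes of variables and Hausdorff measure are handled on Borel functions. A
  representative that is Borel on the plane and zero off \<Omega> passes between the two. It is
  obtained for the real and imaginary parts separately, since a completion-measurable real function
  agrees almost everywhere with a Borel one.\<close>

lemma rep_exists:
  assumes \<Omega>: "\<Omega> \<in> sets borel" and f: "f \<in> borel_measurable (lebesgue_on \<Omega>)"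
  shows "\<exists>f'. rep \<Omega> f f'"
proof -
  have f1: "(\<lambda>x. if x \<in> \<Omega> then f x else 0) \<in> borel_measurable lebesgue"
    using f \<Omega> by (subst borel_measurable_if) auto
  then have "(\<lambda>x. Re (if x \<in> \<Omega> then f x else 0)) \<in> borel_measurable lebesgue"
    "(\<lambda>x. Im (if x \<in> \<Omega> then f x else 0)) \<in> borel_measurable lebesgue" by measurable
  from this[THEN completion_ex_borel_measurable_real] obtain a b where
    ab: "a \<in> BM" "b \<in> BM"
     "AE x in lborel. Re (if x \<in> \<Omega> then f x else 0) = a x" "AE x in lborel. Im (if x \<in> \<Omega> then f x else 0) = b x"
    by auto
  note [measurable] = ab(1,2) \<Omega>
  have "rep \<Omega> f (\<lambda>x. ind \<Omega> x *\<^sub>R Complex (a x) (b x))"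
    unfolding rep_def
  proof (intro conjI)
    have "(\<lambda>x. ind \<Omega> x *\<^sub>R Complex (a x) (b x)) = (\<lambda>x. ind \<Omega> x *\<^sub>R (of_real (a x) + \<i> * of_real (b x)))"
      by (simp add: Complex_eq)
    then show "(\<lambda>x. ind \<Omega> x *\<^sub>R Complex (a x) (b x)) \<in> BM"
      by simp
    show "AE x in lborel. x \<in> \<Omega> \<longrightarrow> f x = ind \<Omega> x *\<^sub>R Complex (a x) (b x)"
      using ab(3,4) by eventually_elim (auto simp: complex_eq_iff)
  qed auto
  then show ?thesis by blast
qed

lemma
  assumes \<Omega>: "\<Omega> \<in> sets borel" and r: "rep \<Omega> f f'"
  shows rep_measurable: "f \<in> borel_measurable (lebesgue_on \<Omega>)"
    and rep_integral: "integral\<^sup>L (lebesgue_on \<Omega>) f = integral\<^sup>L lborel f'"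
    and rep_integrable: "integrable (lebesgue_on \<Omega>) f \<longleftrightarrow> L1 f'"
proof -
  have f'[measurable]: "f' \<in> BM" using r by (auto simp: rep_def)
  define f1 where "f1 x = (if x \<in> \<Omega> then f x else 0)" for x
  have ae: "AE x in lborel. f' x = f1 x"
  proof -
    have "AE x in lborel. x \<in> \<Omega> \<longrightarrow> f x = f' x" and "\<forall>x. x \<notin> \<Omega> \<longrightarrow> f' x = 0"
      using r by (auto simp: rep_def)
    then show ?thesis unfolding f1_def by (auto elim!: eventually_mono)
  qed
  have ae': "AE x in lebesgue. f' x = f1 x" using ae by (rule AE_completion)
  have f'l: "f' \<in> borel_measurable lebesgue" by (rule measurable_completion) simp
  have m1: "f1 \<in> borel_measurable lebesgue"
    using borel_measurable_AE[OF f'l ae'] .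
  show m: "f \<in> borel_measurable (lebesgue_on \<Omega>)"
    using m1 \<Omega> unfolding f1_def by (subst (asm) borel_measurable_if) auto
  have "integral\<^sup>L (lebesgue_on \<Omega>) f = integral\<^sup>L lebesgue f1"
    using \<Omega> by (subst integral_restrict_space) (auto intro!: bochner_cong simp: f1_def)
  also have "\<dots> = integral\<^sup>L lebesgue f'"
    using m1 f'l ae' by (intro integral_cong_AE) auto
  also have "\<dots> = integral\<^sup>L lborel f'" by (rule integral_completion) simp
  finally show "integral\<^sup>L (lebesgue_on \<Omega>) f = integral\<^sup>L lborel f'" .
  have "integrable (lebesgue_on \<Omega>) f \<longleftrightarrow> integrable lebesgue f1"
    using \<Omega> by (subst integrable_restrict_space) (auto intro!: Bochner_Integration.integrable_cong simp: f1_def)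
  also have "\<dots> \<longleftrightarrow> integrable lebesgue f'"
    using m1 f'l ae' by (intro integrable_cong_AE) auto
  also have "\<dots> \<longleftrightarrow> L1 f'" by (rule integrable_completion) simp
  finally show "integrable (lebesgue_on \<Omega>) f \<longleftrightarrow> L1 f'" .
qed

lemma rep_mult: "rep \<Omega> f f' \<Longrightarrow> g \<in> BM \<Longrightarrow> rep \<Omega> (\<lambda>x. f x * g x) (\<lambda>x. f' x * g x)"
  unfolding rep_def by (auto elim: eventually_mono)

lemma rep_add: "rep \<Omega> f f' \<Longrightarrow> rep \<Omega> g g' \<Longrightarrow> rep \<Omega> (\<lambda>x. f x + g x) (\<lambda>x. f' x + g' x)"
  unfolding rep_def by (elim conjE, intro conjI, simp, simp, erule eventually_elim2, assumption, auto)

lemma smooth_borel: "smooth f \<Longrightarrow> f \<in> BM"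
  using smooth_cont borel_measurable_continuous_onI by blast

definition box_bump :: "nat \<Rightarrow> real^2 \<Rightarrow> real^2 \<Rightarrow> real^2 \<Rightarrow> complex" where
  "box_bump n a b x = (\<Prod>i\<in>UNIV. of_real (bump (real n * (x $ i - a $ i))) * of_real (bump (real n * (b $ i - x $ i))))"

lemma smooth_prod: "(\<And>i. i \<in> I \<Longrightarrow> smooth (f i)) \<Longrightarrow> smooth (\<lambda>x. \<Prod>i\<in>I. f i x)"
  by (induction I rule: infinite_finite_induct) (auto intro: smooth_mult smooth_const)

lemma smooth_affine: "smooth (\<lambda>x. complex_of_real (c * (a \<bullet> x) + d))"
  by (simp add: smooth_add smooth_mult smooth_const smooth_inner)

lemma smooth_box_bump: "smooth (box_bump n a b)"
proof -
  have "smooth (\<lambda>x. complex_of_real (bump (real n * (x $ i - a $ i))))"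
    "smooth (\<lambda>x. complex_of_real (bump (real n * (b $ i - x $ i))))" for i
    using smooth_bumpp[OF smooth_affine[of "real n" "axis i 1" "- real n * a $ i"]] smooth_bumpp[OF smooth_affine[of "- real n" "axis i 1" "real n * b $ i"]]
    by (simp_all add: inner_axis' algebra_simps del: of_real_add of_real_mult of_real_diff of_real_minus)
  then show ?thesis unfolding box_bump_def[abs_def] by (intro smooth_prod smooth_mult)
qed

lemma box_bump_outside: "x \<notin> box a b \<Longrightarrow> box_bump n a b x = 0"
proof -
  assume "x \<notin> box a b"
  then obtain i where "x $ i \<le> a $ i \<or> b $ i \<le> x $ i" by (auto simp: mem_box_cart not_less)
  then have "bump (real n * (x $ i - a $ i)) = 0 \<or> bump (real n * (b $ i - x $ i)) = 0"
    by (auto simp: bump_zero_iff mult_nonneg_nonpos)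
  then show ?thesis unfolding box_bump_def by (intro prod_zero) auto
qed

lemma norm_box_bump: "norm (box_bump n a b x) \<le> 1"
  unfolding box_bump_def
  unfolding prod_norm[symmetric] norm_mult
  by (intro prod_le_1 conjI mult_le_one mult_nonneg_nonneg) (simp_all add: bump_nonneg bump_le1)

lemma box_bump_tendsto: "(\<lambda>n. box_bump n a b x) \<longlonglongrightarrow> ind (box a b) x"
proof -
  have "(\<lambda>n. box_bump n a b x) \<longlonglongrightarrow>
     (\<Prod>i\<in>UNIV. of_real (ind {0<..} (x $ i - a $ i)) * of_real (ind {0<..} (b $ i - x $ i)))"
    unfolding box_bump_def by (intro tendsto_prod tendsto_mult tendsto_of_real bump_scaled_tendsto)
  also have "(\<Prod>i\<in>UNIV. of_real (ind {0<..} (x $ i - a $ i)) * of_real (ind {0<..} (b $ i - x $ i)))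
      = (ind (box a b) x :: complex)"
    by (auto simp: indicator_def mem_box_cart UNIV_2 forall_2)
  finally show ?thesis .
qed

lemma test_functionI:
  assumes "smooth \<phi>" "compact K" "K \<subseteq> \<Omega>" "\<And>x. x \<notin> K \<Longrightarrow> \<phi> x = 0"
  shows "test_function \<Omega> \<phi>"
proof -
  have "closure {x. \<phi> x \<noteq> 0} \<subseteq> K"
    using assms by (intro closure_minimal) (auto intro: compact_imp_closed)
  moreover from this have "compact (closure {x. \<phi> x \<noteq> 0})"
    using assms(2) by (metis compact_Int_closed closed_closure Int_absorb1)
  ultimately show ?thesis unfolding test_function_def using assms by blast
qed

text \<open>As f is only locally integrable, the argument is run on one closed box inside \<Omega>
  at a time: smooth bumps converge boundedly to the indicators of smaller boxes, so all box
  integrals of f vanish. Countably many such boxes cover \<Omega>.\<close>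

lemma fundamental_lemma:
  assumes \<Omega>: "open \<Omega>" and f: "locally_integrable \<Omega> f"
    and 0: "\<And>\<phi>. test_function \<Omega> \<phi> \<Longrightarrow> integral\<^sup>L (lebesgue_on \<Omega>) (\<lambda>x. f x * \<phi> x) = 0"
  shows "AE x in lebesgue_on \<Omega>. f x = 0"
proof -
  have main: "AE x in lborel. x \<in> cbox p q \<longrightarrow> f x = 0" if K: "cbox p q \<subseteq> \<Omega>" for p q
  proof -
    have int: "integrable (lebesgue_on (cbox p q)) f" using f K by (auto simp: locally_integrable_def)
    then obtain f' where r: "rep (cbox p q) f f'" using rep_exists[of "cbox p q" f] by auto
    have f'i: "L1 f'" using rep_integrable[OF _ r] int by simp
    then have [measurable]: "f' \<in> BM" by auto
    have sub: "(LBINT x. ind (box a b) x *\<^sub>R f' x) = 0" if ab: "box a b \<subseteq> box p q" for a b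
    proof (cases "box a b = {}")
      case False
      \<comment> \<open>For a nonempty open box the closure is the closed box, so the support of
        \<open>box_bump\<close> remains inside \<Omega>; an empty box has been set aside because its
        closed version need not be contained in anything.\<close>
      then have ab': "cbox a b \<subseteq> cbox p q" using closure_mono[OF ab] by (metis closure_box bot.extremum_uniqueI ab)
      have "(LBINT x. f' x * box_bump n a b x) = 0" for n
      proof -
        have "test_function \<Omega> (box_bump n a b)"
          by (rule test_functionI[OF smooth_box_bump compact_cbox[of a b]])
            (use ab' K box_subset_cbox[of a b] in \<open>auto intro: box_bump_outside\<close>)
        from 0[OF this] have "integral\<^sup>L (lebesgue_on \<Omega>) (\<lambda>x. f x * box_bump n a b x) = 0" .
        moreover have "rep \<Omega> (\<lambda>x. f x * box_bump n a b x) (\<lambda>x. f' x * box_bump n a b x)"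
        proof -
          have 1: "rep (cbox p q) (\<lambda>x. f x * box_bump n a b x) (\<lambda>x. f' x * box_bump n a b x)"
            by (rule rep_mult[OF r smooth_borel[OF smooth_box_bump]])
          have "box_bump n a b x = 0" if "x \<notin> cbox p q" for x
            using that ab box_subset_cbox[of p q] by (intro box_bump_outside) auto
          with 1 K show ?thesis unfolding rep_def by (auto elim!: eventually_mono)
        qed
        ultimately show ?thesis using rep_integral[OF borel_open[OF \<Omega>]] by simp
      qed
      moreover have "(\<lambda>n. LBINT x. f' x * box_bump n a b x) \<longlonglongrightarrow> (LBINT x. f' x * ind (box a b) x)"
      proof (rule integral_dominated_convergence[where w="\<lambda>x. norm (f' x)"])
        show "AE x in lborel. norm (f' x * box_bump i a b x) \<le> norm (f' x)" for i
          using norm_box_bump by (auto simp: norm_mult intro!: mult_left_le)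
        show "AE x in lborel. (\<lambda>i. f' x * box_bump i a b x) \<longlonglongrightarrow> f' x * ind (box a b) x"
          by (intro AE_I2 tendsto_mult box_bump_tendsto tendsto_const)
        have [measurable]: "box_bump i a b \<in> BM" for i
          by (rule smooth_borel[OF smooth_box_bump])
        show "(\<lambda>x. f' x * box_bump i a b x) \<in> borel_measurable lborel" for i by measurable
      qed (use f'i in auto)
      ultimately have "(LBINT x. f' x * ind (box a b) x) = 0"
        by (simp add: LIMSEQ_const_iff)
      moreover have "(\<lambda>x. f' x * ind (box a b) x) = (\<lambda>x. ind (box a b) x *\<^sub>R f' x)"
        by (auto simp: indicator_def)
      ultimately show ?thesis by simp
    qed auto
    have "AE x in lborel. ind (box p q) x *\<^sub>R f' x = 0"
    proof (rule AE_zero_of_box_integrals)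
      show "L1 (\<lambda>x. indicat_real (box p q) x *\<^sub>R f' x)"
        using f'i by (intro integrable_mult_indicator) auto
      fix a b :: "real^2"
      obtain c d where cd: "box a b \<inter> box p q = box c d" by (rule that[OF box_Int_box])
      have "(LBINT x. indicat_real (box a b) x *\<^sub>R indicat_real (box p q) x *\<^sub>R f' x) =
         (LBINT x. ind (box c d) x *\<^sub>R f' x)"
        unfolding cd[symmetric] by (intro bochner_cong) (auto simp: indicator_def)
      also have "\<dots> = 0" using sub cd by blast
      finally show "(LBINT x. indicat_real (box a b) x *\<^sub>R indicat_real (box p q) x *\<^sub>R f' x) = 0" .
    qed
    moreover have "AE x in lborel. x \<notin> cbox p q - box p q"
    proof -
      have "negligible (cbox p q - box p q)" by (rule negligible_frontier_interval)
      then have "cbox p q - box p q \<in> null_sets lborel"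
        by (simp add: negligible_iff_null_sets null_sets_completion_iff)
      then show ?thesis by (rule AE_not_in)
    qed
    moreover have "AE x in lborel. x \<in> cbox p q \<longrightarrow> f x = f' x" using r by (auto simp: rep_def)
    ultimately show ?thesis by eventually_elim (auto simp: indicator_def)
  qed
  obtain D where D: "countable D" "D \<subseteq> Pow \<Omega>" "\<And>X. X \<in> D \<Longrightarrow> \<exists>a b. X = cbox a b" "\<Union>D = \<Omega>"
    using open_countable_Union_open_cbox[OF \<Omega>] by metis
  have "AE x in lborel. x \<in> X \<longrightarrow> f x = 0" if "X \<in> D" for X
    using main D(2,3) that by (metis PowD subsetD)
  then have "AE x in lborel. \<forall>X\<in>D. x \<in> X \<longrightarrow> f x = 0"
    unfolding AE_ball_countable[OF D(1)] by blast
  then have "AE x in lborel. x \<in> \<Omega> \<longrightarrow> f x = 0"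
    by eventually_elim (use D in auto)
  then show ?thesis using \<Omega> by (subst AE_lebesgue_on_iff) auto
qed

section \<open>Uniqueness of weak derivatives\<close>

lemma locally_integrable_diff:
  "locally_integrable \<Omega> f \<Longrightarrow> locally_integrable \<Omega> g \<Longrightarrow> locally_integrable \<Omega> (\<lambda>x. f x - g x)"
  unfolding locally_integrable_def by auto

lemma locally_integrable_test:
  assumes f: "locally_integrable \<Omega> f" and \<Omega>: "open \<Omega>" and \<phi>: "test_function \<Omega> \<phi>"
  shows "integrable (lebesgue_on \<Omega>) (\<lambda>x. f x * \<phi> x)"
proof -
  define K where "K = closure {x. \<phi> x \<noteq> 0}"
  have K: "compact K" "K \<subseteq> \<Omega>" "\<And>x. x \<notin> K \<Longrightarrow> \<phi> x = 0"
    using \<phi> closure_subset[of "{x. \<phi> x \<noteq> 0}"] unfolding K_def test_function_def by blast+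
  have \<phi>c: "continuous_on UNIV \<phi>" using \<phi> by (auto simp: test_function_def intro: smooth_cont)
  have int: "integrable (lebesgue_on K) f" using f K by (auto simp: locally_integrable_def)
  have Kb: "K \<in> sets borel" using K by (simp add: compact_imp_closed)
  obtain f' where r: "rep K f f'" using rep_exists[OF Kb borel_measurable_integrable[OF int]] by blast
  have f'i: "L1 f'" using rep_integrable[OF Kb r] int by simp
  have "bounded (\<phi> ` K)" by (intro compact_imp_bounded compact_continuous_image continuous_on_subset[OF \<phi>c] K) auto
  then obtain C where C: "\<And>x. x \<in> K \<Longrightarrow> norm (\<phi> x) \<le> C" by (auto simp: bounded_iff)
  have [measurable]: "\<phi> \<in> BM" using \<phi>c by (rule borel_measurable_continuous_onI)
  have "L1 (\<lambda>x. f' x * \<phi> x)"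
  proof (rule bochner_bound[of _ "\<lambda>x. C * norm (f' x)"])
    show "(\<lambda>x. f' x * \<phi> x) \<in> borel_measurable lborel" using f'i by measurable
    have "norm (f' x * \<phi> x) \<le> norm (C * norm (f' x))" for x
    proof (cases "x \<in> K")
      case True
      have "norm (f' x * \<phi> x) \<le> norm (f' x) * C" using C[OF True] by (auto simp: norm_mult intro: mult_left_mono)
      also have "\<dots> \<le> norm (C * norm (f' x))" by (simp add: mult.commute)
      finally show ?thesis .
    qed (use K in auto)
    then show "AE x in lborel. norm (f' x * \<phi> x) \<le> norm (C * norm (f' x))" by auto
  qed (use f'i in auto)
  moreover have "rep \<Omega> (\<lambda>x. f x * \<phi> x) (\<lambda>x. f' x * \<phi> x)"
    using rep_mult[OF r, of \<phi>] K unfolding rep_def by (auto elim!: eventually_mono)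
  ultimately show ?thesis using rep_integrable[OF borel_open[OF \<Omega>]] by simp
qed

text \<open>\<open>sobolev\<close>, \<open>has_trace\<close> and
  \<open>has_normal_derivative\<close> each assert the existence of their own weak derivatives; this
  identifies them with one another.\<close>

lemma weak_partial_unique:
  assumes \<Omega>: "open \<Omega>" and "weak_partial \<Omega> i u d" "weak_partial \<Omega> i u d'"
  shows "AE x in lebesgue_on \<Omega>. d x = d' x"
proof -
  have "AE x in lebesgue_on \<Omega>. d x - d' x = 0"
  proof (rule fundamental_lemma[OF \<Omega>])
    show "locally_integrable \<Omega> (\<lambda>x. d x - d' x)" using assms by (auto simp: weak_partial_def intro: locally_integrable_diff)
    fix \<phi> assume t: "test_function \<Omega> \<phi>"
    have "integral\<^sup>L (lebesgue_on \<Omega>) (\<lambda>x. d x * \<phi> x) = integral\<^sup>L (lebesgue_on \<Omega>) (\<lambda>x. d' x * \<phi> x)"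
    proof -
      have "(LINT x|lebesgue_on \<Omega>. u x * partial i \<phi> x) = - (LINT x|lebesgue_on \<Omega>. d x * \<phi> x)"
        "(LINT x|lebesgue_on \<Omega>. u x * partial i \<phi> x) = - (LINT x|lebesgue_on \<Omega>. d' x * \<phi> x)"
        using assms(2,3) t unfolding weak_partial_def by simp_all
      then show ?thesis by simp
    qed
    then show "(LINT x|lebesgue_on \<Omega>. (d x - d' x) * \<phi> x) = 0"
      using assms t locally_integrable_test[OF _ \<Omega> t] unfolding weak_partial_def left_diff_distrib
      by (subst Bochner_Integration.integral_diff) auto
  qed
  then show ?thesis by simp
qed

text \<open>It identifies the unnamed Laplacian in \<open>has_normal_derivative\<close> with the
  right-hand side supplied by the differential equation.\<close>

lemma weak_laplacian_unique:
  assumes \<Omega>: "open \<Omega>" and "weak_laplacian \<Omega> u d" "weak_laplacian \<Omega> u d'"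
  shows "AE x in lebesgue_on \<Omega>. d x = d' x"
proof -
  have "AE x in lebesgue_on \<Omega>. d x - d' x = 0"
  proof (rule fundamental_lemma[OF \<Omega>])
    show "locally_integrable \<Omega> (\<lambda>x. d x - d' x)" using assms by (auto simp: weak_laplacian_def intro: locally_integrable_diff)
    fix \<phi> assume t: "test_function \<Omega> \<phi>"
    have "integral\<^sup>L (lebesgue_on \<Omega>) (\<lambda>x. d x * \<phi> x) = integral\<^sup>L (lebesgue_on \<Omega>) (\<lambda>x. d' x * \<phi> x)"
      using assms(2,3) t unfolding weak_laplacian_def by simp
    then show "(LINT x|lebesgue_on \<Omega>. (d x - d' x) * \<phi> x) = 0"
      using assms t locally_integrable_test[OF _ \<Omega> t] unfolding weak_laplacian_def left_diff_distrib
      by (subst Bochner_Integration.integral_diff) auto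
  qed
  then show ?thesis by simp
qed

section \<open>Sectors in oblique coordinates\<close>

definition dir :: "real \<Rightarrow> real^2" where "dir az = vector [cos az, sin az]"
text \<open>The direction \<open>dir az\<close> turned clockwise by a right angle. On the lower edge
  of a sector it is the exterior unit normal, on the upper edge the interior one; all opposite signs
  between the two edges come from this.\<close>

definition nrm :: "real \<Rightarrow> real^2" where "nrm az = vector [sin az, - cos az]"

lemma dir_nth [simp]: "dir az $ 1 = cos az" "dir az $ 2 = sin az"
  by (auto simp: dir_def)
lemma nrm_nth [simp]: "nrm az $ 1 = sin az" "nrm az $ 2 = - cos az"
  by (auto simp: nrm_def)

lemma inner_2: "x \<bullet> y = x $ 1 * y $ 1 + x $ 2 * (y::real^2) $ 2"
  by (simp add: inner_vec_def sum_2)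

lemma nrm_dir: "nrm az \<bullet> dir \<phi> = sin (az - \<phi>)"
  by (simp add: inner_2 sin_diff)
lemma dir_dir: "dir az \<bullet> dir \<phi> = cos (az - \<phi>)"
  by (simp add: inner_2 cos_diff)
lemma norm_dir [simp]: "norm (dir az) = 1"
  by (simp add: norm_eq_sqrt_inner dir_dir)

lemma norm_2: "norm (x::real^2) = sqrt ((x $ 1)\<^sup>2 + (x $ 2)\<^sup>2)"
  by (simp add: norm_eq_sqrt_inner inner_2 power2_eq_square)

lemma polar_form:
  assumes "x \<noteq> 0"
  shows "x = norm x *\<^sub>R dir (polar_angle x)" "- pi < polar_angle x" "polar_angle x \<le> pi"
proof -
  let ?z = "Complex (x $ 1) (x $ 2)"
  have n: "norm ?z = norm x" by (simp add: norm_2 cmod_def)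
  then have "?z \<noteq> 0" using assms by (metis norm_eq_zero)
  then have "?z = of_real (norm ?z) * exp (\<i> * of_real (Arg ?z))" by (rule Arg_eq)
  then have "?z = of_real (norm x) * cis (polar_angle x)" by (simp add: n polar_angle_def cis_conv_exp)
  then have "x $ 1 = norm x * cos (polar_angle x)" "x $ 2 = norm x * sin (polar_angle x)"
    by (auto simp: complex_eq_iff)
  then show "x = norm x *\<^sub>R dir (polar_angle x)" by (simp add: vec_eq_iff forall_2)
  show "- pi < polar_angle x" "polar_angle x \<le> pi"
    using mpi_less_Arg Arg_le_pi by (auto simp: polar_angle_def)
qed

lemma polar_angle_dir:
  assumes "r > 0" "- pi < az" "az \<le> pi"
  shows "polar_angle (r *\<^sub>R dir az) = az"
  unfolding polar_angle_def
proof (rule Arg_unique[of r])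
  show "of_real r * exp (\<i> * of_real az) = Complex ((r *\<^sub>R dir az) $ 1) ((r *\<^sub>R dir az) $ 2)"
    by (simp add: cis_conv_exp[symmetric] complex_eq_iff)
qed (use assms in auto)

text \<open>A cone of opening less than pi is an intersection of two half-planes. In polar form the
  two inner products are |x| sin(az2 - \<phi>) and -|x| sin(\<phi> - az1), where \<phi> is the polar
  angle. The second claim is the closed version, needed for closures.\<close>

lemma cone_iff:
  assumes "- pi < az1" "az1 < az2" "az2 < pi" "az2 - az1 < pi"
  shows "x \<in> sector az1 az2 \<longleftrightarrow> nrm az2 \<bullet> x > 0 \<and> nrm az1 \<bullet> x < 0"
    and "x \<noteq> 0 \<Longrightarrow> nrm az2 \<bullet> x \<ge> 0 \<Longrightarrow> nrm az1 \<bullet> x \<le> 0 \<Longrightarrow> az1 \<le> polar_angle x \<and> polar_angle x \<le> az2"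
proof -
  \<comment> \<open>A difference of two angles ranges over (-2 pi, 2 pi), where sin is nonnegative
    on a second interval to the left of -pi. The two sign conditions together rule it out: if one
    difference lay there, the other would exceed pi.\<close>
  have sp: "sin d > 0 \<Longrightarrow> 0 < d \<or> d < - pi" "sin d \<ge> 0 \<Longrightarrow> d \<le> pi" "sin d \<ge> 0 \<Longrightarrow> 0 \<le> d \<or> d \<le> - pi"
    if "-2 * pi < d" "d < 2 * pi" for d
  proof -
    have 1: "sin d \<le> 0" if "- pi \<le> d" "d \<le> 0"
      using sin_ge_zero[of "- d"] that by simp
    have 2: "sin d < 0" if "- pi < d" "d < 0"
      using sin_gt_zero[of "- d"] that by simp
    show "sin d > 0 \<Longrightarrow> 0 < d \<or> d < - pi" using 1 by fastforce
    show "sin d \<ge> 0 \<Longrightarrow> d \<le> pi"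
      using sin_gt_zero[of "d - pi"] \<open>d < 2 * pi\<close> by (force simp: sin_diff)
    show "sin d \<ge> 0 \<Longrightarrow> 0 \<le> d \<or> d \<le> - pi" using 2 by fastforce
  qed
  have f: "nrm az2 \<bullet> x = norm x * sin (az2 - polar_angle x)" "nrm az1 \<bullet> x = - (norm x * sin (polar_angle x - az1))"
    if "x \<noteq> 0"
  proof -
    have "nrm az \<bullet> x = norm x * sin (az - polar_angle x)" for az
      using polar_form(1)[OF that] nrm_dir by (metis inner_scaleR_right)
    moreover have "sin (az1 - polar_angle x) = - sin (polar_angle x - az1)"
      by (metis minus_diff_eq sin_minus)
    ultimately show "nrm az2 \<bullet> x = norm x * sin (az2 - polar_angle x)" "nrm az1 \<bullet> x = - (norm x * sin (polar_angle x - az1))"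
      by simp_all
  qed
  show "x \<in> sector az1 az2 \<longleftrightarrow> nrm az2 \<bullet> x > 0 \<and> nrm az1 \<bullet> x < 0"
  proof (cases "x = 0")
    case False
    note pf = polar_form[OF False]
    have n: "norm x > 0" using False by simp
    have "nrm az2 \<bullet> x > 0 \<longleftrightarrow> sin (az2 - polar_angle x) > 0" "nrm az1 \<bullet> x < 0 \<longleftrightarrow> sin (polar_angle x - az1) > 0"
      using f[OF False] n by (auto simp: zero_less_mult_iff)
    moreover have "sin (az2 - polar_angle x) > 0 \<and> sin (polar_angle x - az1) > 0 \<longleftrightarrow>
      az1 < polar_angle x \<and> polar_angle x < az2"
    proof safe
      assume s: "sin (az2 - polar_angle x) > 0" "sin (polar_angle x - az1) > 0"
      have "-2*pi < az2 - polar_angle x" "az2 - polar_angle x < 2 * pi"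
        "-2*pi < polar_angle x - az1" "polar_angle x - az1 < 2*pi" using assms pf by auto
      with sp(1,2)[of "az2 - polar_angle x"] sp(1,2)[of "polar_angle x - az1"] s assms pf
      show "az1 < polar_angle x" "polar_angle x < az2" by auto
    qed (use assms in \<open>auto intro!: sin_gt_zero\<close>)
    ultimately show ?thesis using False by (simp add: sector_def)
  qed (simp add: sector_def)
  assume x: "x \<noteq> 0" and s: "nrm az2 \<bullet> x \<ge> 0" "nrm az1 \<bullet> x \<le> 0"
  note pf = polar_form[OF x]
  have s: "sin (az2 - polar_angle x) \<ge> 0" "sin (polar_angle x - az1) \<ge> 0"
    using f[OF x] s x by (auto simp: zero_le_mult_iff)
  have "-2*pi < az2 - polar_angle x" "az2 - polar_angle x < 2 * pi"
    "-2*pi < polar_angle x - az1" "polar_angle x - az1 < 2*pi" using assms pf by auto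
  with sp(2,3)[of "az2 - polar_angle x"] sp(2,3)[of "polar_angle x - az1"] s assms pf
  show "az1 \<le> polar_angle x \<and> polar_angle x \<le> az2" by auto
qed

text \<open>Oblique coordinates whose axes are the two edges: the open quadrant becomes the cone, so
  Fubini and the one-variable fundamental theorem act along the edges.\<close>

definition cone_map :: "real \<Rightarrow> real \<Rightarrow> real \<times> real \<Rightarrow> real^2" where
  "cone_map az1 az2 p = fst p *\<^sub>R dir az1 + snd p *\<^sub>R dir az2"

lemma cone_map_eq: "cone_map az1 az2 (s, t) = s *\<^sub>R dir az1 + t *\<^sub>R dir az2"
  by (simp add: cone_map_def)

lemma continuous_cone_map: "continuous_on A (cone_map az1 az2)"
  unfolding cone_map_def[abs_def] by (intro continuous_intros)

lemma borel_cone_map [measurable]: "cone_map az1 az2 \<in> borel \<rightarrow>\<^sub>M borel"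
  by (intro borel_measurable_continuous_onI continuous_cone_map)

lemma nrm_cone_map: "nrm az2 \<bullet> cone_map az1 az2 (s, t) = s * sin (az2 - az1)"
  "nrm az1 \<bullet> cone_map az1 az2 (s, t) = - t * sin (az2 - az1)"
proof -
  have "sin (az1 - az2) = - sin (az2 - az1)" by (metis minus_diff_eq sin_minus)
  then show "nrm az2 \<bullet> cone_map az1 az2 (s, t) = s * sin (az2 - az1)"
  "nrm az1 \<bullet> cone_map az1 az2 (s, t) = - t * sin (az2 - az1)"
  by (simp_all add: cone_map_eq inner_add_right nrm_dir)
qed

lemma cone_map_mem:
  assumes "- pi < az1" "az1 < az2" "az2 < pi" "az2 - az1 < pi"
  shows "cone_map az1 az2 (s, t) \<in> sector az1 az2 \<longleftrightarrow> s > 0 \<and> t > 0"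
proof -
  have "sin (az2 - az1) > 0" using assms by (intro sin_gt_zero) auto
  then show ?thesis using cone_iff(1)[OF assms] by (auto simp: nrm_cone_map zero_less_mult_iff mult_less_0_iff)
qed

lemma continuous_vector: "continuous_on UNIV (\<lambda>p::real \<times> real. vector [fst p, snd p] :: real^2)"
proof -
  have "(\<lambda>p::real \<times> real. vector [fst p, snd p] :: real^2) = (\<lambda>p. fst p *\<^sub>R axis 1 1 + snd p *\<^sub>R axis 2 1)"
    by (auto simp: vec_eq_iff forall_2 axis_def)
  then show ?thesis by (simp only:) (intro continuous_intros)
qed

lemma lborel_distr_vector: "distr lborel borel (\<lambda>p. vector [fst p, snd p] :: real^2) = lborel"
proof (rule lborel_eqI[symmetric])
  have [measurable]: "(\<lambda>p::real \<times> real. vector [fst p, snd p] :: real^2) \<in> borel \<rightarrow>\<^sub>M borel"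
    by (rule borel_measurable_continuous_onI[OF continuous_vector])
  fix l u :: "real^2" assume lu: "\<And>b. b \<in> Basis \<Longrightarrow> l \<bullet> b \<le> u \<bullet> b"
  have le: "l $ i \<le> u $ i" for i using lu[of "axis i 1"] by (simp add: inner_axis)
  have "emeasure (distr lborel borel (\<lambda>p. vector [fst p, snd p])) (box l u) =
     emeasure lborel (box (l $ 1, l $ 2) (u $ 1, u $ 2))"
  proof (subst emeasure_distr)
    have "(\<lambda>p::real \<times> real. vector [fst p, snd p]) -` box l u \<inter> space lborel = box (l $ 1, l $ 2) (u $ 1, u $ 2)"
      by (auto simp: mem_box_cart forall_2 mem_box Basis_prod_def)
    then show "emeasure lborel ((\<lambda>p. vector [fst p, snd p]) -` box l u \<inter> space lborel) =
      emeasure lborel (box (l $ 1, l $ 2) (u $ 1, u $ 2))" by simp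
  qed auto
  also have "\<dots> = ennreal (\<Prod>b\<in>Basis. ((u $ 1, u $ 2) - (l $ 1, l $ 2)) \<bullet> b)"
    by (subst emeasure_lborel_box) (use le in \<open>auto simp: Basis_prod_def\<close>)
  also have "(\<Prod>b\<in>Basis. ((u $ 1, u $ 2) - (l $ 1, l $ 2)) \<bullet> b) = (u $ 1 - l $ 1) * (u $ 2 - l $ 2)"
    by (simp add: Basis_prod_def)
  also have "\<dots> = (\<Prod>i\<in>UNIV. (u - l) $ i)" by (simp add: UNIV_2)
  also have "\<dots> = (\<Prod>b\<in>Basis. (u - l) \<bullet> b)"
    by (subst prod.reindex_bij_betw[symmetric, where h="\<lambda>i. axis i 1" and S=UNIV])
      (auto simp: inner_axis bij_betw_def inj_on_def axis_eq_axis Basis_vec_def)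
  finally show "emeasure (distr lborel borel (\<lambda>p. vector [fst p, snd p])) (box l u) = (\<Prod>b\<in>Basis. (u - l) \<bullet> b)" .
qed simp

text \<open>The Jacobian of the oblique map is sin(az2 - az1). The preimage of a box under
  \<open>A\<close> is its image under the inverse \<open>g\<close>, and linear images have a measure
  formula by determinants. That formula lives on \<open>real^2\<close>, so pairs are first carried
  there by \<open>lborel_distr_vector\<close>.\<close>

lemma lborel_cone:
  assumes D: "sin (az2 - az1) > 0"
  shows "lborel = density (distr lborel borel (cone_map az1 az2)) (\<lambda>_. ennreal (sin (az2 - az1)))"
proof (rule lborel_eqI)
  let ?D = "sin (az2 - az1)"
  let ?E = "\<lambda>p::real \<times> real. vector [fst p, snd p] :: real^2"
  define A :: "real^2 \<Rightarrow> real^2" where "A x = x $ 1 *\<^sub>R dir az1 + x $ 2 *\<^sub>R dir az2" for x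
  define g :: "real^2 \<Rightarrow> real^2" where "g x = vector [nrm az2 \<bullet> x / ?D, - (nrm az1 \<bullet> x) / ?D]" for x
  have g1: "g x $ 1 = nrm az2 \<bullet> x / ?D" and g2: "g x $ 2 = - (nrm az1 \<bullet> x) / ?D" for x by (auto simp: g_def)
  have lin: "linear g"
    by (rule linearI) (auto simp: vec_eq_iff forall_2 g1 g2 inner_add_right add_divide_distrib diff_divide_distrib)
  have ag: "A (g x) = x" for x
  proof -
    have "sin (az2 - az1) *\<^sub>R A (g x) = ?D *\<^sub>R x"
    proof -
      have "?D *\<^sub>R A (g x) = (nrm az2 \<bullet> x) *\<^sub>R dir az1 - (nrm az1 \<bullet> x) *\<^sub>R dir az2"
        using D unfolding A_def by (simp add: g1 g2 scaleR_add_right scaleR_diff_right)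
      also have "\<dots> = ?D *\<^sub>R x"
        by (simp add: vec_eq_iff forall_2 inner_2 sin_diff algebra_simps)
      finally show ?thesis .
    qed
    then show ?thesis using D by simp
  qed
  have ga: "g (A x) = x" for x
    using D nrm_cone_map(1)[of az2 az1 "x $ 1" "x $ 2"] nrm_cone_map(2)[of az1 az2 "x $ 1" "x $ 2"]
    by (simp add: vec_eq_iff forall_2 g1 g2 A_def cone_map_eq)
  have det: "det (matrix g) = 1 / ?D"
  proof -
    have "det (matrix g) = (sin az2 * cos az1 - cos az2 * sin az1) / (?D * ?D)"
      by (simp add: det_2 matrix_def g1 g2 inner_axis diff_divide_distrib mult_ac)
    then show ?thesis using D by (simp add: sin_diff)
  qed
  fix l u :: "real^2" assume lu: "\<And>b. b \<in> Basis \<Longrightarrow> l \<bullet> b \<le> u \<bullet> b"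
  have bm: "box l u \<in> lmeasurable" by simp
  have im: "g ` box l u = A -` box l u"
    by (auto simp: ag ga image_iff intro!: bexI[of _ "A _"])
  have Am: "A \<in> borel \<rightarrow>\<^sub>M borel"
    unfolding A_def[abs_def] by (intro borel_measurable_continuous_onI continuous_intros)
  have bS: "A -` box l u \<in> sets borel" using measurable_sets[OF Am, of "box l u"] by simp
  have Em: "?E \<in> borel \<rightarrow>\<^sub>M borel"
    by (rule borel_measurable_continuous_onI[OF continuous_vector])
  have "emeasure lborel (cone_map az1 az2 -` box l u) = emeasure (distr lborel borel ?E) (A -` box l u)"
    using bS Em by (subst emeasure_distr) (auto simp: vimage_def A_def cone_map_def)
  also have "\<dots> = emeasure lborel (A -` box l u)" by (simp add: lborel_distr_vector)
  also have "\<dots> = emeasure lebesgue (g ` box l u)" using bS by (simp add: im emeasure_completion)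
  also have "\<dots> = ennreal (1 / ?D * measure lebesgue (box l u))"
    using measure_linear_image[OF lin bm] measurable_linear_image[OF lin bm] D
    by (simp add: emeasure_eq_measure2 det)
  finally have "ennreal ?D * emeasure lborel (cone_map az1 az2 -` box l u) = ennreal (measure lebesgue (box l u))"
    using D by (simp add: ennreal_mult[symmetric])
  also have "\<dots> = (\<Prod>b\<in>Basis. (u - l) \<bullet> b)" using lu by (simp add: measure_completion measure_lborel_box_eq)
  finally show "emeasure (density (distr lborel borel (cone_map az1 az2)) (\<lambda>_. ennreal ?D)) (box l u) = (\<Prod>b\<in>Basis. (u - l) \<bullet> b)"
    by (simp add: emeasure_density_const emeasure_distr)
qed simp

lemma
  fixes f :: "real^2 \<Rightarrow> complex"
  assumes D: "sin (az2 - az1) > 0" and [measurable]: "f \<in> BM"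
  shows integral_cone: "(LBINT x. f x) = sin (az2 - az1) *\<^sub>R (LBINT p. f (cone_map az1 az2 p))"
    and integrable_cone: "L1 f \<longleftrightarrow> L1 (\<lambda>p. f (cone_map az1 az2 p))"
proof -
  show "(LBINT x. f x) = sin (az2 - az1) *\<^sub>R (LBINT p. f (cone_map az1 az2 p))"
    using D by (subst lborel_cone[OF D]) (simp add: integral_density integral_distr)
  show "L1 f \<longleftrightarrow> L1 (\<lambda>p. f (cone_map az1 az2 p))"
  proof -
    have "L1 f \<longleftrightarrow> L1 (\<lambda>p. sin (az2 - az1) *\<^sub>R f (cone_map az1 az2 p))"
      using D by (subst lborel_cone[OF D]) (simp add: integrable_density integrable_distr_eq)
    also have "\<dots> \<longleftrightarrow> L1 (\<lambda>p. f (cone_map az1 az2 p))"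
      using D integrable_scaleR_right[of "1 / sin (az2 - az1)" lborel "\<lambda>p. sin (az2 - az1) *\<^sub>R f (cone_map az1 az2 p)"]
      by auto
    finally show ?thesis .
  qed
qed

lemma nn_integral_cone:
  assumes D: "sin (az2 - az1) > 0" and [measurable]: "f \<in> BM"
  shows "(LNN x. f x) = ennreal (sin (az2 - az1)) * (LNN p. f (cone_map az1 az2 p))"
  using D by (subst lborel_cone[OF D]) (simp add: nn_integral_density nn_integral_distr nn_integral_cmult)

lemma AE_cone:
  assumes D: "sin (az2 - az1) > 0" and P: "Measurable.pred borel P"
  shows "(AE x in lborel. P x) \<longleftrightarrow> (AE p in lborel. P (cone_map az1 az2 p))"
  using D P by (subst lborel_cone[OF D]) (simp add: AE_density AE_distr_iff pred_def)

lemma sector_inner: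
  assumes "- pi < azm" "azm < azM" "azM < pi" and x: "x \<in> sector azm azM"
  shows "dir ((azm + azM) / 2) \<bullet> x \<ge> cos ((azM - azm) / 2) * norm x"
proof -
  have x0: "x \<noteq> 0" and a: "azm < polar_angle x" "polar_angle x < azM" using x by (auto simp: sector_def)
  have "dir ((azm + azM) / 2) \<bullet> x = norm x * cos ((azm + azM) / 2 - polar_angle x)"
    using polar_form(1)[OF x0] dir_dir by (metis inner_scaleR_right)
  moreover have "cos ((azM - azm) / 2) \<le> cos \<bar>(azm + azM) / 2 - polar_angle x\<bar>"
    using a assms by (intro cos_monotone_0_pi_le) (auto simp: abs_if field_simps)
  ultimately show ?thesis by (simp add: mult.commute[of _ "norm x"] mult_left_mono)
qed

lemma cos_half_gt:
  assumes "- pi < azm" "azm < azM" "azM < pi" shows "cos ((azM - azm) / 2) > -1"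
proof -
  have "cos pi < cos ((azM - azm) / 2)" using assms by (intro cos_monotone_0_pi) auto
  then show ?thesis by simp
qed

text \<open>Expanding the square gives |x|^2 + \<epsilon>^2 + 2 \<epsilon> (a . x), where a is the
  unit vector of the bisector and a . x \<ge> k |x| with k the cosine of half the opening. Half the
  opening is below pi, so k > -1, and the arithmetic-geometric inequality leaves the factor 1 + k.
  Reflex corners are included. The second set of the union brings in the edges and the
  vertex.\<close>

lemma sector_translate_norm:
  assumes "- pi < azm" "azm < azM" "azM < pi"
  shows "\<exists>m>0. m \<le> 1 \<and> (\<forall>x \<epsilon>. x \<in> sector azm azM \<union> {x. cos ((azM - azm) / 2) * norm x \<le> dir ((azm + azM) / 2) \<bullet> x} \<longrightarrow> \<epsilon> \<ge> 0 \<longrightarrow>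
     m * ((norm x)\<^sup>2 + \<epsilon>\<^sup>2) \<le> (norm (x + \<epsilon> *\<^sub>R dir ((azm + azM) / 2)))\<^sup>2)"
proof -
  define k where "k = cos ((azM - azm) / 2)"
  define m where "m = min 1 (1 + k)"
  have k: "k > -1" using cos_half_gt[OF assms] by (simp add: k_def)
  have "m * ((norm x)\<^sup>2 + \<epsilon>\<^sup>2) \<le> (norm (x + \<epsilon> *\<^sub>R dir ((azm + azM) / 2)))\<^sup>2"
    if "x \<in> sector azm azM \<union> {x. cos ((azM - azm) / 2) * norm x \<le> dir ((azm + azM) / 2) \<bullet> x}" "\<epsilon> \<ge> 0" for x \<epsilon>
  proof -
    have i: "k * norm x \<le> dir ((azm + azM) / 2) \<bullet> x" using that sector_inner[OF assms] by (auto simp: k_def)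
    have "(norm (x + \<epsilon> *\<^sub>R dir ((azm + azM) / 2)))\<^sup>2 = (norm x)\<^sup>2 + \<epsilon>\<^sup>2 + 2 * \<epsilon> * (dir ((azm + azM) / 2) \<bullet> x)"
      unfolding power2_norm_eq_inner
      by (simp add: inner_add_left inner_add_right dir_dir inner_commute power2_eq_square algebra_simps)
    moreover have "2 * \<epsilon> * (k * norm x) \<le> 2 * \<epsilon> * (dir ((azm + azM) / 2) \<bullet> x)"
      using i that by (intro mult_left_mono) auto
    moreover have "m * ((norm x)\<^sup>2 + \<epsilon>\<^sup>2) \<le> (norm x)\<^sup>2 + \<epsilon>\<^sup>2 + 2 * \<epsilon> * (k * norm x)"
    proof (cases "k \<ge> 0")
      case True
      then have "0 \<le> 2 * \<epsilon> * (k * norm x)" using that by simp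
      then show ?thesis using True by (simp add: m_def min_def)
    next
      case False
      have "2 * (\<epsilon> * norm x) \<le> (norm x)\<^sup>2 + \<epsilon>\<^sup>2"
        using sum_squares_bound[of \<epsilon> "norm x"] by (simp add: power2_eq_square algebra_simps)
      then have "k * ((norm x)\<^sup>2 + \<epsilon>\<^sup>2) \<le> k * (2 * (\<epsilon> * norm x))" using False by (intro mult_left_mono_neg) auto
      then show ?thesis using False by (simp add: m_def min_def algebra_simps)
    qed
    ultimately show ?thesis by linarith
  qed
  moreover have "m > 0" "m \<le> 1" using k by (auto simp: m_def)
  ultimately show ?thesis by blast
qed

lemma sector_split:
  "sector azm azM = sector azm az0 \<union> sector az0 azM \<union> ray az0" if "azm < az0" "az0 < azM"
  using that by (auto simp: sector_def ray_def)

lemma ray_iff: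
  assumes "- pi < az" "az < pi"
  shows "ray az = (\<lambda>t. t *\<^sub>R dir az) ` {0<..}"
proof
  show "ray az \<subseteq> (\<lambda>t. t *\<^sub>R dir az) ` {0<..}"
    using polar_form(1) by (auto simp: ray_def image_iff) (metis greaterThan_iff zero_less_norm_iff)
  show "(\<lambda>t. t *\<^sub>R dir az) ` {0<..} \<subseteq> ray az"
  proof
    fix x assume "x \<in> (\<lambda>t. t *\<^sub>R dir az) ` {0<..}"
    then obtain t where "t > 0" "x = t *\<^sub>R dir az" by auto
    then show "x \<in> ray az" using polar_angle_dir[of t az] assms norm_dir[of az]
      by (auto simp: ray_def simp del: norm_dir)
  qed
qed

lemma ray_null:
  assumes "- pi < az" "az < pi"
  shows "AE x in lborel. x \<notin> ray az"
proof -
  have "AE x in lborel. nrm az \<bullet> x \<noteq> 0"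
  proof -
    have "nrm az \<noteq> 0" using norm_dir[of az] sin_zero_iff[of 0] by (auto simp: vec_eq_iff forall_2) (metis sin_cos_squared_add zero_power2 add_0 zero_neq_one)
    then have "negligible {x. nrm az \<bullet> x = 0}" by (rule negligible_hyperplane[OF disjI1])
    then have "{x. nrm az \<bullet> x = 0} \<in> null_sets lborel"
      by (subst null_sets_completion_iff[symmetric]) (auto simp: negligible_iff_null_sets)
    from AE_not_in[OF this] show ?thesis by simp
  qed
  then show ?thesis
  proof eventually_elim
    case (elim x)
    then show ?case using assms by (auto simp: ray_iff nrm_dir)
  qed
qed

section \<open>Hausdorff measure on the edges of a corner\<close>

lemma hausdorff_outer_singleton: "hausdorff_outer {x} = 0"
proof -
  have "hausdorff_pre \<delta> {x} \<le> 0" if "\<delta> > 0" for \<delta>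
  proof -
    have "hausdorff_pre \<delta> {x} \<le> (\<Sum>i::nat. ennreal (diameter {x}))"
      unfolding hausdorff_pre_def using that by (intro INF_lower) auto
    then show ?thesis by simp
  qed
  then have "hausdorff_outer {x} \<le> 0" unfolding hausdorff_outer_def by (intro SUP_least) auto
  then show ?thesis by simp
qed

text \<open>The upper bound comes from cutting the segment into short equal pieces. The lower bound
  comes from projecting a cover onto the line: projection does not increase distances, so each
  covering set lands in an interval no longer than its diameter, and countable subadditivity of
  length applies.\<close>

lemma hausdorff_outer_segment:
  fixes e :: "real^2"
  assumes e: "norm e = 1" and ab: "a \<le> b"
  shows "hausdorff_outer ((\<lambda>t. t *\<^sub>R e) ` {a<..<b}) = ennreal (b - a)"
proof (rule antisym)
  let ?S = "(\<lambda>t. t *\<^sub>R e) ` {a<..<b}"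
  show "hausdorff_outer ?S \<le> ennreal (b - a)"
    unfolding hausdorff_outer_def
  proof (rule SUP_least)
    fix \<delta> :: real assume "\<delta> \<in> {0<..}"
    then have \<delta>: "\<delta> > 0" by simp
    \<comment> \<open>The segment is divided into N + 1 pieces, so there is at least one, and each
      has length at most \<delta>.\<close>
    obtain N :: nat where N: "(b - a) / \<delta> < real N" using reals_Archimedean2 by blast
    define d where "d = (b - a) / real (Suc N)"
    have d0: "d \<ge> 0" using ab by (simp add: d_def)
    have dd: "d \<le> \<delta>"
    proof -
      have "b - a \<le> real N * \<delta>" using N \<delta> by (simp add: pos_divide_less_eq)
      also have "\<dots> \<le> real (Suc N) * \<delta>" using \<delta> by simp
      finally show ?thesis by (simp add: d_def pos_divide_le_eq mult.commute)
    qed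
    define C where "C i = (if i \<le> N then (\<lambda>t. t *\<^sub>R e) ` {a + real i * d .. a + real (Suc i) * d} else {})" for i
    have bd: "bounded (C i)" for i
      unfolding C_def by (auto intro!: compact_imp_bounded compact_continuous_image continuous_intros)
    have dm: "diameter (C i) \<le> (if i \<le> N then d else 0)" for i
    proof (cases "i \<le> N")
      case True
      have "diameter (C i) \<le> d"
      proof (rule diameter_le)
        fix x y assume "x \<in> C i" "y \<in> C i"
        then obtain s t where st: "x = s *\<^sub>R e" "y = t *\<^sub>R e" "s \<in> {a + real i * d .. a + real (Suc i) * d}"
          "t \<in> {a + real i * d .. a + real (Suc i) * d}" using True unfolding C_def if_P[OF True] by (elim imageE) blast
        have "norm (x - y) = \<bar>s - t\<bar>" using st e by (simp flip: scaleR_diff_left)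
        also have "\<dots> \<le> d" using st(3,4) by (auto simp: abs_le_iff algebra_simps)
        finally show "norm (x - y) \<le> d" .
      qed (use d0 in auto)
      then show ?thesis using True by simp
    qed (simp add: C_def)
    have cov: "?S \<subseteq> (\<Union>i. C i)"
    proof
      fix x assume "x \<in> ?S"
      then obtain t where t': "x = t *\<^sub>R e" "t \<in> {a<..<b}" by (elim imageE)
      then have t: "x = t *\<^sub>R e" "a < t" "t < b" by auto
      then have dp: "d > 0" by (simp add: d_def)
      define i where "i = nat \<lfloor>(t - a) / d\<rfloor>"
      have i1: "real i \<le> (t - a) / d" "(t - a) / d < real i + 1"
        using t dp unfolding i_def by (auto simp: of_nat_nat)
      have "b - a = real (Suc N) * d" by (simp add: d_def)
      then have "(t - a) / d < real (Suc N)" using t dp by (simp add: pos_divide_less_eq)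
      then have "i \<le> N" using i1 by linarith
      moreover have "t \<in> {a + real i * d .. a + real (Suc i) * d}"
        using i1 dp by (simp add: field_simps)
      ultimately have "x \<in> C i" using t by (auto simp: C_def)
      then show "x \<in> (\<Union>i. C i)" by blast
    qed
    have "hausdorff_pre \<delta> ?S \<le> (\<Sum>i. ennreal (diameter (C i)))"
      unfolding hausdorff_pre_def
    proof (rule INF_lower, clarify, intro conjI allI)
      show "diameter (C i) \<le> \<delta>" for i using dm[of i] dd d0 \<delta> by (auto split: if_splits)
    qed (use cov bd in auto)
    also have "\<dots> \<le> (\<Sum>i. ennreal (if i \<le> N then d else 0))"
      using dm by (intro suminf_le ennreal_leI) auto
    also have "\<dots> = (\<Sum>i\<in>{..N}. ennreal (if i \<le> N then d else 0))"
      by (rule suminf_finite) auto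
    also have "\<dots> = ennreal (\<Sum>i\<in>{..N}. d)" by (subst sum_ennreal[symmetric]) (use d0 in \<open>auto intro: sum.cong\<close>)
    also have "(\<Sum>i\<in>{..N}. d) = b - a" by (simp add: d_def)
    finally show "hausdorff_pre \<delta> ?S \<le> ennreal (b - a)" .
  qed
  \<comment> \<open>The projection argument works for every mesh; 1 is just one member of the
    supremum.\<close>
  have "ennreal (b - a) \<le> hausdorff_pre 1 ?S"
    unfolding hausdorff_pre_def
  proof (rule INF_greatest, clarify)
    fix C :: "nat \<Rightarrow> (real^2) set"
    assume cov: "?S \<subseteq> (\<Union>i. C i)" and C: "\<forall>i. bounded (C i) \<and> diameter (C i) \<le> 1"
    define P where "P i = (if C i = {} then {} else {Inf ((\<lambda>x. x \<bullet> e) ` C i) .. Sup ((\<lambda>x. x \<bullet> e) ` C i)})" for i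
    have PB: "bounded ((\<lambda>x. x \<bullet> e) ` C i)" for i
      using C by (intro bounded_linear_image bounded_linear_inner_left) auto
    have 1: "emeasure lborel (P i) \<le> ennreal (diameter (C i))" for i
    proof (cases "C i = {}")
      case False
      have "Sup ((\<lambda>x. x \<bullet> e) ` C i) \<le> y \<bullet> e + diameter (C i)" if y: "y \<in> C i" for y
      proof (rule cSup_least)
        fix z assume "z \<in> (\<lambda>x. x \<bullet> e) ` C i"
        then obtain x where x: "x \<in> C i" "z = x \<bullet> e" by auto
        have "x \<bullet> e - y \<bullet> e \<le> norm (x - y)"
          using norm_cauchy_schwarz[of "x - y" e] e by (simp add: inner_diff_left)
        also have "\<dots> \<le> diameter (C i)"
          using diameter_bounded_bound[of "C i" x y] C x y by (simp add: dist_norm)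
        finally show "z \<le> y \<bullet> e + diameter (C i)" using x by simp
      qed (use False in auto)
      then have "Sup ((\<lambda>x. x \<bullet> e) ` C i) - diameter (C i) \<le> Inf ((\<lambda>x. x \<bullet> e) ` C i)"
        using False by (intro cInf_greatest) (auto simp: algebra_simps)
      moreover have "Inf ((\<lambda>x. x \<bullet> e) ` C i) \<le> Sup ((\<lambda>x. x \<bullet> e) ` C i)"
        using False PB[of i] by (intro cInf_le_cSup) (auto intro: bounded_imp_bdd_above bounded_imp_bdd_below)
      ultimately show ?thesis using False by (auto simp: P_def intro!: ennreal_leI)
    qed (simp add: P_def)
    have "{a<..<b} \<subseteq> (\<Union>i. P i)"
    proof
      fix t assume t: "t \<in> {a<..<b}"
      then obtain i where i: "t *\<^sub>R e \<in> C i" using cov by blast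
      have "t = (t *\<^sub>R e) \<bullet> e" using e by (simp add: norm_eq_1)
      then have "t \<in> (\<lambda>x. x \<bullet> e) ` C i" using i by blast
      then have "Inf ((\<lambda>x. x \<bullet> e) ` C i) \<le> t" "t \<le> Sup ((\<lambda>x. x \<bullet> e) ` C i)"
        using PB[of i] by (auto intro!: cInf_lower cSup_upper intro: bounded_imp_bdd_above bounded_imp_bdd_below)
      then show "t \<in> (\<Union>i. P i)" using i by (auto simp: P_def)
    qed
    then have "emeasure lborel {a<..<b} \<le> emeasure lborel (\<Union>i. P i)"
      by (intro emeasure_mono) (auto simp: P_def)
    also have "\<dots> \<le> (\<Sum>i. emeasure lborel (P i))"
      by (intro emeasure_subadditive_countably) (auto simp: P_def)
    also have "\<dots> \<le> (\<Sum>i. ennreal (diameter (C i)))" using 1 by (intro suminf_le) auto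
    finally show "ennreal (b - a) \<le> (\<Sum>i. ennreal (diameter (C i)))" using ab by simp
  qed
  also have "\<dots> \<le> hausdorff_outer ?S" unfolding hausdorff_outer_def by (rule SUP_upper) simp
  finally show "ennreal (b - a) \<le> hausdorff_outer ?S" .
qed

text \<open>Both measures give an interval its length, and Lebesgue measure is determined by that.
  Integrals over an edge thereby become ordinary integrals in the arc length t.\<close>

lemma lborel_hausdorff_line:
  fixes e :: "real^2"
  assumes e: "norm e = 1"
  shows "lborel = distr (density hausdorff_measure (ind (range (\<lambda>t. t *\<^sub>R e)))) borel (\<lambda>x. x \<bullet> e)"
proof (rule lborel_eqI)
  have line: "range (\<lambda>t. t *\<^sub>R e) \<in> sets borel"
  proof -
    have "range (\<lambda>t. t *\<^sub>R e) = {x. x = (x \<bullet> e) *\<^sub>R e}" using e by (auto simp: norm_eq_1)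
    also have "closed \<dots>" by (intro closed_Collect_eq continuous_intros)
    finally show ?thesis by (simp add: borel_closed)
  qed
  have h[measurable_cong]: "sets hausdorff_measure = sets borel" by (rule sets_hausdorff_measure)
  have sp: "space hausdorff_measure = UNIV" using sets_eq_imp_space_eq[OF h] by simp
  fix l u :: real assume "\<And>b. b \<in> Basis \<Longrightarrow> l \<bullet> b \<le> u \<bullet> b"
  then have lu: "l \<le> u" by simp
  have im: "(\<lambda>x. x \<bullet> e) -` box l u \<inter> range (\<lambda>t. t *\<^sub>R e) = (\<lambda>t. t *\<^sub>R e) ` {l<..<u}"
    using e by (auto simp: norm_eq_1 box_real)
  have vm [measurable]: "(\<lambda>x. x \<bullet> e) -` box l u \<in> sets borel"
  proof -
    have "(\<lambda>x. x \<bullet> e) \<in> BM" by simp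
    from measurable_sets_borel[OF this, of "box l u"] show ?thesis by simp
  qed
  have "emeasure (distr (density hausdorff_measure (ind (range (\<lambda>t. t *\<^sub>R e)))) borel (\<lambda>x. x \<bullet> e)) (box l u)
     = emeasure (density hausdorff_measure (ind (range (\<lambda>t. t *\<^sub>R e)))) ((\<lambda>x. x \<bullet> e) -` box l u)"
    proof -
    have dm: "(\<lambda>x. x \<bullet> e) \<in> density hausdorff_measure (ind (range (\<lambda>t. t *\<^sub>R e))) \<rightarrow>\<^sub>M borel" by measurable
    have bx: "box l u \<in> sets borel" by simp
    show ?thesis by (simp only: emeasure_distr[OF dm bx] sp space_density Int_UNIV_right)
  qed
  also have "\<dots> = emeasure hausdorff_measure ((\<lambda>x. x \<bullet> e) -` box l u \<inter> range (\<lambda>t. t *\<^sub>R e))"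
  proof -
    have "(\<lambda>x. ind (range (\<lambda>t. t *\<^sub>R e)) x :: ennreal) \<in> borel_measurable hausdorff_measure"
      using line by (simp add: sets_hausdorff_measure)
    then show ?thesis using line vm
      by (subst emeasure_density) (auto simp: sets_hausdorff_measure indicator_inter_arith[symmetric] Int_commute)
  qed
  also have "\<dots> = hausdorff_outer ((\<lambda>t. t *\<^sub>R e) ` {l<..<u})"
    unfolding im[symmetric] using line vm by (subst emeasure_hausdorff_measure) auto
  also have "\<dots> = ennreal (u - l)" by (rule hausdorff_outer_segment[OF e lu])
  finally show "emeasure (distr (density hausdorff_measure (ind (range (\<lambda>t. t *\<^sub>R e)))) borel (\<lambda>x. x \<bullet> e)) (box l u)
     = (\<Prod>b\<in>Basis. (u - l) \<bullet> b)" by simp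
qed simp

lemma dir_nonzero [simp]: "dir az \<noteq> 0"
  using norm_dir[of az] by force

abbreviation seg :: "real \<Rightarrow> real \<Rightarrow> (real^2) set" where
  "seg az h \<equiv> (\<lambda>t. t *\<^sub>R dir az) ` {0<..<h}"

lemma line_borel: "range (\<lambda>t. t *\<^sub>R dir az) \<in> sets borel"
  and seg_borel: "seg az h \<in> sets borel"
proof -
  have 1: "range (\<lambda>t. t *\<^sub>R dir az) = {x. x = (x \<bullet> dir az) *\<^sub>R dir az}" by (auto simp: dir_dir)
  also have c: "closed \<dots>" by (intro closed_Collect_eq continuous_intros)
  finally show l: "range (\<lambda>t. t *\<^sub>R dir az) \<in> sets borel" using c by (simp add: borel_closed)
  have "seg az h = {x. x = (x \<bullet> dir az) *\<^sub>R dir az} \<inter> {x. 0 < x \<bullet> dir az} \<inter> {x. x \<bullet> dir az < h}"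
    by (auto simp: dir_dir image_iff)
  also have "\<dots> \<in> sets borel"
    using c by (intro sets.Int borel_closed borel_open open_Collect_less continuous_intros)
  finally show "seg az h \<in> sets borel" .
qed

lemma indicator_seg:
  "ind (seg az h) x = ind (range (\<lambda>t. t *\<^sub>R dir az)) x * (ind {0<..<h} (x \<bullet> dir az) :: 'b :: semiring_1)"
  by (cases "x \<in> range (\<lambda>t. t *\<^sub>R dir az)") (auto simp: indicator_def dir_dir)

lemma hausdorff_seg_nn:
  fixes f :: "real^2 \<Rightarrow> ennreal"
  assumes f: "f \<in> BM"
  shows "(\<integral>\<^sup>+x. ind (seg az h) x * f x \<partial>hausdorff_measure) =
    (LNN t. ind {0<..<h} t * f (t *\<^sub>R dir az))"
proof -
  have [measurable]: "(\<lambda>t. f (t *\<^sub>R dir az)) \<in> BM" using f by measurable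
  have h[measurable_cong]: "sets hausdorff_measure = sets borel" by (rule sets_hausdorff_measure)
  note [measurable] = f line_borel[of az]
  have "(LNN t. ind {0<..<h} t * f (t *\<^sub>R dir az)) =
     (\<integral>\<^sup>+x. ind (range (\<lambda>t. t *\<^sub>R dir az)) x * (ind {0<..<h} (x \<bullet> dir az) * f ((x \<bullet> dir az) *\<^sub>R dir az)) \<partial>hausdorff_measure)"
    by (subst lborel_hausdorff_line[OF norm_dir[of az]]) (simp add: nn_integral_distr nn_integral_density)
  also have "\<dots> = (\<integral>\<^sup>+x. ind (seg az h) x * f x \<partial>hausdorff_measure)"
    by (intro nn_integral_cong, unfold indicator_seg) (auto simp: indicator_def dir_dir)
  finally show ?thesis by simp
qed

lemma hausdorff_seg_int:
  fixes f :: "real^2 \<Rightarrow> complex"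
  assumes f: "f \<in> BM"
    and i: "L1 (\<lambda>t. ind {0<..<h} t *\<^sub>R f (t *\<^sub>R dir az))"
  shows "has_bochner_integral hausdorff_measure (\<lambda>x. ind (seg az h) x *\<^sub>R f x)
    (LBINT t. ind {0<..<h} t *\<^sub>R f (t *\<^sub>R dir az))"
proof -
  have [measurable]: "(\<lambda>t. f (t *\<^sub>R dir az)) \<in> BM" using f by measurable
  have h[measurable_cong]: "sets hausdorff_measure = sets borel" by (rule sets_hausdorff_measure)
  note [measurable] = f line_borel[of az]
  let ?g = "\<lambda>x. ind (range (\<lambda>t. t *\<^sub>R dir az)) x *\<^sub>R (ind {0<..<h} (x \<bullet> dir az) *\<^sub>R f ((x \<bullet> dir az) *\<^sub>R dir az))"
  have eq: "?g = (\<lambda>x. ind (seg az h) x *\<^sub>R f x)"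
  proof
    show "?g x = ind (seg az h) x *\<^sub>R f x" for x
      unfolding indicator_seg by (cases "x \<in> range (\<lambda>t. t *\<^sub>R dir az)") (auto simp: dir_dir)
  qed
  have den: "density hausdorff_measure (ind (range (\<lambda>t. t *\<^sub>R dir az))) =
      density hausdorff_measure (\<lambda>x. ennreal (ind (range (\<lambda>t. t *\<^sub>R dir az)) x))"
    by (simp add: ennreal_indicator)
  have "(LBINT t. ind {0<..<h} t *\<^sub>R f (t *\<^sub>R dir az)) = (\<integral>x. ?g x \<partial>hausdorff_measure)"
    by (subst lborel_hausdorff_line[OF norm_dir[of az]]) (simp add: integral_distr den integral_density)
  moreover have "integrable hausdorff_measure ?g"
    using i by (subst (asm) lborel_hausdorff_line[OF norm_dir[of az]])
      (simp add: integrable_distr_eq den integrable_density)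
  ultimately show ?thesis unfolding eq by (simp add: has_bochner_integral_iff)
qed

text \<open>Only the shape of the frontier inside one ball is recorded. Integrands supported in that
  ball never see the rest of the boundary, so its surface measure reduces there to two segments and
  the vertex, which is a null set.\<close>

locale corner_frontier =
  fixes \<Omega> :: "(real^2) set" and azm azM h :: real
  assumes fr: "frontier \<Omega> \<inter> ball 0 h = insert 0 (seg azm h \<union> seg azM h)"
    and disj: "seg azm h \<inter> seg azM h = {}" and hpos: "h > 0"
begin

lemma surface_measurable:
  fixes f :: "real^2 \<Rightarrow> complex"
  assumes "f \<in> borel_measurable (surface_measure \<Omega>)"
  shows "(\<lambda>x. ind (frontier \<Omega>) x *\<^sub>R f x) \<in> BM"
proof -
  have "(\<lambda>x. ind (frontier \<Omega>) x *\<^sub>R f x) \<in> borel_measurable hausdorff_measure"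
    using assms unfolding surface_measure_def
    by (subst (asm) borel_measurable_restrict_space_iff) (auto simp: sets_hausdorff_measure hausdorff_measure_def space_measure_of_conv)
  then show ?thesis by (simp add: measurable_cong_sets[OF sets_hausdorff_measure refl])
qed

lemma AE_not_vertex: "AE x in hausdorff_measure. x \<noteq> 0"
proof -
  have "{0} \<in> null_sets hausdorff_measure"
    by (auto simp: null_sets_def sets_hausdorff_measure emeasure_hausdorff_measure hausdorff_outer_singleton)
  from AE_not_in[OF this] show ?thesis by simp
qed

lemma surface_nn:
  fixes f :: "real^2 \<Rightarrow> ennreal"
  assumes f: "f \<in> BM" and 0: "\<And>x. x \<notin> ball 0 h \<Longrightarrow> f x = 0"
  shows "(\<integral>\<^sup>+x. f x \<partial>surface_measure \<Omega>) =
    (LNN t. ind {0<..<h} t * f (t *\<^sub>R dir azm)) + (LNN t. ind {0<..<h} t * f (t *\<^sub>R dir azM))"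
proof -
  have h[measurable_cong]: "sets hausdorff_measure = sets borel" by (rule sets_hausdorff_measure)
  note [measurable] = f seg_borel[of azm h] seg_borel[of azM h]
  have "(\<integral>\<^sup>+x. f x \<partial>surface_measure \<Omega>) = (\<integral>\<^sup>+x. f x * ind (frontier \<Omega>) x \<partial>hausdorff_measure)"
    unfolding surface_measure_def by (subst nn_integral_restrict_space) (auto simp: sets_hausdorff_measure h)
  also have "\<dots> = (\<integral>\<^sup>+x. ind (seg azm h) x * f x + ind (seg azM h) x * f x \<partial>hausdorff_measure)"
  proof (rule nn_integral_cong_AE)
    show "AE x in hausdorff_measure. f x * ind (frontier \<Omega>) x = ind (seg azm h) x * f x + ind (seg azM h) x * f x"
      using AE_not_vertex
    proof eventually_elim
      case (elim x)
      show ?case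
      proof (cases "x \<in> ball 0 h")
        case True
        then have "x \<in> frontier \<Omega> \<longleftrightarrow> x \<in> seg azm h \<or> x \<in> seg azM h" using fr elim by blast
        moreover have "\<not> (x \<in> seg azm h \<and> x \<in> seg azM h)" using disj by blast
        ultimately show ?thesis by (auto simp: indicator_def simp del: image_iff)
      qed (simp add: 0)
    qed
  qed
  also have "\<dots> = (\<integral>\<^sup>+x. ind (seg azm h) x * f x \<partial>hausdorff_measure) + (\<integral>\<^sup>+x. ind (seg azM h) x * f x \<partial>hausdorff_measure)"
    by (rule nn_integral_add) measurable
  finally show ?thesis by (simp add: hausdorff_seg_nn[OF f])
qed

lemma surface_int:
  fixes f :: "real^2 \<Rightarrow> complex"
  assumes f: "f \<in> BM" and 0: "\<And>x. x \<notin> ball 0 h \<Longrightarrow> f x = 0"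
    and i: "L1 (\<lambda>t. ind {0<..<h} t *\<^sub>R f (t *\<^sub>R dir azm))"
      "L1 (\<lambda>t. ind {0<..<h} t *\<^sub>R f (t *\<^sub>R dir azM))"
  shows "(\<integral>x. f x \<partial>surface_measure \<Omega>) =
    (LBINT t. ind {0<..<h} t *\<^sub>R f (t *\<^sub>R dir azm)) + (LBINT t. ind {0<..<h} t *\<^sub>R f (t *\<^sub>R dir azM))"
proof -
  have h[measurable_cong]: "sets hausdorff_measure = sets borel" by (rule sets_hausdorff_measure)
  note [measurable] = f seg_borel[of azm h] seg_borel[of azM h]
  have "(\<integral>x. f x \<partial>surface_measure \<Omega>) = (\<integral>x. ind (frontier \<Omega>) x *\<^sub>R f x \<partial>hausdorff_measure)"
    unfolding surface_measure_def by (subst integral_restrict_space) (auto simp: sets_hausdorff_measure h)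
  also have "\<dots> = (\<integral>x. ind (seg azm h) x *\<^sub>R f x + ind (seg azM h) x *\<^sub>R f x \<partial>hausdorff_measure)"
  proof (rule integral_cong_AE)
    show "AE x in hausdorff_measure. ind (frontier \<Omega>) x *\<^sub>R f x = ind (seg azm h) x *\<^sub>R f x + ind (seg azM h) x *\<^sub>R f x"
      using AE_not_vertex
    proof eventually_elim
      case (elim x)
      show ?case
      proof (cases "x \<in> ball 0 h")
        case True
        then have "x \<in> frontier \<Omega> \<longleftrightarrow> x \<in> seg azm h \<or> x \<in> seg azM h" using fr elim by blast
        moreover have "\<not> (x \<in> seg azm h \<and> x \<in> seg azM h)" using disj by blast
        ultimately show ?thesis by (auto simp: indicator_def simp del: image_iff)
      qed (simp add: 0)
    qed
    have [measurable]: "frontier \<Omega> \<in> sets borel" by (simp add: borel_closed)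
    show "(\<lambda>x. ind (frontier \<Omega>) x *\<^sub>R f x) \<in> borel_measurable hausdorff_measure" by measurable
  qed measurable
  also have "\<dots> = (LBINT t. ind {0<..<h} t *\<^sub>R f (t *\<^sub>R dir azm)) + (LBINT t. ind {0<..<h} t *\<^sub>R f (t *\<^sub>R dir azM))"
    using has_bochner_integral_add[OF hausdorff_seg_int[OF f i(1)] hausdorff_seg_int[OF f i(2)]]
    by (simp add: has_bochner_integral_iff)
  finally show ?thesis .
qed

end

section \<open>Green's formula on a sector\<close>

lemma integral_half_line:
  fixes F :: "real \<Rightarrow> complex"
  assumes d: "\<And>s. (F has_vector_derivative f s) (at s)" and c: "continuous_on UNIV f"
    and R: "R > 0" "\<And>s. R \<le> s \<Longrightarrow> F s = 0" "\<And>s. R \<le> s \<Longrightarrow> f s = 0"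
  shows "(LBINT s. ind {0<..} s *\<^sub>R f s) = - F 0"
proof -
  have [measurable]: "f \<in> BM" by (rule borel_measurable_continuous_onI[OF c])
  have "(LBINT s. ind {0<..} s *\<^sub>R f s) = (LBINT s. ind {0..R} s *\<^sub>R f s)"
  proof (rule integral_cong_AE)
    show "AE s in lborel. ind {0<..} s *\<^sub>R f s = ind {0..R} s *\<^sub>R f s"
      using AE_lborel_singleton[of 0] by eventually_elim (auto simp: indicator_def R)
  qed auto
  also have "\<dots> = F R - F 0"
    by (rule integral_FTC_atLeastAtMost)
      (use R d in \<open>auto intro: has_vector_derivative_at_within continuous_on_subset[OF c]\<close>)
  finally show ?thesis using R by simp
qed

lemma integrable_cont_bounded_support:
  fixes f :: "'a::euclidean_space \<Rightarrow> complex"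
  assumes c: "continuous_on UNIV f" and 0: "\<And>x. norm x \<ge> R \<Longrightarrow> f x = 0"
  shows "L1 f"
proof -
  have "L1 (\<lambda>x. ind (cball 0 R) x *\<^sub>R f x)"
    by (rule borel_integrable_compact) (auto intro: continuous_on_subset[OF c])
  also have "(\<lambda>x. ind (cball 0 R) x *\<^sub>R f x) = f"
    using 0 by (auto simp: indicator_def fun_eq_iff)
  finally show ?thesis .
qed

text \<open>Fubini in the order that integrates each derivative along its own variable first,
  followed by the fundamental theorem on a half-line; the support condition removes the
  contributions at infinity.\<close>

lemma quadrant_derivative:
  fixes f f1 f2 :: "real \<times> real \<Rightarrow> complex"
  assumes c: "continuous_on UNIV f1" "continuous_on UNIV f2"
    and d: "\<And>s t. ((\<lambda>s. f (s, t)) has_vector_derivative f1 (s, t)) (at s)"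
      "\<And>s t. ((\<lambda>t. g (s, t)) has_vector_derivative f2 (s, t)) (at t)"
    and R: "R > 0" "\<And>p. norm p \<ge> R \<Longrightarrow> f p = 0" "\<And>p. norm p \<ge> R \<Longrightarrow> g p = 0" "\<And>p. norm p \<ge> R \<Longrightarrow> f1 p = 0"
       "\<And>p. norm p \<ge> R \<Longrightarrow> f2 p = 0"
  shows "(LBINT p. ind ({0<..} \<times> {0<..}) p *\<^sub>R (f1 p + f2 p)) =
    - (LBINT t. ind {0<..} t *\<^sub>R f (0, t)) - (LBINT s. ind {0<..} s *\<^sub>R g (s, 0))"
proof -
  let ?Q = "{0<..} \<times> {0<..} :: (real \<times> real) set"
  have Q: "?Q \<in> sets lborel" by (simp add: borel_Times)
  have i: "L1 (\<lambda>p. ind ?Q p *\<^sub>R f1 p)" "L1 (\<lambda>p. ind ?Q p *\<^sub>R f2 p)"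
    by (rule integrable_mult_indicator[OF Q integrable_cont_bounded_support[OF c(1) R(4)]], assumption)
      (rule integrable_mult_indicator[OF Q integrable_cont_bounded_support[OF c(2) R(5)]], assumption)
  have le: "R \<le> s \<Longrightarrow> R \<le> norm (s, t::real)" "R \<le> s \<Longrightarrow> R \<le> norm (t, s)" for s t :: real
    using norm_fst_le[of s t] norm_snd_le[of s t] by (auto intro: order_trans)
  have "(LBINT p. ind ?Q p *\<^sub>R f1 p) = (LBINT t. (LBINT s. ind ?Q (s, t) *\<^sub>R f1 (s, t)))"
    using lborel_pair.integral_snd[of "\<lambda>s t. ind ?Q (s, t) *\<^sub>R f1 (s, t)"] i(1)
    by (simp add: lborel_prod case_prod_unfold)
  also have "\<dots> = (LBINT t. - (ind {0<..} t *\<^sub>R f (0, t)))"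
  proof (rule bochner_cong)
    fix t :: real
    have "(LBINT s. ind ?Q (s, t) *\<^sub>R f1 (s, t)) = ind {0<..} t *\<^sub>R (LBINT s. ind {0<..} s *\<^sub>R f1 (s, t))"
      by (auto simp: indicator_def)
    also have "(LBINT s. ind {0<..} s *\<^sub>R f1 (s, t)) = - f (0, t)"
      by (rule integral_half_line[of "\<lambda>s. f (s, t)", OF d(1) _ R(1)])
        (use R le in \<open>auto intro!: continuous_on_compose2[OF c(1)] continuous_intros\<close>)
    finally show "(LBINT s. ind ?Q (s, t) *\<^sub>R f1 (s, t)) = - (ind {0<..} t *\<^sub>R f (0, t))" by simp
  qed simp
  finally have 1: "(LBINT p. ind ?Q p *\<^sub>R f1 p) = - (LBINT t. ind {0<..} t *\<^sub>R f (0, t))" by simp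
  have "(LBINT p. ind ?Q p *\<^sub>R f2 p) = (LBINT s. (LBINT t. ind ?Q (s, t) *\<^sub>R f2 (s, t)))"
    using lborel_pair.integral_fst'[of "\<lambda>p. ind ?Q p *\<^sub>R f2 p"] i(2)
    by (simp add: lborel_prod)
  also have "\<dots> = (LBINT s. - (ind {0<..} s *\<^sub>R g (s, 0)))"
  proof (rule bochner_cong)
    fix s :: real
    have "(LBINT t. ind ?Q (s, t) *\<^sub>R f2 (s, t)) = ind {0<..} s *\<^sub>R (LBINT t. ind {0<..} t *\<^sub>R f2 (s, t))"
      by (auto simp: indicator_def)
    also have "(LBINT t. ind {0<..} t *\<^sub>R f2 (s, t)) = - g (s, 0)"
      by (rule integral_half_line[of "\<lambda>t. g (s, t)", OF d(2) _ R(1)])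
        (use R le in \<open>auto intro!: continuous_on_compose2[OF c(2)] continuous_intros\<close>)
    finally show "(LBINT t. ind ?Q (s, t) *\<^sub>R f2 (s, t)) = - (ind {0<..} s *\<^sub>R g (s, 0))" by simp
  qed simp
  finally have 2: "(LBINT p. ind ?Q p *\<^sub>R f2 p) = - (LBINT s. ind {0<..} s *\<^sub>R g (s, 0))" by simp
  show ?thesis using 1 2 i by (simp add: scaleR_add_right)
qed

lemma open_sector:
  assumes "- pi < az1" "az1 < az2" "az2 < pi"
  shows "open (sector az1 az2)"
proof -
  have cone: "open (sector a b)" if "- pi < a" "a < b" "b < pi" "b - a < pi" for a b
  proof -
    have "sector a b = {x. 0 < nrm b \<bullet> x} \<inter> {x. nrm a \<bullet> x < 0}" using cone_iff(1)[OF that] by auto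
    then show ?thesis by (auto intro!: open_Int open_Collect_less continuous_intros)
  qed
  \<comment> \<open>A quarter of the opening is below pi/2, so the three cones of opening 2d are
    convex; the middle one covers the ray that the outer two leave out.\<close>
  define d where "d = (az2 - az1) / 4"
  have d: "4 * d = az2 - az1" "d > 0" using assms by (auto simp: d_def)
  have "sector az1 az2 = sector az1 (az1 + 2 * d) \<union> sector (az1 + d) (az1 + 3 * d) \<union> sector (az1 + 2 * d) az2"
    using assms d by (auto simp: sector_def)
  moreover have "open (sector az1 (az1 + 2 * d))" "open (sector (az1 + d) (az1 + 3 * d))" "open (sector (az1 + 2 * d) az2)"
    using assms d pi_gt_zero by (intro cone; linarith)+
  ultimately show ?thesis by auto
qed

text \<open>The component of the vector field (X, Y) along \<open>nrm az\<close>, hence the outward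
  flux density on the lower edge and the inward one on the upper edge.\<close>

definition ncomp :: "real \<Rightarrow> (real^2 \<Rightarrow> complex) \<Rightarrow> (real^2 \<Rightarrow> complex) \<Rightarrow> real^2 \<Rightarrow> complex" where
  "ncomp az X Y x = of_real (sin az) * X x - of_real (cos az) * Y x"

lemma directional_derivative:
  assumes "smooth X"
  shows "((\<lambda>s. X (y + s *\<^sub>R dir az)) has_vector_derivative
     of_real (cos az) * partial 1 X (y + s *\<^sub>R dir az) + of_real (sin az) * partial 2 X (y + s *\<^sub>R dir az)) (at s)"
proof -
  have 1: "((\<lambda>s. y + s *\<^sub>R dir az) has_derivative (\<lambda>h. h *\<^sub>R dir az)) (at s)"
    by (auto intro!: derivative_eq_intros)
  have 2: "(X has_derivative (\<lambda>h. \<Sum>i\<in>UNIV. of_real (h $ i) * partial i X (y + s *\<^sub>R dir az))) (at (y + s *\<^sub>R dir az))"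
    by (rule has_derivative_partial[OF smooth_diff[OF assms]])
  show ?thesis unfolding has_vector_derivative_def
    by (rule has_derivative_eq_rhs[OF has_derivative_compose[OF 1 2]])
      (auto simp: sum_2 scaleR_conv_of_real[where 'a=complex] algebra_simps)
qed

text \<open>The divergence theorem is transported to the quadrant, where the oblique components of
  the field are differentiated along the axes; the Jacobian absorbs the factor produced by the
  oblique basis.\<close>

lemma cone_divergence:
  assumes "- pi < az1" "az1 < az2" "az2 < pi" "az2 - az1 < pi"
    and X: "smooth X" "\<And>x. R \<le> norm x \<Longrightarrow> X x = 0" and Y: "smooth Y" "\<And>x. R \<le> norm x \<Longrightarrow> Y x = 0" and R: "R > 0"
  shows "(LBINT x. ind (sector az1 az2) x *\<^sub>R (partial 1 X x + partial 2 Y x)) =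
    (LBINT t. ind {0<..} t *\<^sub>R ncomp az1 X Y (t *\<^sub>R dir az1)) -
    (LBINT t. ind {0<..} t *\<^sub>R ncomp az2 X Y (t *\<^sub>R dir az2))"
proof -
  let ?D = "sin (az2 - az1)"
  have D: "?D > 0" using assms by (intro sin_gt_zero) auto
  have D1: "?D \<le> 1" by simp
  \<comment> \<open>Both normal components of \<open>cone_map az1 az2 p\<close> together are at
    least sin(az2 - az1) |p|, and each is at most the norm. So |p| \<ge> R' forces the norm to be at
    least R + 1, strictly beyond the support radius.\<close>
  define R' where "R' = 2 * (R + 1) / ?D"
  have R': "R' > 0" using R D by (simp add: R'_def)
  have big: "R < norm (cone_map az1 az2 p)" if "norm p \<ge> R'" for p
  proof -
    obtain s t where p: "p = (s, t)" by (cases p)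
    have n1: "norm (nrm az) = 1" for az by (simp add: norm_2)
    have "norm p \<le> \<bar>s\<bar> + \<bar>t\<bar>" using norm_Pair_le[of s t] by (simp add: p)
    then have "norm p * ?D \<le> (\<bar>s\<bar> + \<bar>t\<bar>) * ?D" using D by (intro mult_right_mono) auto
    moreover have "2 * (R + 1) \<le> norm p * ?D" using that D by (simp add: R'_def pos_divide_le_eq)
    ultimately have "2 * (R + 1) \<le> (\<bar>s\<bar> + \<bar>t\<bar>) * ?D" by linarith
    also have "\<dots> = \<bar>nrm az2 \<bullet> cone_map az1 az2 p\<bar> + \<bar>nrm az1 \<bullet> cone_map az1 az2 p\<bar>"
      using D by (simp add: p nrm_cone_map abs_mult algebra_simps)
    also have "\<dots> \<le> 2 * norm (cone_map az1 az2 p)"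
      using Cauchy_Schwarz_ineq2[of "nrm az2" "cone_map az1 az2 p"] Cauchy_Schwarz_ineq2[of "nrm az1" "cone_map az1 az2 p"]
      by (simp add: n1)
    finally show ?thesis by simp
  qed
  let ?L = "cone_map az1 az2"
  \<comment> \<open>If (X, Y) = \<alpha> dir az1 + \<beta> dir az2, then f and g are \<alpha> and
    \<beta> times the Jacobian. Their derivatives along s and t therefore add up to the Jacobian
    times the divergence.\<close>
  define f where "f p = ncomp az2 X Y (?L p)" for p
  define g where "g p = - ncomp az1 X Y (?L p)" for p
  define f1 where "f1 p = of_real (cos az1) * ncomp az2 (partial 1 X) (partial 1 Y) (?L p) +
      of_real (sin az1) * ncomp az2 (partial 2 X) (partial 2 Y) (?L p)" for p
  define f2 where "f2 p = - (of_real (cos az2) * ncomp az1 (partial 1 X) (partial 1 Y) (?L p) +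
      of_real (sin az2) * ncomp az1 (partial 2 X) (partial 2 Y) (?L p))" for p
  have cX: "continuous_on UNIV (\<lambda>p. partial i X (?L p))" "continuous_on UNIV (\<lambda>p. partial i Y (?L p))" for i
    using smooth_cont[OF smooth_partial[OF X(1)]] smooth_cont[OF smooth_partial[OF Y(1)]]
    by (auto intro!: continuous_on_compose2[OF _ continuous_cone_map])
  have pX: "partial i X x = 0" "partial i Y x = 0" if "R < norm x" for i x
    using partial_outside(1)[of R X x i] partial_outside(1)[of R Y x i] X Y that by auto
  have dX: "((\<lambda>s. Z (?L (s, t))) has_vector_derivative
     of_real (cos az1) * partial 1 Z (?L (s, t)) + of_real (sin az1) * partial 2 Z (?L (s, t))) (at s)"
    "((\<lambda>t. Z (?L (s, t))) has_vector_derivative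
     of_real (cos az2) * partial 1 Z (?L (s, t)) + of_real (sin az2) * partial 2 Z (?L (s, t))) (at t)"
    if "smooth Z" for Z s t
    using directional_derivative[OF that, of "t *\<^sub>R dir az2" az1 s] directional_derivative[OF that, of "s *\<^sub>R dir az1" az2 t]
    by (simp_all add: cone_map_eq add.commute)
  have "(LBINT p. ind ({0<..} \<times> {0<..}) p *\<^sub>R (f1 p + f2 p)) =
    - (LBINT t. ind {0<..} t *\<^sub>R f (0, t)) - (LBINT s. ind {0<..} s *\<^sub>R g (s, 0))"
  proof (rule quadrant_derivative[OF _ _ _ _ R'])
    show "continuous_on UNIV f1" "continuous_on UNIV f2"
      unfolding f1_def[abs_def] f2_def[abs_def] ncomp_def by (intro continuous_intros cX)+
    show "((\<lambda>s. f (s, t)) has_vector_derivative f1 (s, t)) (at s)" for s t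
      unfolding f_def f1_def ncomp_def
      by (rule has_vector_derivative_eq_rhs[OF has_vector_derivative_diff[OF
          has_vector_derivative_mult_right[OF dX(1)[OF X(1)]] has_vector_derivative_mult_right[OF dX(1)[OF Y(1)]]]])
        (simp add: algebra_simps)
    show "((\<lambda>t. g (s, t)) has_vector_derivative f2 (s, t)) (at t)" for s t
      unfolding g_def f2_def ncomp_def
      by (rule has_vector_derivative_eq_rhs[OF has_vector_derivative_minus[OF has_vector_derivative_diff[OF
          has_vector_derivative_mult_right[OF dX(2)[OF X(1)]] has_vector_derivative_mult_right[OF dX(2)[OF Y(1)]]]]])
        (simp add: algebra_simps)
  qed (use big X(2) Y(2) pX in \<open>auto simp: f_def g_def f1_def f2_def ncomp_def less_imp_le\<close>)
  moreover have "f1 p + f2 p = of_real ?D * (partial 1 X (?L p) + partial 2 Y (?L p))" for p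
    by (simp add: f1_def f2_def ncomp_def sin_diff algebra_simps)
  moreover have "(LBINT x. ind (sector az1 az2) x *\<^sub>R (partial 1 X x + partial 2 Y x)) =
    (LBINT p. ind ({0<..} \<times> {0<..}) p *\<^sub>R (of_real ?D * (partial 1 X (?L p) + partial 2 Y (?L p))))"
  proof -
    have [measurable]: "partial 1 X \<in> BM" "partial 2 Y \<in> BM"
      using X Y by (auto intro!: smooth_borel smooth_partial)
    have [measurable]: "sector az1 az2 \<in> sets borel" using open_sector[OF assms(1-3)] by simp
    have "(LBINT x. ind (sector az1 az2) x *\<^sub>R (partial 1 X x + partial 2 Y x)) =
       ?D *\<^sub>R (LBINT p. ind (sector az1 az2) (?L p) *\<^sub>R (partial 1 X (?L p) + partial 2 Y (?L p)))"
      by (rule integral_cone[OF D]) measurable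
    also have "\<dots> = (LBINT p. ?D *\<^sub>R (ind (sector az1 az2) (?L p) *\<^sub>R (partial 1 X (?L p) + partial 2 Y (?L p))))"
      by (rule integral_scaleR_right[symmetric])
    also have "\<dots> = (LBINT p. ind ({0<..} \<times> {0<..}) p *\<^sub>R (of_real ?D * (partial 1 X (?L p) + partial 2 Y (?L p))))"
      by (intro bochner_cong)
        (auto simp: indicator_def cone_map_mem[OF assms(1-4)] scaleR_conv_of_real)
    finally show ?thesis .
  qed
  ultimately show ?thesis by (simp add: f_def g_def cone_map_eq)
qed

text \<open>Cutting along the bisector gives two convex cones even when the sector is reflex. The
  bisector is a null set, and its two flux terms cancel because it is the upper edge of one cone and
  the lower edge of the other.\<close>

lemma sector_divergence:
  assumes "- pi < azm" "azm < azM" "azM < pi"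
    and X: "smooth X" "\<And>x. R \<le> norm x \<Longrightarrow> X x = 0" and Y: "smooth Y" "\<And>x. R \<le> norm x \<Longrightarrow> Y x = 0" and R: "R > 0"
  shows "(LBINT x. ind (sector azm azM) x *\<^sub>R (partial 1 X x + partial 2 Y x)) =
    (LBINT t. ind {0<..} t *\<^sub>R ncomp azm X Y (t *\<^sub>R dir azm)) -
    (LBINT t. ind {0<..} t *\<^sub>R ncomp azM X Y (t *\<^sub>R dir azM))"
proof -
  define az0 where "az0 = (azm + azM) / 2"
  have t: "azm < az0" "az0 < azM" "- pi < az0" "az0 < pi" "az0 - azm < pi" "azM - az0 < pi"
    using assms by (auto simp: az0_def field_simps)
  let ?F = "\<lambda>x. partial 1 X x + partial 2 Y x"
  have F: "L1 ?F"
  proof (rule integrable_cont_bounded_support[where R="R + 1"])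
    show "continuous_on UNIV ?F" by (intro smooth_cont smooth_add smooth_partial X Y)
    show "?F x = 0" if "R + 1 \<le> norm x" for x
      using partial_outside(1)[of R X x 1] partial_outside(1)[of R Y x 2] X Y that by auto
  qed
  have s: "sector azm az0 \<in> sets lborel" "sector az0 azM \<in> sets lborel" "sector azm azM \<in> sets lborel"
    using open_sector assms t by auto
  have "(LBINT x. ind (sector azm azM) x *\<^sub>R ?F x) =
     (LBINT x. ind (sector azm az0) x *\<^sub>R ?F x + ind (sector az0 azM) x *\<^sub>R ?F x)"
  proof (rule integral_cong_AE)
    show "AE x in lborel. ind (sector azm azM) x *\<^sub>R ?F x = ind (sector azm az0) x *\<^sub>R ?F x + ind (sector az0 azM) x *\<^sub>R ?F x"
      using ray_null[OF t(3,4)]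
    proof eventually_elim
      case (elim x)
      have "\<not> (x \<in> sector azm az0 \<and> x \<in> sector az0 azM)" by (auto simp: sector_def)
      then show ?case using elim sector_split[OF t(1,2)] by (auto simp: indicator_def)
    qed
  qed (use F s in measurable)
  also have "\<dots> = (LBINT x. ind (sector azm az0) x *\<^sub>R ?F x) + (LBINT x. ind (sector az0 azM) x *\<^sub>R ?F x)"
    using F s by (intro Bochner_Integration.integral_add integrable_mult_indicator)
  also have "\<dots> = (LBINT t. ind {0<..} t *\<^sub>R ncomp azm X Y (t *\<^sub>R dir azm)) -
    (LBINT t. ind {0<..} t *\<^sub>R ncomp azM X Y (t *\<^sub>R dir azM))"
    using cone_divergence[OF assms(1) t(1,4,5) X Y R] cone_divergence[OF t(3,2) assms(3) t(6) X Y R] by simp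
  finally show ?thesis .
qed

text \<open>This is the divergence theorem for the field \<psi> grad \<phi>. On the boundary no
  derivative falls on \<psi>, so the formula persists when \<psi> runs through smooth approximations
  of an H^1 function whose boundary values converge.\<close>

lemma green_sector:
  assumes "- pi < azm" "azm < azM" "azM < pi"
    and \<psi>: "smooth \<psi>" and \<phi>: "smooth \<phi>" "\<And>x. R \<le> norm x \<Longrightarrow> \<phi> x = 0" and R: "R > 0"
  shows "(LBINT x. ind (sector azm azM) x *\<^sub>R ((\<Sum>i\<in>UNIV. partial i \<psi> x * partial i \<phi> x) + \<psi> x * laplacian \<phi> x)) =
    (LBINT t. ind {0<..} t *\<^sub>R (\<psi> (t *\<^sub>R dir azm) * ncomp azm (partial 1 \<phi>) (partial 2 \<phi>) (t *\<^sub>R dir azm))) -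
    (LBINT t. ind {0<..} t *\<^sub>R (\<psi> (t *\<^sub>R dir azM) * ncomp azM (partial 1 \<phi>) (partial 2 \<phi>) (t *\<^sub>R dir azM)))"
proof -
  have d: "partial i (\<lambda>x. \<psi> x * partial i \<phi> x) x = \<psi> x * partial i (partial i \<phi>) x + partial i \<psi> x * partial i \<phi> x" for i x
    by (intro partial_mult smooth_diff smooth_partial \<psi> \<phi>)
  have "(\<Sum>i\<in>UNIV. partial i \<psi> x * partial i \<phi> x) + \<psi> x * laplacian \<phi> x =
    partial 1 (\<lambda>x. \<psi> x * partial 1 \<phi> x) x + partial 2 (\<lambda>x. \<psi> x * partial 2 \<phi> x) x" for x
    unfolding d laplacian_def by (simp add: sum_2 algebra_simps)
  moreover have "ncomp az (\<lambda>x. \<psi> x * partial 1 \<phi> x) (\<lambda>x. \<psi> x * partial 2 \<phi> x) x = \<psi> x * ncomp az (partial 1 \<phi>) (partial 2 \<phi>) x" for az x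
    by (simp add: ncomp_def algebra_simps)
  moreover have "\<psi> x * partial i \<phi> x = 0" if "R + 1 \<le> norm x" for x i
    using partial_outside(1)[of R \<phi> x i] \<phi> that by simp
  ultimately show ?thesis
    using sector_divergence[OF assms(1-3), of "\<lambda>x. \<psi> x * partial 1 \<phi> x" "R + 1" "\<lambda>x. \<psi> x * partial 2 \<phi> x"] R
    by (simp add: smooth_mult smooth_partial \<psi> \<phi>)
qed

lemma L1_mult_tendsto:
  fixes f :: "'a \<Rightarrow> complex" and u :: "nat \<Rightarrow> 'a \<Rightarrow> complex"
  assumes u: "\<And>n. integrable M (u n)" and f: "integrable M f" and b[measurable]: "b \<in> borel_measurable M" and C: "\<And>x. norm (b x) \<le> C"
    and lim: "(\<lambda>n. \<integral>\<^sup>+x. norm (u n x - f x) \<partial>M) \<longlonglongrightarrow> 0"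
  shows "(\<lambda>n. \<integral>x. u n x * b x \<partial>M) \<longlonglongrightarrow> (\<integral>x. f x * b x \<partial>M)"
proof (rule tendsto_L1_int)
  have [measurable]: "f \<in> borel_measurable M" "u n \<in> borel_measurable M" for n using u f by auto
  have ib: "integrable M (\<lambda>x. g x * b x)" if "integrable M g" for g :: "'a \<Rightarrow> complex"
  proof (rule bochner_bound[of _ "\<lambda>x. C * norm (g x)"])
    have [measurable]: "g \<in> borel_measurable M" using that by auto
    show "(\<lambda>x. g x * b x) \<in> borel_measurable M" by measurable
    have "norm (g x * b x) \<le> norm (C * norm (g x))" for x
    proof -
      have "C \<ge> 0" using C norm_ge_zero order_trans by blast
      then show ?thesis using mult_left_mono[OF C[of x], of "norm (g x)"] by (simp add: norm_mult abs_mult mult.commute)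
    qed
    then show "AE x in M. norm (g x * b x) \<le> norm (C * norm (g x))" by simp
  qed (use that in auto)
  show "integrable M (\<lambda>x. u n x * b x)" for n using ib u .
  show "integrable M (\<lambda>x. f x * b x)" using ib f .
  have "(\<lambda>n. ennreal C * (\<integral>\<^sup>+x. norm (u n x - f x) \<partial>M)) \<longlonglongrightarrow> ennreal C * 0"
    by (intro ennreal_tendsto_cmult lim) simp
  moreover have "(\<integral>\<^sup>+x. norm (u n x * b x - f x * b x) \<partial>M) \<le> ennreal C * (\<integral>\<^sup>+x. norm (u n x - f x) \<partial>M)" for n
  proof -
    have "norm (u n x * b x - f x * b x) \<le> C * norm (u n x - f x)" for x
    proof -
      have "norm (u n x * b x - f x * b x) = norm (u n x - f x) * norm (b x)"
        by (simp add: norm_mult[symmetric] algebra_simps)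
      also have "\<dots> \<le> norm (u n x - f x) * C" using C by (intro mult_left_mono) auto
      finally show ?thesis by (simp add: mult.commute)
    qed
    moreover have "C \<ge> 0" using C norm_ge_zero order_trans by blast
    ultimately have "(\<integral>\<^sup>+x. norm (u n x * b x - f x * b x) \<partial>M) \<le> (\<integral>\<^sup>+x. ennreal C * norm (u n x - f x) \<partial>M)"
      by (intro nn_integral_mono) (simp add: ennreal_mult[symmetric] ennreal_leI)
    also have "\<dots> = ennreal C * (\<integral>\<^sup>+x. norm (u n x - f x) \<partial>M)" by (rule nn_integral_cmult) measurable
    finally show ?thesis .
  qed
  ultimately show "(\<lambda>n. \<integral>\<^sup>+x. norm (u n x * b x - f x * b x) \<partial>M) \<longlonglongrightarrow> 0"
    using tendsto_sandwich[of "\<lambda>_. 0" "\<lambda>n. \<integral>\<^sup>+x. norm (u n x * b x - f x * b x) \<partial>M" sequentially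
        "\<lambda>n. ennreal C * (\<integral>\<^sup>+x. norm (u n x - f x) \<partial>M)" 0] by simp
qed

lemma bounded_cont_support:
  fixes f :: "'a::euclidean_space \<Rightarrow> complex"
  assumes c: "continuous_on UNIV f" and 0: "\<And>x. norm x \<ge> R \<Longrightarrow> f x = 0"
  shows "\<exists>C\<ge>0. \<forall>x. norm (f x) \<le> C"
proof -
  have "bounded (f ` cball 0 R)"
    by (intro compact_imp_bounded compact_continuous_image continuous_on_subset[OF c]) auto
  then obtain C where C: "\<And>x. x \<in> cball 0 R \<Longrightarrow> norm (f x) \<le> C" unfolding bounded_iff by blast
  have "norm (f x) \<le> max C 0" for x
    using C[of x] 0[of x] by (cases "norm x \<le> R") auto
  then show ?thesis by (intro exI[of _ "max C 0"]) auto
qed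

section \<open>Integrability of polar kernels\<close>

lemma integrable_even:
  fixes f :: "real \<Rightarrow> real"
  assumes [measurable]: "f \<in> BM" and pos: "\<And>t. f t \<ge> 0" and even: "\<And>t. f (- t) = f t"
    and fin: "(LNN t. ennreal (f t) * ind {0..} t) < \<infinity>"
  shows "L1 f"
proof -
  let ?g = "\<lambda>t. f t * ind {0..} t"
  have i: "L1 ?g"
  proof (rule integrableI_bounded)
    have "(LNN t. norm (?g t)) = (LNN t. ennreal (f t) * ind {0..} t)"
      by (intro nn_integral_cong) (auto simp: indicator_def pos)
    then show "(LNN t. norm (?g t)) < \<infinity>" using fin by simp
  qed simp
  have "L1 (\<lambda>t. ?g (0 + (-1) * t))"
    by (rule lborel_integrable_real_affine[OF i]) simp
  then have "L1 (\<lambda>t. ?g t + ?g (- t))" using i by simp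
  then show ?thesis
    by (rule bochner_bound) (auto simp: indicator_def pos even abs_of_nonneg)
qed

lemma integrable_inv_sqrt: "L1 (\<lambda>t::real. ind {-1..1} t * \<bar>t\<bar> powr (-1/2))"
proof (rule integrable_even)
  have "(LNN t. ennreal (ind {-1..1} t * \<bar>t\<bar> powr (-1/2)) * ind {0..} t) =
     (LNN t. ind {0..1} t * ennreal (t powr (-1/2)))"
    by (intro nn_integral_cong) (auto simp: indicator_def)
  also have "\<dots> = (LNN t. ennreal (ind {0..1} t * t powr (-1/2)))"
    by (intro nn_integral_cong) (auto simp: indicator_def)
  also have "\<dots> = ennreal (1 powr (-1/2 + 1) / (-1/2 + 1))"
    by (rule nn_integral_has_integral_lebesgue[OF _ has_integral_powr_from_0]) auto
  finally show "(LNN t. ennreal (ind {-1..1} t * \<bar>t\<bar> powr (-1/2)) * ind {0..} t) < \<infinity>" by simp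
qed (auto simp: indicator_def)

lemma integrable_inv_plus: "L1 (\<lambda>t::real. 1 / (1 + t\<^sup>2))"
proof (rule integrable_even)
  have "(LNN t. ennreal (1 / (1 + t\<^sup>2)) * ind {0..} t) = pi / 2 - arctan 0"
    by (rule nn_integral_FTC_atLeast[OF _ _ _ tendsto_arctan_at_top])
      (auto intro!: derivative_eq_intros simp: add_nonneg_eq_0_iff inverse_eq_divide)
  then show "(LNN t. ennreal (1 / (1 + t\<^sup>2)) * ind {0..} t) < \<infinity>" by simp
qed auto

lemma integrable_prod2:
  fixes f g :: "real \<Rightarrow> real"
  assumes f: "L1 f" "\<And>t. f t \<ge> 0" and g: "L1 g" "\<And>t. g t \<ge> 0"
  shows "L1 (\<lambda>x::real^2. f (x $ 1) * g (x $ 2))"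
proof (rule integrableI_bounded)
  have [measurable]: "f \<in> BM" "g \<in> BM" using f g by auto
  have "(\<lambda>x::real^2. x $ i) \<in> BM" for i
    by (intro borel_measurable_continuous_onI continuous_intros)
  note [measurable] = this[of 1] this[of 2]
  show "(\<lambda>x::real^2. f (x $ 1) * g (x $ 2)) \<in> borel_measurable lborel" by measurable
  have D: "sin (pi / 2 - 0) > 0" by simp
  have "(LNN x. norm (f ((x::real^2) $ 1) * g (x $ 2))) = (LNN x. ennreal (f ((x::real^2) $ 1)) * ennreal (g (x $ 2)))"
    using f g by (simp add: ennreal_mult)
  also have "\<dots> = (\<integral>\<^sup>+p. ennreal (f (fst p)) * ennreal (g (snd p)) \<partial>(lborel :: (real \<times> real) measure))"
    by (subst nn_integral_cone[OF D]) (simp_all add: cone_map_def)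
  also have "\<dots> = (LNN s. \<integral>\<^sup>+t. ennreal (f s) * ennreal (g t) \<partial>lborel)"
    unfolding lborel_prod[symmetric] by (subst lborel.nn_integral_fst[symmetric]) auto
  also have "\<dots> = (LNN s. ennreal (f s) * (LNN t. ennreal (g t)))"
    by (intro nn_integral_cong nn_integral_cmult) auto
  also have "\<dots> = (LNN s. ennreal (f s)) * (LNN t. ennreal (g t))"
    by (rule nn_integral_multc) auto
  also have "\<dots> < \<infinity>"
    using f g by (auto simp: ennreal_mult_less_top nn_integral_eq_integral)
  finally show "(LNN x. norm (f ((x::real^2) $ 1) * g (x $ 2))) < \<infinity>" .
qed

text \<open>Since |x1| |x2| \<le> |x|^2, the function 1/|x| is dominated by |x1|^(-1/2) |x2|^(-1/2),
  a product of integrable functions of one variable; polar coordinates are avoided.\<close>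

lemma integrable_inv_norm: "L1 (\<lambda>x::real^2. ind (cball 0 1) x / norm x)"
proof -
  let ?f = "\<lambda>t::real. ind {-1..1} t * \<bar>t\<bar> powr (-1/2) :: real"
  have n: "AE x::real^2 in lborel. x $ i \<noteq> 0" for i
  proof -
    have "negligible {x::real^2. axis i 1 \<bullet> x = 0}" by (intro negligible_hyperplane) simp
    then have "{x::real^2. axis i 1 \<bullet> x = 0} \<in> null_sets lborel"
      by (subst null_sets_completion_iff[symmetric]) (auto simp: negligible_iff_null_sets)
    from AE_not_in[OF this] show ?thesis by (simp add: inner_axis')
  qed
  show ?thesis
  proof (rule bochner_bound[OF integrable_prod2[of ?f ?f]])
    show "AE x::real^2 in lborel. norm (ind (cball 0 1) x / norm x) \<le> norm (?f (x $ 1) * ?f (x $ 2))"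
      using n[of 1] n[of 2]
    proof eventually_elim
      case (elim x)
      show ?case
      proof (cases "x \<in> cball 0 1")
        case True
        then have b: "\<bar>x $ 1\<bar> \<le> 1" "\<bar>x $ 2\<bar> \<le> 1"
          using component_le_norm_cart[of x] by (auto intro: order_trans)
        have "\<bar>x $ 1\<bar> * \<bar>x $ 2\<bar> \<le> (norm x)\<^sup>2"
        proof -
          have "\<bar>x $ 1\<bar> * \<bar>x $ 2\<bar> \<le> norm x * norm x"
            by (intro mult_mono component_le_norm_cart) auto
          then show ?thesis by (simp add: power2_eq_square)
        qed
        then have "sqrt (\<bar>x $ 1\<bar> * \<bar>x $ 2\<bar>) \<le> norm x" by (rule real_le_lsqrt[rotated 1]) auto
        moreover have "sqrt (\<bar>x $ 1\<bar> * \<bar>x $ 2\<bar>) > 0" using elim by simp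
        moreover from calculation have "0 < norm x" by linarith
        ultimately have "1 / norm x \<le> 1 / sqrt (\<bar>x $ 1\<bar> * \<bar>x $ 2\<bar>)" by (intro divide_left_mono mult_pos_pos) auto
        also have "\<dots> = \<bar>x $ 1\<bar> powr (-1/2) * \<bar>x $ 2\<bar> powr (-1/2)"
        proof -
          have pw: "t powr (-1/2) = 1 / sqrt t" if "t > 0" for t :: real
            using that powr_minus_divide[of t "1/2"] by (simp add: powr_half_sqrt)
          show ?thesis unfolding real_sqrt_mult using pw[of "\<bar>x $ 1\<bar>"] pw[of "\<bar>x $ 2\<bar>"] elim by simp
        qed
        also have "\<dots> = norm (?f (x $ 1) * ?f (x $ 2))" using b by (auto simp: abs_mult indicator_def abs_le_iff)
        finally show ?thesis using True by simp
      qed simp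
    qed
    have [measurable]: "cball (0::real^2) 1 \<in> sets borel" by simp
    show "(\<lambda>x::real^2. ind (cball 0 1) x / norm x) \<in> borel_measurable lborel" by measurable
  qed (use integrable_inv_sqrt in simp_all)
qed

lemma integrable_inv_norm_ball: "L1 (\<lambda>x::real^2. ind (cball 0 R) x / norm x)"
proof (rule bochner_bound)
  have "L1 (ind (cball 0 R) :: real^2 \<Rightarrow> real)"
    by (rule integrable_real_indicator) (auto simp: emeasure_lborel_cball_finite[unfolded infinity_ennreal_def])
  with integrable_inv_norm
  show "L1 (\<lambda>x::real^2. ind (cball 0 1) x / norm x + ind (cball 0 R) x)" by simp
  have [measurable]: "cball (0::real^2) R \<in> sets borel" by simp
  show "(\<lambda>x::real^2. ind (cball 0 R) x / norm x) \<in> borel_measurable lborel" by measurable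
  have "norm (ind (cball 0 R) x / norm x) \<le> norm (ind (cball 0 1) x / norm x + (ind (cball 0 R) x :: real))" for x :: "real^2"
    by (auto simp: indicator_def divide_le_eq not_le distrib_right)
  then show "AE x::real^2 in lborel. norm (ind (cball 0 R) x / norm x) \<le> norm (ind (cball 0 1) x / norm x + (ind (cball 0 R) x :: real))"
    by auto
qed

section \<open>The complex coordinate and a harmonic pole\<close>

definition zc :: "real^2 \<Rightarrow> complex" where "zc x = of_real (x $ 1) + \<i> * of_real (x $ 2)"

lemma zc_dir: "zc (t *\<^sub>R dir az) = of_real t * cis az"
  by (simp add: zc_def complex_eq_iff)

lemma zc_add: "zc (x + y) = zc x + zc y" by (simp add: zc_def algebra_simps)
lemma norm_zc: "norm (zc x) = norm x"
  by (simp add: zc_def cmod_def norm_2)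

lemma bounded_linear_zc: "bounded_linear zc"
  by (rule linear_conv_bounded_linear[THEN iffD1], rule linearI) (auto simp: zc_def algebra_simps scaleR_conv_of_real[where 'a=complex])

lemma smooth_zc: "smooth (\<lambda>x. zc (x - y))" "smooth (\<lambda>x. cnj (zc (x - y)))"
  using smooth_linear[OF bounded_linear_zc, of y]
    smooth_linear[OF bounded_linear_compose[OF bounded_linear_cnj bounded_linear_zc], of y] by auto

text \<open>A complex derivative acts on real directions by multiplication with the direction, which
  is 1 for the first axis and i for the second. The Laplacian of a holomorphic function thus carries
  the factor 1 + i^2 = 0.\<close>

lemma partial_holomorphic:
  assumes "(h has_field_derivative h') (at (zc (x - y)))"
  shows "partial i (\<lambda>x. h (zc (x - y))) x = h' * zc (axis i 1)"
proof -
  have "((\<lambda>x. zc (x - y)) has_derivative zc) (at x)"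
  proof -
    have "((\<lambda>x. x - y) has_derivative (\<lambda>h. h - 0)) (at x)"
      by (intro has_derivative_diff has_derivative_ident has_derivative_const)
    from bounded_linear.has_derivative[OF bounded_linear_zc this] show ?thesis by simp
  qed
  from has_derivative_compose[OF this assms[unfolded has_field_derivative_def]]
  show ?thesis by (intro partial_eq) auto
qed

lemma zc_axis: "zc (axis 1 1) = 1" "zc (axis 2 1) = \<i>"
  by (auto simp: zc_def axis_def)

text \<open>The regularised holomorphic power: it agrees with \<open>\<zeta>\<^sup>-\<^sup>3\<close>, \<open>\<zeta> = zc (x - y)\<close>, where \<open>\<bar>\<zeta>\<bar>\<^sup>2 > c\<close>,
  and is smooth on the whole plane.\<close>

text \<open>Since \<open>1/z = cnj z/|z|\<^sup>2\<close>, this is a smooth function equal to \<open>(z - y) powi (-3)\<close> wherever \<open>|z - y|\<^sup>2 \<ge> c\<close>.\<close>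

definition pole3 :: "real \<Rightarrow> real^2 \<Rightarrow> real^2 \<Rightarrow> complex" where
  "pole3 c y x = (cnj (zc (x - y)) * inverse (of_real ((norm (x - y))\<^sup>2) + of_real (bump (c - (norm (x - y))\<^sup>2)))) ^ 3"

lemma smooth_pole3: assumes "c > 0" shows "smooth (pole3 c y)"
proof -
  have "(norm (x - y))\<^sup>2 + bump (c - (norm (x - y))\<^sup>2) > 0" for x
  proof (cases "x = y")
    case True then show ?thesis using assms by (simp add: bump_pos_iff)
  next
    case False then show ?thesis using bump_nonneg by (simp add: add_pos_nonneg)
  qed
  then have nz: "complex_of_real ((norm (x - y))\<^sup>2) + of_real (bump (c - (norm (x - y))\<^sup>2)) \<noteq> 0" for x
    by (metis of_real_add of_real_eq_0_iff less_irrefl)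
  have "smooth (\<lambda>x. complex_of_real (c - (norm (x - y))\<^sup>2))"
    using smooth_minus[OF smooth_const smooth_norm2] by (simp only: of_real_diff)
  then show ?thesis unfolding pole3_def[abs_def]
    by (intro smooth_power smooth_mult smooth_inverse smooth_add smooth_zc smooth_norm2 smooth_bumpp nz)
qed

lemma pole3_eq: assumes "(norm (x - y))\<^sup>2 > c" "c > 0" shows "pole3 c y x = inverse (zc (x - y)) ^ 3"
proof -
  have b: "bump (c - (norm (x - y))\<^sup>2) = 0" using assms by (simp add: bump_zero_iff)
  have nz: "zc (x - y) \<noteq> 0" using assms norm_zc[of "x - y"] by auto
  have "complex_of_real ((norm (x - y))\<^sup>2) = zc (x - y) * cnj (zc (x - y))"
    using complex_norm_square[of "zc (x - y)"] by (simp add: norm_zc)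
  then have "cnj (zc (x - y)) * inverse (of_real ((norm (x - y))\<^sup>2)) = inverse (zc (x - y))"
    using nz by (simp add: field_simps)
  then show ?thesis by (simp add: pole3_def b)
qed

lemma pole3_deriv:
  assumes "(norm (x - y))\<^sup>2 > c" "c > 0"
  shows "partial i (pole3 c y) x = - 3 * inverse (zc (x - y)) ^ 4 * zc (axis i 1)"
    and "laplacian (pole3 c y) x = 0"
proof -
  define U where "U = {x. (norm (x - y))\<^sup>2 > c}"
  have U: "open U" "x \<in> U" unfolding U_def using assms by (auto intro!: open_Collect_less continuous_intros)
  have nz: "zc (z - y) \<noteq> 0" if "z \<in> U" for z using that assms norm_zc[of "z - y"] by (auto simp: U_def)
  have D: "((\<lambda>w::complex. inverse w ^ n) has_field_derivative (- of_nat n * inverse w ^ (n + 1))) (at w)" if "w \<noteq> 0" "n > 0" for w n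
  proof -
    obtain m where m: "n = Suc m" using \<open>n > 0\<close> gr0_implies_Suc by blast
    show ?thesis
      by (rule DERIV_cong[OF DERIV_power[OF DERIV_inverse[OF \<open>w \<noteq> 0\<close>]]]) (simp add: m algebra_simps)
  qed
  have p: "partial i (pole3 c y) z = - 3 * inverse (zc (z - y)) ^ 4 * zc (axis i 1)" if "z \<in> U" for z i
  proof -
    have "partial i (pole3 c y) z = partial i (\<lambda>x. inverse (zc (x - y)) ^ 3) z"
      by (rule partial_cong_open[OF U(1) that]) (auto simp: U_def assms intro: pole3_eq)
    also have "\<dots> = (- of_nat 3 * inverse (zc (z - y)) ^ (3 + 1)) * zc (axis i 1)"
      by (rule partial_holomorphic[OF D[OF nz[OF that]]]) simp
    finally show ?thesis by simp
  qed
  show "partial i (pole3 c y) x = - 3 * inverse (zc (x - y)) ^ 4 * zc (axis i 1)" by (rule p[OF U(2)])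
  have "partial i (partial i (pole3 c y)) x = 12 * inverse (zc (x - y)) ^ 5 * zc (axis i 1) ^ 2" for i
  proof -
    have "partial i (partial i (pole3 c y)) x = partial i (\<lambda>z. - 3 * inverse (zc (z - y)) ^ 4 * zc (axis i 1)) x"
      by (rule partial_cong_open[OF U]) (rule p)
    also have "\<dots> = (- 3 * (- of_nat 4 * inverse (zc (x - y)) ^ (4 + 1)) * zc (axis i 1)) * zc (axis i 1)"
      by (rule partial_holomorphic[where h="\<lambda>w. - 3 * inverse w ^ 4 * zc (axis i 1)"])
        (intro DERIV_cmult_right DERIV_cmult D nz U, simp)
    finally show ?thesis by (simp add: power2_eq_square)
  qed
  then show "laplacian (pole3 c y) x = 0"
    by (simp add: laplacian_def sum_2 zc_axis)
qed

section \<open>The vertex coefficient vanishes\<close>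

text \<open>The integrand has the antiderivative -(t cis az + cis az0)^-2 / (2 cis az), which
  vanishes at infinity, so only the value at t = 0 remains. The hypothesis is the translation
  estimate of the sector at \<epsilon> = 1; it excludes zeros of the denominator and yields an
  integrable majorant of Cauchy type.\<close>

lemma integral_pole_ray:
  assumes bound: "\<And>t. t \<ge> 0 \<Longrightarrow> m * (t\<^sup>2 + 1) \<le> (norm (of_real t * cis az + cis az0))\<^sup>2" and m: "m > 0"
  shows "L1 (\<lambda>t. ind {0<..} t *\<^sub>R inverse (of_real t * cis az + cis az0) ^ 3)"
    and "(LBINT t. ind {0<..} t *\<^sub>R inverse (of_real t * cis az + cis az0) ^ 3) = inverse (cis az0) ^ 2 * inverse (cis az) / 2"
    and "t \<ge> 0 \<Longrightarrow> norm (inverse (of_real t * cis az + cis az0) ^ 3) \<le> 1 / (m * sqrt m) * (1 / (1 + t\<^sup>2))"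
proof -
  let ?g = "\<lambda>t::real. of_real t * cis az + cis az0"
  have nz: "?g t \<noteq> 0" if "t \<ge> 0" for t
  proof -
    have "0 < m * (t\<^sup>2 + 1)" using m by (intro mult_pos_pos) (auto simp: add_nonneg_pos)
    then show ?thesis using bound[OF that] by auto
  qed
  show bd: "norm (inverse (?g t) ^ 3) \<le> 1 / (m * sqrt m) * (1 / (1 + t\<^sup>2))" if "t \<ge> 0" for t
  proof -
    have p: "0 < 1 + t\<^sup>2" by (simp add: add_pos_nonneg)
    have "m \<le> (norm (?g t))\<^sup>2"
    proof -
      have "m * 1 \<le> m * (t\<^sup>2 + 1)" using m by (intro mult_left_mono) auto
      then show ?thesis using bound[OF that] by linarith
    qed
    then have 1: "sqrt m \<le> norm (?g t)" by (simp add: real_le_lsqrt m less_imp_le)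
    have "m * (1 + t\<^sup>2) * sqrt m \<le> (norm (?g t))\<^sup>2 * norm (?g t)"
      using bound[OF that] 1 m by (intro mult_mono) (auto simp: add.commute)
    also have "\<dots> = norm (?g t) ^ 3" by (simp add: power3_eq_cube power2_eq_square)
    finally have "inverse (norm (?g t) ^ 3) \<le> inverse (m * (1 + t\<^sup>2) * sqrt m)"
      using m p by (intro le_imp_inverse_le mult_pos_pos) auto
    then show ?thesis by (simp add: norm_power norm_inverse power_inverse divide_inverse mult_ac)
  qed
  show int: "L1 (\<lambda>t. ind {0<..} t *\<^sub>R inverse (?g t) ^ 3)"
  proof (rule bochner_bound)
    show "L1 (\<lambda>t. 1 / (m * sqrt m) * (1 / (1 + t\<^sup>2)))"
      by (intro integrable_mult_right integrable_inv_plus)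
    show "AE t in lborel. norm (ind {0<..} t *\<^sub>R inverse (?g t) ^ 3) \<le> norm (1 / (m * sqrt m) * (1 / (1 + t\<^sup>2)))"
      using bd m by (auto simp: indicator_def intro: order_trans)
  qed measurable
  have "(LBINT t=0..\<infinity>. inverse (?g t) ^ 3) = 0 - (- (inverse (cis az0) ^ 2 * inverse (cis az) / 2))"
  proof (rule interval_integral_FTC_integrable[where F="\<lambda>t. - (inverse (?g t) ^ 2 * inverse (cis az) / 2)"])
    show "((\<lambda>t. - (inverse (?g t) ^ 2 * inverse (cis az) / 2)) has_vector_derivative inverse (?g t) ^ 3) (at t)"
      if "0 < ereal t" for t
    proof -
      have z: "?g t \<noteq> 0" using nz that by (simp add: zero_ereal_def)
      have "((\<lambda>z. - (inverse (z * cis az + cis az0) ^ 2 * inverse (cis az) / 2)) has_field_derivative inverse (?g t) ^ 3) (at (of_real t))"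
      proof (rule DERIV_cong)
        show "((\<lambda>z. - (inverse (z * cis az + cis az0) ^ 2 * inverse (cis az) / 2)) has_field_derivative
          - ((of_nat 2 * (- (cis az * inverse (?g t ^ Suc (Suc 0))) * inverse (?g t) ^ (2 - Suc 0))) * inverse (cis az) / 2)) (at (of_real t))"
          by (intro DERIV_minus DERIV_cdivide DERIV_cmult_right DERIV_power DERIV_inverse_fun z)
            (auto intro!: derivative_eq_intros)
        have "cis az * inverse (cis az) = 1" by (rule right_inverse) (rule cis_neq_zero)
        then show "- ((of_nat 2 * (- (cis az * inverse (?g t ^ Suc (Suc 0))) * inverse (?g t) ^ (2 - Suc 0))) * inverse (cis az) / 2) = inverse (?g t) ^ 3"
          by (simp add: power_inverse[symmetric] power2_eq_square power3_eq_cube)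
      qed
      from has_vector_derivative_real_field[OF this] show ?thesis by simp
    qed
    show "isCont (\<lambda>t. inverse (?g t) ^ 3) t" if "0 < ereal t" for t
      using nz[of t] that by (intro continuous_intros) (auto simp: zero_ereal_def)
    show "set_integrable lborel (einterval 0 \<infinity>) (\<lambda>t. inverse (?g t) ^ 3)"
      using int by (simp add: set_integrable_def einterval_eq zero_ereal_def)
    have "((\<lambda>t. - (inverse (?g t) ^ 2 * inverse (cis az) / 2)) \<longlongrightarrow> - (inverse (?g 0) ^ 2 * inverse (cis az) / 2)) (at_right 0)"
      using nz[of 0] by (intro tendsto_intros) auto
    then show "(((\<lambda>t. - (inverse (?g t) ^ 2 * inverse (cis az) / 2)) \<circ> real_of_ereal) \<longlongrightarrow> - (inverse (cis az0) ^ 2 * inverse (cis az) / 2)) (at_right 0)"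
      by (simp add: zero_ereal_def ereal_tendsto_simps1)
    have "((\<lambda>t. norm (inverse (?g t) ^ 2)) \<longlongrightarrow> 0) at_top"
    proof (rule tendsto_sandwich[of "\<lambda>_. 0"])
      show "\<forall>\<^sub>F t in at_top. norm (inverse (?g t) ^ 2) \<le> (1 / m) * inverse (t\<^sup>2)"
        using eventually_gt_at_top[of 0]
      proof eventually_elim
        case (elim t)
        have "m * t\<^sup>2 \<le> (norm (?g t))\<^sup>2" using bound[of t] m elim by (simp add: algebra_simps)
        then have "inverse ((norm (?g t))\<^sup>2) \<le> inverse (m * t\<^sup>2)" using m elim by (intro le_imp_inverse_le) auto
        then show ?case by (simp add: norm_power norm_inverse power_inverse divide_inverse)
      qed
      have "((\<lambda>t::real. inverse (t\<^sup>2)) \<longlongrightarrow> 0) at_top"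
        by (intro tendsto_inverse_0_at_top filterlim_pow_at_top filterlim_ident) auto
      then show "((\<lambda>t. 1 / m * inverse (t\<^sup>2)) \<longlongrightarrow> 0) at_top" by (rule tendsto_mult_right_zero)
    qed auto
    then have "((\<lambda>t. inverse (?g t) ^ 2) \<longlongrightarrow> 0) at_top" by (rule tendsto_norm_zero_cancel)
    then have "((\<lambda>t. - (inverse (?g t) ^ 2 * inverse (cis az) / 2)) \<longlongrightarrow> - (0 * inverse (cis az) / 2)) at_top"
      by (intro tendsto_intros) auto
    then show "(((\<lambda>t. - (inverse (?g t) ^ 2 * inverse (cis az) / 2)) \<circ> real_of_ereal) \<longlongrightarrow> 0) (at_left \<infinity>)"
      by (simp add: ereal_tendsto_simps1)
  qed auto
  then show "(LBINT t. ind {0<..} t *\<^sub>R inverse (?g t) ^ 3) = inverse (cis az0) ^ 2 * inverse (cis az) / 2"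
    by (simp add: interval_lebesgue_integral_def set_lebesgue_integral_def einterval_eq zero_ereal_def)
qed

text \<open>The interface between the boundary value problem and the analysis at the vertex: a very
  weak form of the equation for u with an interior source F and densities \<open>bm\<close>,
  \<open>bM\<close> on the two edges. Here u is merely integrable, all derivatives rest on the test
  function, and the two conclusions (zero edge coefficient, decay of u) are drawn from this identity
  by different choices of it.\<close>

locale corner_identity =
  fixes azm azM \<delta> K :: real and u F :: "real^2 \<Rightarrow> complex" and bm bM :: "real \<Rightarrow> complex"
  assumes angles: "- pi < azm" "azm < azM" "azM < pi" and \<delta>: "\<delta> > 0"
    and u: "L1 u" "\<And>x. x \<notin> sector azm azM \<Longrightarrow> u x = 0"
    and F: "F \<in> BM" "\<And>x. norm (F x) \<le> K" "\<And>x. x \<notin> sector azm azM \<Longrightarrow> F x = 0"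
    and b: "bm \<in> BM" "bM \<in> BM" "\<And>t. norm (bm t) \<le> K" "\<And>t. norm (bM t) \<le> K"
    and identity: "\<And>\<phi> r. smooth \<phi> \<Longrightarrow> r < \<delta> \<Longrightarrow> (\<And>x. r \<le> norm x \<Longrightarrow> \<phi> x = 0) \<Longrightarrow>
      (LBINT x. u x * laplacian \<phi> x) = (LBINT x. F x * \<phi> x) +
        (LBINT t. ind {0<..} t *\<^sub>R (bm t * \<phi> (t *\<^sub>R dir azm))) +
        (LBINT t. ind {0<..} t *\<^sub>R (bM t * \<phi> (t *\<^sub>R dir azM)))"
begin

lemma K0: "K \<ge> 0" using F(2)[of 0] norm_ge_zero order_trans by blast

abbreviation "az0 \<equiv> (azm + azM) / 2"
text \<open>The value is 1 up to radius \<delta>/4 and 0 from \<delta>/2 on. Products with it are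
  admissible in \<open>identity\<close> with r = \<delta>/2, and its derivatives live in an annulus
  away from the vertex, where the singular kernels are harmless.\<close>

abbreviation "ct \<equiv> cutoff (\<delta> / 4) (\<delta> / 2)"

lemma ct: "smooth (\<lambda>x. of_real (ct x))" "norm x \<le> \<delta> / 4 \<Longrightarrow> ct x = 1" "\<delta> / 2 \<le> norm x \<Longrightarrow> ct x = 0"
   "0 \<le> ct x" "ct x \<le> 1"
  using cutoff[of "\<delta> / 4" "\<delta> / 2"] \<delta> by auto

lemma ct_deriv_bounds: "\<exists>C\<ge>0. \<forall>x i. norm (partial i (\<lambda>x. of_real (ct x)) x) \<le> C \<and> norm (laplacian (\<lambda>x. of_real (ct x)) x) \<le> C"
proof -
  have 0: "of_real (ct x) = (0::complex)" if "\<delta> / 2 \<le> norm x" for x using ct(3) that by simp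
  have p: "\<exists>C\<ge>0. \<forall>x. norm (partial i (\<lambda>x. of_real (ct x)) x) \<le> C" for i
  proof (rule bounded_cont_support[where R=\<delta>])
    show "partial i (\<lambda>x. of_real (ct x)) x = 0" if "\<delta> \<le> norm x" for x
      using partial_outside(1)[of "\<delta> / 2" "\<lambda>x. of_real (ct x)" x i] 0 that \<delta> by simp
  qed (intro smooth_cont smooth_partial ct)
  have l: "\<exists>C\<ge>0. \<forall>x. norm (laplacian (\<lambda>x. of_real (ct x)) x) \<le> C"
  proof (rule bounded_cont_support[where R=\<delta>])
    show "laplacian (\<lambda>x. of_real (ct x)) x = 0" if "\<delta> \<le> norm x" for x
      using partial_outside(2)[of "\<delta> / 2" "\<lambda>x. of_real (ct x)" x] 0 that \<delta> by simp
  qed (intro smooth_cont smooth_laplacian ct)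
  obtain C where C: "\<And>i. C i \<ge> 0" "\<And>i x. norm (partial i (\<lambda>x. of_real (ct x)) x) \<le> C i" using p by metis
  obtain C' where C': "C' \<ge> 0" "\<And>x. norm (laplacian (\<lambda>x. of_real (ct x)) x) \<le> C'" using l by metis
  have "C i \<le> C 1 + C 2 + C'" for i
  proof -
    have "i = 1 \<or> i = 2" by (rule exhaust_2)
    then show ?thesis using C(1)[of 1] C(1)[of 2] C'(1) by auto
  qed
  moreover have "C' \<le> C 1 + C 2 + C'" "0 \<le> C 1 + C 2 + C'" using C(1)[of 1] C(1)[of 2] C'(1) by auto
  ultimately show ?thesis using C(2) C'(2) by (meson order_trans)
qed

lemma ct_deriv_zero:
  assumes "norm x < \<delta> / 4"
  shows "partial i (\<lambda>x. of_real (ct x)) x = 0" "laplacian (\<lambda>x. of_real (ct x)) x = 0"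
proof -
  have o: "open (ball (0::real^2) (\<delta> / 4))" "x \<in> ball 0 (\<delta> / 4)" using assms by auto
  show "partial i (\<lambda>x. of_real (ct x)) x = 0"
    using partial_cong_open[OF o, of "\<lambda>x. of_real (ct x)" "\<lambda>_. 1" i] ct(2) by (auto simp: partial_const)
  show "laplacian (\<lambda>x. of_real (ct x)) x = 0"
    using laplacian_cong_open[OF o, of "\<lambda>x. of_real (ct x)" "\<lambda>_. 1"] ct(2) by (auto simp: laplacian_def partial_const)
qed

text \<open>Substituting e n * t for t uses the homogeneity of degree -3: the kernel yields (e n)^-3
  and the line element e n, and the prefactor (e n)^2 restores the balance. The density and the
  cut-off are then evaluated at points tending to the vertex, and dominated convergence leaves
  \<beta> times the explicit ray integral.\<close>

lemma boundary_limit: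
  assumes az: "az = azm \<or> az = azM" and b': "b \<in> BM" "\<And>t. norm (b t) \<le> K"
    and lim: "(b \<longlongrightarrow> \<beta>) (at_right 0)" and m: "m > 0"
    and mb: "\<And>t. t \<ge> 0 \<Longrightarrow> m * (t\<^sup>2 + 1) \<le> (norm (of_real t * cis az + cis az0))\<^sup>2"
    and e: "e \<longlonglongrightarrow> 0" "\<And>n. e n > 0"
    and P: "\<And>n t. t \<ge> 0 \<Longrightarrow> P n (t *\<^sub>R dir az) = inverse (of_real t * cis az + of_real (e n) * cis az0) ^ 3"
  shows "(\<lambda>n. of_real ((e n)\<^sup>2) * (LBINT t. ind {0<..} t *\<^sub>R (b t * (of_real (ct (t *\<^sub>R dir az)) * P n (t *\<^sub>R dir az))))) \<longlonglongrightarrow>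
      \<beta> * (inverse (cis az0) ^ 2 * inverse (cis az) / 2)"
proof -
  note [measurable] = b'(1)
  let ?g = "\<lambda>t::real. inverse (of_real t * cis az + cis az0) ^ 3"
  note pr = integral_pole_ray[OF mb m]
  have cm[measurable]: "(\<lambda>t. complex_of_real (ct (t *\<^sub>R dir az))) \<in> BM"
    using smooth_borel[OF ct(1)] by measurable
  have eq: "of_real ((e n)\<^sup>2) * (LBINT t. ind {0<..} t *\<^sub>R (b t * (of_real (ct (t *\<^sub>R dir az)) * P n (t *\<^sub>R dir az)))) =
     (LBINT t. ind {0<..} t *\<^sub>R (b (e n * t) * (of_real (ct ((e n * t) *\<^sub>R dir az)) * ?g t)))" for n
  proof -
    \<comment> \<open>The summand 0 reproduces the shape c + d t of the affine substitution rule, so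
      that the rule applies literally.\<close>
    define G where "G t = ind {0<..} (0 + e n * t) *\<^sub>R (b (0 + e n * t) * (of_real (ct ((0 + e n * t) *\<^sub>R dir az)) * P n ((0 + e n * t) *\<^sub>R dir az)))" for t
    have en0: "e n > 0" by (rule e(2))
    have "(LBINT t. ind {0<..} t *\<^sub>R (b t * (of_real (ct (t *\<^sub>R dir az)) * P n (t *\<^sub>R dir az)))) =
      \<bar>e n\<bar> *\<^sub>R (LBINT t. G t)"
      unfolding G_def using en0 by (intro lborel_integral_real_affine) auto
    moreover have "of_real ((e n)\<^sup>2) * (\<bar>e n\<bar> *\<^sub>R z) = of_real (e n ^ 3) * z" for z :: complex
      using en0 by (simp add: scaleR_conv_of_real[where 'a=complex] power2_eq_square power3_eq_cube)
    ultimately have "of_real ((e n)\<^sup>2) * (LBINT t. ind {0<..} t *\<^sub>R (b t * (of_real (ct (t *\<^sub>R dir az)) * P n (t *\<^sub>R dir az)))) =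
      of_real (e n ^ 3) * (LBINT t. G t)" by simp
    also have "\<dots> = (LBINT t. of_real (e n ^ 3) * G t)" by (rule integral_mult_right_zero[symmetric])
    also have "\<dots> = (LBINT t. ind {0<..} t *\<^sub>R (b (e n * t) * (of_real (ct ((e n * t) *\<^sub>R dir az)) * ?g t)))"
    proof (rule bochner_cong)
      fix t :: real
      show "of_real (e n ^ 3) * G t =
        ind {0<..} t *\<^sub>R (b (e n * t) * (of_real (ct ((e n * t) *\<^sub>R dir az)) * ?g t))"
      proof (cases "t > 0")
        case True
        then have en: "e n * t > 0" using e(2)[of n] by simp
        have "of_real (e n * t) * cis az + of_real (e n) * cis az0 = of_real (e n) * (of_real t * cis az + cis az0)"
          by (simp add: algebra_simps)
        then have "P n ((e n * t) *\<^sub>R dir az) = inverse (of_real (e n) * (of_real t * cis az + cis az0)) ^ 3"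
          using P[of "e n * t" n] en by simp
        also have "\<dots> = inverse (of_real (e n ^ 3)) * ?g t" by (simp add: inverse_mult_distrib power_mult_distrib power_inverse)
        finally have "of_real (e n ^ 3) * P n ((e n * t) *\<^sub>R dir az) = ?g t" using e(2)[of n] by simp
        then show ?thesis using True en by (simp add: G_def mult.left_commute)
      next
        case False
        then have "\<not> e n * t > 0" using e(2)[of n] by (simp add: not_less mult_nonneg_nonpos)
        then show ?thesis using False by (simp add: G_def)
      qed
    qed simp
    finally show ?thesis .
  qed
  have "(\<lambda>n. LBINT t. ind {0<..} t *\<^sub>R (b (e n * t) * (of_real (ct ((e n * t) *\<^sub>R dir az)) * ?g t))) \<longlonglongrightarrow>
      (LBINT t. \<beta> * (ind {0<..} t *\<^sub>R ?g t))"
  proof (rule integral_dominated_convergence[where w="\<lambda>t. K * (1 / (m * sqrt m) * (1 / (1 + t\<^sup>2)))"])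
    show "L1 (\<lambda>t. K * (1 / (m * sqrt m) * (1 / (1 + t\<^sup>2))))"
      by (intro integrable_mult_right integrable_inv_plus)
    show "AE t in lborel. norm (ind {0<..} t *\<^sub>R (b (e n * t) * (of_real (ct ((e n * t) *\<^sub>R dir az)) * ?g t))) \<le> K * (1 / (m * sqrt m) * (1 / (1 + t\<^sup>2)))" for n
    proof (rule AE_I2)
      fix t :: real
      have "norm (b (e n * t) * (of_real (ct ((e n * t) *\<^sub>R dir az)) * ?g t)) \<le> K * (1 / (m * sqrt m) * (1 / (1 + t\<^sup>2)))" if "t > 0"
      proof -
        have "norm (of_real (ct ((e n * t) *\<^sub>R dir az)) * ?g t) \<le> 1 * (1 / (m * sqrt m) * (1 / (1 + t\<^sup>2)))"
          unfolding norm_mult using ct(4,5) pr(3)[of t] that by (intro mult_mono) auto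
        then show ?thesis unfolding norm_mult[of "b (e n * t)"] using b'(2) K0 by (intro mult_mono) auto
      qed
      moreover have "0 \<le> K * (1 / (m * sqrt m) * (1 / (1 + t\<^sup>2)))" using K0 m by simp
      ultimately show "norm (ind {0<..} t *\<^sub>R (b (e n * t) * (of_real (ct ((e n * t) *\<^sub>R dir az)) * ?g t))) \<le> K * (1 / (m * sqrt m) * (1 / (1 + t\<^sup>2)))"
        by (auto simp: indicator_def)
    qed
    show "AE t in lborel. (\<lambda>n. ind {0<..} t *\<^sub>R (b (e n * t) * (of_real (ct ((e n * t) *\<^sub>R dir az)) * ?g t))) \<longlonglongrightarrow> \<beta> * (ind {0<..} t *\<^sub>R ?g t)"
    proof (rule AE_I2)
      fix t :: real
      show "(\<lambda>n. ind {0<..} t *\<^sub>R (b (e n * t) * (of_real (ct ((e n * t) *\<^sub>R dir az)) * ?g t))) \<longlonglongrightarrow> \<beta> * (ind {0<..} t *\<^sub>R ?g t)"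
      proof (cases "t > 0")
        case True
        have et: "(\<lambda>n. e n * t) \<longlonglongrightarrow> 0" using tendsto_mult_left_zero[OF e(1)] by simp
        have pos: "e n * t > 0" for n using e(2) True by simp
        have "filterlim (\<lambda>n. e n * t) (at_right 0) sequentially"
          unfolding filterlim_at
        proof (intro conjI always_eventually allI et)
          show "e n * t \<in> {0<..}" "e n * t \<noteq> 0" for n using pos[of n] by auto
        qed
        then have "(\<lambda>n. b (e n * t)) \<longlonglongrightarrow> \<beta>" using filterlim_compose[OF lim] by blast
        moreover have "(\<lambda>n. complex_of_real (ct ((e n * t) *\<^sub>R dir az))) \<longlonglongrightarrow> of_real (ct (0 *\<^sub>R dir az))"
          using continuous_on_tendsto_compose[OF smooth_cont[OF ct(1)] tendsto_scaleR[OF et tendsto_const[of "dir az"]]] by simp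
        ultimately have "(\<lambda>n. b (e n * t) * (of_real (ct ((e n * t) *\<^sub>R dir az)) * ?g t)) \<longlonglongrightarrow> \<beta> * (of_real (ct (0 *\<^sub>R dir az)) * ?g t)"
          by (intro tendsto_mult tendsto_const)
        then show ?thesis using True ct(2)[of 0] \<delta> by simp
      qed simp
    qed
  qed (measurable)
  moreover have "(LBINT t. \<beta> * (ind {0<..} t *\<^sub>R ?g t)) = \<beta> * (inverse (cis az0) ^ 2 * inverse (cis az) / 2)"
    by (simp only: integral_mult_right_zero pr(2))
  ultimately show ?thesis unfolding eq by (simp only:)
qed

text \<open>After multiplication by (e n)^2 the term with u tends to 0, because the kernel is
  harmonic on the sector and only derivatives of the cut-off remain, with bounds independent of n.
  The term with F tends to 0 by the extra dimension of the plane. What survives is \<beta> times a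
  number that is nonzero unless the edges are opposite.\<close>

theorem vertex_coefficient_zero:
  assumes lim: "(bm \<longlongrightarrow> \<beta>) (at_right 0)" "(bM \<longlongrightarrow> \<beta>) (at_right 0)" and npi: "azM - azm \<noteq> pi"
  shows "\<beta> = 0"
proof -
  \<comment> \<open>The second set is what adds the edges and the vertex, so that the estimates hold
    both in the interior integrals and on the two rays.\<close>
  define Z where "Z = sector azm azM \<union> {x. cos ((azM - azm) / 2) * norm x \<le> dir az0 \<bullet> x}"
  obtain m where m: "m > 0" "m \<le> 1" and mb: "\<And>x \<epsilon>. x \<in> Z \<Longrightarrow> \<epsilon> \<ge> 0 \<Longrightarrow> m * ((norm x)\<^sup>2 + \<epsilon>\<^sup>2) \<le> (norm (x + \<epsilon> *\<^sub>R dir az0))\<^sup>2"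
    using sector_translate_norm[OF angles] unfolding Z_def by blast
  define e where "e n = inverse (real (Suc n))" for n
  define y where "y n = - (e n *\<^sub>R dir az0)" for n
  \<comment> \<open>On \<open>Z\<close> the squared distance to the pole is at least m (e n)^2.
    Regularising below half of that leaves the kernel exact on \<open>Z\<close>, with some room for
    derivatives.\<close>
  define P where "P n = pole3 (m * (e n)\<^sup>2 / 2) (y n)" for n
  have e: "e \<longlonglongrightarrow> 0" "e n > 0" "e n \<le> 1" for n
    using LIMSEQ_inverse_real_of_nat by (auto simp: e_def[abs_def] inverse_eq_divide)
  have e2: "(\<lambda>n. (e n)\<^sup>2) \<longlonglongrightarrow> 0" using tendsto_power[OF e(1), of 2] by simp
  have e21: "(e n)\<^sup>2 \<le> 1" for n using e(2,3)[of n] by (simp add: power_le_one)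
  have c: "m * (e n)\<^sup>2 / 2 > 0" for n using m e(2)[of n] by simp
  have N: "m * ((norm x)\<^sup>2 + (e n)\<^sup>2) \<le> (norm (x - y n))\<^sup>2" if "x \<in> Z" for x n
    using mb[OF that, of "e n"] e(2)[of n] by (simp add: y_def)
  have far: "m * (e n)\<^sup>2 / 2 < (norm (x - y n))\<^sup>2" if "x \<in> Z" for x n
  proof -
    have "m * (e n)\<^sup>2 \<le> m * ((norm x)\<^sup>2 + (e n)\<^sup>2)" using m by (intro mult_left_mono) auto
    then show ?thesis using N[OF that, of n] c[of n] by linarith
  qed
  have N1: "sqrt m * norm x \<le> norm (x - y n)" if "x \<in> Z" for x n
  proof -
    have "m * (norm x)\<^sup>2 \<le> m * ((norm x)\<^sup>2 + (e n)\<^sup>2)" using m by (intro mult_left_mono) auto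
    then have "m * (norm x)\<^sup>2 \<le> (norm (x - y n))\<^sup>2" using N[OF that, of n] by linarith
    then have "(sqrt m * norm x)\<^sup>2 \<le> (norm (x - y n))\<^sup>2" using m by (simp add: power_mult_distrib)
    then show ?thesis by (rule power2_le_imp_le) simp
  qed
  have N2: "m * (e n)\<^sup>2 \<le> (norm (x - y n))\<^sup>2" if "x \<in> Z" for x n
  proof -
    have "m * (e n)\<^sup>2 \<le> m * ((norm x)\<^sup>2 + (e n)\<^sup>2)" using m by (intro mult_left_mono) auto
    then show ?thesis using N[OF that, of n] by linarith
  qed
  have P3: "P n x = inverse (zc (x - y n)) ^ 3" if "x \<in> Z" for x n
    unfolding P_def by (rule pole3_eq[OF far[OF that] c])
  have nP: "norm (P n x) = inverse (norm (x - y n)) ^ 3" if "x \<in> Z" for x n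
    by (simp add: P3[OF that] norm_power norm_inverse norm_zc)
  have dP: "norm (partial i (P n) x) = 3 * inverse (norm (x - y n)) ^ 4" if "x \<in> Z" for x n i
    unfolding P_def pole3_deriv(1)[OF far[OF that] c] by (simp add: norm_mult norm_power norm_inverse norm_zc)
  have lP: "laplacian (P n) x = 0" if "x \<in> Z" for x n
    unfolding P_def by (rule pole3_deriv(2)[OF far[OF that] c])
  have sP: "smooth (P n)" for n unfolding P_def by (rule smooth_pole3[OF c])
  have secZ: "x \<in> Z" if "x \<in> sector azm azM" for x using that by (simp add: Z_def)
  have rayZ: "t *\<^sub>R dir az \<in> Z" if "t \<ge> 0" "az = azm \<or> az = azM" for t az
  proof -
    have h: "az0 - azm = (azM - azm) / 2" "az0 - azM = - ((azM - azm) / 2)" by (auto simp: field_simps)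
    have "cos (az0 - az) = cos ((azM - azm) / 2)" using that(2) by (elim disjE) (simp_all only: h cos_minus)
    then show ?thesis using that by (simp add: Z_def dir_dir mult.commute)
  qed
  define \<phi> where "\<phi> n x = of_real (ct x) * P n x" for n x
  have s\<phi>: "smooth (\<phi> n)" for n unfolding \<phi>_def[abs_def] by (intro smooth_mult ct sP)
  have id: "(LBINT x. u x * laplacian (\<phi> n) x) = (LBINT x. F x * \<phi> n x) +
        (LBINT t. ind {0<..} t *\<^sub>R (bm t * \<phi> n (t *\<^sub>R dir azm))) +
        (LBINT t. ind {0<..} t *\<^sub>R (bM t * \<phi> n (t *\<^sub>R dir azM)))" for n
    by (rule identity[OF s\<phi>, of "\<delta> / 2"]) (use \<delta> ct(3) in \<open>auto simp: \<phi>_def\<close>)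
  obtain C where C: "C \<ge> 0" "\<And>x i. norm (partial i (\<lambda>x. of_real (ct x)) x) \<le> C" "\<And>x. norm (laplacian (\<lambda>x. of_real (ct x)) x) \<le> C"
    using ct_deriv_bounds by blast
  \<comment> \<open>A lower bound for the distance to the pole on the part of the sector with |x|
    \<ge> \<delta>/4, where the cut-off may vary. \<open>C1\<close> is the resulting bound for the
    product rule, with the gradient of the kernel at most 3 \<rho>^-4 and the kernel at most
    \<rho>^-3.\<close>
  define \<rho> where "\<rho> = sqrt m * (\<delta> / 4)"
  have \<rho>: "\<rho> > 0" using m \<delta> by (simp add: \<rho>_def)
  define C1 where "C1 = 2 * (C * (3 * inverse \<rho> ^ 4) + C * (3 * inverse \<rho> ^ 4)) + C * inverse \<rho> ^ 3"
  have C1: "C1 \<ge> 0" using C(1) \<rho> by (simp add: C1_def)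
  have lap: "norm (laplacian (\<phi> n) x) \<le> C1" if x: "x \<in> sector azm azM" for x n
  proof -
    have eq: "laplacian (\<phi> n) x = 2 * (partial 1 (\<lambda>x. of_real (ct x)) x * partial 1 (P n) x + partial 2 (\<lambda>x. of_real (ct x)) x * partial 2 (P n) x)
       + laplacian (\<lambda>x. of_real (ct x)) x * P n x"
      unfolding \<phi>_def[abs_def] by (simp add: laplacian_mult[OF ct(1) sP] lP[OF secZ[OF x]] sum_2)
    show ?thesis
    proof (cases "norm x < \<delta> / 4")
      case True
      then show ?thesis using C1 by (simp add: eq ct_deriv_zero)
    next
      case False
      have "\<rho> \<le> sqrt m * norm x" using False m by (simp add: \<rho>_def)
      then have "\<rho> \<le> norm (x - y n)" using N1[OF secZ[OF x], of n] by linarith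
      then have i: "inverse (norm (x - y n)) \<le> inverse \<rho>" using \<rho> by (intro le_imp_inverse_le)
      have i4: "3 * inverse (norm (x - y n)) ^ 4 \<le> 3 * inverse \<rho> ^ 4" and i3: "inverse (norm (x - y n)) ^ 3 \<le> inverse \<rho> ^ 3"
        using i by (auto intro!: power_mono)
      have a: "norm (partial j (\<lambda>x. of_real (ct x)) x * partial j (P n) x) \<le> C * (3 * inverse \<rho> ^ 4)" for j
        unfolding norm_mult dP[OF secZ[OF x]] by (intro mult_mono C i4) (use C in auto)
      have b': "norm (laplacian (\<lambda>x. of_real (ct x)) x * P n x) \<le> C * inverse \<rho> ^ 3"
        unfolding norm_mult nP[OF secZ[OF x]] by (intro mult_mono C i3) (use C in auto)
      have "norm (laplacian (\<phi> n) x) \<le> 2 * norm (partial 1 (\<lambda>x. of_real (ct x)) x * partial 1 (P n) x + partial 2 (\<lambda>x. of_real (ct x)) x * partial 2 (P n) x)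
        + norm (laplacian (\<lambda>x. of_real (ct x)) x * P n x)"
        unfolding eq by (rule order_trans[OF norm_triangle_ineq]) (simp only: norm_mult norm_numeral order_refl)
      also have "\<dots> \<le> C1" unfolding C1_def
        by (intro add_mono mult_left_mono b' order_trans[OF norm_triangle_ineq] a) auto
      finally show ?thesis .
    qed
  qed
  note [measurable] = smooth_borel[OF smooth_laplacian[OF s\<phi>]] smooth_borel[OF s\<phi>] F(1)
  have um[measurable]: "u \<in> BM" using u by auto
  have T1: "(\<lambda>n. LBINT x. of_real ((e n)\<^sup>2) * (u x * laplacian (\<phi> n) x)) \<longlonglongrightarrow> (\<integral>x. 0 \<partial>(lborel :: (real^2) measure))"
  proof (rule integral_dominated_convergence[where w="\<lambda>x. C1 * norm (u x)"])
    have bd: "norm (of_real ((e n)\<^sup>2) * (u x * laplacian (\<phi> n) x)) \<le> (e n)\<^sup>2 * (C1 * norm (u x))" for n x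
    proof (cases "x \<in> sector azm azM")
      case True
      have "norm (u x * laplacian (\<phi> n) x) \<le> C1 * norm (u x)"
        unfolding norm_mult by (subst mult.commute) (intro mult_right_mono lap True, simp)
      then show ?thesis unfolding norm_mult[of "of_real ((e n)\<^sup>2)"] norm_of_real abs_power2 by (rule mult_left_mono) simp
    qed (simp add: u)
    show "AE x in lborel. norm (of_real ((e n)\<^sup>2) * (u x * laplacian (\<phi> n) x)) \<le> C1 * norm (u x)" for n
    proof (rule AE_I2)
      fix x
      have "(e n)\<^sup>2 * (C1 * norm (u x)) \<le> 1 * (C1 * norm (u x))" using e21 C1 by (intro mult_right_mono) auto
      then show "norm (of_real ((e n)\<^sup>2) * (u x * laplacian (\<phi> n) x)) \<le> C1 * norm (u x)" using bd[of n x] by linarith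
    qed
    show "AE x in lborel. (\<lambda>n. of_real ((e n)\<^sup>2) * (u x * laplacian (\<phi> n) x)) \<longlonglongrightarrow> 0"
      by (intro AE_I2 Lim_null_comparison[OF always_eventually[OF allI[OF bd]] tendsto_mult_left_zero[OF e2]])
  qed (use u in \<open>auto intro: integrable_mult_right\<close>)
  \<comment> \<open>Of the three powers of the distance N to the pole, two are paid for by (e n)^2
    \<le> N^2 / m and the third by N \<ge> sqrt m |x|. The majorant is a multiple of 1/|x|,
    integrable near 0 in the plane, while at a fixed x the product tends to 0.\<close>
  have T2: "(\<lambda>n. LBINT x. of_real ((e n)\<^sup>2) * (F x * \<phi> n x)) \<longlonglongrightarrow> (\<integral>x. 0 \<partial>(lborel :: (real^2) measure))"
  proof (rule integral_dominated_convergence[where w="\<lambda>x. (K * (1 / m) * (1 / sqrt m)) * (ind (cball 0 \<delta>) x / norm x)"])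
    show "L1 (\<lambda>x::real^2. (K * (1 / m) * (1 / sqrt m)) * (ind (cball 0 \<delta>) x / norm x))"
      by (intro integrable_mult_right integrable_inv_norm_ball)
    have bd: "norm (F x * \<phi> n x) \<le> K * inverse (norm (x - y n)) ^ 3" if x: "x \<in> sector azm azM" for x n
    proof -
      have "norm (\<phi> n x) \<le> 1 * inverse (norm (x - y n)) ^ 3"
        unfolding \<phi>_def norm_mult nP[OF secZ[OF x]] using ct(4,5)[of x] by (intro mult_right_mono) auto
      then show ?thesis unfolding norm_mult using F(2)[of x] K0 by (intro mult_mono) auto
    qed
    show "AE x in lborel. norm (of_real ((e n)\<^sup>2) * (F x * \<phi> n x)) \<le> (K * (1 / m) * (1 / sqrt m)) * (ind (cball 0 \<delta>) x / norm x)" for n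
    proof (rule AE_I2)
      fix x :: "real^2"
      show "norm (of_real ((e n)\<^sup>2) * (F x * \<phi> n x)) \<le> (K * (1 / m) * (1 / sqrt m)) * (ind (cball 0 \<delta>) x / norm x)"
      proof (cases "x \<in> sector azm azM \<and> norm x \<le> \<delta>")
        case True
        then have x: "x \<in> sector azm azM" "x \<noteq> 0" by (auto simp: sector_def)
        let ?N = "norm (x - y n)"
        have N0: "?N > 0" using far[OF secZ[OF x(1)], of n] c[of n] by auto
        have 1: "(e n)\<^sup>2 * inverse (?N ^ 2) \<le> 1 / m"
          using N2[OF secZ[OF x(1)], of n] N0 m by (simp add: field_simps)
        have 2: "inverse ?N \<le> 1 / sqrt m * (1 / norm x)"
        proof -
          have "inverse ?N \<le> inverse (sqrt m * norm x)" using N1[OF secZ[OF x(1)], of n] m x(2) by (intro le_imp_inverse_le) auto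
          then show ?thesis by (simp add: divide_inverse)
        qed
        have "norm (of_real ((e n)\<^sup>2) * (F x * \<phi> n x)) = (e n)\<^sup>2 * norm (F x * \<phi> n x)" by (simp only: norm_mult norm_of_real abs_power2)
        also have "\<dots> \<le> (e n)\<^sup>2 * (K * inverse ?N ^ 3)" using bd[OF x(1), of n] by (intro mult_left_mono) auto
        also have "\<dots> = K * (((e n)\<^sup>2 * inverse (?N ^ 2)) * inverse ?N)" by (simp add: power_inverse power2_eq_square power3_eq_cube)
        also have "\<dots> \<le> K * ((1 / m) * (1 / sqrt m * (1 / norm x)))"
          using 1 2 K0 m N0 by (intro mult_left_mono mult_mono) auto
        finally show ?thesis using True by simp
      next
        case False
        have "F x * \<phi> n x = 0"
        proof (cases "x \<in> sector azm azM")
          case True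
          then have "\<delta> / 2 \<le> norm x" using False \<delta> by auto
          then show ?thesis by (simp add: \<phi>_def ct(3))
        qed (simp add: F)
        then have "norm (of_real ((e n)\<^sup>2) * (F x * \<phi> n x)) = 0" by (simp only: mult_zero_right norm_zero)
        moreover have "0 \<le> (K * (1 / m) * (1 / sqrt m)) * (ind (cball 0 \<delta>) x / norm x)" using K0 m by simp
        ultimately show ?thesis by linarith
      qed
    qed
    show "AE x in lborel. (\<lambda>n. of_real ((e n)\<^sup>2) * (F x * \<phi> n x)) \<longlonglongrightarrow> 0"
    proof (rule AE_I2)
      fix x :: "real^2"
      show "(\<lambda>n. of_real ((e n)\<^sup>2) * (F x * \<phi> n x)) \<longlonglongrightarrow> 0"
      proof (cases "x \<in> sector azm azM")
        case True
        then have x0: "x \<noteq> 0" by (auto simp: sector_def)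
        have "norm (of_real ((e n)\<^sup>2) * (F x * \<phi> n x)) \<le> (e n)\<^sup>2 * (K * inverse (sqrt m * norm x) ^ 3)" for n
        proof -
          have "inverse (norm (x - y n)) \<le> inverse (sqrt m * norm x)" using N1[OF secZ[OF True], of n] m x0 by (intro le_imp_inverse_le) auto
          then have "K * inverse (norm (x - y n)) ^ 3 \<le> K * inverse (sqrt m * norm x) ^ 3"
            using K0 by (intro mult_left_mono power_mono) auto
          then have "norm (F x * \<phi> n x) \<le> K * inverse (sqrt m * norm x) ^ 3" using bd[OF True, of n] by linarith
          then show ?thesis unfolding norm_mult[of "of_real ((e n)\<^sup>2)"] norm_of_real abs_power2 by (rule mult_left_mono) simp
        qed
        then show ?thesis by (intro Lim_null_comparison[OF always_eventually[OF allI] tendsto_mult_left_zero[OF e2]])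
      qed (simp add: F)
    qed
  qed measurable
  have T3: "(\<lambda>n. of_real ((e n)\<^sup>2) * (LBINT t. ind {0<..} t *\<^sub>R (b t * \<phi> n (t *\<^sub>R dir az)))) \<longlonglongrightarrow>
      \<beta> * (inverse (cis az0) ^ 2 * inverse (cis az) / 2)"
    if az: "az = azm \<or> az = azM" and b': "b \<in> BM" "\<And>t. norm (b t) \<le> K" "(b \<longlongrightarrow> \<beta>) (at_right 0)" for b az
    unfolding \<phi>_def
  proof (rule boundary_limit[OF az b' m(1) _ e(1,2)])
    show "m * (t\<^sup>2 + 1) \<le> (norm (of_real t * cis az + cis az0))\<^sup>2" if "t \<ge> 0" for t
    proof -
      have "zc (t *\<^sub>R dir az + 1 *\<^sub>R dir az0) = of_real t * cis az + cis az0"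
        using zc_dir[of t az] zc_dir[of 1 az0] by (simp add: zc_add)
      then show ?thesis using mb[OF rayZ[OF that az], of 1] that norm_zc[of "t *\<^sub>R dir az + 1 *\<^sub>R dir az0"] by simp
    qed
    show "P n (t *\<^sub>R dir az) = inverse (of_real t * cis az + of_real (e n) * cis az0) ^ 3" if "t \<ge> 0" for n t
      using P3[OF rayZ[OF that az], of n] zc_dir[of t az] zc_dir[of "e n" az0] by (simp add: y_def zc_add)
  qed
  have "(\<lambda>n. of_real ((e n)\<^sup>2) * (LBINT x. u x * laplacian (\<phi> n) x)) \<longlonglongrightarrow>
     0 + \<beta> * (inverse (cis az0) ^ 2 * inverse (cis azm) / 2) + \<beta> * (inverse (cis az0) ^ 2 * inverse (cis azM) / 2)"
    unfolding id distrib_left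
  proof (intro tendsto_add T3 b lim)
    show "(\<lambda>n. of_real ((e n)\<^sup>2) * (LBINT x. F x * \<phi> n x)) \<longlonglongrightarrow> 0"
      using T2 unfolding integral_mult_right_zero by simp
  qed auto
  moreover have "(\<lambda>n. of_real ((e n)\<^sup>2) * (LBINT x. u x * laplacian (\<phi> n) x)) \<longlonglongrightarrow> 0"
    using T1 unfolding integral_mult_right_zero by simp
  ultimately have "0 = 0 + \<beta> * (inverse (cis az0) ^ 2 * inverse (cis azm) / 2) + \<beta> * (inverse (cis az0) ^ 2 * inverse (cis azM) / 2)"
    by (rule LIMSEQ_unique[rotated])
  then have "\<beta> * (inverse (cis az0) ^ 2 / 2) * (inverse (cis azm) + inverse (cis azM)) = 0"
    by (simp add: algebra_simps add_divide_distrib)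
  moreover have "inverse (cis az0) ^ 2 \<noteq> 0" by (simp del: cis_inverse)
  \<comment> \<open>A vanishing sum makes the two edges opposite, so the opening is an odd multiple
    of pi; strictly between 0 and 2 pi only pi itself is possible.\<close>
  moreover have "inverse (cis azm) + inverse (cis azM) \<noteq> 0"
  proof
    assume "inverse (cis azm) + inverse (cis azM) = 0"
    then have cs: "cos azm = - cos azM" "sin azm = - sin azM" by (auto simp: complex_eq_iff)
    have "cos (azM - azm) = - (cos azM * cos azM + sin azM * sin azM)"
      by (simp only: cos_diff cs mult_minus_right minus_add_distrib)
    also have "cos azM * cos azM + sin azM * sin azM = 1"
      using sin_cos_squared_add2[of azM] by (simp only: power2_eq_square)
    finally have "cos (azM - azm) = -1" .
    then obtain k :: int where k: "azM - azm = (2 * k + 1) * pi" by (auto simp: cos_eq_minus1)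
    have "0 < azM - azm" "azM - azm < 2 * pi" using angles by auto
    then have "0 < (2 * real_of_int k + 1) * pi" "(2 * real_of_int k + 1) * pi < 2 * pi" using k by auto
    then have "0 < 2 * real_of_int k + 1" "2 * real_of_int k + 1 < 2" by (auto simp: zero_less_mult_iff)
    then have "k = 0" by linarith
    then show False using k npi by simp
  qed
  ultimately show ?thesis by simp
qed

end

section \<open>Logarithmic potentials\<close>

text \<open>The gradient of the kernel behaves like 1/|p - y|, which is not integrable along an
  edge. Giving up half a power of the increment leaves the singularity |p - y|^(-1/2), integrable on
  edges and in the plane alike. The bound is uniform in \<epsilon>.\<close>

lemma ln_diff_bound:
  fixes p y y' :: "'a::real_normed_vector"
  assumes "p \<noteq> y" "p \<noteq> y'"
  shows "\<bar>ln ((norm (p - y))\<^sup>2 + \<epsilon>\<^sup>2) - ln ((norm (p - y'))\<^sup>2 + \<epsilon>\<^sup>2)\<bar> \<le>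
    4 * sqrt (norm (y - y')) * (1 / sqrt (norm (p - y)) + 1 / sqrt (norm (p - y')))"
proof -
  have main: "ln (a\<^sup>2 + \<epsilon>\<^sup>2) - ln (b\<^sup>2 + \<epsilon>\<^sup>2) \<le> 4 * sqrt d * (1 / sqrt b)"
    if ab: "b > 0" "a > 0" "a \<le> b + d" "d \<ge> 0" for a b d :: real
  proof -
    let ?s = "sqrt (a\<^sup>2 + \<epsilon>\<^sup>2)" and ?t = "sqrt (b\<^sup>2 + \<epsilon>\<^sup>2)"
    have tb: "b \<le> ?t" using ab by (simp add: real_le_rsqrt)
    have s0: "?s > 0" "?t > 0" using ab by (auto simp: add_pos_nonneg)
    have "?s \<le> ?t + d"
    proof -
      have "?s \<le> sqrt ((b + d)\<^sup>2 + (\<epsilon> + 0)\<^sup>2)" using ab by (intro real_sqrt_le_mono) (simp add: power_mono)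
      also have "\<dots> \<le> sqrt (b\<^sup>2 + \<epsilon>\<^sup>2) + sqrt (d\<^sup>2 + 0\<^sup>2)" by (rule real_sqrt_sum_squares_triangle_ineq)
      finally show ?thesis using ab by simp
    qed
    then have "?s / ?t \<le> (?t + d) / ?t" using s0 by (intro divide_right_mono) auto
    also have "\<dots> = 1 + d / ?t" using less_imp_neq[OF s0(2)] by (simp only: add_divide_distrib divide_self not_sym simp_thms)
    also have "\<dots> \<le> 1 + d / b" using tb ab s0 by (intro add_left_mono divide_left_mono mult_pos_pos)
    \<comment> \<open>This weakening trades the full increment for its square root: ln((1 + x)^2)
      \<le> 2x with x = sqrt (d / b). The second factor 2 of the constant 4 comes from ln of a
      square root.\<close>
    also have "\<dots> \<le> (1 + sqrt (d / b))\<^sup>2" using ab by (simp add: power2_eq_square algebra_simps)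
    finally have st: "?s / ?t \<le> (1 + sqrt (d / b))\<^sup>2" .
    have p: "1 + sqrt (d / b) > 0" using ab by (simp add: add_pos_nonneg)
    have lnd: "ln x - ln w = ln (x / w)" if "x > 0" "w > 0" for x w :: real using that by (simp add: ln_div)
    have "ln ?s - ln ?t = ln (?s / ?t)" by (rule lnd[OF s0])
    also have "\<dots> \<le> ln ((1 + sqrt (d / b))\<^sup>2)" using st divide_pos_pos[OF s0] p by (intro ln_mono) auto
    also have "\<dots> = 2 * ln (1 + sqrt (d / b))" using p by (simp add: ln_realpow)
    also have "\<dots> \<le> 2 * sqrt (d / b)" using ab ln_add_one_self_le_self[of "sqrt (d / b)"] by simp
    finally have "ln ?s - ln ?t \<le> 2 * (sqrt d * (1 / sqrt b))" by (simp add: real_sqrt_divide)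
    moreover have "ln x = 2 * ln (sqrt x)" if "sqrt x > 0" for x
      using that by (simp add: ln_sqrt)
    from this[OF s0(1)] this[OF s0(2)] have "ln (a\<^sup>2 + \<epsilon>\<^sup>2) = 2 * ln ?s" "ln (b\<^sup>2 + \<epsilon>\<^sup>2) = 2 * ln ?t" .
    ultimately show ?thesis by simp
  qed
  have pos: "norm (p - y) > 0" "norm (p - y') > 0" using assms by auto
  have tri: "norm (p - y) \<le> norm (p - y') + norm (y - y')" "norm (p - y') \<le> norm (p - y) + norm (y - y')"
    using norm_triangle_ineq4[of "p - y'" "y - y'"] norm_triangle_ineq[of "p - y" "y - y'"] by (simp_all add: algebra_simps)
  have "4 * sqrt (norm (y - y')) * (1 / sqrt (norm (p - y))) \<ge> 0" "4 * sqrt (norm (y - y')) * (1 / sqrt (norm (p - y'))) \<ge> 0"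
    using pos by auto
  then show ?thesis
    using main[OF pos(2,1) tri(1) norm_ge_zero] main[OF pos tri(2) norm_ge_zero] unfolding distrib_left by linarith
qed

text \<open>For small values -ln(a^2) = 4 ln(1 / sqrt a) \<le> 4 / sqrt a, so the kernel has the
  same integrable majorant as its increments; for large values ln x \<le> x - 1 suffices.\<close>

lemma ln_bound:
  assumes "a > 0" "a \<le> D" "\<epsilon> \<le> 1" "0 \<le> \<epsilon>"
  shows "\<bar>ln (a\<^sup>2 + \<epsilon>\<^sup>2)\<bar> \<le> D\<^sup>2 + 1 + 4 * (1 / sqrt (a::real))"
proof -
  have q: "a\<^sup>2 + \<epsilon>\<^sup>2 > 0" using assms by (simp add: add_pos_nonneg)
  have "a\<^sup>2 \<le> D\<^sup>2" "\<epsilon>\<^sup>2 \<le> 1" using assms by (auto intro: power_mono simp: power_le_one)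
  moreover have "ln (a\<^sup>2 + \<epsilon>\<^sup>2) \<le> a\<^sup>2 + \<epsilon>\<^sup>2 - 1" using q by (rule ln_le_minus_one)
  moreover have "1 / sqrt a > 0" using assms by simp
  ultimately have 1: "ln (a\<^sup>2 + \<epsilon>\<^sup>2) \<le> D\<^sup>2 + 1 + 4 * (1 / sqrt a)" by linarith
  have "ln (a\<^sup>2) \<le> ln (a\<^sup>2 + \<epsilon>\<^sup>2)" using assms q by (subst ln_le_cancel_iff) auto
  moreover have "- ln (a\<^sup>2) = 4 * ln (1 / sqrt a)"
    using assms by (simp add: ln_div ln_sqrt ln_realpow)
  moreover have "ln (1 / sqrt a) \<le> 1 / sqrt a" using assms ln_le_minus_one[of "1 / sqrt a"] by simp
  moreover have "0 \<le> D\<^sup>2 + 1" by simp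
  ultimately have "- ln (a\<^sup>2 + \<epsilon>\<^sup>2) \<le> D\<^sup>2 + 1 + 4 * (1 / sqrt a)" by linarith
  with 1 show ?thesis by linarith
qed

text \<open>Its Laplacian is the approximate identity \<open>poisson \<epsilon>\<close> defined below.\<close>

definition log_kernel :: "real \<Rightarrow> real^2 \<Rightarrow> real" where
  "log_kernel \<epsilon> z = ln ((norm z)\<^sup>2 + \<epsilon>\<^sup>2)"

text \<open>The measure M and the position map p are left abstract, so that one proof serves plane
  densities (p the identity) and edge densities (p the parametrised ray). The uniform bound B on the
  potentials with kernel |p - y|^(-1/2) gives equicontinuity with exponent 1/2, and its finiteness
  at each y gives the majorant for the limit \<epsilon> \<rightarrow> 0.\<close>

lemma log_potential:
  fixes c :: "'a \<Rightarrow> complex" and p :: "'a \<Rightarrow> real^2"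
  assumes c: "integrable M c" and p[measurable]: "p \<in> M \<rightarrow>\<^sub>M borel"
    and D: "\<And>\<omega> y. y \<in> Y \<Longrightarrow> c \<omega> \<noteq> 0 \<Longrightarrow> norm (p \<omega> - y) \<le> D"
    and ae: "\<And>y. y \<in> Y \<Longrightarrow> AE \<omega> in M. p \<omega> \<noteq> y"
    and i: "\<And>y. y \<in> Y \<Longrightarrow> integrable M (\<lambda>\<omega>. norm (c \<omega>) * (1 / sqrt (norm (p \<omega> - y))))"
    and B: "\<And>y. y \<in> Y \<Longrightarrow> (\<integral>\<omega>. norm (c \<omega>) * (1 / sqrt (norm (p \<omega> - y))) \<partial>M) \<le> B"
    and e: "e \<longlonglongrightarrow> 0" "\<And>n. 0 < e n" "\<And>n. e n \<le> (1::real)"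
  shows "y \<in> Y \<Longrightarrow> convergent (\<lambda>n. \<integral>\<omega>. c \<omega> * of_real (log_kernel (e n) (p \<omega> - y)) \<partial>M)" (is "_ \<Longrightarrow> ?conv")
    and "y \<in> Y \<Longrightarrow> y' \<in> Y \<Longrightarrow> norm ((\<integral>\<omega>. c \<omega> * of_real (log_kernel (e n) (p \<omega> - y)) \<partial>M) - (\<integral>\<omega>. c \<omega> * of_real (log_kernel (e n) (p \<omega> - y')) \<partial>M))
      \<le> 8 * B * sqrt (norm (y - y'))"
proof -
  have [measurable]: "c \<in> borel_measurable M" using c by auto
  have [measurable]: "log_kernel \<epsilon> \<in> BM" for \<epsilon> unfolding log_kernel_def[abs_def] by measurable
  have bd: "norm (c \<omega> * of_real (log_kernel (e n) (p \<omega> - y))) \<le> (D\<^sup>2 + 1) * norm (c \<omega>) + 4 * (norm (c \<omega>) * (1 / sqrt (norm (p \<omega> - y))))"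
    if y: "y \<in> Y" and \<omega>: "p \<omega> \<noteq> y" for y \<omega> n
  proof (cases "c \<omega> = 0")
    case False
    have "\<bar>log_kernel (e n) (p \<omega> - y)\<bar> \<le> D\<^sup>2 + 1 + 4 * (1 / sqrt (norm (p \<omega> - y)))"
      unfolding log_kernel_def using \<omega> D[OF y False] e(2,3)[of n] by (intro ln_bound) auto
    then have "norm (c \<omega>) * \<bar>log_kernel (e n) (p \<omega> - y)\<bar> \<le> norm (c \<omega>) * (D\<^sup>2 + 1 + 4 * (1 / sqrt (norm (p \<omega> - y))))"
      by (intro mult_left_mono) auto
    then show ?thesis by (simp add: norm_mult algebra_simps)
  qed simp
  have dom: "integrable M (\<lambda>\<omega>. (D\<^sup>2 + 1) * norm (c \<omega>) + 4 * (norm (c \<omega>) * (1 / sqrt (norm (p \<omega> - y)))))" if "y \<in> Y" for y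
    using c i[OF that] by (intro bochner_add integrable_mult_right) auto
  have int: "integrable M (\<lambda>\<omega>. c \<omega> * of_real (log_kernel (e n) (p \<omega> - y)))" if "y \<in> Y" for y n
    by (rule bochner_bound[OF dom[OF that]])
      (measurable, use ae[OF that] in eventually_elim, use bd[OF that] in \<open>force intro: order_trans\<close>)
  show ?conv if y: "y \<in> Y"
  proof (rule convergentI, rule integral_dominated_convergence[where w="\<lambda>\<omega>. (D\<^sup>2 + 1) * norm (c \<omega>) + 4 * (norm (c \<omega>) * (1 / sqrt (norm (p \<omega> - y))))"])
    show "AE \<omega> in M. (\<lambda>n. c \<omega> * of_real (log_kernel (e n) (p \<omega> - y))) \<longlonglongrightarrow> c \<omega> * of_real (log_kernel 0 (p \<omega> - y))"
      using ae[OF y]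
    proof eventually_elim
      case (elim \<omega>)
      then have "(norm (p \<omega> - y))\<^sup>2 + 0\<^sup>2 \<noteq> 0" by simp
      then have "(\<lambda>n. ln ((norm (p \<omega> - y))\<^sup>2 + (e n)\<^sup>2)) \<longlonglongrightarrow> ln ((norm (p \<omega> - y))\<^sup>2 + 0\<^sup>2)"
        by (intro tendsto_ln tendsto_add tendsto_power e tendsto_const)
      then show ?case unfolding log_kernel_def by (intro tendsto_mult tendsto_of_real tendsto_const)
    qed
    show "AE \<omega> in M. norm (c \<omega> * of_real (log_kernel (e n) (p \<omega> - y))) \<le> (D\<^sup>2 + 1) * norm (c \<omega>) + 4 * (norm (c \<omega>) * (1 / sqrt (norm (p \<omega> - y))))" for n
      using ae[OF y] by eventually_elim (rule bd[OF y])
  qed (use dom[OF y] in \<open>measurable\<close>)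
  assume yy: "y \<in> Y" "y' \<in> Y"
  let ?w = "\<lambda>\<omega>. 4 * sqrt (norm (y - y')) * (norm (c \<omega>) * (1 / sqrt (norm (p \<omega> - y))) + norm (c \<omega>) * (1 / sqrt (norm (p \<omega> - y'))))"
  have "norm ((\<integral>\<omega>. c \<omega> * of_real (log_kernel (e n) (p \<omega> - y)) \<partial>M) - (\<integral>\<omega>. c \<omega> * of_real (log_kernel (e n) (p \<omega> - y')) \<partial>M))
    = norm (\<integral>\<omega>. c \<omega> * of_real (log_kernel (e n) (p \<omega> - y)) - c \<omega> * of_real (log_kernel (e n) (p \<omega> - y')) \<partial>M)"
    using int yy by (subst Bochner_Integration.integral_diff) auto
  also have "\<dots> \<le> (\<integral>\<omega>. ?w \<omega> \<partial>M)"
  proof (rule order_trans[OF integral_norm_bound], rule integral_mono_AE)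
    show "AE \<omega> in M. norm (c \<omega> * of_real (log_kernel (e n) (p \<omega> - y)) - c \<omega> * of_real (log_kernel (e n) (p \<omega> - y'))) \<le> ?w \<omega>"
      using ae[OF yy(1)] ae[OF yy(2)]
    proof eventually_elim
      case (elim \<omega>)
      have "norm (c \<omega> * of_real (log_kernel (e n) (p \<omega> - y)) - c \<omega> * of_real (log_kernel (e n) (p \<omega> - y'))) =
         norm (c \<omega>) * \<bar>log_kernel (e n) (p \<omega> - y) - log_kernel (e n) (p \<omega> - y')\<bar>"
        by (simp only: right_diff_distrib[symmetric] norm_mult of_real_diff[symmetric] norm_of_real)
      also have "\<dots> \<le> norm (c \<omega>) * (4 * sqrt (norm (y - y')) * (1 / sqrt (norm (p \<omega> - y)) + 1 / sqrt (norm (p \<omega> - y'))))"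
        unfolding log_kernel_def using elim by (intro mult_left_mono ln_diff_bound) auto
      finally show ?case by (simp add: algebra_simps)
    qed
  qed (use int yy i in \<open>auto intro!: integrable_mult_right bochner_add\<close>)
  also have "\<dots> = 4 * sqrt (norm (y - y')) * ((\<integral>\<omega>. norm (c \<omega>) * (1 / sqrt (norm (p \<omega> - y))) \<partial>M) + (\<integral>\<omega>. norm (c \<omega>) * (1 / sqrt (norm (p \<omega> - y'))) \<partial>M))"
    using i[OF yy(1)] i[OF yy(2)] by (simp only: integral_mult_right_zero Bochner_Integration.integral_add)
  also have "\<dots> \<le> 4 * sqrt (norm (y - y')) * (B + B)"
    using B[OF yy(1)] B[OF yy(2)] by (intro mult_left_mono add_mono) auto
  finally show "norm ((\<integral>\<omega>. c \<omega> * of_real (log_kernel (e n) (p \<omega> - y)) \<partial>M) - (\<integral>\<omega>. c \<omega> * of_real (log_kernel (e n) (p \<omega> - y')) \<partial>M))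
      \<le> 8 * B * sqrt (norm (y - y'))" by (simp add: algebra_simps)
qed

lemma integrable_translate:
  fixes f :: "'a::euclidean_space \<Rightarrow> real"
  assumes "L1 f"
  shows "L1 (\<lambda>x. f (x - y))" "(LBINT x. f (x - y)) = (LBINT x. f x)"
proof -
  have [measurable]: "f \<in> BM" using assms by auto
  have "lborel = distr lborel borel (\<lambda>x. - y + x)" by (rule lborel_distr_plus[symmetric])
  then have *: "lborel = distr lborel borel (\<lambda>x. x - y)" by (simp add: algebra_simps)
  show "(LBINT x. f (x - y)) = (LBINT x. f x)"
    by (subst (2) *) (simp add: integral_distr)
  show "L1 (\<lambda>x. f (x - y))"
    using assms by (subst (asm) *) (simp add: integrable_distr_eq)
qed

lemma inv_sqrt_le: "(a::real) > 0 \<Longrightarrow> 1 / sqrt a \<le> 1 + 1 / a"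
proof -
  assume a: "a > 0"
  show ?thesis
  proof (cases "a \<ge> 1")
    case True
    then have "1 / sqrt a \<le> 1" by simp
    then show ?thesis using a by (simp add: add_increasing2)
  next
    case False
    have "sqrt a * sqrt a \<le> 1 * sqrt a" using a False by (intro mult_right_mono) auto
    then have "a \<le> sqrt a" using a by simp
    then have "1 / sqrt a \<le> 1 / a" using a by (intro divide_left_mono) auto
    then show ?thesis by linarith
  qed
qed

text \<open>The kernel |z|^(-1/2) is at most 2 plus 1/|z| on the unit ball. Translating the singular
  part makes its integral independent of y, which is where uniformity comes from.\<close>

lemma plane_potential_bound:
  fixes c :: "real^2 \<Rightarrow> complex"
  assumes c[measurable]: "c \<in> BM" and K: "\<And>x. norm (c x) \<le> K" and R: "\<And>x. norm x > R \<Longrightarrow> c x = 0"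
  shows "\<exists>B. \<forall>y. L1 (\<lambda>x. norm (c x) * (1 / sqrt (norm (x - y)))) \<and>
    (LBINT x. norm (c x) * (1 / sqrt (norm (x - y)))) \<le> B"
proof -
  let ?w = "\<lambda>(y::real^2) (x::real^2). K * (2 * ind (cball 0 R) x + ind (cball 0 1) (x - y) / norm (x - y)) :: real"
  have K0: "K \<ge> 0" using K[of 0] norm_ge_zero order_trans by blast
  have iR: "L1 (ind (cball 0 R) :: real^2 \<Rightarrow> real)"
    by (rule integrable_real_indicator) (auto simp: emeasure_lborel_cball_finite[unfolded infinity_ennreal_def])
  note iT = integrable_translate[OF integrable_inv_norm]
  have iw: "L1 (?w y)" for y
    using iR iT(1) by (intro integrable_mult_right bochner_add) auto
  have le: "norm (norm (c x) * (1 / sqrt (norm (x - y)))) \<le> ?w y x" for x y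
  proof (cases "norm x \<le> R")
    case True
    have 1: "1 / sqrt (norm (x - y)) \<le> 2 + ind (cball 0 1) (x - y) / norm (x - y)"
    proof (cases "x = y")
      case False
      then have "1 / sqrt (norm (x - y)) \<le> 1 + 1 / norm (x - y)" by (intro inv_sqrt_le) simp
      also have "1 / norm (x - y) \<le> 1 + ind (cball 0 1) (x - y) / norm (x - y)"
        using False by (auto simp: indicator_def)
      finally show ?thesis by simp
    qed simp
    have "norm (norm (c x) * (1 / sqrt (norm (x - y)))) = norm (c x) * (1 / sqrt (norm (x - y)))" by simp
    also have "\<dots> \<le> K * (2 + ind (cball 0 1) (x - y) / norm (x - y))"
      using 1 K K0 by (intro mult_mono) auto
    finally show ?thesis using True by simp
  next
    case False
    then have "c x = 0" using R by simp
    then show ?thesis using K0 by simp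
  qed
  have i: "L1 (\<lambda>x. norm (c x) * (1 / sqrt (norm (x - y))))" for y
    by (rule bochner_bound[OF iw[of y]]) (measurable, use le in \<open>auto intro: order_trans[OF _ abs_ge_self]\<close>)
  have le1: "(LBINT x. norm (c x) * (1 / sqrt (norm (x - y)))) \<le> (LBINT x. ?w y x)" for y
    using i iw le by (intro integral_mono) (auto intro: order_trans[OF abs_ge_self])
  have eq: "(LBINT x. ?w y x) = K * (2 * (LBINT x. ind (cball (0::real^2) R) x) + (LBINT x. ind (cball (0::real^2) 1) x / norm x))" for y
    using iR iT(1)[of y] by (simp only: integral_mult_right_zero Bochner_Integration.integral_add integrable_mult_right iT(2))
  show ?thesis by (rule exI, intro allI conjI, rule i, rule order_trans[OF le1 eq[THEN eq_refl]])
qed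

text \<open>The distance from y to a point of the line is at least the distance from the projection
  of y, so the worst case is a pole on the line itself; translation along the line then makes the
  bound independent of y.\<close>

lemma line_potential_bound:
  fixes c :: "real \<Rightarrow> complex"
  assumes c[measurable]: "c \<in> BM" and K: "\<And>x. norm (c x) \<le> K" and R: "\<And>t. \<bar>t\<bar> > R \<Longrightarrow> c t = 0"
  shows "\<exists>B. \<forall>y. L1 (\<lambda>t. norm (c t) * (1 / sqrt (norm (t *\<^sub>R dir az - y)))) \<and>
    (LBINT t. norm (c t) * (1 / sqrt (norm (t *\<^sub>R dir az - y)))) \<le> B"
proof -
  let ?s = "\<lambda>t::real. ind {-1..1} t * \<bar>t\<bar> powr (-1/2) :: real"
  let ?w = "\<lambda>y t. K * (ind {-R..R} t + ?s (t - dir az \<bullet> y))"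
  have K0: "K \<ge> 0" using K[of 0] norm_ge_zero order_trans by blast
  have iR: "L1 (ind {-R..R} :: real \<Rightarrow> real)"
    using emeasure_bounded_finite[of "{-R..R}"] by (intro integrable_real_indicator) auto
  note iT = integrable_translate[OF integrable_inv_sqrt]
  have iw: "L1 (?w y)" for y
    using iR iT(1) by (intro integrable_mult_right bochner_add) auto
  have ae: "AE t in lborel. t \<noteq> dir az \<bullet> y" for y by (rule AE_lborel_singleton)
  have le: "norm (norm (c t) * (1 / sqrt (norm (t *\<^sub>R dir az - y)))) \<le> ?w y t" if t: "t \<noteq> dir az \<bullet> y" for t y
  proof (cases "\<bar>t\<bar> \<le> R")
    case True
    let ?a = "\<bar>t - dir az \<bullet> y\<bar>"
    have a0: "?a > 0" using t by simp
    have "\<bar>dir az \<bullet> (t *\<^sub>R dir az - y)\<bar> \<le> norm (t *\<^sub>R dir az - y)"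
      using Cauchy_Schwarz_ineq2[of "dir az" "t *\<^sub>R dir az - y"] by simp
    then have an: "?a \<le> norm (t *\<^sub>R dir az - y)" by (simp add: inner_diff_right dir_dir)
    have "1 / sqrt (norm (t *\<^sub>R dir az - y)) \<le> 1 / sqrt ?a"
      using an a0 by (intro divide_left_mono mult_pos_pos) auto
    also have "\<dots> \<le> 1 + ?s (t - dir az \<bullet> y)"
    proof (cases "?a \<le> 1")
      case True
      have "?a powr (-1/2) = 1 / sqrt ?a" using a0 powr_minus_divide[of ?a "1/2"] by (simp add: powr_half_sqrt)
      then show ?thesis using True by (simp add: indicator_def abs_le_iff)
    next
      case False
      then have "1 / sqrt ?a \<le> 1" by simp
      moreover have "0 \<le> ?s (t - dir az \<bullet> y)" by simp
      ultimately show ?thesis by linarith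
    qed
    finally have 1: "1 / sqrt (norm (t *\<^sub>R dir az - y)) \<le> 1 + ?s (t - dir az \<bullet> y)" .
    have "norm (norm (c t) * (1 / sqrt (norm (t *\<^sub>R dir az - y)))) = norm (c t) * (1 / sqrt (norm (t *\<^sub>R dir az - y)))" by simp
    also have "\<dots> \<le> K * (1 + ?s (t - dir az \<bullet> y))"
      using 1 K K0 by (intro mult_mono) auto
    finally show ?thesis using True by (simp add: abs_le_iff)
  next
    case False
    then have "c t = 0" using R by simp
    moreover have "0 \<le> ?w y t" using K0 by simp
    ultimately show ?thesis by simp
  qed
  have i: "L1 (\<lambda>t. norm (c t) * (1 / sqrt (norm (t *\<^sub>R dir az - y))))" for y
  proof (rule bochner_bound[OF iw[of y]])
    show "AE t in lborel. norm (norm (c t) * (1 / sqrt (norm (t *\<^sub>R dir az - y)))) \<le> norm (?w y t)"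
      using ae[of y] by eventually_elim (rule order_trans[OF le], auto)
  qed measurable
  have le1: "(LBINT t. norm (c t) * (1 / sqrt (norm (t *\<^sub>R dir az - y)))) \<le> (LBINT t. ?w y t)" for y
  proof (rule integral_mono_AE[OF i iw])
    show "AE t in lborel. norm (c t) * (1 / sqrt (norm (t *\<^sub>R dir az - y))) \<le> ?w y t"
      using ae[of y] by eventually_elim (rule order_trans[OF _ le], auto)
  qed
  have eq: "(LBINT t. ?w y t) = K * ((LBINT t. ind {-R..R} t) + (LBINT t. ?s t))" for y
    using iR iT(1)[of "dir az \<bullet> y"] by (simp only: integral_mult_right_zero Bochner_Integration.integral_add iT(2))
  show ?thesis by (rule exI, intro allI conjI, rule i, rule order_trans[OF le1 eq[THEN eq_refl]])
qed

text \<open>Up to a factor 2 the field z / (|z|^2 + \<epsilon>^2) is the gradient of the logarithmic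
  kernel. At distance at least r from its singularity it is Lipschitz with a constant independent of
  \<epsilon>; it will be evaluated only where the cut-off varies.\<close>

lemma gradient_kernel_diff:
  fixes z z' :: "'a::real_normed_vector"
  assumes r: "r > 0" "r \<le> norm z" "r \<le> norm z'"
  shows "norm (z /\<^sub>R ((norm z)\<^sup>2 + \<epsilon>\<^sup>2) - z' /\<^sub>R ((norm z')\<^sup>2 + \<epsilon>\<^sup>2)) \<le> 3 / r\<^sup>2 * norm (z - z')"
proof -
  let ?A = "(norm z)\<^sup>2 + \<epsilon>\<^sup>2" and ?B = "(norm z')\<^sup>2 + \<epsilon>\<^sup>2" and ?d = "norm (z - z')"
  have n: "0 < norm z" "0 < norm z'" using r by auto
  have AB: "?A > 0" "?B > 0" using n by (auto simp: add_pos_nonneg)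
  have r2: "r\<^sup>2 \<le> (norm z)\<^sup>2" "r\<^sup>2 \<le> (norm z')\<^sup>2" using r by (auto intro: power_mono)
  have Ar: "inverse ?A \<le> 1 / r\<^sup>2"
    using r2 r AB by (simp add: inverse_eq_divide frac_le add_increasing2)
  have "z /\<^sub>R ?A - z' /\<^sub>R ?B = (z - z') /\<^sub>R ?A + (inverse ?A - inverse ?B) *\<^sub>R z'"
    by (simp add: algebra_simps)
  then have "norm (z /\<^sub>R ?A - z' /\<^sub>R ?B) \<le> norm ((z - z') /\<^sub>R ?A) + norm ((inverse ?A - inverse ?B) *\<^sub>R z')"
    by (metis norm_triangle_ineq)
  also have "norm ((z - z') /\<^sub>R ?A) = inverse ?A * ?d" using AB by simp
  also have "norm ((inverse ?A - inverse ?B) *\<^sub>R z') = \<bar>inverse ?A - inverse ?B\<bar> * norm z'" by simp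
  also have "\<bar>inverse ?A - inverse ?B\<bar> * norm z' \<le> 2 / r\<^sup>2 * ?d"
  proof -
    have "inverse ?A - inverse ?B = (norm z' - norm z) * (norm z' + norm z) * (inverse ?A * inverse ?B)"
    proof -
      have "inverse ?A - inverse ?B = (?B - ?A) * (inverse ?A * inverse ?B)"
      proof -
        have "inverse a - inverse b = (b - a) * (inverse a * inverse b)" if "a > 0" "b > 0" for a b :: real
          using that by (simp add: field_simps)
        from this[OF AB] show ?thesis .
      qed
      also have "?B - ?A = (norm z' - norm z) * (norm z' + norm z)" by (simp add: power2_eq_square algebra_simps)
      finally show ?thesis .
    qed
    then have "\<bar>inverse ?A - inverse ?B\<bar> = \<bar>norm z' - norm z\<bar> * ((norm z' + norm z) * (inverse ?A * inverse ?B))"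
      using AB n by (simp add: abs_mult)
    also have "\<dots> \<le> ?d * ((norm z' + norm z) * (inverse ?A * inverse ?B))"
      using AB n norm_triangle_ineq3[of z' z] by (intro mult_right_mono) (auto simp: norm_minus_commute)
    finally have "\<bar>inverse ?A - inverse ?B\<bar> * norm z' \<le> ?d * ((norm z' + norm z) * (inverse ?A * inverse ?B)) * norm z'"
      by (intro mult_right_mono) auto
    also have "\<dots> = ?d * ((norm z')\<^sup>2 * inverse ?B * inverse ?A + (norm z * inverse ?A) * (norm z' * inverse ?B))"
      by (simp add: algebra_simps power2_eq_square)
    also have "\<dots> \<le> ?d * (1 * (1 / r\<^sup>2) + (1 / r) * (1 / r))"
    proof (intro mult_left_mono add_mono mult_mono)
      show "(norm z')\<^sup>2 * inverse ?B \<le> 1" using AB by (simp add: divide_inverse[symmetric])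
      have k: "norm x * inverse ((norm x)\<^sup>2 + \<epsilon>\<^sup>2) \<le> 1 / r" if "r \<le> norm x" for x :: 'a
      proof -
        have x: "norm x > 0" using that r(1) by linarith
        have "inverse ((norm x)\<^sup>2 + \<epsilon>\<^sup>2) \<le> inverse ((norm x)\<^sup>2)" using x by (intro le_imp_inverse_le) auto
        then have "norm x * inverse ((norm x)\<^sup>2 + \<epsilon>\<^sup>2) \<le> norm x * inverse ((norm x)\<^sup>2)" by (intro mult_left_mono) auto
        also have "\<dots> = 1 / norm x" using x by (simp add: power2_eq_square divide_inverse)
        also have "\<dots> \<le> 1 / r" using that r x by (intro divide_left_mono mult_pos_pos) auto
        finally show ?thesis .
      qed
      show "norm z * inverse ?A \<le> 1 / r" "norm z' * inverse ?B \<le> 1 / r" using k r by auto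
    qed (use AB Ar n r in auto)
    finally show ?thesis by (simp add: power2_eq_square algebra_simps)
  qed
  also have "inverse ?A * ?d \<le> 1 / r\<^sup>2 * ?d" using Ar by (intro mult_right_mono) auto
  finally show ?thesis by (simp add: algebra_simps)
qed

section \<open>An approximate identity and the Hoelder representative\<close>

definition poisson :: "real \<Rightarrow> real^2 \<Rightarrow> real" where
  "poisson \<epsilon> z = 4 * \<epsilon>\<^sup>2 / ((norm z)\<^sup>2 + \<epsilon>\<^sup>2)\<^sup>2"

text \<open>With q = |x - y|^2 + \<epsilon>^2 the second derivatives add up to 4/q - 4 |x - y|^2 /
  q^2, and the leading parts cancel to 4 \<epsilon>^2 / q^2. This is an approximate identity up to a
  constant mass; its power 2 differs from the power 3/2 of the half-space Poisson kernel over the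
  plane.\<close>

lemma
  assumes "\<epsilon> \<noteq> 0"
  shows smooth_log_kernel: "smooth (\<lambda>x. of_real (log_kernel \<epsilon> (x - y)))"
    and partial_log_kernel: "partial i (\<lambda>x. of_real (log_kernel \<epsilon> (x - y))) x = 2 * of_real (((x - y) /\<^sub>R ((norm (x - y))\<^sup>2 + \<epsilon>\<^sup>2)) $ i)"
    and laplacian_log_kernel: "laplacian (\<lambda>x. of_real (log_kernel \<epsilon> (x - y))) x = of_real (poisson \<epsilon> (x - y))"
proof -
  define q where "q x = (norm (x - y))\<^sup>2 + \<epsilon>\<^sup>2" for x
  have q0: "q x > 0" for x using assms by (simp add: q_def add_nonneg_pos)
  have sq: "smooth (\<lambda>x. of_real (q x))"
    unfolding q_def of_real_add by (intro smooth_add smooth_norm2 smooth_const)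
  have pq: "partial i (\<lambda>x. of_real (q x)) x = 2 * of_real (x $ i - y $ i)" for i x
    unfolding q_def of_real_add
    by (simp only: partial_add[OF smooth_diff[OF smooth_norm2] smooth_diff[OF smooth_const]] partial_norm2 partial_const add_0_right)
  have si: "smooth (\<lambda>x. of_real (inverse (q x)))"
    unfolding of_real_inverse using q0 by (intro smooth_inverse sq) (metis of_real_eq_0_iff less_irrefl)
  have dln: "(ln has_real_derivative inverse (q x)) (at (q x))" for x
    by (rule DERIV_ln[OF q0])
  have lk: "log_kernel \<epsilon> (x - y) = ln (q x)" for x by (simp add: log_kernel_def q_def)
  show "smooth (\<lambda>x. of_real (log_kernel \<epsilon> (x - y)))"
    unfolding lk by (rule smooth_comp[OF sq dln si])
  have p: "partial i (\<lambda>x. of_real (log_kernel \<epsilon> (x - y))) x = of_real (inverse (q x)) * (2 * of_real (x $ i - y $ i))" for i x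
    unfolding lk partial_comp[OF smooth_diff[OF sq] dln] pq ..
  then show "partial i (\<lambda>x. of_real (log_kernel \<epsilon> (x - y))) x = 2 * of_real (((x - y) /\<^sub>R ((norm (x - y))\<^sup>2 + \<epsilon>\<^sup>2)) $ i)"
    by (simp add: q_def)
  have din: "(inverse has_real_derivative - (inverse (q x))\<^sup>2) (at (q x))" for x
    using DERIV_inverse[of "q x" UNIV] q0[of x] by (simp add: numeral_2_eq_2)
  have sl: "smooth (\<lambda>x. 2 * of_real (x $ i - y $ i))" for i
    unfolding of_real_diff by (intro smooth_mult smooth_const smooth_minus smooth_nth)
  have pl: "partial j (\<lambda>x. 2 * complex_of_real (x $ i - y $ i)) x = (if i = j then 2 else 0)" for i j x
    unfolding of_real_diff
    by (simp only: partial_mult[OF smooth_diff[OF smooth_const] smooth_diff[OF smooth_minus[OF smooth_nth smooth_const]]])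
      (simp add: partial_minus[OF smooth_diff[OF smooth_nth] smooth_diff[OF smooth_const]] partial_const partial_nth)
  have "partial i (partial i (\<lambda>x. of_real (log_kernel \<epsilon> (x - y)))) x =
     of_real (inverse (q x)) * 2 + of_real (- (inverse (q x))\<^sup>2) * (2 * of_real (x $ i - y $ i)) * (2 * of_real (x $ i - y $ i))" for i
  proof -
    have "partial i (\<lambda>x. of_real (log_kernel \<epsilon> (x - y))) = (\<lambda>x. of_real (inverse (q x)) * (2 * of_real (x $ i - y $ i)))"
      using p by blast
    then show ?thesis
      by (simp only: partial_mult[OF smooth_diff[OF si] smooth_diff[OF sl]] pl partial_comp[OF smooth_diff[OF sq] din] pq if_True simp_thms)
  qed
  then have "laplacian (\<lambda>x. of_real (log_kernel \<epsilon> (x - y))) x =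
     of_real (4 * inverse (q x) - 4 * (inverse (q x))\<^sup>2 * ((x $ 1 - y $ 1)\<^sup>2 + (x $ 2 - y $ 2)\<^sup>2))"
    unfolding laplacian_def by (simp add: sum_2 power2_eq_square algebra_simps)
  also have "(x $ 1 - y $ 1)\<^sup>2 + (x $ 2 - y $ 2)\<^sup>2 = q x - \<epsilon>\<^sup>2"
    by (simp add: q_def norm_2)
  also have "4 * inverse (q x) - 4 * (inverse (q x))\<^sup>2 * (q x - \<epsilon>\<^sup>2) = 4 * \<epsilon>\<^sup>2 / (q x)\<^sup>2"
    using q0[of x] by (simp add: field_simps power2_eq_square)
  finally show "laplacian (\<lambda>x. of_real (log_kernel \<epsilon> (x - y))) x = of_real (poisson \<epsilon> (x - y))"
    by (simp add: poisson_def q_def)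
qed

lemma borel_poisson [measurable]: "poisson \<epsilon> \<in> BM"
  unfolding poisson_def[abs_def] by measurable

lemma poisson_nonneg: "poisson \<epsilon> z \<ge> 0"
  by (simp add: poisson_def)

lemma poisson_bound: "\<epsilon> \<noteq> 0 \<Longrightarrow> poisson \<epsilon> z \<le> 4 / \<epsilon>\<^sup>2"
proof -
  assume "\<epsilon> \<noteq> 0"
  then have e: "\<epsilon>\<^sup>2 > 0" by simp
  have "4 * A / (B + A)\<^sup>2 \<le> 4 / A" if "A > 0" "B \<ge> 0" for A B :: real
  proof -
    have "4 * A / (B + A)\<^sup>2 \<le> 4 * A / A\<^sup>2"
      using that by (intro divide_left_mono power_mono mult_pos_pos zero_less_power) auto
    then show ?thesis using that by (simp add: power2_eq_square)
  qed
  from this[OF e, of "(norm z)\<^sup>2"] show ?thesis by (simp add: poisson_def)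
qed

text \<open>From (1 + a)(1 + b) \<le> (1 + a + b)^2 the kernel is dominated by a product of
  one-variable Cauchy densities.\<close>

lemma integrable_poisson: "L1 (poisson 1)"
proof (rule bochner_bound)
  show "L1 (\<lambda>x::real^2. 4 * (1 / (1 + (x $ 1)\<^sup>2) * (1 / (1 + (x $ 2)\<^sup>2))))"
    by (intro integrable_mult_right integrable_prod2 integrable_inv_plus) auto
  have "norm (poisson 1 x) \<le> norm (4 * (1 / (1 + (x $ 1)\<^sup>2) * (1 / (1 + (x $ 2)\<^sup>2))))" for x
  proof -
    let ?a = "(x $ 1)\<^sup>2" and ?b = "(x $ 2)\<^sup>2"
    have n: "(norm x)\<^sup>2 = ?a + ?b" by (simp add: norm_2)
    have ab: "0 \<le> ?a" "0 \<le> ?b" by auto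
    have "4 / (a + b + 1)\<^sup>2 \<le> 4 / ((1 + a) * (1 + b))" if "a \<ge> 0" "b \<ge> 0" for a b :: real
    proof -
      have "(1 + a) * (1 + b) \<le> (a + b + 1)\<^sup>2" unfolding power2_eq_square using that by (intro mult_mono) auto
      then show ?thesis using that by (intro divide_left_mono mult_pos_pos zero_less_power) auto
    qed
    from this[OF ab] have "4 / (?a + ?b + 1)\<^sup>2 \<le> 4 / ((1 + ?a) * (1 + ?b))" .
    moreover have "norm (4 * (1 / (1 + ?a) * (1 / (1 + ?b)))) = 4 / ((1 + ?a) * (1 + ?b))"
      using ab by (simp add: abs_mult)
    ultimately show ?thesis by (simp add: poisson_def n)
  qed
  then show "AE x in lborel. norm (poisson 1 x) \<le> norm (4 * (1 / (1 + (x $ 1)\<^sup>2) * (1 / (1 + (x $ 2)\<^sup>2))))" by blast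
qed measurable

lemma poisson_mass_pos: "(LBINT z. poisson 1 z) > 0"
proof -
  have "measure lborel (ball (0::real^2) 1) \<le> (LBINT z. poisson 1 z)"
  proof -
    have "(LBINT z. ind (ball (0::real^2) 1) z) \<le> (LBINT z. poisson 1 z)"
    proof (rule integral_mono)
      show "L1 (indicat_real (ball (0::real^2) 1))"
        by (rule integrable_real_indicator) (auto simp: emeasure_lborel_ball_finite[unfolded infinity_ennreal_def])
      show "indicat_real (ball 0 1) z \<le> poisson 1 z" for z
      proof (cases "norm z < 1")
        case True
        then have "(norm z)\<^sup>2 \<le> 1\<^sup>2" by (intro power_mono) auto
        then have "((norm z)\<^sup>2 + 1)\<^sup>2 \<le> 2\<^sup>2" by (intro power_mono) auto
        moreover have "((norm z)\<^sup>2 + 1)\<^sup>2 > 0" by (intro zero_less_power add_nonneg_pos) auto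
        ultimately have "1 \<le> 4 / ((norm z)\<^sup>2 + 1)\<^sup>2" by (simp only: le_divide_eq_1_pos) simp
        then have "1 \<le> poisson 1 z" by (simp only: poisson_def power_one mult_1_right)
        then show ?thesis using True by simp
      qed (simp add: poisson_nonneg)
    qed (rule integrable_poisson)
    then show ?thesis by simp
  qed
  moreover have "measure lborel (ball (0::real^2) 1) > 0" using content_ball_pos[of 1 "0::real^2"] by simp
  ultimately show ?thesis by linarith
qed

lemma poisson_convolution:
  assumes "\<epsilon> > 0" and [measurable]: "Q \<in> sets borel"
  shows "(LBINT y. ind Q y * poisson \<epsilon> (x - y)) = (LBINT z. ind Q (x - \<epsilon> *\<^sub>R z) * poisson 1 z)"
proof -
  have "(LBINT y. ind Q y * poisson \<epsilon> (x - y)) =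
     (\<integral>y. ind Q y * poisson \<epsilon> (x - y) \<partial>(density (distr lborel borel (\<lambda>z. x + (- \<epsilon>) *\<^sub>R z)) (\<lambda>_. ennreal (\<bar>- \<epsilon>\<bar> ^ DIM(real^2)))))"
    using assms by (subst lborel_affine[of "- \<epsilon>" x]) auto
  also have "\<dots> = (LBINT z. \<epsilon>\<^sup>2 * (ind Q (x - \<epsilon> *\<^sub>R z) * poisson \<epsilon> (\<epsilon> *\<^sub>R z)))"
    using assms by (subst integral_density) (auto simp: integral_distr)
  also have "\<dots> = (LBINT z. ind Q (x - \<epsilon> *\<^sub>R z) * poisson 1 z)"
  proof (rule bochner_cong)
    fix z :: "real^2"
    have eq: "(norm (\<epsilon> *\<^sub>R z))\<^sup>2 + \<epsilon>\<^sup>2 = \<epsilon>\<^sup>2 * ((norm z)\<^sup>2 + 1)" by (simp add: power_mult_distrib algebra_simps)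
    have "\<epsilon>\<^sup>2 * poisson \<epsilon> (\<epsilon> *\<^sub>R z) = poisson 1 z"
    proof -
      have "E * (4 * E / (E * N)\<^sup>2) = 4 / N\<^sup>2" if "E > 0" "N > 0" for E N :: real
        using that by (simp add: field_simps power2_eq_square)
      from this[of "\<epsilon>\<^sup>2" "(norm z)\<^sup>2 + 1"] eq assms show ?thesis
        by (simp only: poisson_def eq power_one mult_1_right) (simp add: add_nonneg_pos)
    qed
    then show "\<epsilon>\<^sup>2 * (ind Q (x - \<epsilon> *\<^sub>R z) * poisson \<epsilon> (\<epsilon> *\<^sub>R z)) = ind Q (x - \<epsilon> *\<^sub>R z) * poisson 1 z"
      by (simp add: mult.left_commute)
  qed simp
  finally show ?thesis .
qed

text \<open>For a merely integrable c the convolution is not followed pointwise but in the mean over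
  boxes. Fubini moves the kernel onto the indicator of the box, and the smoothed indicator converges
  at every point off the frontier of the box, which is a null set.\<close>

lemma poisson_box_limit:
  assumes c: "L1 c" and e: "e \<longlonglongrightarrow> 0" "\<And>n. 0 < e n"
  shows "(\<lambda>n. LBINT y. ind (box a b) y *\<^sub>R (LBINT x. c x * of_real (poisson (e n) (x - y)))) \<longlonglongrightarrow>
    (LBINT x. ind (box a b) x *\<^sub>R (of_real (LBINT z. poisson 1 z) * (c x :: complex)))"
proof -
  let ?Q = "box a b"
  have [measurable]: "c \<in> BM" using c by auto
  define W where "W n x = (LBINT z. ind ?Q (x - e n *\<^sub>R z) * poisson 1 z)" for n x
  let ?k = "\<integral>z. poisson 1 z \<partial>lborel"
  have Wm[measurable]: "W n \<in> BM" for n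
    unfolding W_def[abs_def] by measurable
  have iW: "L1 (\<lambda>z. ind ?Q (x - e n *\<^sub>R z) * poisson 1 z)" for n x
    by (rule bochner_bound[OF integrable_poisson]) (auto simp: indicator_def poisson_nonneg)
  have W1: "norm (W n x) \<le> ?k" for n x
  proof -
    have "W n x \<ge> 0" unfolding W_def by (intro integral_nonneg_AE) (auto simp: poisson_nonneg)
    moreover have "W n x \<le> ?k" unfolding W_def
      by (intro integral_mono iW integrable_poisson) (auto simp: indicator_def poisson_nonneg)
    ultimately show ?thesis by simp
  qed
  have iQ: "L1 (indicat_real ?Q)"
    by (rule integrable_real_indicator) (auto simp: emeasure_lborel_box_finite[unfolded infinity_ennreal_def])
  have fub: "(LBINT y. ind ?Q y *\<^sub>R (LBINT x. c x * of_real (poisson (e n) (x - y)))) = (LBINT x. c x * of_real (W n x))" for n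
  proof -
    let ?f = "\<lambda>x y. c x * of_real (ind ?Q y * poisson (e n) (x - y))"
    let ?g = "\<lambda>p. norm (c (fst p)) * (4 / (e n)\<^sup>2 * ind ?Q (snd p))"
    have fm: "case_prod ?f \<in> borel_measurable (lborel \<Otimes>\<^sub>M lborel)" by measurable
    have "integrable (lborel \<Otimes>\<^sub>M lborel) ?g"
    proof (rule lborel_pair.Fubini_integrable)
      show "?g \<in> borel_measurable (lborel \<Otimes>\<^sub>M lborel)" by measurable
      show "L1 (\<lambda>x. LBINT y. norm (?g (x, y)))"
        using c by (simp add: abs_mult)
      show "AE x in lborel. L1 (\<lambda>y. ?g (x, y))" using iQ by simp
    qed
    then have fi: "integrable (lborel \<Otimes>\<^sub>M lborel) (case_prod ?f)"
    proof (rule bochner_bound[OF _ fm], intro AE_I2)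
      fix p :: "(real^2) \<times> (real^2)"
      have "ind ?Q (snd p) * poisson (e n) (fst p - snd p) \<le> ind ?Q (snd p) * (4 / (e n)\<^sup>2)"
        using e(2)[of n] by (intro mult_left_mono poisson_bound) auto
      then have "norm (c (fst p)) * \<bar>ind ?Q (snd p) * poisson (e n) (fst p - snd p)\<bar> \<le> norm (c (fst p)) * (4 / (e n)\<^sup>2 * ind ?Q (snd p))"
        using poisson_nonneg by (intro mult_left_mono) (auto simp: abs_mult mult.commute)
      then show "norm (case_prod ?f p) \<le> norm (?g p)"
        by (simp add: case_prod_unfold norm_mult abs_mult)
    qed
    have "(LBINT y. ind ?Q y *\<^sub>R (LBINT x. c x * of_real (poisson (e n) (x - y)))) = (LBINT y. (LBINT x. ?f x y))"
      by (intro bochner_cong) (auto simp: indicator_def)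
    also have "\<dots> = (LBINT x. (LBINT y. ?f x y))" by (rule lborel_pair.Fubini_integral[OF fi])
    also have "\<dots> = (LBINT x. c x * of_real (W n x))"
    proof (rule bochner_cong)
      fix x
      have "(LBINT y. ?f x y) = c x * (LBINT y. of_real (ind ?Q y * poisson (e n) (x - y)))"
        by (rule integral_mult_right_zero)
      also have "(LBINT y. complex_of_real (ind ?Q y * poisson (e n) (x - y))) = of_real (LBINT y. ind ?Q y * poisson (e n) (x - y))"
        by (rule integral_complex_of_real)
      finally show "(LBINT y. ?f x y) = c x * of_real (W n x)"
        unfolding W_def using poisson_convolution[OF e(2)[of n], of ?Q x] by simp
    qed simp
    finally show ?thesis .
  qed
  have Wlim: "(\<lambda>n. W n x) \<longlonglongrightarrow> ind ?Q x * ?k" if x: "x \<notin> frontier ?Q" for x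
  proof -
    have "(\<lambda>n. W n x) \<longlonglongrightarrow> (LBINT z. ind ?Q x * poisson 1 z)"
      unfolding W_def
    proof (rule integral_dominated_convergence[where w="poisson 1"])
      show "AE z in lborel. (\<lambda>n. ind ?Q (x - e n *\<^sub>R z) * poisson 1 z) \<longlonglongrightarrow> ind ?Q x * poisson 1 z"
      proof (intro AE_I2 tendsto_mult tendsto_const)
        fix z :: "real^2"
        have "(\<lambda>n. x - e n *\<^sub>R z) \<longlonglongrightarrow> x - 0 *\<^sub>R z" by (intro tendsto_intros e)
        then have l: "(\<lambda>n. x - e n *\<^sub>R z) \<longlonglongrightarrow> x" by simp
        have "isCont (indicat_real ?Q) x" using x by (simp add: isCont_indicator)
        then show "(\<lambda>n. indicat_real ?Q (x - e n *\<^sub>R z)) \<longlonglongrightarrow> ind ?Q x"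
          by (rule isCont_tendsto_compose[OF _ l])
      qed
    qed (auto simp: integrable_poisson indicator_def poisson_nonneg)
    then show ?thesis by simp
  qed
  have "(\<lambda>n. LBINT x. c x * of_real (W n x)) \<longlonglongrightarrow> (LBINT x. ind ?Q x *\<^sub>R (of_real ?k * c x))"
  proof (rule integral_dominated_convergence[where w="\<lambda>x. ?k * norm (c x)"])
    have "negligible (frontier ?Q)" by (intro negligible_convex_frontier convex_box)
    then have "frontier ?Q \<in> null_sets lborel"
      by (subst null_sets_completion_iff[symmetric]) (auto simp: negligible_iff_null_sets borel_closed)
    from AE_not_in[OF this]
    show "AE x in lborel. (\<lambda>n. c x * of_real (W n x)) \<longlonglongrightarrow> ind ?Q x *\<^sub>R (of_real ?k * c x)"
    proof eventually_elim
      case (elim x)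
      have "(\<lambda>n. c x * of_real (W n x)) \<longlonglongrightarrow> c x * of_real (ind ?Q x * ?k)"
        by (intro tendsto_mult tendsto_const tendsto_of_real Wlim elim)
      then show ?case by (simp add: scaleR_conv_of_real mult_ac)
    qed
    show "AE x in lborel. norm (c x * of_real (W n x)) \<le> ?k * norm (c x)" for n
    proof (rule AE_I2)
      fix x
      have "norm (c x) * norm (W n x) \<le> norm (c x) * ?k" using W1 by (intro mult_left_mono) auto
      then show "norm (c x * of_real (W n x)) \<le> ?k * norm (c x)" by (simp add: norm_mult mult.commute)
    qed
  qed (use c in auto)
  then show ?thesis unfolding fub .
qed

text \<open>The pointwise limit R of the smoothed functions inherits the uniform Hoelder bound. Its
  box integrals agree with those of c times the total mass of the kernel, so the two coincide almost
  everywhere: regularity of the mollifications is passed on to c.\<close>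

lemma holder_representative:
  fixes c :: "real^2 \<Rightarrow> complex"
  assumes c: "L1 c" and e: "e \<longlonglongrightarrow> 0" "\<And>n. 0 < e n" and s: "s > 0"
    and P: "\<And>n y. P n y = (LBINT x. c x * of_real (poisson (e n) (x - y)))"
    and conv: "\<And>y. y \<in> ball 0 s \<Longrightarrow> convergent (\<lambda>n. P n y)"
    and hol: "\<And>n y y'. y \<in> ball 0 s \<Longrightarrow> y' \<in> ball 0 s \<Longrightarrow> norm (P n y - P n y') \<le> C * sqrt (norm (y - y'))"
  obtains R where "\<And>y y'. y \<in> ball 0 s \<Longrightarrow> y' \<in> ball 0 s \<Longrightarrow> norm (R y - R y') \<le> C * sqrt (norm (y - y'))"
    "AE x in lborel. norm x < s / 2 \<longrightarrow> R x = of_real (LBINT z. poisson 1 z) * c x"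
proof -
  let ?k = "\<integral>z. poisson 1 z \<partial>lborel"
  have [measurable]: "c \<in> BM" using c by auto
  have Pm[measurable]: "P n \<in> BM" for n unfolding P[abs_def] by measurable
  define R where "R y = lim (\<lambda>n. P n y)" for y
  have lim: "(\<lambda>n. P n y) \<longlonglongrightarrow> R y" if "y \<in> ball 0 s" for y
    using conv[OF that] by (simp add: R_def convergent_LIMSEQ_iff)
  have Rh: "norm (R y - R y') \<le> C * sqrt (norm (y - y'))" if "y \<in> ball 0 s" "y' \<in> ball 0 s" for y y'
    by (rule LIMSEQ_le_const2[OF tendsto_norm[OF tendsto_diff[OF lim[OF that(1)] lim[OF that(2)]]]]) (use hol that in auto)
  \<comment> \<open>The open cube of half-side s/2 lies in the ball of radius s, because the norm is
    at most the sum of the two coordinates, and contains the ball of radius s/2. A box is used since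
    vanishing is detected by box integrals.\<close>
  define v :: "real^2" where "v = (\<chi> i. s / 2)"
  define Q0 where "Q0 = box (- v) v"
  have Q0: "Q0 \<subseteq> ball 0 s"
  proof
    fix x assume "x \<in> Q0"
    then have "- (s / 2) < x $ i \<and> x $ i < s / 2" for i by (simp add: Q0_def v_def mem_box_cart)
    then have "\<bar>x $ i\<bar> < s / 2" for i by (simp only: abs_less_iff minus_less_iff[of "x $ i"])
    then have "\<bar>x $ 1\<bar> + \<bar>x $ 2\<bar> < s / 2 + s / 2" by (intro add_strict_mono)
    then have "norm x < s" using norm_le_l1_cart[of x] by (simp add: sum_2)
    then show "x \<in> ball 0 s" by simp
  qed
  have C0: "norm (P n y) \<le> norm (P n 0) + \<bar>C\<bar> * sqrt s" if "y \<in> ball 0 s" for n y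
  proof -
    have "norm (P n y - P n 0) \<le> C * sqrt (norm (y - 0))" using s by (intro hol that) auto
    also have "\<dots> \<le> \<bar>C\<bar> * sqrt s" using that by (intro mult_mono) auto
    finally show ?thesis using norm_triangle_ineq2[of "P n y" "P n 0"] by linarith
  qed
  have "Bseq (\<lambda>n. P n 0)" using conv[of 0] s by (intro convergent_imp_Bseq) auto
  then obtain B where B: "\<And>n. norm (P n 0) \<le> B" by (auto simp: Bseq_def)
  define B' where "B' = B + \<bar>C\<bar> * sqrt s"
  have PB: "norm (P n y) \<le> B'" if "y \<in> Q0" for n y
    using C0[of y n] B[of n] Q0 that by (auto simp: B'_def)
  have iQ: "L1 (indicat_real Q0)" unfolding Q0_def
    by (rule integrable_real_indicator) (auto simp: emeasure_lborel_box_finite[unfolded infinity_ennreal_def])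
  have Rm: "(\<lambda>y. ind Q0 y *\<^sub>R R y) \<in> BM"
  proof (rule borel_measurable_LIMSEQ_metric)
    show "(\<lambda>y. ind Q0 y *\<^sub>R P n y) \<in> BM" for n by (simp add: Q0_def)
    show "(\<lambda>n. ind Q0 y *\<^sub>R P n y) \<longlonglongrightarrow> ind Q0 y *\<^sub>R R y" for y
      using lim[of y] Q0 by (cases "y \<in> Q0") auto
  qed
  have B'0: "B' \<ge> 0"
  proof -
    have "0 \<le> \<bar>C\<bar> * sqrt s" using s by simp
    then show ?thesis using B[of 0] norm_ge_zero[of "P 0 0"] unfolding B'_def by linarith
  qed
  have RB: "norm (R y) \<le> B'" if "y \<in> Q0" for y
    by (rule LIMSEQ_le_const2[OF tendsto_norm[OF lim]]) (use that Q0 PB in auto)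
  have iR: "L1 (\<lambda>y. ind Q0 y *\<^sub>R R y)"
  proof (rule bochner_bound[of _ "\<lambda>y. B' * indicat_real Q0 y"])
    show "L1 (\<lambda>y. B' * indicat_real Q0 y)" by (intro integrable_mult_right iQ)
    have "norm (ind Q0 y *\<^sub>R R y) \<le> norm (B' * indicat_real Q0 y)" for y
      using RB[of y] B'0 by (cases "y \<in> Q0") auto
    then show "AE y in lborel. norm (ind Q0 y *\<^sub>R R y) \<le> norm (B' * indicat_real Q0 y)" by blast
  qed (use Rm in simp)
  have ic: "L1 (\<lambda>y. ind Q0 y *\<^sub>R (of_real ?k * c y))"
    using c by (intro integrable_mult_indicator integrable_mult_right) (auto simp: Q0_def)
  have "AE y in lborel. ind Q0 y *\<^sub>R R y - ind Q0 y *\<^sub>R (of_real ?k * c y) = 0"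
  proof (rule AE_zero_of_box_integrals[OF bochner_diff[OF iR ic]])
    fix a b :: "real^2"
    obtain a' b' where ab: "box a b \<inter> Q0 = box a' b'" by (rule that, unfold Q0_def, rule box_Int_box)
    have "(\<lambda>n. LBINT y. ind (box a' b') y *\<^sub>R P n y) \<longlonglongrightarrow> (LBINT y. ind (box a' b') y *\<^sub>R (ind Q0 y *\<^sub>R R y))"
    proof (rule integral_dominated_convergence[where w="\<lambda>y. B' * indicat_real Q0 y"])
      show "AE y in lborel. (\<lambda>n. ind (box a' b') y *\<^sub>R P n y) \<longlonglongrightarrow> ind (box a' b') y *\<^sub>R (ind Q0 y *\<^sub>R R y)"
      proof (rule AE_I2)
        fix y
        show "(\<lambda>n. ind (box a' b') y *\<^sub>R P n y) \<longlonglongrightarrow> ind (box a' b') y *\<^sub>R (ind Q0 y *\<^sub>R R y)"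
        proof (cases "y \<in> box a' b'")
          case True
          then have "y \<in> Q0" using ab by blast
          then show ?thesis using True lim[of y] Q0 by auto
        qed simp
      qed
      show "AE y in lborel. norm (ind (box a' b') y *\<^sub>R P n y) \<le> B' * indicat_real Q0 y" for n
      proof (rule AE_I2)
        fix y
        show "norm (ind (box a' b') y *\<^sub>R P n y) \<le> B' * indicat_real Q0 y"
        proof (cases "y \<in> box a' b'")
          case True
          then have "y \<in> Q0" using ab by blast
          then show ?thesis using True PB by simp
        qed (simp add: B'0)
      qed
      show "(\<lambda>y. ind (box a' b') y *\<^sub>R (ind Q0 y *\<^sub>R R y)) \<in> borel_measurable lborel"
        unfolding measurable_lborel2 by (rule borel_measurable_scaleR[OF _ Rm]) simp
    qed (use iQ in \<open>auto intro!: integrable_mult_right\<close>)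
    moreover have "(\<lambda>n. LBINT y. ind (box a' b') y *\<^sub>R P n y) \<longlonglongrightarrow> (LBINT x. ind (box a' b') x *\<^sub>R (of_real ?k * c x))"
      unfolding P by (rule poisson_box_limit[OF c e])
    ultimately have eq: "(LBINT y. ind (box a' b') y *\<^sub>R (ind Q0 y *\<^sub>R R y)) = (LBINT x. ind (box a' b') x *\<^sub>R (of_real ?k * c x))"
      by (rule LIMSEQ_unique)
    have ind: "indicat_real (box a b) y *\<^sub>R (indicat_real Q0 y *\<^sub>R z) = indicat_real (box a' b') y *\<^sub>R z" for y and z :: complex
      unfolding ab[symmetric] by (simp add: indicator_def)
    have ind': "indicat_real (box a' b') y *\<^sub>R (indicat_real Q0 y *\<^sub>R z) = indicat_real (box a' b') y *\<^sub>R z" for y and z :: complex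
      unfolding ab[symmetric] by (simp add: indicator_def)
    have "(LBINT x. indicat_real (box a b) x *\<^sub>R (ind Q0 x *\<^sub>R R x - ind Q0 x *\<^sub>R (of_real ?k * c x))) =
       (LBINT x. indicat_real (box a b) x *\<^sub>R (ind Q0 x *\<^sub>R R x)) - (LBINT x. indicat_real (box a b) x *\<^sub>R (ind Q0 x *\<^sub>R (of_real ?k * c x)))"
      unfolding scaleR_diff_right
      by (rule Bochner_Integration.integral_diff) (intro integrable_mult_indicator iR ic, simp)+
    also have "\<dots> = 0" using eq unfolding ind ind' by simp
    finally show "(LBINT x. indicat_real (box a b) x *\<^sub>R (ind Q0 x *\<^sub>R R x - ind Q0 x *\<^sub>R (of_real ?k * c x))) = 0" .
  qed
  then have "AE x in lborel. norm x < s / 2 \<longrightarrow> R x = of_real ?k * c x"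
  proof eventually_elim
    case (elim x)
    have "x \<in> Q0" if "norm x < s / 2"
    proof -
      have "\<bar>x $ i\<bar> < s / 2" for i using component_le_norm_cart[of x i] that by linarith
      moreover have "\<bar>z\<bar> < r \<Longrightarrow> - r < z \<and> z < r" for z r :: real by linarith
      ultimately have "- (s / 2) < x $ i \<and> x $ i < s / 2" for i by blast
      then show ?thesis by (simp add: Q0_def v_def mem_box_cart)
    qed
    then show ?case using elim by auto
  qed
  then show ?thesis using that Rh by blast
qed

section \<open>Decay at the vertex\<close>

context corner_identity begin

text \<open>Half the radius at which the cut-off starts to vary: points of \<open>Y\<close> keep
  distance at least \<delta>/8 from all derivatives of the cut-off.\<close>

abbreviation "Y \<equiv> ball (0::real^2) (\<delta> / 8)"

definition ee :: "nat \<Rightarrow> real" where "ee n = inverse (real (Suc n))"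

lemma ee: "ee \<longlonglongrightarrow> 0" "0 < ee n" "ee n \<le> 1"
  using LIMSEQ_inverse_real_of_nat by (auto simp: ee_def[abs_def] inverse_eq_divide)

text \<open>Pointwise convergence and a Hoelder bound of exponent 1/2 uniform in n. Both parts are
  stable under sums and signs, so each term of the representation can be treated separately.\<close>

definition equiholder :: "(nat \<Rightarrow> real^2 \<Rightarrow> complex) \<Rightarrow> bool" where
  "equiholder f \<longleftrightarrow> (\<forall>y\<in>Y. convergent (\<lambda>n. f n y)) \<and>
     (\<exists>C. \<forall>n. \<forall>y\<in>Y. \<forall>y'\<in>Y. norm (f n y - f n y') \<le> C * sqrt (norm (y - y')))"

lemma equiholder_add:
  assumes "equiholder f" "equiholder g" shows "equiholder (\<lambda>n y. f n y + g n y)"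
proof -
  obtain C C' where C: "\<forall>n. \<forall>y\<in>Y. \<forall>y'\<in>Y. norm (f n y - f n y') \<le> C * sqrt (norm (y - y'))"
    "\<forall>n. \<forall>y\<in>Y. \<forall>y'\<in>Y. norm (g n y - g n y') \<le> C' * sqrt (norm (y - y'))"
    using assms unfolding equiholder_def by blast
  have "norm ((f n y + g n y) - (f n y' + g n y')) \<le> (C + C') * sqrt (norm (y - y'))" if "y \<in> Y" "y' \<in> Y" for n y y'
  proof -
    have "norm ((f n y + g n y) - (f n y' + g n y')) \<le> norm (f n y - f n y') + norm (g n y - g n y')"
      using norm_triangle_ineq[of "f n y - f n y'" "g n y - g n y'"] by (simp add: algebra_simps)
    also have "\<dots> \<le> C * sqrt (norm (y - y')) + C' * sqrt (norm (y - y'))" using C that by (intro add_mono) blast+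
    finally show ?thesis by (simp add: algebra_simps)
  qed
  moreover have "convergent (\<lambda>n. f n y + g n y)" if "y \<in> Y" for y
    using assms that unfolding equiholder_def by (intro convergent_add) blast+
  ultimately show ?thesis unfolding equiholder_def by blast
qed

lemma equiholder_uminus:
  assumes "equiholder f" shows "equiholder (\<lambda>n y. - f n y)"
proof -
  have "norm (- f n y - - f n y') = norm (f n y - f n y')" for n y y'
    using norm_minus_commute[of "f n y" "f n y'"] by simp
  then show ?thesis using assms unfolding equiholder_def by (auto simp: convergent_minus_iff[symmetric])
qed

lemma equiholder_log:
  fixes c :: "'a \<Rightarrow> complex" and p :: "'a \<Rightarrow> real^2"
  assumes "integrable M c" "p \<in> M \<rightarrow>\<^sub>M borel"
    and D: "\<And>\<omega>. c \<omega> \<noteq> 0 \<Longrightarrow> norm (p \<omega>) \<le> \<delta>"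
    and ae: "\<And>y. y \<in> Y \<Longrightarrow> AE \<omega> in M. p \<omega> \<noteq> y"
    and i: "\<forall>y\<in>Y. integrable M (\<lambda>\<omega>. norm (c \<omega>) * (1 / sqrt (norm (p \<omega> - y)))) \<and>
      (\<integral>\<omega>. norm (c \<omega>) * (1 / sqrt (norm (p \<omega> - y))) \<partial>M) \<le> B"
  shows "equiholder (\<lambda>n y. \<integral>\<omega>. c \<omega> * of_real (log_kernel (ee n) (p \<omega> - y)) \<partial>M)"
proof -
  have D': "norm (p \<omega> - y) \<le> 2 * \<delta>" if "y \<in> Y" "c \<omega> \<noteq> 0" for \<omega> y
    using norm_triangle_ineq4[of "p \<omega>" y] D[OF that(2)] that(1) \<delta> by simp
  note lp = log_potential[OF assms(1,2), of Y "2 * \<delta>" B ee, OF D' ae _ _ ee]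
  have 1: "convergent (\<lambda>n. \<integral>\<omega>. c \<omega> * of_real (log_kernel (ee n) (p \<omega> - y)) \<partial>M)" if "y \<in> Y" for y
    by (rule lp(1)) (use i that in auto)
  have 2: "norm ((\<integral>\<omega>. c \<omega> * of_real (log_kernel (ee n) (p \<omega> - y)) \<partial>M) - (\<integral>\<omega>. c \<omega> * of_real (log_kernel (ee n) (p \<omega> - y')) \<partial>M))
      \<le> 8 * B * sqrt (norm (y - y'))" if "y \<in> Y" "y' \<in> Y" for n y y'
    by (rule lp(2)) (use i that in auto)
  show ?thesis unfolding equiholder_def
    by (intro conjI ballI exI[of _ "8 * B"] allI 1 2)
qed

lemma u_mult:
  assumes "continuous_on UNIV g" "\<And>x. \<delta> \<le> norm x \<Longrightarrow> g x = 0"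
  shows "L1 (\<lambda>x. u x * g x)"
proof -
  obtain C where C: "\<forall>x. norm (g x) \<le> C" using bounded_cont_support[OF assms] by blast
  have [measurable]: "g \<in> BM" "u \<in> BM"
    using borel_measurable_continuous_onI[OF assms(1)] u by auto
  show ?thesis
  proof (rule bochner_bound)
    show "L1 (\<lambda>x. norm (u x) * C)" using u by (intro integrable_mult_left) auto
    show "AE x in lborel. norm (u x * g x) \<le> norm (norm (u x) * C)"
    proof (rule AE_I2)
      fix x
      have "norm (u x) * norm (g x) \<le> norm (u x) * C" using C by (intro mult_left_mono) auto
      then show "norm (u x * g x) \<le> norm (norm (u x) * C)" by (simp add: norm_mult)
    qed
  qed measurable
qed

lemma ct_outside: "\<delta> \<le> norm x \<Longrightarrow> partial i (\<lambda>x. of_real (ct x)) x = 0" "\<delta> \<le> norm x \<Longrightarrow> laplacian (\<lambda>x. of_real (ct x)) x = 0"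
  "\<delta> \<le> norm x \<Longrightarrow> ct x = 0"
  using partial_outside[of "\<delta> / 2" "\<lambda>x. of_real (ct x)" x] ct(3) \<delta> by auto

text \<open>The identity is tested with the cut-off times the logarithmic kernel centred at y. The
  Laplacian of the product consists of the cut-off times the approximate identity, a mixed gradient
  term and a term with the Laplacian of the cut-off; solving for the first exhibits the
  mollification of u as a sum of potentials.\<close>

lemma decomposition:
  "(LBINT x. u x * of_real (ct x) * of_real (poisson (ee n) (x - y))) =
    (LBINT x. (F x * of_real (ct x)) * of_real (log_kernel (ee n) (x - y))) +
    (LBINT t. (ind {0<..} t *\<^sub>R (bm t * of_real (ct (t *\<^sub>R dir azm)))) * of_real (log_kernel (ee n) (t *\<^sub>R dir azm - y))) +
    (LBINT t. (ind {0<..} t *\<^sub>R (bM t * of_real (ct (t *\<^sub>R dir azM)))) * of_real (log_kernel (ee n) (t *\<^sub>R dir azM - y))) +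
    - (LBINT x. (u x * laplacian (\<lambda>x. of_real (ct x)) x) * of_real (log_kernel (ee n) (x - y))) +
    - (LBINT x. u x * (2 * (\<Sum>i\<in>UNIV. partial i (\<lambda>x. of_real (ct x)) x * (2 * of_real (((x - y) /\<^sub>R ((norm (x - y))\<^sup>2 + (ee n)\<^sup>2)) $ i)))))"
proof -
  have e: "ee n \<noteq> 0" using ee(2)[of n] by simp
  let ?N = "\<lambda>x. complex_of_real (log_kernel (ee n) (x - y))"
  let ?c = "\<lambda>x. complex_of_real (ct x)"
  let ?g = "\<lambda>x. 2 * (\<Sum>i\<in>UNIV. partial i ?c x * partial i ?N x)"
  have sN: "smooth ?N" by (rule smooth_log_kernel[OF e])
  have s: "smooth (\<lambda>x. ?c x * ?N x)" by (intro smooth_mult ct sN)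
  have id: "(LBINT x. u x * laplacian (\<lambda>x. ?c x * ?N x) x) = (LBINT x. F x * (?c x * ?N x)) +
        (LBINT t. ind {0<..} t *\<^sub>R (bm t * (?c (t *\<^sub>R dir azm) * ?N (t *\<^sub>R dir azm)))) +
        (LBINT t. ind {0<..} t *\<^sub>R (bM t * (?c (t *\<^sub>R dir azM) * ?N (t *\<^sub>R dir azM))))"
    by (rule identity[OF s, of "\<delta> / 2"]) (use \<delta> ct(3) in auto)
  have i1: "L1 (\<lambda>x. u x * (?c x * laplacian ?N x))"
    by (intro u_mult smooth_cont smooth_mult ct smooth_laplacian sN) (simp add: ct_outside)
  have i2: "L1 (\<lambda>x. u x * ?g x)"
    by (intro u_mult smooth_cont smooth_mult smooth_const smooth_sum smooth_partial ct sN) (simp add: ct_outside)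
  have i3: "L1 (\<lambda>x. u x * (laplacian ?c x * ?N x))"
    by (intro u_mult smooth_cont smooth_mult ct smooth_laplacian sN) (simp add: ct_outside)
  have "(LBINT x. u x * laplacian (\<lambda>x. ?c x * ?N x) x) =
     (LBINT x. u x * (?c x * laplacian ?N x) + u x * ?g x + u x * (laplacian ?c x * ?N x))"
    unfolding laplacian_mult[OF ct(1) sN] distrib_left ..
  also have "\<dots> = (LBINT x. u x * (?c x * laplacian ?N x)) + (LBINT x. u x * ?g x) + (LBINT x. u x * (laplacian ?c x * ?N x))"
    using i1 i2 i3 by (simp only: Bochner_Integration.integral_add bochner_add)
  finally show ?thesis
    unfolding id partial_log_kernel[OF e] laplacian_log_kernel[OF e]
    by (simp add: mult.assoc algebra_simps)
qed

text \<open>Here the kernel carries a whole derivative and u is only integrable, but the factor in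
  front restricts x to the annulus, at distance at least \<delta>/8 from y. The increments are
  Lipschitz, and on \<open>Y\<close> a Lipschitz bound becomes one of exponent 1/2 at the cost of
  sqrt \<delta>.\<close>

lemma gradient_equiholder:
  "equiholder (\<lambda>n y. LBINT x. u x * (2 * (\<Sum>i\<in>UNIV. partial i (\<lambda>x. of_real (ct x)) x * (2 * of_real (((x - y) /\<^sub>R ((norm (x - y))\<^sup>2 + (ee n)\<^sup>2)) $ i)))))"
proof -
  let ?c = "\<lambda>x. complex_of_real (ct x)"
  define G where "G n y x = 2 * (\<Sum>i\<in>UNIV. partial i ?c x * (2 * of_real (((x - y) /\<^sub>R ((norm (x - y))\<^sup>2 + (ee n)\<^sup>2)) $ i)))" for n y x
  have um[measurable]: "u \<in> BM" using u by auto
  have i: "L1 (\<lambda>x. u x * G n y x)" for n y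
  proof -
    have e: "ee n \<noteq> 0" using ee(2)[of n] by simp
    have "L1 (\<lambda>x. u x * (2 * (\<Sum>i\<in>UNIV. partial i ?c x * partial i (\<lambda>x. of_real (log_kernel (ee n) (x - y))) x)))"
      by (intro u_mult smooth_cont smooth_mult smooth_const smooth_sum smooth_partial ct smooth_log_kernel[OF e]) (simp add: ct_outside)
    then show ?thesis unfolding partial_log_kernel[OF e] G_def .
  qed
  obtain C where C: "C \<ge> 0" "\<And>x i. norm (partial i ?c x) \<le> C" using ct_deriv_bounds by blast
  define r where "r = \<delta> / 8"
  have r: "r > 0" using \<delta> by (simp add: r_def)
  have away: "r \<le> norm (x - y)" if "y \<in> Y" "\<delta> / 4 \<le> norm x" for x y
    using that norm_triangle_ineq2[of x y] by (simp add: r_def)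
  have comp: "norm (\<Sum>i\<in>UNIV. partial i ?c x * (2 * of_real (w $ i))) \<le> 4 * C * norm w" for x and w :: "real^2"
  proof -
    have "norm (partial i ?c x * (2 * of_real (w $ i))) \<le> C * (2 * norm w)" for i
      unfolding norm_mult using C component_le_norm_cart[of w i] by (intro mult_mono) auto
    then have "norm (\<Sum>i\<in>UNIV. partial i ?c x * (2 * of_real (w $ i))) \<le> (\<Sum>i\<in>(UNIV::2 set). C * (2 * norm w))"
      by (intro sum_norm_le) auto
    then show ?thesis by (simp add: sum_2)
  qed
  define K' where "K' = 8 * C * (3 / r\<^sup>2)"
  have lip: "norm (G n y x - G n y' x) \<le> K' * norm (y - y')" if "y \<in> Y" "y' \<in> Y" for n y y' x
  proof (cases "norm x < \<delta> / 4")
    case True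
    then show ?thesis using C(1) by (simp add: G_def ct_deriv_zero K'_def)
  next
    case False
    let ?z = "\<lambda>y. (x - y) /\<^sub>R ((norm (x - y))\<^sup>2 + (ee n)\<^sup>2)"
    have "G n y x - G n y' x = 2 * (\<Sum>i\<in>UNIV. partial i ?c x * (2 * of_real ((?z y - ?z y') $ i)))"
      unfolding G_def by (simp add: sum_2 algebra_simps)
    then have "norm (G n y x - G n y' x) \<le> 2 * (4 * C * norm (?z y - ?z y'))"
      using comp[of x "?z y - ?z y'"] by (simp only: norm_mult norm_numeral)
    also have "\<dots> \<le> 2 * (4 * C * (3 / r\<^sup>2 * norm ((x - y) - (x - y'))))"
      using False that C(1) by (intro mult_left_mono gradient_kernel_diff r away) auto
    also have "(x - y) - (x - y') = - (y - y')" by simp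
    also have "2 * (4 * C * (3 / r\<^sup>2 * norm (- (y - y')))) = K' * norm (y - y')"
      unfolding norm_minus_cancel K'_def by simp
    finally show ?thesis .
  qed
  have bd: "norm (G n y x) \<le> 8 * C * (1 / r)" if "y \<in> Y" for n y x
  proof (cases "norm x < \<delta> / 4")
    case True
    then show ?thesis using C(1) r by (simp add: G_def ct_deriv_zero)
  next
    case False
    then have a: "r \<le> norm (x - y)" using away[OF that] by simp
    then have a0: "norm (x - y) > 0" using r by linarith
    let ?z = "(x - y) /\<^sub>R ((norm (x - y))\<^sup>2 + (ee n)\<^sup>2)"
    have "norm (G n y x) \<le> 2 * (4 * C * norm ?z)"
      using comp[of x ?z] unfolding G_def by (simp only: norm_mult norm_numeral)
    moreover have "norm ?z \<le> 1 / r"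
    proof -
      have "norm ?z = norm (x - y) / ((norm (x - y))\<^sup>2 + (ee n)\<^sup>2)"
        by (simp add: divide_inverse_commute abs_of_nonneg)
      also have "\<dots> \<le> norm (x - y) / (norm (x - y))\<^sup>2"
        using a0 by (intro divide_left_mono mult_pos_pos zero_less_power add_pos_nonneg) auto
      also have "\<dots> = 1 / norm (x - y)" using a0 by (simp add: power2_eq_square)
      also have "\<dots> \<le> 1 / r" using a a0 r by (intro divide_left_mono mult_pos_pos) auto
      finally show ?thesis .
    qed
    then have "2 * (4 * C * norm ?z) \<le> 2 * (4 * C * (1 / r))" using C(1) by (intro mult_left_mono) auto
    moreover have "2 * (4 * C * (1 / r)) = 8 * C * (1 / r)" by simp
    ultimately show ?thesis by linarith
  qed
  have conv: "convergent (\<lambda>n. LBINT x. u x * G n y x)" if y: "y \<in> Y" for y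
  proof (rule convergentI, rule integral_dominated_convergence[where w="\<lambda>x. (8 * C * (1 / r)) * norm (u x)"])
    let ?L = "\<lambda>x. u x * (2 * (\<Sum>i\<in>UNIV. partial i ?c x * (2 * of_real (((x - y) /\<^sub>R ((norm (x - y))\<^sup>2 + 0\<^sup>2)) $ i))))"
    have lim: "(\<lambda>n. u x * G n y x) \<longlonglongrightarrow> ?L x" for x
    proof (cases "norm x < \<delta> / 4")
      case True
      then show ?thesis by (simp add: G_def ct_deriv_zero)
    next
      case False
      then have "norm (x - y) > 0" using away[OF y, of x] r by linarith
      then have "(norm (x - y))\<^sup>2 + 0\<^sup>2 \<noteq> 0" by simp
      then have "(\<lambda>n. (x - y) /\<^sub>R ((norm (x - y))\<^sup>2 + (ee n)\<^sup>2)) \<longlonglongrightarrow> (x - y) /\<^sub>R ((norm (x - y))\<^sup>2 + 0\<^sup>2)"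
        by (intro tendsto_scaleR tendsto_inverse tendsto_add tendsto_power ee tendsto_const)
      then show ?thesis unfolding G_def
        by (intro tendsto_mult tendsto_const tendsto_sum tendsto_of_real tendsto_vec_nth)
    qed
    then show "AE x in lborel. (\<lambda>n. u x * G n y x) \<longlonglongrightarrow> ?L x" by blast
    show um': "(\<lambda>x. u x * G n y x) \<in> borel_measurable lborel" for n using i[of n y] by (rule borel_measurable_integrable)
    show "?L \<in> borel_measurable lborel"
      by (rule borel_measurable_LIMSEQ_metric[OF um' lim])
    show "AE x in lborel. norm (u x * G n y x) \<le> (8 * C * (1 / r)) * norm (u x)" for n
      using mult_left_mono[OF bd[OF y], of "norm (u x)" for x] by (intro AE_I2) (simp add: norm_mult mult.commute)
  qed (use u in \<open>auto intro!: integrable_mult_right\<close>)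
  have K'0: "K' \<ge> 0" using C(1) by (simp add: K'_def)
  have "norm ((LBINT x. u x * G n y x) - (LBINT x. u x * G n y' x)) \<le> ((LBINT x. norm (u x)) * K' * sqrt \<delta>) * sqrt (norm (y - y'))"
    if yy: "y \<in> Y" "y' \<in> Y" for n y y'
  proof -
    have "norm ((LBINT x. u x * G n y x) - (LBINT x. u x * G n y' x)) = norm (LBINT x. u x * G n y x - u x * G n y' x)"
      using i by (subst Bochner_Integration.integral_diff) auto
    also have "\<dots> \<le> (LBINT x. norm (u x) * (K' * norm (y - y')))"
    proof (rule order_trans[OF integral_norm_bound], rule integral_mono)
      show "norm (u x * G n y x - u x * G n y' x) \<le> norm (u x) * (K' * norm (y - y'))" for x
        unfolding right_diff_distrib[symmetric] norm_mult by (intro mult_left_mono lip yy) auto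
    qed (use i u in \<open>auto intro!: integrable_mult_left\<close>)
    also have "\<dots> = (LBINT x. norm (u x)) * (K' * norm (y - y'))" by (rule integral_mult_left_zero)
    also have "\<dots> \<le> (LBINT x. norm (u x)) * (K' * (sqrt \<delta> * sqrt (norm (y - y'))))"
    proof (intro mult_left_mono)
      have "norm (y - y') \<le> \<delta>" using yy norm_triangle_ineq4[of y y'] \<delta> by simp
      then have "sqrt (norm (y - y')) * sqrt (norm (y - y')) \<le> sqrt \<delta> * sqrt (norm (y - y'))" by (intro mult_right_mono) auto
      then show "norm (y - y') \<le> sqrt \<delta> * sqrt (norm (y - y'))" by simp
    qed (auto simp: K'0)
    finally show ?thesis by (simp add: mult_ac)
  qed
  then show ?thesis using conv unfolding equiholder_def G_def by blast
qed

lemma bounded_integrable: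
  fixes c :: "'a::euclidean_space \<Rightarrow> complex"
  assumes [measurable]: "c \<in> BM" and "\<And>x. norm (c x) \<le> K" "\<And>x. norm x > \<delta> \<Longrightarrow> c x = 0"
  shows "L1 c"
proof (rule bochner_bound[of _ "\<lambda>x. K * indicat_real (cball 0 \<delta>) x"])
  have "L1 (indicat_real (cball (0::'a) \<delta>))"
    by (rule integrable_real_indicator) (auto simp: emeasure_lborel_cball_finite[unfolded infinity_ennreal_def])
  then show "L1 (\<lambda>x::'a. K * indicat_real (cball 0 \<delta>) x)" by (rule integrable_mult_right)
  have "norm (c x) \<le> norm (K * indicat_real (cball 0 \<delta>) x)" for x
    using assms(2)[of x] assms(3)[of x] by (cases "norm x \<le> \<delta>") auto
  then show "AE x in lborel. norm (c x) \<le> norm (K * indicat_real (cball 0 \<delta>) x)" by blast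
qed simp

lemma line_equiholder:
  assumes b': "b \<in> BM" "\<And>t. norm (b t) \<le> K"
  shows "equiholder (\<lambda>n y. LBINT t. (ind {0<..} t *\<^sub>R (b t * of_real (ct (t *\<^sub>R dir az)))) * of_real (log_kernel (ee n) (t *\<^sub>R dir az - y)))"
proof -
  let ?c = "\<lambda>t. ind {0<..} t *\<^sub>R (b t * complex_of_real (ct (t *\<^sub>R dir az)))"
  have [measurable]: "(\<lambda>t. complex_of_real (ct (t *\<^sub>R dir az))) \<in> BM"
    using smooth_borel[OF ct(1)] by measurable
  have m: "?c \<in> BM" using b' by measurable
  have n: "norm (?c t) \<le> K" for t
  proof -
    have "norm (b t) * norm (complex_of_real (ct (t *\<^sub>R dir az))) \<le> K * 1" using b' ct(4,5) K0 by (intro mult_mono) auto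
    then show ?thesis using K0 by (auto simp: indicator_def norm_mult)
  qed
  have z: "?c t = 0" if "norm t > \<delta>" for t using ct_outside(3)[of "t *\<^sub>R dir az"] that by simp
  obtain B where B: "\<forall>y. L1 (\<lambda>t. norm (?c t) * (1 / sqrt (norm (t *\<^sub>R dir az - y)))) \<and>
    (LBINT t. norm (?c t) * (1 / sqrt (norm (t *\<^sub>R dir az - y)))) \<le> B"
    using line_potential_bound[OF m n, of \<delta>] z by fastforce
  show ?thesis
  proof (rule equiholder_log[where B=B])
    show "L1 ?c" by (rule bounded_integrable[OF m n z])
    show "norm (t *\<^sub>R dir az) \<le> \<delta>" if "?c t \<noteq> 0" for t using z[of t] that by (auto simp: not_less[symmetric])
    show "AE t in lborel. t *\<^sub>R dir az \<noteq> y" for y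
      using AE_lborel_singleton[of "dir az \<bullet> y"] by eventually_elim (auto simp: dir_dir)
  qed (use B in auto)
qed

lemma poisson_equiholder:
  "equiholder (\<lambda>n y. LBINT x. u x * of_real (ct x) * of_real (poisson (ee n) (x - y)))"
  unfolding decomposition
proof (intro equiholder_add equiholder_uminus gradient_equiholder line_equiholder b)
  have [measurable]: "u \<in> BM" using u by auto
  note [measurable] = F(1) smooth_borel[OF ct(1)] smooth_borel[OF smooth_laplacian[OF ct(1)]]
  show "equiholder (\<lambda>n y. LBINT x. F x * of_real (ct x) * of_real (log_kernel (ee n) (x - y)))"
  proof -
    let ?c = "\<lambda>x. F x * complex_of_real (ct x)"
    have m: "?c \<in> BM" by measurable
    have n: "norm (?c x) \<le> K" for x
      using mult_mono[OF F(2)[of x], of "ct x" 1] ct(4,5)[of x] K0 by (simp add: norm_mult)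
    have z: "?c x = 0" if "norm x > \<delta>" for x using ct_outside(3)[of x] that by simp
    obtain B where B: "\<forall>y. L1 (\<lambda>x. norm (?c x) * (1 / sqrt (norm (x - y)))) \<and>
      (LBINT x. norm (?c x) * (1 / sqrt (norm (x - y)))) \<le> B"
      using plane_potential_bound[OF m n z] by blast
    show ?thesis
    proof (rule equiholder_log[where B=B])
      show "L1 ?c" by (rule bounded_integrable[OF m n z])
      show "norm x \<le> \<delta>" if "?c x \<noteq> 0" for x using z[of x] that by (auto simp: not_less[symmetric])
      show "AE x in lborel. x \<noteq> y" for y :: "real^2" by (rule AE_lborel_singleton)
    qed (use B in auto)
  qed
  \<comment> \<open>No bound on u is available, so the density is not covered by the plane estimate.
    Since it lives in the annulus, the kernel |x - y|^(-1/2) is simply bounded there by the constant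
    \<open>q\<close>.\<close>
  show "equiholder (\<lambda>n y. LBINT x. u x * laplacian (\<lambda>x. of_real (ct x)) x * of_real (log_kernel (ee n) (x - y)))"
  proof -
    let ?c = "\<lambda>x. u x * laplacian (\<lambda>x. complex_of_real (ct x)) x"
    have ic: "L1 ?c" by (intro u_mult smooth_cont smooth_laplacian ct ct_outside)
    define q where "q = 1 / sqrt (\<delta> / 8)"
    have le: "norm (?c x) * (1 / sqrt (norm (x - y))) \<le> norm (?c x) * q" if y: "y \<in> Y" for x y
    proof (cases "norm x < \<delta> / 4")
      case True
      then show ?thesis by (simp add: ct_deriv_zero)
    next
      case False
      then have "\<delta> / 8 \<le> norm (x - y)" using y norm_triangle_ineq2[of x y] by simp
      then have "1 / sqrt (norm (x - y)) \<le> q" unfolding q_def using \<delta> by (intro divide_left_mono mult_pos_pos) auto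
      then show ?thesis by (intro mult_left_mono) auto
    qed
    have iq: "L1 (\<lambda>x. norm (?c x) * q)" using ic by (intro integrable_mult_left integrable_norm)
    have ii: "L1 (\<lambda>x. norm (?c x) * (1 / sqrt (norm (x - y))))" if "y \<in> Y" for y
      by (rule bochner_bound[OF iq]) (measurable, use le[OF that] in \<open>auto intro: order_trans[OF _ abs_ge_self]\<close>)
    show ?thesis
    proof (rule equiholder_log[where B="\<integral>x. norm (?c x) * q \<partial>lborel", OF ic])
      show "norm x \<le> \<delta>" if "?c x \<noteq> 0" for x using ct_outside(2)[of x] that by (cases "norm x \<le> \<delta>") auto
      show "AE x in lborel. x \<noteq> y" for y :: "real^2" by (rule AE_lborel_singleton)
      show "\<forall>y\<in>Y. L1 (\<lambda>x. norm (?c x) * (1 / sqrt (norm (x - y)))) \<and> (LBINT x. norm (?c x) * (1 / sqrt (norm (x - y)))) \<le> (LBINT x. norm (?c x) * q)"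
        by (intro ballI conjI ii integral_mono iq le)
    qed simp
  qed
qed

text \<open>Near 0 a positive multiple of u has a Hoelder continuous representative R. The opening
  is less than 2 pi, so arbitrarily close to the vertex there are open sets outside the sector,
  where u vanishes. Hence R vanishes at 0, and its modulus of continuity is the claimed
  decay.\<close>

theorem u_vanishes_at_vertex:
  "\<exists>C r. r > 0 \<and> (AE x in lborel. norm x < r \<longrightarrow> norm (u x) \<le> C * sqrt (norm x))"
proof -
  let ?c = "\<lambda>x. u x * complex_of_real (ct x)"
  have ic: "L1 ?c" by (intro u_mult smooth_cont ct) (simp add: ct_outside)
  obtain C where C: "\<forall>n. \<forall>y\<in>Y. \<forall>y'\<in>Y. norm ((LBINT x. ?c x * of_real (poisson (ee n) (x - y))) - (LBINT x. ?c x * of_real (poisson (ee n) (x - y')))) \<le> C * sqrt (norm (y - y'))"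
    using poisson_equiholder unfolding equiholder_def by blast
  have conv: "\<forall>y\<in>Y. convergent (\<lambda>n. LBINT x. ?c x * of_real (poisson (ee n) (x - y)))"
    using poisson_equiholder unfolding equiholder_def by blast
  let ?k = "\<integral>z. poisson 1 z \<partial>lborel"
  have k: "?k > 0" by (rule poisson_mass_pos)
  obtain R where R: "\<And>y y'. y \<in> Y \<Longrightarrow> y' \<in> Y \<Longrightarrow> norm (R y - R y') \<le> C * sqrt (norm (y - y'))"
    "AE x in lborel. norm x < \<delta> / 8 / 2 \<longrightarrow> R x = of_real ?k * ?c x"
    by (rule holder_representative[where P="\<lambda>n y. \<integral>x. ?c x * of_real (poisson (ee n) (x - y)) \<partial>lborel", OF ic ee(1,2), of "\<delta> / 8" C])
      (use \<delta> conv C in auto)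
  have R0: "R 0 = 0"
  proof -
    have small: "norm (R 0) \<le> \<bar>C\<bar> * sqrt \<eta>" if \<eta>: "\<eta> > 0" "\<eta> < \<delta> / 16" for \<eta>
    proof -
      \<comment> \<open>The part of a small ball making a larger angle with the bisector than the
        edges do. It misses the sector and contains points on the opposite side of the vertex, so it
        is open and nonempty.\<close>
      define V where "V = {x. dir az0 \<bullet> x < cos ((azM - azm) / 2) * norm x} \<inter> ball 0 \<eta>"
      have oV: "open V" unfolding V_def by (intro open_Int open_Collect_less continuous_intros open_ball)
      have "- (\<eta> / 2) *\<^sub>R dir az0 \<in> V"
        using mult_strict_right_mono[OF cos_half_gt[OF angles] \<eta>(1)] \<eta> by (simp add: V_def dir_dir)
      then have "\<not> V \<subseteq> {x. False}" by blast
      \<comment> \<open>The representative agrees with u only almost everywhere, so a single good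
        point is extracted from the positive measure of \<open>V\<close>.\<close>
      have "\<exists>x\<in>V. R x = of_real ?k * ?c x"
      proof (rule ccontr)
        assume "\<not> (\<exists>x\<in>V. R x = of_real ?k * ?c x)"
        then have "AE x in lborel. x \<notin> V"
          using R(2) by (auto elim!: eventually_mono simp: V_def) (use \<eta> in force)
        then have "V \<in> null_sets lborel" using oV by (subst (asm) AE_iff_null_sets[symmetric]) auto
        then have "negligible V" by (simp add: negligible_iff_null_sets null_sets_completionI)
        then show False using oV open_not_negligible \<open>- (\<eta> / 2) *\<^sub>R dir az0 \<in> V\<close> by blast
      qed
      then obtain x where x: "x \<in> V" "R x = of_real ?k * ?c x" by blast
      have "x \<notin> sector azm azM" using sector_inner[OF angles, of x] x(1) by (auto simp: V_def)
      then have "R x = 0" using x(2) u by simp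
      moreover have "norm (R 0 - R x) \<le> C * sqrt (norm (0 - x))" using x \<eta> \<delta> by (intro R) (auto simp: V_def)
      moreover have "C * sqrt (norm (0 - x)) \<le> \<bar>C\<bar> * sqrt \<eta>"
        using x(1) by (intro mult_mono) (auto simp: V_def)
      ultimately show ?thesis by simp
    qed
    have "((\<lambda>\<eta>. \<bar>C\<bar> * sqrt \<eta>) \<longlongrightarrow> \<bar>C\<bar> * sqrt 0) (at_right 0)"
      by (intro tendsto_intros)
    moreover have "\<forall>\<^sub>F \<eta> in at_right 0. norm (R 0) \<le> \<bar>C\<bar> * sqrt \<eta>"
      unfolding eventually_at_right_field using small \<delta> by (intro exI[of _ "\<delta> / 16"]) auto
    ultimately have "norm (R 0) \<le> \<bar>C\<bar> * sqrt 0"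
      by (intro tendsto_lowerbound[of "\<lambda>\<eta>. \<bar>C\<bar> * sqrt \<eta>" _ "at_right 0"]) auto
    then show ?thesis by simp
  qed
  have "AE x in lborel. norm x < \<delta> / 16 \<longrightarrow> norm (u x) \<le> (C / ?k) * sqrt (norm x)"
    using R(2)
  proof eventually_elim
    case (elim x)
    show ?case
    proof
      assume x: "norm x < \<delta> / 16"
      then have "R x = of_real ?k * u x" using elim ct(2)[of x] \<delta> by simp
      moreover have "norm (R x - R 0) \<le> C * sqrt (norm (x - 0))" using x \<delta> by (intro R) auto
      ultimately have "?k * norm (u x) \<le> C * sqrt (norm x)" using k by (simp add: R0 norm_mult)
      then show "norm (u x) \<le> (C / ?k) * sqrt (norm x)" using k by (simp add: field_simps)
    qed
  qed
  then show ?thesis using \<delta> by (intro exI[of _ "C / ?k"] exI[of _ "\<delta> / 16"]) auto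
qed

end

section \<open>Continuous representatives from a mixed second derivative\<close>

definition bump_pair :: "nat \<Rightarrow> real \<Rightarrow> real \<Rightarrow> real \<Rightarrow> real" where
  "bump_pair n a b t = bump (real n * (t - a)) * bump (real n * (b - t))"

text \<open>Smoothness of a function of one variable, expressed through all its plane waves: this
  reuses the calculus on the plane and is exactly what tensor products in oblique coordinates need,
  whose factors depend on one inner product each.\<close>

definition smooth1 :: "(real \<Rightarrow> real) \<Rightarrow> bool" where
  "smooth1 f \<longleftrightarrow> (\<forall>a. smooth (\<lambda>x. of_real (f (a \<bullet> x))))"

lemma smooth1_mult: "smooth1 f \<Longrightarrow> smooth1 g \<Longrightarrow> smooth1 (\<lambda>t. f t * g t)"
  by (simp add: smooth1_def smooth_mult)
lemma smooth1_add: "smooth1 f \<Longrightarrow> smooth1 g \<Longrightarrow> smooth1 (\<lambda>t. f t + g t)"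
  by (simp add: smooth1_def smooth_add)
lemma smooth1_const: "smooth1 (\<lambda>t. c)"
  by (simp add: smooth1_def smooth_const)
lemma smooth1_antiderivative:
  assumes "\<And>t. (f has_real_derivative f' t) (at t)" "smooth1 f'" shows "smooth1 f"
  unfolding smooth1_def
proof
  show "smooth (\<lambda>x. of_real (f (a \<bullet> x)))" for a
    by (rule smooth_comp[OF smooth_inner assms(1)]) (use assms(2) in \<open>simp add: smooth1_def\<close>)
qed

lemma smooth1_bump_pair: "smooth1 (bump_pair n a b)"
  unfolding smooth1_def
proof
  fix v :: "real^2"
  have e: "real n * (t - a) = real n * t + - real n * a" "real n * (b - t) = - real n * t + real n * b" for t
    by (simp_all add: algebra_simps)
  show "smooth (\<lambda>x. of_real (bump_pair n a b (v \<bullet> x)))"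
    unfolding bump_pair_def of_real_mult e by (intro smooth_mult smooth_bumpp smooth_affine)
qed

lemma bump_pair_bounds: "0 \<le> bump_pair n a b t" "bump_pair n a b t \<le> 1"
  by (auto simp: bump_pair_def bump_nonneg bump_le1 intro!: mult_le_one)

lemma bump_pair_outside: "t \<le> a \<or> b \<le> t \<Longrightarrow> bump_pair n a b t = 0"
proof -
  assume "t \<le> a \<or> b \<le> t"
  then have "real n * (t - a) \<le> 0 \<or> real n * (b - t) \<le> 0" by (auto simp: mult_nonneg_nonpos)
  then show ?thesis by (auto simp: bump_pair_def bump_zero_iff)
qed

lemma bump_pair_tendsto: "(\<lambda>n. bump_pair n a b t) \<longlonglongrightarrow> ind {a<..<b} t"
proof -
  have "(\<lambda>n. bump_pair n a b t) \<longlonglongrightarrow> ind {0<..} (t - a) * ind {0<..} (b - t)"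
    unfolding bump_pair_def by (intro tendsto_mult bump_scaled_tendsto)
  then show ?thesis by (simp add: indicator_def of_bool_conj[symmetric])
qed

lemma continuous_bump_pair: "continuous_on A (bump_pair n a b)"
proof -
  have "isCont (bump_pair n a b) t" for t
    unfolding bump_pair_def by (intro continuous_intros isCont_o2[OF _ DERIV_isCont[OF bumpp_deriv]])
  then show ?thesis by (simp add: continuous_at_imp_continuous_on)
qed

lemma borel_bump_pair [measurable]: "bump_pair n a b \<in> BM"
  by (rule borel_measurable_continuous_onI[OF continuous_bump_pair])

lemma integrable_bump_pair: "L1 (bump_pair n a b)"
proof (rule bochner_bound[of _ "indicat_real {a..b}"])
  show "L1 (indicat_real {a..b})"
    using emeasure_bounded_finite[of "{a..b}"] by (intro integrable_real_indicator) auto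
  have "norm (bump_pair n a b t) \<le> norm (indicat_real {a..b} t)" for t
    using bump_pair_bounds[of n a b t] bump_pair_outside[of t a b n] by (cases "t \<in> {a..b}") auto
  then show "AE t in lborel. norm (bump_pair n a b t) \<le> norm (indicat_real {a..b} t)" by blast
qed simp

text \<open>The antiderivative of a bump that vanishes to the left of it, written as an integral
  over a half-line so that a product of two of them is an integral over a quadrant.\<close>

definition prim :: "nat \<Rightarrow> real \<Rightarrow> real \<Rightarrow> real \<Rightarrow> real" where
  "prim n a b s = (LBINT t. ind {..s} t * bump_pair n a b t)"

lemma prim_left: "s \<le> a \<Longrightarrow> prim n a b s = 0"
proof -
  assume s: "s \<le> a"
  have "prim n a b s = (\<integral>t. 0 \<partial>(lborel :: real measure))" unfolding prim_def
    by (intro bochner_cong) (use s in \<open>auto simp: indicator_def bump_pair_outside\<close>)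
  then show ?thesis by simp
qed

lemma prim_deriv: "(prim n a b has_real_derivative bump_pair n a b s) (at s)"
proof -
  have "\<exists>F. \<forall>x. - \<infinity> < ereal x \<longrightarrow> ereal x < \<infinity> \<longrightarrow> (F has_vector_derivative bump_pair n a b x) (at x)"
    by (rule einterval_antiderivative) (auto intro: continuous_on_interior[OF continuous_bump_pair[of UNIV]])
  then obtain F where F: "(F has_vector_derivative bump_pair n a b x) (at x)" for x by auto
  have ftc: "(LBINT t. ind {x..y} t *\<^sub>R bump_pair n a b t) = F y - F x" if "x \<le> y" for x y
    by (rule integral_FTC_atLeastAtMost) (use that F in \<open>auto intro: has_vector_derivative_at_within continuous_bump_pair\<close>)
  have "prim n a b s = F s - F a" for s
  proof (cases "a \<le> s")
    case True
    have "prim n a b s = (LBINT t. ind {a..s} t *\<^sub>R bump_pair n a b t)" unfolding prim_def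
      by (intro bochner_cong) (auto simp: indicator_def bump_pair_outside)
    then show ?thesis using ftc[OF True] by simp
  next
    case False
    have "(LBINT t. ind {s..a} t *\<^sub>R bump_pair n a b t) = (\<integral>t. 0 \<partial>(lborel :: real measure))"
      by (intro bochner_cong) (auto simp: indicator_def bump_pair_outside)
    then have "F a - F s = 0" using ftc[of s a] False by simp
    then show ?thesis using prim_left[of s a n b] False by simp
  qed
  then have "prim n a b = (\<lambda>s. F s - F a)" by blast
  moreover have "((\<lambda>s. F s - F a) has_real_derivative bump_pair n a b s) (at s)"
    using F[of s] by (auto intro!: derivative_eq_intros simp: has_real_derivative_iff_has_vector_derivative)
  ultimately show ?thesis by simp
qed

lemma prim_right: "b \<le> s \<Longrightarrow> prim n a b s = prim n a b b"
  unfolding prim_def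
  by (intro bochner_cong) (auto simp: indicator_def bump_pair_outside)

lemma smooth1_prim: "smooth1 (prim n a b)"
  by (rule smooth1_antiderivative[OF prim_deriv smooth1_bump_pair])

lemma continuous_smooth1: "smooth1 f \<Longrightarrow> continuous_on UNIV f"
proof -
  assume "smooth1 f"
  then have "smooth (\<lambda>x. complex_of_real (f ((axis 1 1 :: real^2) \<bullet> x)))" by (simp add: smooth1_def)
  then have "continuous_on UNIV (\<lambda>x. complex_of_real (f ((axis 1 1 :: real^2) \<bullet> x)))" by (rule smooth_cont)
  then have "continuous_on UNIV (\<lambda>t::real. complex_of_real (f ((axis 1 1 :: real^2) \<bullet> (t *\<^sub>R axis 1 (1::real) :: real^2))))"
    by (rule continuous_on_compose2) (auto intro!: continuous_intros)
  then have "continuous_on UNIV (\<lambda>t. Re (complex_of_real (f t)))"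
    by (intro continuous_intros) (simp add: inner_axis_axis)
  then show ?thesis by simp
qed

lemma prim_pos: assumes "a < b" shows "prim 1 a b b > 0"
proof -
  have nn: "prim 1 a b b \<ge> 0" unfolding prim_def by (intro integral_nonneg_AE) (auto simp: bump_pair_bounds)
  have "prim 1 a b b \<noteq> 0"
  proof
    assume z: "prim 1 a b b = 0"
    have "L1 (\<lambda>t. ind {..b} t * bump_pair 1 a b t)"
      using integrable_mult_indicator[OF _ integrable_bump_pair, of "{..b}" 1 a b] by simp
    then have "AE t in lborel. ind {..b} t * bump_pair 1 a b t = 0"
      using z unfolding prim_def by (subst (asm) integral_nonneg_eq_0_iff_AE) (auto simp: bump_pair_bounds)
    then have "AE t in lborel. t \<notin> {a<..<b}"
    proof eventually_elim
      case (elim t)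
      have "bump_pair 1 a b t > 0" if "t \<in> {a<..<b}"
        using that unfolding bump_pair_def by (intro mult_pos_pos) (auto simp: bump_pos_iff)
      then show ?case using elim by (auto simp: indicator_def)
    qed
    then have "{a<..<b} \<in> null_sets lborel" by (subst (asm) AE_iff_null_sets[symmetric]) auto
    then show False using assms by (auto simp: null_sets_def)
  qed
  then show ?thesis using nn by simp
qed

text \<open>The support has a positive distance from 0 and stays within [0, 2 \<delta>]; a product
  of two such factors therefore has compact support inside the open quadrant and is a legitimate
  test function in the cone.\<close>

definition admissible0 :: "real \<Rightarrow> (real \<Rightarrow> real) \<Rightarrow> bool" where
  "admissible0 \<delta> f \<longleftrightarrow> smooth1 f \<and> (\<exists>a>0. \<forall>t. t \<le> a \<or> 2 * \<delta> \<le> t \<longrightarrow> f t = 0)"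

lemma admissible0I:
  assumes "smooth1 f" "0 < a" "\<And>t. t \<le> a \<Longrightarrow> f t = 0" "\<And>t. 2 * \<delta> \<le> t \<Longrightarrow> f t = 0"
  shows "admissible0 \<delta> f"
  unfolding admissible0_def using assms by auto

definition admissible :: "real \<Rightarrow> (real \<Rightarrow> real) \<Rightarrow> (real \<Rightarrow> real) \<Rightarrow> bool" where
  "admissible \<delta> f f' \<longleftrightarrow> admissible0 \<delta> f \<and> (\<forall>t. (f has_real_derivative f' t) (at t))"

lemma borel_fst_snd:
  "(fst :: real \<times> real \<Rightarrow> real) \<in> BM" "(snd :: real \<times> real \<Rightarrow> real) \<in> BM"
  by (auto intro!: borel_measurable_continuous_onI continuous_intros)

lemma borel_fst_snd_comp:
  fixes f :: "real \<Rightarrow> 'a::topological_space"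
  assumes "f \<in> BM"
  shows "(\<lambda>p::real \<times> real. f (fst p)) \<in> BM" "(\<lambda>p::real \<times> real. f (snd p)) \<in> BM"
  using measurable_compose[OF borel_fst_snd(1) assms] measurable_compose[OF borel_fst_snd(2) assms] by auto

lemma integral_prod_real:
  fixes f g :: "real \<Rightarrow> real"
  assumes f: "L1 f" and g: "L1 g"
  shows "(LBINT q. f (fst q) * g (snd q)) = (LBINT s. f s) * (LBINT t. g t)"
    and "L1 (\<lambda>q. f (fst q) * g (snd q))"
proof -
  have [measurable]: "f \<in> BM" "g \<in> BM" using f g by auto
  have i: "integrable (lborel \<Otimes>\<^sub>M lborel) (\<lambda>q. f (fst q) * g (snd q))"
  proof (rule lborel_pair.Fubini_integrable)
    show "L1 (\<lambda>x. LBINT y. norm (f (fst (x, y)) * g (snd (x, y))))"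
      using f by (simp add: abs_mult)
  qed (use g in auto)
  show "L1 (\<lambda>q. f (fst q) * g (snd q))" using i by (simp add: lborel_prod)
  show "(LBINT q. f (fst q) * g (snd q)) = (LBINT s. f s) * (LBINT t. g t)"
    using lborel_pair.integral_fst'[OF i] by (simp add: lborel_prod)
qed

lemma integrable_bounded_mult:
  fixes f g :: "'a::euclidean_space \<Rightarrow> complex"
  assumes f: "L1 f" and g[measurable]: "g \<in> BM" and C: "\<And>x. norm (g x) \<le> C"
  shows "L1 (\<lambda>x. f x * g x)"
proof (rule bochner_bound)
  have [measurable]: "f \<in> BM" using f by auto
  show "L1 (\<lambda>x. norm (f x) * C)" using f by (intro integrable_mult_left) auto
  show "(\<lambda>x. f x * g x) \<in> borel_measurable lborel" by measurable
  show "AE x in lborel. norm (f x * g x) \<le> norm (norm (f x) * C)"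
  proof (rule AE_I2)
    fix x
    have "norm (f x) * norm (g x) \<le> norm (f x) * C" using C by (intro mult_left_mono) auto
    then show "norm (f x * g x) \<le> norm (norm (f x) * C)" by (simp add: norm_mult)
  qed
qed

abbreviation quad :: "real \<times> real \<Rightarrow> (real \<times> real) set" where
  "quad p \<equiv> {q. fst q \<le> fst p \<and> snd q \<le> snd p}"

lemma eventually_le_iff:
  fixes s :: "nat \<Rightarrow> real"
  assumes "s \<longlonglongrightarrow> a" "b \<noteq> a"
  shows "\<forall>\<^sub>F n in sequentially. (s n \<le> b \<longleftrightarrow> a \<le> b)"
proof (cases "a < b")
  case True
  show ?thesis by (rule eventually_mono[OF order_tendstoD(2)[OF assms(1) True]]) (use True in simp)
next
  case False
  then have "b < a" using assms by simp
  show ?thesis by (rule eventually_mono[OF order_tendstoD(1)[OF assms(1) \<open>b < a\<close>]]) (use \<open>b < a\<close> in simp)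
qed

text \<open>When the corner of the quadrant moves, its indicator converges except on the two lines
  through the limiting corner, which are null sets; dominated convergence with majorant |H| does the
  rest. Two integrations of an integrable function thus produce a continuous one.\<close>

lemma quadrant_integral_continuous:
  fixes H :: "real \<times> real \<Rightarrow> complex"
  assumes H: "L1 H"
  shows "continuous_on UNIV (\<lambda>q. LBINT p. H p * ind (quad p) q)"
proof -
  have [measurable]: "H \<in> BM" using H by auto
  have Mq: "(\<lambda>p. H p * ind (quad p) q) \<in> borel_measurable lborel" for q
  proof -
    have "closed {p. fst q \<le> fst p \<and> snd q \<le> snd p}"
      by (intro closed_Collect_conj closed_Collect_le continuous_intros)
    then have [measurable]: "{p. fst q \<le> fst p \<and> snd q \<le> snd p} \<in> sets borel" by (rule borel_closed)
    have "(\<lambda>p. H p * ind {p. fst q \<le> fst p \<and> snd q \<le> snd p} p) \<in> borel_measurable lborel" by measurable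
    also have "(\<lambda>p. H p * ind {p. fst q \<le> fst p \<and> snd q \<le> snd p} p) = (\<lambda>p. H p * ind (quad p) q)"
      by (auto simp: indicator_def)
    finally show ?thesis .
  qed
  show ?thesis
  proof (rule continuous_at_imp_continuous_on, rule ballI, unfold continuous_at_sequentially, intro allI impI)
    fix q :: "real \<times> real" and x :: "nat \<Rightarrow> real \<times> real" assume x: "x \<longlonglongrightarrow> q"
    have "(\<lambda>n. LBINT p. H p * ind (quad p) (x n)) \<longlonglongrightarrow> (LBINT p. H p * ind (quad p) q)"
    proof (rule integral_dominated_convergence[where w="\<lambda>p. norm (H p)"])
      have n1: "AE p in (lborel :: (real \<times> real) measure). fst p \<noteq> fst q" and n2: "AE p in (lborel :: (real \<times> real) measure). snd p \<noteq> snd q"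
      proof -
        have "AE p in (lborel :: real measure) \<Otimes>\<^sub>M (lborel :: real measure). fst p \<noteq> fst q"
          by (rule lborel_pair.AE_pair_measure) (measurable, use AE_lborel_singleton[of "fst q"] in auto)
        then show "AE p in (lborel :: (real \<times> real) measure). fst p \<noteq> fst q" unfolding lborel_prod .
        have "AE p in (lborel :: real measure) \<Otimes>\<^sub>M (lborel :: real measure). snd p \<noteq> snd q"
          by (rule lborel_pair.AE_pair_measure) (measurable, use AE_lborel_singleton[of "snd q"] in auto)
        then show "AE p in (lborel :: (real \<times> real) measure). snd p \<noteq> snd q" unfolding lborel_prod .
      qed
      show "AE p in lborel. (\<lambda>n. H p * ind (quad p) (x n)) \<longlonglongrightarrow> H p * ind (quad p) q"
        using n1 n2
      proof eventually_elim
        case (elim p)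
        have f: "(\<lambda>n. fst (x n)) \<longlonglongrightarrow> fst q" "(\<lambda>n. snd (x n)) \<longlonglongrightarrow> snd q" using x by (auto intro: tendsto_intros)
        have "\<forall>\<^sub>F n in sequentially. (fst (x n) \<le> fst p \<longleftrightarrow> fst q \<le> fst p)"
          by (rule eventually_le_iff[OF f(1) elim(1)])
        moreover have "\<forall>\<^sub>F n in sequentially. (snd (x n) \<le> snd p \<longleftrightarrow> snd q \<le> snd p)"
          by (rule eventually_le_iff[OF f(2) elim(2)])
        ultimately have "\<forall>\<^sub>F n in sequentially. H p * ind (quad p) (x n) = H p * ind (quad p) q"
          by eventually_elim (simp add: indicator_def)
        then show ?case by (rule tendsto_eventually)
      qed
      show "L1 (\<lambda>p. norm (H p))" using H by (rule integrable_norm)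
    qed (rule Mq, rule Mq, auto simp: indicator_def)
    then show "((\<lambda>q. LBINT p. H p * ind (quad p) q) \<circ> x) \<longlonglongrightarrow> (LBINT p. H p * ind (quad p) q)" by (simp add: comp_def)
  qed
qed


text \<open>\<open>G\<close> is the integral over quadrants of the mixed derivative of \<open>v\<close> times a cut-off.\<close>

lemma mixed_representative:
  fixes v vs vt vst :: "real \<times> real \<Rightarrow> complex"
  assumes int: "L1 v" "L1 vs" "L1 vt" "L1 vst" and \<delta>: "\<delta> > 0"
    and W1: "\<And>f f' g. admissible \<delta> f f' \<Longrightarrow> admissible0 \<delta> g \<Longrightarrow>
      (LBINT p. v p * of_real (f' (fst p) * g (snd p))) = - (LBINT p. vs p * of_real (f (fst p) * g (snd p)))"
    and W2: "\<And>f g g'. admissible0 \<delta> f \<Longrightarrow> admissible \<delta> g g' \<Longrightarrow>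
      (LBINT p. v p * of_real (f (fst p) * g' (snd p))) = - (LBINT p. vt p * of_real (f (fst p) * g (snd p)))"
    and W3: "\<And>f g g'. admissible0 \<delta> f \<Longrightarrow> admissible \<delta> g g' \<Longrightarrow>
      (LBINT p. vs p * of_real (f (fst p) * g' (snd p))) = - (LBINT p. vst p * of_real (f (fst p) * g (snd p)))"
  obtains G where "continuous_on UNIV G" "AE p in lborel. p \<in> {0<..<\<delta>} \<times> {0<..<\<delta>} \<longrightarrow> v p = G p"
proof -
  define \<beta> where "\<beta> = bump_pair 1 \<delta> (2 * \<delta>)"
  define m where "m = prim 1 \<delta> (2 * \<delta>) (2 * \<delta>)"
  \<comment> \<open>A cut-off equal to 1 up to \<delta> and to 0 from 2 \<delta> on. Being built
    from a normalised antiderivative, it has an explicit smooth derivative.\<close>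
  define k where "k t = 1 + (- 1 / m) * prim 1 \<delta> (2 * \<delta>) t" for t
  define k' where "k' t = (- 1 / m) * \<beta> t" for t
  have m: "m > 0" unfolding m_def using \<delta> by (intro prim_pos) simp
  have sk: "smooth1 k" "smooth1 k'"
    unfolding k_def[abs_def] k'_def[abs_def] \<beta>_def by (intro smooth1_add smooth1_mult smooth1_const smooth1_prim smooth1_bump_pair)+
  have dk: "(k has_real_derivative k' t) (at t)" for t
    unfolding k_def[abs_def] k'_def \<beta>_def using DERIV_add[OF DERIV_const[of 1] DERIV_cmult[OF prim_deriv[of 1 \<delta> "2 * \<delta>" t], of "- 1 / m"]] by simp
  have k1: "k t = 1" if "t \<le> \<delta>" for t using that by (simp add: k_def prim_left)
  have k0: "k t = 0" if "2 * \<delta> \<le> t" for t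
  proof -
    have "prim 1 \<delta> (2 * \<delta>) t = m" unfolding m_def by (rule prim_right[OF that])
    then show ?thesis using m by (simp add: k_def)
  qed
  have k'0: "k' t = 0" if "2 * \<delta> \<le> t" for t using that by (simp add: k'_def \<beta>_def bump_pair_outside)
  have [measurable]: "k \<in> BM" "k' \<in> BM"
    using sk continuous_smooth1 borel_measurable_continuous_onI by blast+
  have [measurable]: "v \<in> BM" "vs \<in> BM" "vt \<in> BM" "vst \<in> BM"
    using int by auto
  define L where "L a f t = (if t \<le> a then 0 else f t)" for a and f :: "real \<Rightarrow> real" and t :: real
  have bdd: "\<exists>C. \<forall>t\<ge>0. \<bar>f t\<bar> \<le> C" if "smooth1 f" "\<And>t. 2 * \<delta> \<le> t \<Longrightarrow> f t = 0" for f
  proof -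
    have "compact (f ` {0..2 * \<delta>})"
      by (intro compact_continuous_image continuous_on_subset[OF continuous_smooth1[OF that(1)]]) auto
    from compact_imp_bounded[OF this] obtain C where "\<forall>x\<in>f ` {0..2 * \<delta>}. norm x \<le> C" unfolding bounded_iff by blast
    then have C: "\<bar>f t\<bar> \<le> C" if "t \<in> {0..2 * \<delta>}" for t using that by simp
    have "\<bar>f t\<bar> \<le> max C 0" if "t \<ge> 0" for t
      using C[of t] \<open>\<And>t. 2 * \<delta> \<le> t \<Longrightarrow> f t = 0\<close>[of t] that by (cases "t \<le> 2 * \<delta>") auto
    then show ?thesis by blast
  qed
  obtain Ck Ck' where Ck: "\<And>t. t \<ge> 0 \<Longrightarrow> \<bar>k t\<bar> \<le> Ck" "\<And>t. t \<ge> 0 \<Longrightarrow> \<bar>k' t\<bar> \<le> Ck'"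
    using bdd[OF sk(1) k0] bdd[OF sk(2) k'0] by blast
  define Q where "Q = ({0<..} \<times> {0<..} :: (real \<times> real) set)"
  have [measurable]: "Q \<in> sets borel" by (simp add: Q_def borel_Times)
  \<comment> \<open>The product rule for the mixed derivative of v(s, t) k(s) k(t), restricted to
    the quadrant. The sign of two integrations towards infinity is positive, so its integral over
    the quadrant beyond q should return v(q) wherever both cut-offs equal 1.\<close>
  define H where "H p = ind Q p *\<^sub>R (vst p * of_real (k (fst p) * k (snd p)) + vs p * of_real (k (fst p) * k' (snd p))
     + vt p * of_real (k' (fst p) * k (snd p)) + v p * of_real (k' (fst p) * k' (snd p)))" for p
  have iH1: "L1 (\<lambda>p. ind Q p *\<^sub>R (w p * of_real (f (fst p) * g (snd p))))"
    if "L1 w" "f \<in> {k, k'}" "g \<in> {k, k'}" for w :: "real \<times> real \<Rightarrow> complex" and f g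
  proof -
    have fgm: "f \<in> BM" "g \<in> BM" using that by auto
    note [measurable] = borel_fst_snd_comp(1)[OF fgm(1)] borel_fst_snd_comp(2)[OF fgm(2)]
    have fb: "\<bar>f t\<bar> \<le> max Ck Ck'" "\<bar>g t\<bar> \<le> max Ck Ck'" if "t \<ge> 0" for t
      using \<open>f \<in> {k, k'}\<close> \<open>g \<in> {k, k'}\<close> Ck[OF that] by auto
    have "L1 (\<lambda>p. w p * (ind Q p *\<^sub>R of_real (f (fst p) * g (snd p))))"
    proof (rule integrable_bounded_mult[OF that(1)])
      show "norm (ind Q p *\<^sub>R complex_of_real (f (fst p) * g (snd p))) \<le> max Ck Ck' * max Ck Ck'" for p
      proof (cases "p \<in> Q")
        case True
        then have p: "fst p \<ge> 0" "snd p \<ge> 0" by (auto simp: Q_def)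
        then show ?thesis using True mult_mono[OF fb(1)[OF p(1)] fb(2)[OF p(2)]] fb(1)[OF p(1)] by (auto simp: norm_mult abs_mult)
      qed simp
    qed measurable
    then show ?thesis by (simp add: mult.commute mult.left_commute)
  qed
  have iH: "L1 H" unfolding H_def[abs_def] scaleR_add_right
    using int by (intro bochner_add iH1) auto
  have Hm[measurable]: "H \<in> BM" using iH by auto
  define G where "G q = (LBINT p. H p * ind (quad p) q)" for q
  have cG: "continuous_on UNIV G" unfolding G_def[abs_def] by (rule quadrant_integral_continuous[OF iH])
  have [measurable]: "G \<in> BM" by (rule borel_measurable_continuous_onI[OF cG])
  define S where "S = {0<..<\<delta>} \<times> {0<..<\<delta>}"
  \<comment> \<open>Pointwise differentiation is replaced by duality: v and the candidate
    \<open>G\<close> are compared after testing against products of bumps, whose antiderivatives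
    times the cut-off are admissible.\<close>
  have key: "(LBINT p. v p * of_real (bump_pair n a b (fst p) * bump_pair n c d (snd p))) =
     (LBINT q. G q * of_real (bump_pair n a b (fst q) * bump_pair n c d (snd q)))"
    if ab: "0 < a" "b \<le> \<delta>" "0 < c" "d \<le> \<delta>" for a b c d n
  proof -
    define A where "A = prim n a b" define A' where "A' = bump_pair n a b"
    define B where "B = prim n c d" define B' where "B' = bump_pair n c d"
    have sm: "smooth1 A" "smooth1 A'" "smooth1 B" "smooth1 B'"
      by (auto simp: A_def A'_def B_def B'_def smooth1_prim smooth1_bump_pair)
    have dA: "(A has_real_derivative A' t) (at t)" "(B has_real_derivative B' t) (at t)" for t
      by (auto simp: A_def A'_def B_def B'_def prim_deriv)
    have zA: "t \<le> a \<Longrightarrow> A t = 0" "t \<le> c \<Longrightarrow> B t = 0" "t \<le> a \<Longrightarrow> A' t = 0" "t \<le> c \<Longrightarrow> B' t = 0"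
       "\<delta> \<le> t \<Longrightarrow> A' t = 0" "\<delta> \<le> t \<Longrightarrow> B' t = 0" for t
      using ab by (auto simp: A_def A'_def B_def B'_def prim_left bump_pair_outside)
    \<comment> \<open>The bump ends where the cut-off starts to decrease, so (A k)' = A' + A k' has
      the bump itself as its first summand.\<close>
    have Ak: "A' t * k t = A' t" "B' t * k t = B' t" for t
      using zA(5,6)[of t] k1[of t] by (cases "t \<le> \<delta>"; auto)+
    let ?a = "\<lambda>t. A t * k t" and ?a1 = "\<lambda>t. A' t + A t * k' t" and ?b = "\<lambda>t. B t * k t" and ?b1 = "\<lambda>t. B' t + B t * k' t"
    let ?ak = "\<lambda>t. A t * k' t" and ?bk = "\<lambda>t. B t * k' t"
    have ad0: "admissible0 \<delta> ?a" "admissible0 \<delta> ?b" "admissible0 \<delta> ?ak" "admissible0 \<delta> ?bk" "admissible0 \<delta> A'" "admissible0 \<delta> B'" "admissible0 \<delta> ?b1"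
    proof -
      note I = admissible0I[where \<delta>=\<delta>]
      show "admissible0 \<delta> ?a" by (rule I[of _ a]) (use sm sk zA k0 ab in \<open>auto intro!: smooth1_mult\<close>)
      show "admissible0 \<delta> ?b" by (rule I[of _ c]) (use sm sk zA k0 ab in \<open>auto intro!: smooth1_mult\<close>)
      show "admissible0 \<delta> ?ak" by (rule I[of _ a]) (use sm sk zA k'0 ab in \<open>auto intro!: smooth1_mult\<close>)
      show "admissible0 \<delta> ?bk" by (rule I[of _ c]) (use sm sk zA k'0 ab in \<open>auto intro!: smooth1_mult\<close>)
      show "admissible0 \<delta> A'" by (rule I[of _ a]) (use sm zA ab \<delta> in auto)
      show "admissible0 \<delta> B'" by (rule I[of _ c]) (use sm zA ab \<delta> in auto)
      show "admissible0 \<delta> ?b1" by (rule I[of _ c]) (use sm sk zA k'0 ab \<delta> in \<open>auto intro!: smooth1_mult smooth1_add\<close>)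
    qed
    have dd: "(?a has_real_derivative ?a1 t) (at t)" "(?b has_real_derivative ?b1 t) (at t)" for t
      using DERIV_mult[OF dA(1)[of t] dk[of t]] DERIV_mult[OF dA(2)[of t] dk[of t]] Ak[of t] by (simp_all add: mult.commute add.commute)
    have ad: "admissible \<delta> ?a ?a1" "admissible \<delta> ?b ?b1"
      using ad0 dd by (auto simp: admissible_def)
    have [measurable]: "A \<in> BM" "A' \<in> BM" "B \<in> BM" "B' \<in> BM"
      using sm continuous_smooth1 borel_measurable_continuous_onI by blast+
    have i: "L1 (\<lambda>p. w p * of_real (f (fst p) * g (snd p)))"
      if w: "L1 w" and fg: "admissible0 \<delta> f" "admissible0 \<delta> g" for w :: "real \<times> real \<Rightarrow> complex" and f g
    proof -
      have b: "\<exists>C. \<forall>t. \<bar>f t\<bar> \<le> C" if "admissible0 \<delta> f" for f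
      proof -
        have sf: "smooth1 f" and f0: "\<And>t. t \<le> 0 \<or> 2 * \<delta> \<le> t \<Longrightarrow> f t = 0"
          using that unfolding admissible0_def by (auto intro: order_trans less_imp_le)
        obtain C where C: "\<And>t. t \<ge> 0 \<Longrightarrow> \<bar>f t\<bar> \<le> C" using bdd[OF sf] f0 by blast
        have "\<bar>f t\<bar> \<le> C" for t using C[of t] C[of 0] f0[of t] by (cases "t \<ge> 0") auto
        then show ?thesis by blast
      qed
      obtain C C' where C: "\<And>t. \<bar>f t\<bar> \<le> C" "\<And>t. \<bar>g t\<bar> \<le> C'" using b[OF fg(1)] b[OF fg(2)] by blast
      have fgm: "f \<in> BM" "g \<in> BM"
        using fg continuous_smooth1 borel_measurable_continuous_onI unfolding admissible0_def by blast+
      note [measurable] = borel_fst_snd_comp(1)[OF fgm(1)] borel_fst_snd_comp(2)[OF fgm(2)]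
      show ?thesis
      proof (rule integrable_bounded_mult[OF w])
        show "norm (complex_of_real (f (fst p) * g (snd p))) \<le> C * C'" for p
        proof -
          have "\<bar>f (fst p)\<bar> * \<bar>g (snd p)\<bar> \<le> C * C'" using C by (intro mult_mono) (auto intro: order_trans[OF abs_ge_zero])
          then show ?thesis by (simp add: abs_mult flip: of_real_mult)
        qed
      qed measurable
    qed
    define I where "I w f g = (LBINT p. w p * of_real (f (fst p) * g (snd p)))" for w :: "real \<times> real \<Rightarrow> complex" and f g
    have Iadd1: "I w (\<lambda>t. f t + f2 t) g = I w f g + I w f2 g"
      if "L1 w" "admissible0 \<delta> f" "admissible0 \<delta> f2" "admissible0 \<delta> g" for w f f2 g
      unfolding I_def using i[OF that(1,2,4)] i[OF that(1,3,4)] by (simp add: distrib_right distrib_left)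
    have Iadd2: "I w f (\<lambda>t. g t + g2 t) = I w f g + I w f g2"
      if "L1 w" "admissible0 \<delta> f" "admissible0 \<delta> g" "admissible0 \<delta> g2" for w f g g2
      unfolding I_def using i[OF that(1,2,3)] i[OF that(1,2,4)] by (simp add: distrib_left)
    have e1: "I v ?a1 ?b1 = I vst ?a ?b"
      using W1[OF ad(1) ad0(7)] W3[OF ad0(1) ad(2)] by (simp add: I_def)
    have e2: "I v ?a1 ?b1 = I v A' B' + I v A' ?bk + I v ?ak B' + I v ?ak ?bk"
    proof -
      have "I v ?a1 ?b1 = I v A' ?b1 + I v ?ak ?b1" by (rule Iadd1[OF int(1) ad0(5,3,7)])
      also have "I v A' ?b1 = I v A' B' + I v A' ?bk" by (rule Iadd2[OF int(1) ad0(5,6,4)])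
      also have "I v ?ak ?b1 = I v ?ak B' + I v ?ak ?bk" by (rule Iadd2[OF int(1) ad0(3,6,4)])
      finally show ?thesis by simp
    qed
    have e3: "I v A' ?bk + I v ?ak ?bk = - I vs ?a ?bk"
      using W1[OF ad(1) ad0(4)] Iadd1[OF int(1) ad0(5,3,4)] by (simp add: I_def)
    have e4: "I v ?ak B' + I v ?ak ?bk = - I vt ?ak ?b"
      using W2[OF ad0(3) ad(2)] Iadd2[OF int(1) ad0(3,6,4)] by (simp add: I_def)
    \<comment> \<open>The product of the two derivatives expands into four terms. Isolating the pure
      bump term by inclusion and exclusion and integrating the others by parts leaves exactly the
      four summands of \<open>H\<close>.\<close>
    have "I v A' B' = I vst ?a ?b + I vs ?a ?bk + I vt ?ak ?b + I v ?ak ?bk"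
    proof -
      have "I v A' B' = I v ?a1 ?b1 - (I v A' ?bk + I v ?ak ?bk) - (I v ?ak B' + I v ?ak ?bk) + I v ?ak ?bk"
        unfolding e2 by (simp only: algebra_simps)
      then show ?thesis unfolding e1 e3 e4 by (simp only: diff_minus_eq_add)
    qed
    also have "\<dots> = (LBINT p. H p * of_real (A (fst p) * B (snd p)))"
    proof -
      have "(LBINT p. H p * of_real (A (fst p) * B (snd p))) = (LBINT p. vst p * of_real (?a (fst p) * ?b (snd p)) + vs p * of_real (?a (fst p) * ?bk (snd p))
        + vt p * of_real (?ak (fst p) * ?b (snd p)) + v p * of_real (?ak (fst p) * ?bk (snd p)))"
      proof (rule bochner_cong)
        fix p
        show "H p * of_real (A (fst p) * B (snd p)) = vst p * of_real (?a (fst p) * ?b (snd p)) + vs p * of_real (?a (fst p) * ?bk (snd p))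
        + vt p * of_real (?ak (fst p) * ?b (snd p)) + v p * of_real (?ak (fst p) * ?bk (snd p))"
        proof (cases "p \<in> Q")
          case True then show ?thesis by (simp add: H_def algebra_simps)
        next
          case False
          then have "A (fst p) = 0 \<or> B (snd p) = 0" using zA(1)[of "fst p"] zA(2)[of "snd p"] ab by (cases p) (auto simp: Q_def)
          then show ?thesis by auto
        qed
      qed simp
      also have "\<dots> = I vst ?a ?b + I vs ?a ?bk + I vt ?ak ?b + I v ?ak ?bk" unfolding I_def
        using i[OF int(4) ad0(1,2)] i[OF int(2) ad0(1,4)] i[OF int(3) ad0(3,2)] i[OF int(1) ad0(3,4)]
        by (simp only: Bochner_Integration.integral_add bochner_add)
      finally show ?thesis by simp
    qed
    \<comment> \<open>A product of antiderivatives at p is the integral of the bumps over all q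
      below p in both coordinates. Exchanging the integrations turns this into the quadrant integral
      \<open>G\<close> paired with the bumps.\<close>
    also have "\<dots> = (LBINT p. (LBINT q. H p * ind (quad p) q * of_real (A' (fst q) * B' (snd q))))"
    proof (rule bochner_cong)
      fix p :: "real \<times> real"
      have ii: "L1 (\<lambda>s. ind {..fst p} s * A' s)" "L1 (\<lambda>s. ind {..snd p} s * B' s)"
        using integrable_mult_indicator[OF _ integrable_bump_pair, of "{..fst p}" n a b] integrable_mult_indicator[OF _ integrable_bump_pair, of "{..snd p}" n c d]
        by (auto simp: A'_def B'_def)
      have "A (fst p) * B (snd p) = (LBINT q. (ind {..fst p} (fst q) * A' (fst q)) * (ind {..snd p} (snd q) * B' (snd q)))"
        unfolding integral_prod_real(1)[OF ii] by (simp add: A_def B_def prim_def A'_def B'_def)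
      also have "\<dots> = (LBINT q. ind (quad p) q * (A' (fst q) * B' (snd q)))"
        by (intro bochner_cong) (auto simp: indicator_def)
      finally have "of_real (A (fst p) * B (snd p)) = (LBINT q. complex_of_real (ind (quad p) q * (A' (fst q) * B' (snd q))))"
        by (simp only: integral_complex_of_real)
      then have "H p * of_real (A (fst p) * B (snd p)) = (LBINT q. H p * complex_of_real (ind (quad p) q * (A' (fst q) * B' (snd q))))"
        by (simp only: integral_mult_right_zero)
      also have "\<dots> = (LBINT q. H p * ind (quad p) q * of_real (A' (fst q) * B' (snd q)))"
        by (intro bochner_cong) (auto simp: indicator_def)
      finally show "H p * of_real (A (fst p) * B (snd p)) = (LBINT q. H p * ind (quad p) q * of_real (A' (fst q) * B' (snd q)))" .
    qed simp
    also have "\<dots> = (LBINT q. (LBINT p. H p * ind (quad p) q * of_real (A' (fst q) * B' (snd q))))"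
    proof (rule lborel_pair.Fubini_integral[symmetric])
      let ?f = "\<lambda>p q. H p * ind (quad p) q * of_real (A' (fst q) * B' (snd q))"
      have iAB: "L1 (\<lambda>q. A' (fst q) * B' (snd q))"
        unfolding A'_def B'_def by (rule integral_prod_real(2)[OF integrable_bump_pair integrable_bump_pair])
      have Am: "A' \<in> BM" "B' \<in> BM" by measurable
      note [measurable] = measurable_compose[OF measurable_snd borel_fst_snd_comp(1)[OF Am(1)], of borel] measurable_compose[OF measurable_snd borel_fst_snd_comp(2)[OF Am(2)], of borel]
        borel_fst_snd_comp(1)[OF Am(1)] borel_fst_snd_comp(2)[OF Am(2)]
      have "integrable (lborel \<Otimes>\<^sub>M lborel) (\<lambda>x. norm (H (fst x)) * norm (A' (fst (snd x)) * B' (snd (snd x))))"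
      proof (rule lborel_pair.Fubini_integrable)
        show "L1 (\<lambda>x. LBINT y. norm (norm (H (fst (x, y))) * norm (A' (fst (snd (x, y))) * B' (snd (snd (x, y))))))"
          using iH by (simp add: abs_mult)
        show "AE x in lborel. L1 (\<lambda>y. norm (H (fst (x, y))) * norm (A' (fst (snd (x, y))) * B' (snd (snd (x, y)))))"
          using integrable_norm[OF iAB] by (intro AE_I2 integrable_mult_right) simp
      qed measurable
      then show "integrable (lborel \<Otimes>\<^sub>M lborel) (case_prod ?f)"
      proof (rule bochner_bound)
        have "{x::(real \<times> real) \<times> (real \<times> real). fst (snd x) \<le> fst (fst x) \<and> snd (snd x) \<le> snd (fst x)} \<in> sets (borel \<Otimes>\<^sub>M borel)"
        proof -
          have "closed {x::(real \<times> real) \<times> (real \<times> real). fst (snd x) \<le> fst (fst x) \<and> snd (snd x) \<le> snd (fst x)}"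
            by (intro closed_Collect_conj closed_Collect_le continuous_intros)
          from borel_closed[OF this] show ?thesis by (simp only: borel_prod)
        qed
        moreover have "case_prod ?f = (\<lambda>x. H (fst x) * ind {x. fst (snd x) \<le> fst (fst x) \<and> snd (snd x) \<le> snd (fst x)} x * of_real (A' (fst (snd x)) * B' (snd (snd x))))"
          by (auto simp: indicator_def)
        ultimately show "case_prod ?f \<in> borel_measurable (lborel \<Otimes>\<^sub>M lborel)" by simp
        show "AE x in lborel \<Otimes>\<^sub>M lborel. norm (case_prod ?f x) \<le> norm (norm (H (fst x)) * norm (A' (fst (snd x)) * B' (snd (snd x))))"
          by (intro AE_I2) (auto simp: norm_mult indicator_def abs_mult)
      qed
    qed
    also have "\<dots> = (LBINT q. G q * of_real (A' (fst q) * B' (snd q)))"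
      unfolding G_def by (intro bochner_cong) (auto simp: integral_mult_left_zero)
    finally show ?thesis by (simp add: I_def A'_def B'_def)
  qed
  have iG: "L1 (\<lambda>q. ind (cbox (0, 0) (\<delta>, \<delta>)) q *\<^sub>R G q)"
    by (rule borel_integrable_compact) (auto intro: continuous_on_subset[OF cG])
  define W where "W q = ind (cbox (0, 0) (\<delta>, \<delta>)) q *\<^sub>R (v q - G q)" for q
  have iW: "L1 W"
    using integrable_mult_indicator[OF _ int(1), of "cbox (0, 0) (\<delta>, \<delta>)"] iG
    unfolding W_def[abs_def] scaleR_diff_right by (intro bochner_diff) auto
  have [measurable]: "W \<in> BM" using iW by auto
  \<comment> \<open>The boxes have positive lower ends because the antiderivatives must vanish near
    the axes to be admissible; the axes are approached only in the exhaustion below.\<close>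
  have box0: "(LBINT q. ind ({a<..<b} \<times> {c<..<d}) q *\<^sub>R W q) = 0" if ab: "0 < a" "b \<le> \<delta>" "0 < c" "d \<le> \<delta>" for a b c d
  proof -
    have z: "(LBINT q. W q * of_real (bump_pair n a b (fst q) * bump_pair n c d (snd q))) = 0" for n
    proof -
      let ?b = "\<lambda>q. complex_of_real (bump_pair n a b (fst q) * bump_pair n c d (snd q))"
      have out: "?b q = 0" if "q \<notin> cbox (0, 0) (\<delta>, \<delta>)" for q
        using that ab by (cases q) (auto simp: bump_pair_outside)
      have nb: "norm (?b q) \<le> 1" for q
      proof -
        have "bump_pair n a b (fst q) * bump_pair n c d (snd q) \<le> 1" using bump_pair_bounds by (intro mult_le_one) auto
        moreover have "0 \<le> bump_pair n a b (fst q) * bump_pair n c d (snd q)" using bump_pair_bounds by simp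
        ultimately show ?thesis by (simp only: norm_of_real abs_of_nonneg)
      qed
      note [measurable] = borel_fst_snd_comp(1)[OF borel_bump_pair[of n a b]] borel_fst_snd_comp(2)[OF borel_bump_pair[of n c d]]
      have i1: "L1 (\<lambda>q. v q * ?b q)" by (rule integrable_bounded_mult[OF int(1) _ nb]) measurable
      have "L1 (\<lambda>q. (ind (cbox (0, 0) (\<delta>, \<delta>)) q *\<^sub>R G q) * ?b q)" by (rule integrable_bounded_mult[OF iG _ nb]) measurable
      also have "(\<lambda>q. (ind (cbox (0, 0) (\<delta>, \<delta>)) q *\<^sub>R G q) * ?b q) = (\<lambda>q. G q * ?b q)"
      proof
        show "(ind (cbox (0, 0) (\<delta>, \<delta>)) q *\<^sub>R G q) * ?b q = G q * ?b q" for q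
          by (cases "q \<in> cbox (0, 0) (\<delta>, \<delta>)") (simp_all only: out indicator_simps mult_zero_right scaleR_one not_False_eq_True)
      qed
      finally have i2: "L1 (\<lambda>q. G q * ?b q)" .
      have "(LBINT q. W q * ?b q) = (LBINT q. v q * ?b q - G q * ?b q)"
      proof (rule bochner_cong)
        show "W q * ?b q = v q * ?b q - G q * ?b q" for q
          by (cases "q \<in> cbox (0, 0) (\<delta>, \<delta>)") (simp_all only: W_def out indicator_simps mult_zero_right scaleR_one diff_self left_diff_distrib not_False_eq_True)
      qed simp
      also have "\<dots> = 0" using key[OF ab, of n] i1 i2 by (subst Bochner_Integration.integral_diff) auto
      finally show ?thesis .
    qed
    have "(\<lambda>n. LBINT q. W q * of_real (bump_pair n a b (fst q) * bump_pair n c d (snd q))) \<longlonglongrightarrow>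
        (LBINT q. ind ({a<..<b} \<times> {c<..<d}) q *\<^sub>R W q)"
    proof (rule integral_dominated_convergence[where w="\<lambda>q. norm (W q)"])
      show "AE q in lborel. (\<lambda>n. W q * of_real (bump_pair n a b (fst q) * bump_pair n c d (snd q))) \<longlonglongrightarrow> ind ({a<..<b} \<times> {c<..<d}) q *\<^sub>R W q"
      proof (rule AE_I2)
        fix q
        have "(\<lambda>n. W q * of_real (bump_pair n a b (fst q) * bump_pair n c d (snd q))) \<longlonglongrightarrow> W q * of_real (ind {a<..<b} (fst q) * ind {c<..<d} (snd q))"
          by (intro tendsto_mult tendsto_of_real bump_pair_tendsto tendsto_const)
        moreover have "W q * of_real (ind {a<..<b} (fst q) * ind {c<..<d} (snd q)) = ind ({a<..<b} \<times> {c<..<d}) q *\<^sub>R W q"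
          by (cases q) (auto simp: indicator_def)
        ultimately show "(\<lambda>n. W q * of_real (bump_pair n a b (fst q) * bump_pair n c d (snd q))) \<longlonglongrightarrow> ind ({a<..<b} \<times> {c<..<d}) q *\<^sub>R W q" by simp
      qed
      show "AE q in lborel. norm (W q * of_real (bump_pair n a b (fst q) * bump_pair n c d (snd q))) \<le> norm (W q)" for n
      proof (rule AE_I2)
        fix q
        have "bump_pair n a b (fst q) * bump_pair n c d (snd q) \<le> 1" using bump_pair_bounds by (intro mult_le_one) auto
        moreover have "0 \<le> bump_pair n a b (fst q) * bump_pair n c d (snd q)" using bump_pair_bounds by simp
        ultimately show "norm (W q * of_real (bump_pair n a b (fst q) * bump_pair n c d (snd q))) \<le> norm (W q)"
          by (simp only: norm_mult norm_of_real abs_of_nonneg) (simp add: mult_left_le)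
      qed
      note [measurable] = borel_fst_snd_comp(1)[OF borel_bump_pair[of _ a b]] borel_fst_snd_comp(2)[OF borel_bump_pair[of _ c d]]
      have [measurable]: "{a<..<b} \<times> {c<..<d} \<in> sets borel" by (simp add: borel_Times)
      show "(\<lambda>q. ind ({a<..<b} \<times> {c<..<d}) q *\<^sub>R W q) \<in> borel_measurable lborel" by measurable
      show "(\<lambda>q. W q * of_real (bump_pair n a b (fst q) * bump_pair n c d (snd q))) \<in> borel_measurable lborel" for n by measurable
    qed (use iW in auto)
    then show ?thesis unfolding z by (simp add: LIMSEQ_const_iff)
  qed
  \<comment> \<open>Squares exhausting the open one; the shift by 2 keeps every lower end strictly
    below \<delta>.\<close>
  have "AE q in lborel. q \<in> {\<delta> / real (n + 2)<..<\<delta>} \<times> {\<delta> / real (n + 2)<..<\<delta>} \<longrightarrow> W q = 0" for n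
  proof -
    let ?e = "\<delta> / real (n + 2)"
    have e: "?e > 0" using \<delta> by simp
    have [measurable]: "{?e<..<\<delta>} \<times> {?e<..<\<delta>} \<in> sets borel" by (simp add: borel_Times)
    have "AE q in lborel. ind ({?e<..<\<delta>} \<times> {?e<..<\<delta>}) q *\<^sub>R W q = 0"
    proof (rule AE_zero_of_box_integrals)
      show "L1 (\<lambda>q. ind ({?e<..<\<delta>} \<times> {?e<..<\<delta>}) q *\<^sub>R W q)"
        using iW by (intro integrable_mult_indicator) (auto intro!: borel_Times)
      fix a b :: "real \<times> real"
      have "ind (box a b) q *\<^sub>R (ind ({?e<..<\<delta>} \<times> {?e<..<\<delta>}) q *\<^sub>R W q) =
        ind ({max ?e (fst a)<..<min \<delta> (fst b)} \<times> {max ?e (snd a)<..<min \<delta> (snd b)}) q *\<^sub>R W q" for q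
        by (cases q) (auto simp: indicator_def mem_box Basis_prod_def inner_prod_def)
      then show "(LBINT q. ind (box a b) q *\<^sub>R (ind ({?e<..<\<delta>} \<times> {?e<..<\<delta>}) q *\<^sub>R W q)) = 0"
        by (simp only:) (rule box0, use e in auto)
    qed
    then show ?thesis by eventually_elim (auto simp: indicator_def)
  qed
  then have "AE q in lborel. \<forall>n. q \<in> {\<delta> / real (n + 2)<..<\<delta>} \<times> {\<delta> / real (n + 2)<..<\<delta>} \<longrightarrow> W q = 0"
    by (subst AE_all_countable) blast
  then have "AE p in lborel. p \<in> {0<..<\<delta>} \<times> {0<..<\<delta>} \<longrightarrow> v p = G p"
  proof eventually_elim
    case (elim q)
    show ?case
    proof
      assume q: "q \<in> {0<..<\<delta>} \<times> {0<..<\<delta>}"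
      define e where "e = min (fst q) (snd q)"
      have e: "e > 0" using q by (auto simp: e_def)
      obtain n :: nat where n: "\<delta> / e < real n" using reals_Archimedean2 by blast
      have "\<delta> < real n * e" using n e by (simp add: pos_divide_less_eq)
      also have "\<dots> \<le> real (n + 2) * e" using e by simp
      finally have "\<delta> / real (n + 2) < e" by (simp add: pos_divide_less_eq mult.commute)
      then have "q \<in> {\<delta> / real (n + 2)<..<\<delta>} \<times> {\<delta> / real (n + 2)<..<\<delta>}" using q by (cases q) (auto simp: e_def)
      then have "W q = 0" using elim by blast
      moreover have "q \<in> cbox (0, 0) (\<delta>, \<delta>)" using q by (cases q) auto
      ultimately show "v q = G q" by (simp add: W_def)
    qed
  qed
  then show ?thesis using that cG by blast
qed

section \<open>Corner domains and traces\<close>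

lemma tendsto_dir: "(f \<longlongrightarrow> az) F \<Longrightarrow> ((\<lambda>x. dir (f x)) \<longlongrightarrow> dir az) F"
proof (rule vec_tendstoI)
  fix i :: 2 assume f: "(f \<longlongrightarrow> az) F"
  show "((\<lambda>x. dir (f x) $ i) \<longlongrightarrow> dir az $ i) F"
    using exhaust_2[of i] isCont_tendsto_compose[OF isCont_cos f] isCont_tendsto_compose[OF isCont_sin f] by auto
qed

text \<open>A reflex sector is not an intersection of half-planes, but its two halves are convex
  cones and sit in closed ones. The union of these is closed and covers the sector, the bisecting
  ray included.\<close>

lemma closure_sector_angles:
  assumes a: "- pi < azm" "azm < azM" "azM < pi" and x: "x \<in> closure (sector azm azM)" "x \<noteq> 0"
  shows "azm \<le> polar_angle x \<and> polar_angle x \<le> azM"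
proof -
  define az0 where "az0 = (azm + azM) / 2"
  have t: "azm < az0" "az0 < azM" "- pi < az0" "az0 < pi" "az0 - azm < pi" "azM - az0 < pi"
    using a by (auto simp: az0_def field_simps)
  let ?C = "\<lambda>a b. {x. 0 \<le> nrm b \<bullet> x} \<inter> {x. nrm a \<bullet> x \<le> 0}"
  have "closed (?C azm az0 \<union> ?C az0 azM)"
    by (intro closed_Un closed_Int closed_Collect_le continuous_intros)
  moreover have "sector azm azM \<subseteq> ?C azm az0 \<union> ?C az0 azM"
  proof
    fix y assume "y \<in> sector azm azM"
    then consider "y \<in> sector azm az0" | "y \<in> sector az0 azM" | "y \<in> ray az0" using sector_split[OF t(1,2)] by blast
    then show "y \<in> ?C azm az0 \<union> ?C az0 azM"
    proof cases
      case 1 then show ?thesis using cone_iff(1)[OF a(1) t(1,4,5)] by auto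
    next
      case 2 then show ?thesis using cone_iff(1)[OF t(3,2) a(3) t(6)] by auto
    next
      case 3
      then obtain s where s: "s > 0" "y = s *\<^sub>R dir az0" using ray_iff[OF t(3,4)] by auto
      have "sin (az0 - azm) \<ge> 0" using t by (intro sin_ge_zero) auto
      then have "sin (azm - az0) \<le> 0" using sin_minus[of "az0 - azm"] by simp
      then show ?thesis using s by (auto simp: nrm_dir mult_nonneg_nonpos)
    qed
  qed
  ultimately have "x \<in> ?C azm az0 \<union> ?C az0 azM" using x(1) closure_minimal by blast
  then show ?thesis
    using cone_iff(2)[OF a(1) t(1,4,5) x(2)] cone_iff(2)[OF t(3,2) a(3) t(6) x(2)] t by auto
qed

locale corner_domain =
  fixes \<Omega> :: "(real^2) set" and azm azM h :: real
  assumes angles: "- pi < azm" "azm < azM" "azM < pi" and h: "h > 0"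
    and \<Omega>: "open \<Omega>" "bounded \<Omega>" and corner: "\<Omega> \<inter> ball 0 h = sector_disc azm azM h" and vertex: "0 \<in> frontier \<Omega>"
begin

lemma mem_iff: "norm x < h \<Longrightarrow> x \<in> \<Omega> \<longleftrightarrow> x \<in> sector azm azM"
proof -
  assume "norm x < h"
  then have x: "x \<in> ball 0 h" by simp
  have "x \<in> \<Omega> \<inter> ball 0 h \<longleftrightarrow> x \<in> sector azm azM \<inter> ball 0 h" unfolding corner sector_disc_def ..
  then show ?thesis using x by blast
qed

lemma edge:
  assumes az: "az = azm \<or> az = azM" and t: "0 < t" "t < h"
  shows "t *\<^sub>R dir az \<in> frontier \<Omega>"
proof -
  define s where "s = (if az = azm then 1 else -1 :: real)"
  \<comment> \<open>Angles strictly inside the sector approaching the edge; with s the same formula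
    moves upwards from the lower edge and downwards from the upper one, and n + 2 keeps the shift
    below the full opening.\<close>
  define f where "f n = az + s * ((azM - azm) / real (n + 2))" for n
  have f1: "azm < f n" "f n < azM" for n
  proof -
    have "(azM - azm) / real (n + 2) < azM - azm" "0 < (azM - azm) / real (n + 2)"
      using angles by (auto simp: divide_less_eq)
    moreover define e where "e = (azM - azm) / real (n + 2)"
    ultimately have "0 < e" "e < azM - azm" by auto
    then show "azm < f n" "f n < azM" using az angles unfolding f_def s_def e_def[symmetric] by (auto split: if_splits)
  qed
  have "t *\<^sub>R dir (f n) \<in> \<Omega>" for n
  proof -
    have "polar_angle (t *\<^sub>R dir (f n)) = f n" using f1[of n] angles t by (intro polar_angle_dir) auto
    then have "t *\<^sub>R dir (f n) \<in> sector azm azM" using f1[of n] t by (auto simp: sector_def)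
    then show ?thesis using t by (subst mem_iff) auto
  qed
  moreover have "(\<lambda>n. t *\<^sub>R dir (f n)) \<longlonglongrightarrow> t *\<^sub>R dir az"
  proof (intro tendsto_scaleR tendsto_const tendsto_dir)
    have "(\<lambda>n. az + s * ((azM - azm) / real (n + 2))) \<longlonglongrightarrow> az + s * 0"
      by (intro tendsto_intros LIMSEQ_ignore_initial_segment[of "\<lambda>n. (azM - azm) / real n"] lim_const_over_n)
    then show "f \<longlonglongrightarrow> az" by (simp add: f_def[abs_def])
  qed
  ultimately have 1: "t *\<^sub>R dir az \<in> closure \<Omega>" unfolding closure_sequential
    by (intro exI[of _ "\<lambda>n. t *\<^sub>R dir (f n)"]) auto
  have "polar_angle (t *\<^sub>R dir az) = az" using az angles t by (intro polar_angle_dir) auto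
  then have "t *\<^sub>R dir az \<notin> sector azm azM" using az by (auto simp: sector_def)
  then have "t *\<^sub>R dir az \<notin> \<Omega>" using t by (subst mem_iff) auto
  then show ?thesis using 1 \<Omega> by (simp add: frontier_def interior_open)
qed

lemma frontier_eq: "frontier \<Omega> \<inter> ball 0 h = insert 0 (seg azm h \<union> seg azM h)"
proof (intro equalityI subsetI)
  fix x assume x: "x \<in> frontier \<Omega> \<inter> ball 0 h"
  then have nx: "norm x < h" by simp
  have xc: "x \<in> closure \<Omega>" "x \<notin> \<Omega>" using x \<Omega> by (auto simp: frontier_def interior_open)
  show "x \<in> insert 0 (seg azm h \<union> seg azM h)"
  proof (cases "x = 0")
    case False
    have "x \<in> closure (ball 0 h \<inter> \<Omega>)" using open_Int_closure_subset[of "ball 0 h" \<Omega>] xc(1) nx by auto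
    moreover have "ball 0 h \<inter> \<Omega> \<subseteq> sector azm azM" using corner unfolding sector_disc_def by blast
    ultimately have "x \<in> closure (sector azm azM)" using closure_mono by blast
    from closure_sector_angles[OF angles this False]
    have p: "azm \<le> polar_angle x" "polar_angle x \<le> azM" by auto
    have "x \<notin> sector azm azM" using mem_iff[OF nx] xc by blast
    then have "polar_angle x = azm \<or> polar_angle x = azM" using p False by (auto simp: sector_def)
    moreover have "x \<in> seg (polar_angle x) h"
      using polar_form(1)[OF False] False nx by (intro image_eqI[of _ _ "norm x"]) auto
    ultimately show ?thesis by auto
  qed simp
next
  fix x assume "x \<in> insert 0 (seg azm h \<union> seg azM h)"
  then show "x \<in> frontier \<Omega> \<inter> ball 0 h" using vertex h edge by auto
qed

sublocale corner_frontier \<Omega> azm azM h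
proof
  show "seg azm h \<inter> seg azM h = {}"
  proof -
    have False if "s *\<^sub>R dir azm = t *\<^sub>R dir azM" "0 < s" "0 < t" for s t
    proof -
      have "azm = azM" using polar_angle_dir[OF that(2), of azm] polar_angle_dir[OF that(3), of azM] that(1) angles by simp
      then show False using angles by simp
    qed
    then show ?thesis by auto
  qed
qed (rule frontier_eq, rule h)

end

section \<open>Mean convergence and traces along a coordinate axis\<close>

lemma ennreal_square_tendsto_0:
  fixes X :: "nat \<Rightarrow> ennreal"
  assumes "(\<lambda>n. (X n)\<^sup>2) \<longlonglongrightarrow> 0" shows "X \<longlonglongrightarrow> 0"
proof (rule order_tendstoI)
  fix a :: ennreal assume "0 < a"
  then have "0 < a\<^sup>2" by (simp add: zero_less_iff_neq_zero)
  from order_tendstoD(2)[OF assms this] show "\<forall>\<^sub>F n in sequentially. X n < a"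
    by eventually_elim (meson not_less power_mono zero_le)
qed simp

text \<open>Cauchy-Schwarz on a set of finite measure. Traces and H^1 approximations are given in
  the square mean, while limits under integrals with bounded factors need only the first
  mean.\<close>

lemma L2_imp_L1:
  fixes f :: "nat \<Rightarrow> 'a \<Rightarrow> complex"
  assumes [measurable]: "\<And>n. f n \<in> borel_measurable M" "A \<in> sets M" and A: "emeasure M A < \<infinity>"
    and lim: "(\<lambda>n. \<integral>\<^sup>+x. ennreal ((norm (f n x))\<^sup>2) * ind A x \<partial>M) \<longlonglongrightarrow> 0"
  shows "(\<lambda>n. \<integral>\<^sup>+x. ennreal (norm (f n x)) * ind A x \<partial>M) \<longlonglongrightarrow> 0"
proof (rule ennreal_square_tendsto_0, rule tendsto_sandwich[of "\<lambda>_. 0"])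
  show "\<forall>\<^sub>F n in sequentially. (\<integral>\<^sup>+x. ennreal (norm (f n x)) * ind A x \<partial>M)\<^sup>2 \<le> emeasure M A * (\<integral>\<^sup>+x. ennreal ((norm (f n x))\<^sup>2) * ind A x \<partial>M)"
  proof (intro always_eventually allI)
    fix n
    have "(\<integral>\<^sup>+x. ennreal (norm (f n x)) * ind A x \<partial>M)\<^sup>2 = (\<integral>\<^sup>+x. ind A x * (ennreal (norm (f n x)) * ind A x) \<partial>M)\<^sup>2"
      by (intro arg_cong[where f="\<lambda>x. x\<^sup>2"] nn_integral_cong) (auto simp: indicator_def)
    also have "\<dots> \<le> (\<integral>\<^sup>+x. (ind A x)\<^sup>2 \<partial>M) * (\<integral>\<^sup>+x. (ennreal (norm (f n x)) * ind A x)\<^sup>2 \<partial>M)"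
      by (rule Cauchy_Schwarz_nn_integral) measurable
    also have "(\<integral>\<^sup>+x. (ind A x)\<^sup>2 \<partial>M) = (\<integral>\<^sup>+x. ind A x \<partial>M)"
      by (intro nn_integral_cong) (auto simp: indicator_def)
    also have "\<dots> = emeasure M A" by simp
    also have "(\<integral>\<^sup>+x. (ennreal (norm (f n x)) * ind A x)\<^sup>2 \<partial>M) = (\<integral>\<^sup>+x. ennreal ((norm (f n x))\<^sup>2) * ind A x \<partial>M)"
      by (intro nn_integral_cong) (auto simp: indicator_def ennreal_power)
    finally show "(\<integral>\<^sup>+x. ennreal (norm (f n x)) * ind A x \<partial>M)\<^sup>2 \<le> emeasure M A * (\<integral>\<^sup>+x. ennreal ((norm (f n x))\<^sup>2) * ind A x \<partial>M)" .
  qed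
  have "(\<lambda>n. emeasure M A * (\<integral>\<^sup>+x. ennreal ((norm (f n x))\<^sup>2) * ind A x \<partial>M)) \<longlonglongrightarrow> emeasure M A * 0"
    by (intro ennreal_tendsto_cmult lim) (use A in \<open>simp add: less_top\<close>)
  then show "(\<lambda>n. emeasure M A * (\<integral>\<^sup>+x. ennreal ((norm (f n x))\<^sup>2) * ind A x \<partial>M)) \<longlonglongrightarrow> 0" by simp
qed auto

lemma rep_L1_tendsto:
  assumes \<Omega>: "open \<Omega>" "bounded \<Omega>" and r: "rep \<Omega> f f'" and \<psi>[measurable]: "\<And>n. \<psi> n \<in> BM"
    and lim: "(\<lambda>n. \<integral>\<^sup>+x. ennreal ((norm (\<psi> n x - f x))\<^sup>2) \<partial>lebesgue_on \<Omega>) \<longlonglongrightarrow> 0"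
  shows "(\<lambda>n. LNN x. ennreal (norm (ind \<Omega> x *\<^sub>R \<psi> n x - f' x))) \<longlonglongrightarrow> 0"
proof -
  have [measurable]: "f' \<in> BM" "\<Omega> \<in> sets borel" using r \<Omega> by (auto simp: rep_def)
  let ?F = "\<lambda>n x. ind \<Omega> x *\<^sub>R \<psi> n x - f' x"
  have "(\<integral>\<^sup>+x. ennreal ((norm (\<psi> n x - f x))\<^sup>2) \<partial>lebesgue_on \<Omega>) = (LNN x. ennreal ((norm (?F n x))\<^sup>2) * ind \<Omega> x)" for n
  proof -
    have "(\<integral>\<^sup>+x. ennreal ((norm (\<psi> n x - f x))\<^sup>2) \<partial>lebesgue_on \<Omega>) = (LNN x. ennreal ((norm (\<psi> n x - f x))\<^sup>2) * ind \<Omega> x)"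
      using \<Omega> by (subst nn_integral_restrict_space) (auto simp: nn_integral_completion)
    also have "\<dots> = (LNN x. ennreal ((norm (?F n x))\<^sup>2) * ind \<Omega> x)"
    proof (rule nn_integral_cong_AE)
      have "AE x in lborel. x \<in> \<Omega> \<longrightarrow> f x = f' x" using r by (auto simp: rep_def)
      then show "AE x in lborel. ennreal ((norm (\<psi> n x - f x))\<^sup>2) * ind \<Omega> x = ennreal ((norm (?F n x))\<^sup>2) * ind \<Omega> x"
        by eventually_elim (auto simp: indicator_def)
    qed
    finally show ?thesis .
  qed
  with lim have "(\<lambda>n. LNN x. ennreal ((norm (?F n x))\<^sup>2) * ind \<Omega> x) \<longlonglongrightarrow> 0" by simp
  then have "(\<lambda>n. LNN x. ennreal (norm (?F n x)) * ind \<Omega> x) \<longlonglongrightarrow> 0"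
    by (rule L2_imp_L1[rotated 3]) (use emeasure_bounded_finite[OF \<Omega>(2)] in auto)
  also have "(\<lambda>n. LNN x. ennreal (norm (?F n x)) * ind \<Omega> x) = (\<lambda>n. LNN x. ennreal (norm (?F n x)))"
    using r by (intro ext nn_integral_cong) (auto simp: indicator_def rep_def)
  finally show ?thesis .
qed

lemma rep_square_integrable:
  assumes \<Omega>: "open \<Omega>" "bounded \<Omega>" and s: "square_integrable \<Omega> f"
  obtains f' where "rep \<Omega> f f'" "L1 f'"
proof -
  have [measurable]: "\<Omega> \<in> sets borel" using \<Omega> by auto
  obtain f' where r: "rep \<Omega> f f'" using rep_exists[of \<Omega> f] s \<Omega> by (auto simp: square_integrable_def)
  have [measurable]: "f' \<in> BM" using r by (auto simp: rep_def)
  have "f \<in> borel_measurable (lebesgue_on \<Omega>)" using s by (simp add: square_integrable_def)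
  have "integrable (lebesgue_on \<Omega>) f"
  proof (rule bochner_bound[of _ "\<lambda>x. 1 + (norm (f x))\<^sup>2"])
    have "integrable (lebesgue_on \<Omega>) (\<lambda>x. 1 :: real)"
      using emeasure_bounded_finite[OF \<Omega>(2)] by (intro finite_measure.integrable_const finite_measureI)
        (auto simp: emeasure_restrict_space less_top emeasure_completion)
    then show "integrable (lebesgue_on \<Omega>) (\<lambda>x. 1 + (norm (f x))\<^sup>2)"
      using s by (intro bochner_add) (auto simp: square_integrable_def)
    have "norm (f x) \<le> norm (1 + (norm (f x))\<^sup>2)" for x
    proof -
      have "0 \<le> (norm (f x) - 1)\<^sup>2" by simp
      then have "2 * norm (f x) \<le> 1 + (norm (f x))\<^sup>2" unfolding power2_diff by simp
      then have "norm (f x) \<le> 1 + (norm (f x))\<^sup>2" using norm_ge_zero[of "f x"] by linarith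
      then show ?thesis by simp
    qed
    then show "AE x in lebesgue_on \<Omega>. norm (f x) \<le> norm (1 + (norm (f x))\<^sup>2)" by simp
  qed fact
  then have "L1 f'" using rep_integrable[OF _ r] \<Omega> by simp
  with r show ?thesis by (rule that)
qed

lemma nn_integral_prod_real:
  fixes f :: "real \<times> real \<Rightarrow> ennreal"
  assumes "f \<in> BM"
  shows "(LNN p. f p) = (LNN s. \<integral>\<^sup>+t. f (s, t) \<partial>lborel)"
proof -
  have "f \<in> borel_measurable (lborel \<Otimes>\<^sub>M lborel)" using assms by (simp add: lborel_prod)
  from lborel.nn_integral_fst[OF this] show ?thesis by (simp add: lborel_prod)
qed

text \<open>Absolute continuity of the integral: every point eventually leaves the shrinking strips,
  and |D| is an integrable majorant.\<close>

lemma strip_integral_small: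
  fixes D :: "real \<times> real \<Rightarrow> complex"
  assumes D: "L1 D" and e: "e > 0"
  obtains \<tau>0 where "\<tau>0 > 0" "\<And>\<tau>. \<tau> \<le> \<tau>0 \<Longrightarrow> (LNN p. ind ({0<..<\<delta>} \<times> {0<..<\<tau>}) p * ennreal (norm (D p))) \<le> ennreal e"
proof -
  have [measurable]: "D \<in> BM" using D by auto
  have [measurable]: "{0<..<a} \<times> {0<..<b::real} \<in> sets borel" for a b :: real by (intro borel_Times) auto
  let ?u = "\<lambda>n p. ind ({0<..<\<delta>} \<times> {0<..<1 / real (n + 1)}) p * ennreal (norm (D p))"
  have "(\<lambda>n. LNN p. ?u n p) \<longlonglongrightarrow> (\<integral>\<^sup>+p. 0 \<partial>(lborel :: (real \<times> real) measure))"
  proof (rule nn_integral_dominated_convergence[where w="\<lambda>p. ennreal (norm (D p))"])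
    show "(LNN p. ennreal (norm (D p))) < \<infinity>" using D by (simp add: integrable_iff_bounded)
    show "AE p in lborel. (\<lambda>n. ?u n p) \<longlonglongrightarrow> 0"
    proof (rule AE_I2)
      fix p :: "real \<times> real"
      show "(\<lambda>n. ?u n p) \<longlonglongrightarrow> 0"
      proof (cases "snd p > 0")
        case True
        have l: "(\<lambda>n. 1 / real (n + 1)) \<longlonglongrightarrow> 0" by (rule LIMSEQ_ignore_initial_segment[OF lim_const_over_n])
        have "\<forall>\<^sub>F n in sequentially. 1 / real (n + 1) < snd p" by (rule order_tendstoD(2)[OF l True])
        then have "\<forall>\<^sub>F n in sequentially. ?u n p = 0"
          by eventually_elim (cases p, auto simp: indicator_def)
        then show ?thesis by (rule tendsto_eventually)
      next
        case False
        then have "?u n p = 0" for n by (cases p) (auto simp: indicator_def)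
        then show ?thesis by (simp only: tendsto_const)
      qed
    qed
  qed (auto simp: indicator_def)
  then have "(\<lambda>n. LNN p. ?u n p) \<longlonglongrightarrow> 0" by simp
  from order_tendstoD(2)[OF this, of "ennreal e"] e obtain n where n: "(LNN p. ?u n p) < ennreal e"
    by (auto simp: eventually_sequentially)
  show ?thesis
  proof (rule that[of "1 / real (n + 1)"])
    fix \<tau> assume \<tau>: "\<tau> \<le> 1 / real (n + 1)"
    have "(LNN p. ind ({0<..<\<delta>} \<times> {0<..<\<tau>}) p * ennreal (norm (D p))) \<le> (LNN p. ?u n p)"
      by (intro nn_integral_mono mult_right_mono) (use \<tau> in \<open>auto simp: indicator_def\<close>)
    then show "(LNN p. ind ({0<..<\<delta>} \<times> {0<..<\<tau>}) p * ennreal (norm (D p))) \<le> ennreal e" using n by auto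
  qed simp
qed

lemma ennreal_norm_triangle:
  fixes a b c d e :: complex
  shows "ennreal (norm (a - e)) \<le> ennreal (norm (b - a)) + (ennreal (norm (b - c)) + (ennreal (norm (c - d)) + ennreal (norm (d - e))))"
proof -
  have "norm (a - e) \<le> norm (b - a) + (norm (b - c) + (norm (c - d) + norm (d - e)))"
    using norm_triangle_ineq4[of "b - e" "b - a"] norm_triangle_ineq[of "b - c" "c - e"] norm_triangle_ineq[of "c - d" "d - e"] by simp
  then show ?thesis by (simp flip: ennreal_plus add: ennreal_leI)
qed

text \<open>Two notions of boundary value have to agree: the mean limit g of the smooth
  approximations on the axis, and the continuous extension G from the interior. Four steps connect
  g(s) with G(s, 0): to the approximation on the axis, up to height t at the cost of its derivative
  in t, across to G(s, t), and down again by continuity of G. The second is controlled only in the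
  mean, hence the averaging over a strip.\<close>

lemma trace_on_axis:
  fixes \<Psi> D :: "nat \<Rightarrow> real \<times> real \<Rightarrow> complex"
  assumes \<delta>: "\<delta> > 0" and c: "\<And>n. continuous_on UNIV (\<Psi> n)" "\<And>n. continuous_on UNIV (D n)"
    and d: "\<And>n s t. ((\<lambda>t. \<Psi> n (s, t)) has_vector_derivative D n (s, t)) (at t)"
    and G: "continuous_on UNIV G" and Dt: "L1 Dt" and g[measurable]: "g \<in> BM"
    and l1: "(\<lambda>n. LNN p. ind ({0<..<\<delta>} \<times> {0<..<\<delta>}) p * ennreal (norm (\<Psi> n p - G p))) \<longlonglongrightarrow> 0"
    and l2: "(\<lambda>n. LNN p. ind ({0<..<\<delta>} \<times> {0<..<\<delta>}) p * ennreal (norm (D n p - Dt p))) \<longlonglongrightarrow> 0"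
    and l3: "(\<lambda>n. LNN s. ind {0<..<\<delta>} s * ennreal (norm (\<Psi> n (s, 0) - g s))) \<longlonglongrightarrow> 0"
  shows "AE s in lborel. s \<in> {0<..<\<delta>} \<longrightarrow> g s = G (s, 0)"
proof -
  have c2: "continuous_on UNIV (\<lambda>t. F (s, t))" "continuous_on UNIV (\<lambda>t. F (t, s))" if "continuous_on UNIV F" for F :: "real \<times> real \<Rightarrow> complex" and s :: real
    by (auto intro!: continuous_on_compose2[OF that] continuous_intros)
  note [measurable] = borel_measurable_continuous_onI[OF c(1)] borel_measurable_continuous_onI[OF c(2)] borel_measurable_continuous_onI[OF G]
    borel_measurable_continuous_onI[OF c2(1)[OF c(1)]] borel_measurable_continuous_onI[OF c2(1)[OF c(2)]] borel_measurable_continuous_onI[OF c2(1)[OF G]]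
    borel_measurable_continuous_onI[OF c2(2)[OF c(1)]] borel_measurable_continuous_onI[OF c2(2)[OF G]]
  have [measurable]: "Dt \<in> BM" using Dt by auto
  have [measurable]: "{0<..<a} \<times> {0<..<b::real} \<in> sets borel" for a b :: real by (intro borel_Times) auto
  define L where "L = (LNN s. ind {0<..<\<delta>} s * ennreal (norm (g s - G (s, 0))))"
  have key: "L \<le> ennreal ((\<delta> + 1) * e)" if e: "e > 0" for e
  proof -
    have "uniformly_continuous_on (cbox (0, 0) (\<delta>, \<delta>)) G"
      by (intro compact_uniformly_continuous continuous_on_subset[OF G]) auto
    then obtain \<rho> where \<rho>: "\<rho> > 0" "\<And>p q. p \<in> cbox (0, 0) (\<delta>, \<delta>) \<Longrightarrow> q \<in> cbox (0, 0) (\<delta>, \<delta>) \<Longrightarrow> dist q p < \<rho> \<Longrightarrow> dist (G q) (G p) < e"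
      unfolding uniformly_continuous_on_def using e by metis
    obtain \<tau>0 where \<tau>0: "\<tau>0 > 0" "\<And>\<tau>. \<tau> \<le> \<tau>0 \<Longrightarrow> (LNN p. ind ({0<..<\<delta>} \<times> {0<..<\<tau>}) p * ennreal (norm (Dt p))) \<le> ennreal e"
      using strip_integral_small[OF Dt e] by blast
    \<comment> \<open>The height is small enough for uniform continuity of \<open>G\<close>, for the
      integral of the limiting derivative over the strip, and to stay within the square.\<close>
    define \<tau> where "\<tau> = min \<tau>0 (min \<delta> (\<rho> / 2))"
    have \<tau>: "\<tau> > 0" "\<tau> \<le> \<delta>" "\<tau> < \<rho>" "\<tau> \<le> \<tau>0" using \<tau>0 \<rho> \<delta> by (auto simp: \<tau>_def)
    have G1: "norm (G (s, t) - G (s, 0)) \<le> e" if "s \<in> {0<..<\<delta>}" "t \<in> {0<..<\<tau>}" for s t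
    proof -
      have "dist (s, t) (s, 0) < \<rho>" using that \<tau> by (simp add: dist_Pair_Pair dist_real_def)
      then have "dist (G (s, t)) (G (s, 0)) < e" using that \<tau> \<delta> by (intro \<rho>(2)) auto
      then show ?thesis by (simp add: dist_norm)
    qed
    define a b d where "a n = (LNN s. ind {0<..<\<delta>} s * ennreal (norm (\<Psi> n (s, 0) - g s)))"
      and "b n = (LNN p. ind ({0<..<\<delta>} \<times> {0<..<\<delta>}) p * ennreal (norm (\<Psi> n p - G p)))"
      and "d n = (LNN p. ind ({0<..<\<delta>} \<times> {0<..<\<delta>}) p * ennreal (norm (D n p - Dt p)))" for n
    have iR: "ind ({0<..<\<delta>} \<times> {0<..<\<tau>}) (s, t) = ind {0<..<\<delta>} s * (ind {0<..<\<tau>} t :: ennreal)" for s t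
      by (auto simp: indicator_def)
    \<comment> \<open>Averaging over heights below \<tau> multiplies every term by \<tau> except the
      area term \<open>b n\<close>. That one tends to 0 while \<tau> is kept fixed, so \<tau> can be
      divided out after the limit in n and the rest is of order e.\<close>
    have step: "ennreal \<tau> * L \<le> ennreal \<tau> * a n + (b n + (ennreal \<tau> * ennreal (\<delta> * e) + ennreal \<tau> * (d n + ennreal e)))" for n
    proof -
      define I where "I s = (LNN r. ind {0<..<\<tau>} r * ennreal (norm (D n (s, r))))" for s
      have pw: "ennreal (norm (g s - G (s, 0))) \<le> ennreal (norm (\<Psi> n (s, 0) - g s)) + (ennreal (norm (\<Psi> n (s, t) - G (s, t))) + (ennreal e + I s))"
        if st: "s \<in> {0<..<\<delta>}" "t \<in> {0<..<\<tau>}" for s t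
      proof -
        have i: "L1 (\<lambda>r. ind {0..t} r *\<^sub>R D n (s, r))"
          by (rule borel_integrable_compact) (auto intro: continuous_on_subset[OF c2(1)[OF c(2)]])
        have "\<Psi> n (s, t) - \<Psi> n (s, 0) = (LBINT r. ind {0..t} r *\<^sub>R D n (s, r))"
          by (rule integral_FTC_atLeastAtMost[symmetric])
            (use st d in \<open>auto intro: has_vector_derivative_at_within continuous_on_subset[OF c2(1)[OF c(2)]]\<close>)
        then have "ennreal (norm (\<Psi> n (s, t) - \<Psi> n (s, 0))) \<le> (LNN r. ennreal (norm (ind {0..t} r *\<^sub>R D n (s, r))))"
          using integral_norm_bound_ennreal[OF i] by simp
        also have "\<dots> \<le> I s" unfolding I_def
        proof (rule nn_integral_mono_AE)
          show "AE r in lborel. ennreal (norm (ind {0..t} r *\<^sub>R D n (s, r))) \<le> ind {0<..<\<tau>} r * ennreal (norm (D n (s, r)))"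
            using AE_lborel_singleton[of "0::real"] by eventually_elim (use st in \<open>auto simp: indicator_def\<close>)
        qed
        finally have 1: "ennreal (norm (\<Psi> n (s, 0) - \<Psi> n (s, t))) \<le> I s" by (simp add: norm_minus_commute)
        have "ennreal (norm (g s - G (s, 0))) \<le> ennreal (norm (\<Psi> n (s, 0) - g s)) + (ennreal (norm (\<Psi> n (s, 0) - \<Psi> n (s, t))) + (ennreal (norm (\<Psi> n (s, t) - G (s, t))) + ennreal (norm (G (s, t) - G (s, 0)))))"
          by (rule ennreal_norm_triangle)
        also have "\<dots> \<le> ennreal (norm (\<Psi> n (s, 0) - g s)) + (I s + (ennreal (norm (\<Psi> n (s, t) - G (s, t))) + ennreal e))"
          by (intro add_mono order_refl 1 ennreal_leI G1 st)
        finally show ?thesis by (simp only: ac_simps)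
      qed
      have isnd[measurable]: "(\<lambda>p::real \<times> real. ind {0<..<\<tau>} (snd p) :: ennreal) \<in> BM"
        by (rule borel_fst_snd_comp(2)) simp
      have In[measurable]: "I \<in> BM"
      proof -
        have "(\<lambda>p. ind {0<..<\<tau>} (snd p) * ennreal (norm (D n p))) \<in> borel_measurable (lborel \<Otimes>\<^sub>M lborel)"
          using isnd by (simp add: lborel_prod)
        from lborel.borel_measurable_nn_integral_fst[OF this] show ?thesis by (simp add: I_def[abs_def])
      qed
      have i\<tau>: "(LNN t. ind {0<..<\<tau>} t * C) = ennreal \<tau> * C" for C
        using \<tau> by (subst nn_integral_multc) auto
      have s1: "ennreal \<tau> * ennreal (norm (g s - G (s, 0))) \<le> ennreal \<tau> * ennreal (norm (\<Psi> n (s, 0) - g s)) +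
         ((LNN t. ind {0<..<\<tau>} t * ennreal (norm (\<Psi> n (s, t) - G (s, t)))) + (ennreal \<tau> * ennreal e + ennreal \<tau> * I s))"
        if s: "s \<in> {0<..<\<delta>}" for s
      proof -
        have "ennreal \<tau> * ennreal (norm (g s - G (s, 0))) = (LNN t. ind {0<..<\<tau>} t * ennreal (norm (g s - G (s, 0))))" by (simp only: i\<tau>)
        also have "\<dots> \<le> (LNN t. ind {0<..<\<tau>} t * ennreal (norm (\<Psi> n (s, 0) - g s)) + (ind {0<..<\<tau>} t * ennreal (norm (\<Psi> n (s, t) - G (s, t))) +
           (ind {0<..<\<tau>} t * ennreal e + ind {0<..<\<tau>} t * I s)))"
          by (intro nn_integral_mono) (use pw[OF s] in \<open>auto simp: indicator_def\<close>)
        also have "\<dots> = ennreal \<tau> * ennreal (norm (\<Psi> n (s, 0) - g s)) +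
         ((LNN t. ind {0<..<\<tau>} t * ennreal (norm (\<Psi> n (s, t) - G (s, t)))) + (ennreal \<tau> * ennreal e + ennreal \<tau> * I s))"
          by (subst nn_integral_add; (measurable; fail)?)+ (simp only: i\<tau>)
        finally show ?thesis .
      qed
      let ?J = "\<lambda>s. \<integral>\<^sup>+t. ind {0<..<\<tau>} t * ennreal (norm (\<Psi> n (s, t) - G (s, t))) \<partial>lborel"
      have Jm[measurable]: "?J \<in> BM"
      proof -
        have "(\<lambda>p. ind {0<..<\<tau>} (snd p) * ennreal (norm (\<Psi> n p - G p))) \<in> borel_measurable (lborel \<Otimes>\<^sub>M lborel)"
          using isnd by (simp add: lborel_prod)
        from lborel.borel_measurable_nn_integral_fst[OF this] show ?thesis by simp
      qed
      have "ennreal \<tau> * L = (LNN s. ind {0<..<\<delta>} s * (ennreal \<tau> * ennreal (norm (g s - G (s, 0)))))"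
        unfolding L_def by (subst nn_integral_cmult[symmetric]) (auto simp: ac_simps)
      also have "\<dots> \<le> (LNN s. ennreal \<tau> * (ind {0<..<\<delta>} s * ennreal (norm (\<Psi> n (s, 0) - g s))) + (ind {0<..<\<delta>} s * ?J s +
          (ind {0<..<\<delta>} s * (ennreal \<tau> * ennreal e) + ennreal \<tau> * (ind {0<..<\<delta>} s * I s))))"
      proof (intro nn_integral_mono)
        fix s :: real
        show "ind {0<..<\<delta>} s * (ennreal \<tau> * ennreal (norm (g s - G (s, 0)))) \<le> ennreal \<tau> * (ind {0<..<\<delta>} s * ennreal (norm (\<Psi> n (s, 0) - g s))) + (ind {0<..<\<delta>} s * ?J s +
          (ind {0<..<\<delta>} s * (ennreal \<tau> * ennreal e) + ennreal \<tau> * (ind {0<..<\<delta>} s * I s)))"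
          using s1[of s] by (cases "s \<in> {0<..<\<delta>}") auto
      qed
      also have "\<dots> = ennreal \<tau> * a n + ((LNN s. ind {0<..<\<delta>} s * ?J s) + ((LNN s. ind {0<..<\<delta>} s * (ennreal \<tau> * ennreal e)) + ennreal \<tau> * (LNN s. ind {0<..<\<delta>} s * I s)))"
        by (subst nn_integral_add; (measurable; fail)?)+ (simp add: a_def nn_integral_cmult)
      also have "(LNN s. ind {0<..<\<delta>} s * (ennreal \<tau> * ennreal e)) = ennreal \<tau> * ennreal (\<delta> * e)"
        using \<delta> e by (subst nn_integral_multc) (auto simp: ennreal_mult ac_simps)
      also have "(LNN s. ind {0<..<\<delta>} s * ?J s) \<le> b n"
      proof -
        have "(LNN s. ind {0<..<\<delta>} s * ?J s) = (LNN s. \<integral>\<^sup>+t. ind ({0<..<\<delta>} \<times> {0<..<\<tau>}) (s, t) * ennreal (norm (\<Psi> n (s, t) - G (s, t))) \<partial>lborel)"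
          by (intro nn_integral_cong, subst nn_integral_cmult[symmetric]) (auto simp: iR ac_simps)
        also have "\<dots> = (LNN p. ind ({0<..<\<delta>} \<times> {0<..<\<tau>}) p * ennreal (norm (\<Psi> n p - G p)))"
          by (rule nn_integral_prod_real[symmetric]) measurable
        also have "\<dots> \<le> b n" unfolding b_def
          by (intro nn_integral_mono mult_right_mono) (use \<tau> in \<open>auto simp: indicator_def\<close>)
        finally show ?thesis .
      qed
      also have "(LNN s. ind {0<..<\<delta>} s * I s) \<le> d n + ennreal e"
      proof -
        have "(LNN s. ind {0<..<\<delta>} s * I s) = (LNN s. \<integral>\<^sup>+t. ind ({0<..<\<delta>} \<times> {0<..<\<tau>}) (s, t) * ennreal (norm (D n (s, t))) \<partial>lborel)"
          unfolding I_def by (intro nn_integral_cong, subst nn_integral_cmult[symmetric]) (auto simp: iR ac_simps)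
        also have "\<dots> = (LNN p. ind ({0<..<\<delta>} \<times> {0<..<\<tau>}) p * ennreal (norm (D n p)))"
          by (rule nn_integral_prod_real[symmetric]) measurable
        also have "\<dots> \<le> (LNN p. ind ({0<..<\<delta>} \<times> {0<..<\<delta>}) p * ennreal (norm (D n p - Dt p)) + ind ({0<..<\<delta>} \<times> {0<..<\<tau>}) p * ennreal (norm (Dt p)))"
        proof (intro nn_integral_mono)
          fix p :: "real \<times> real"
          have "ennreal (norm (D n p)) \<le> ennreal (norm (D n p - Dt p)) + ennreal (norm (Dt p))"
            using norm_triangle_ineq[of "D n p - Dt p" "Dt p"] by (simp flip: ennreal_plus add: ennreal_leI)
          then show "ind ({0<..<\<delta>} \<times> {0<..<\<tau>}) p * ennreal (norm (D n p)) \<le> ind ({0<..<\<delta>} \<times> {0<..<\<delta>}) p * ennreal (norm (D n p - Dt p)) + ind ({0<..<\<delta>} \<times> {0<..<\<tau>}) p * ennreal (norm (Dt p))"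
            using \<tau> by (cases "p \<in> {0<..<\<delta>} \<times> {0<..<\<tau>}") auto
        qed
        also have "\<dots> = d n + (LNN p. ind ({0<..<\<delta>} \<times> {0<..<\<tau>}) p * ennreal (norm (Dt p)))"
          unfolding d_def by (rule nn_integral_add) measurable
        also have "\<dots> \<le> d n + ennreal e" by (intro add_mono order_refl \<tau>0 \<tau>)
        finally show ?thesis .
      qed
      finally show ?thesis by (simp add: add_mono mult_left_mono)
    qed
    have "(\<lambda>n. ennreal \<tau> * a n + (b n + (ennreal \<tau> * ennreal (\<delta> * e) + ennreal \<tau> * (d n + ennreal e)))) \<longlonglongrightarrow>
        ennreal \<tau> * 0 + (0 + (ennreal \<tau> * ennreal (\<delta> * e) + ennreal \<tau> * (0 + ennreal e)))"
      using l1 l2 l3 unfolding a_def b_def d_def by (intro tendsto_add ennreal_tendsto_cmult tendsto_const) auto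
    then have "ennreal \<tau> * L \<le> ennreal \<tau> * 0 + (0 + (ennreal \<tau> * ennreal (\<delta> * e) + ennreal \<tau> * (0 + ennreal e)))"
      by (rule LIMSEQ_le_const) (use step in blast)
    also have "\<dots> = ennreal \<tau> * ennreal ((\<delta> + 1) * e)"
      using \<tau> \<delta> e by (simp add: distrib_left[symmetric] flip: ennreal_plus) (simp add: algebra_simps)
    finally show ?thesis using \<tau> by (subst (asm) ennreal_mult_le_mult_iff) auto
  qed
  have "L = 0"
  proof -
    have "L \<le> 0 + ennreal e" if "e > 0" for e
      using key[of "e / (\<delta> + 1)"] that \<delta> by simp
    then show ?thesis using ennreal_le_epsilon[of 0 L] by simp
  qed
  then have "AE s in lborel. ind {0<..<\<delta>} s * ennreal (norm (g s - G (s, 0))) = 0"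
    unfolding L_def by (subst (asm) nn_integral_0_iff_AE) auto
  then show ?thesis by eventually_elim auto
qed

section \<open>Weak gradients along oblique directions\<close>

definition weak_gradient :: "(real^2) set \<Rightarrow> (real^2 \<Rightarrow> complex) \<Rightarrow> (2 \<Rightarrow> real^2 \<Rightarrow> complex) \<Rightarrow> bool" where
  "weak_gradient \<Omega> U D \<longleftrightarrow> L1 U \<and> (\<forall>i. L1 (D i)) \<and>
     (\<forall>i \<phi>. test_function \<Omega> \<phi> \<longrightarrow> (LBINT x. U x * partial i \<phi> x) = - (LBINT x. D i x * \<phi> x))"

definition along :: "real \<Rightarrow> (2 \<Rightarrow> real^2 \<Rightarrow> complex) \<Rightarrow> real^2 \<Rightarrow> complex" where
  "along az D x = of_real (cos az) * D 1 x + of_real (sin az) * D 2 x"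

text \<open>Representatives vanish off the domain, so integration by parts is restated over the
  whole plane; only the class of test functions still remembers \<Omega>.\<close>

lemma weak_gradientI:
  assumes \<Omega>: "open \<Omega>" and u: "rep \<Omega> u U" "L1 U"
    and d: "\<And>i. rep \<Omega> (d i) (D i)" "\<And>i. L1 (D i)" "\<And>i. weak_partial \<Omega> i u (d i)"
  shows "weak_gradient \<Omega> U D"
  unfolding weak_gradient_def
proof (intro conjI allI impI u d)
  fix i \<phi> assume t: "test_function \<Omega> \<phi>"
  then have s: "smooth \<phi>" by (simp add: test_function_def)
  have \<Omega>b: "\<Omega> \<in> sets borel" using \<Omega> by simp
  have "integral\<^sup>L (lebesgue_on \<Omega>) (\<lambda>x. u x * partial i \<phi> x) = - integral\<^sup>L (lebesgue_on \<Omega>) (\<lambda>x. d i x * \<phi> x)"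
    using d(3)[of i] t by (simp add: weak_partial_def)
  then show "(LBINT x. U x * partial i \<phi> x) = - (LBINT x. D i x * \<phi> x)"
    using rep_integral[OF \<Omega>b rep_mult[OF u(1) smooth_borel[OF smooth_partial[OF s]]]]
      rep_integral[OF \<Omega>b rep_mult[OF d(1) smooth_borel[OF s]]] by simp
qed

lemma integrable_test:
  assumes "L1 U" and t: "test_function \<Omega> \<phi>"
  shows "L1 (\<lambda>x. U x * \<phi> x)" "L1 (\<lambda>x. U x * partial i \<phi> x)"
proof -
  have s: "smooth \<phi>" using t by (simp add: test_function_def)
  have "bounded (closure {x. \<phi> x \<noteq> 0})" using t by (auto simp: test_function_def intro: compact_imp_bounded)
  then obtain R where "\<And>x. x \<in> closure {x. \<phi> x \<noteq> 0} \<Longrightarrow> norm x \<le> R" unfolding bounded_iff by blast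
  then have R: "norm x \<le> R" if "\<phi> x \<noteq> 0" for x using that closure_subset[of "{x. \<phi> x \<noteq> 0}"] by blast
  have z: "\<phi> x = 0" if "R + 1 \<le> norm x" for x
  proof (rule ccontr)
    assume "\<phi> x \<noteq> 0"
    from R[OF this] that show False by simp
  qed
  have z': "partial i \<phi> x = 0" if "R + 2 \<le> norm x" for x by (rule partial_outside(1)[of "R + 1"]) (use that z in auto)
  obtain C where "\<And>x. norm (\<phi> x) \<le> C" using bounded_cont_support[OF smooth_cont[OF s] z] by blast
  then show "L1 (\<lambda>x. U x * \<phi> x)"
    by (intro integrable_bounded_mult[OF assms(1) smooth_borel[OF s]])
  obtain C where "\<And>x. norm (partial i \<phi> x) \<le> C" using bounded_cont_support[OF smooth_cont[OF smooth_partial[OF s]] z'] by blast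
  then show "L1 (\<lambda>x. U x * partial i \<phi> x)"
    by (intro integrable_bounded_mult[OF assms(1) smooth_borel[OF smooth_partial[OF s]]])
qed

lemma integrable_along: "(\<And>i. L1 (D i)) \<Longrightarrow> L1 (along az D)"
  unfolding along_def[abs_def] by simp

lemma weak_gradient_along:
  assumes w: "weak_gradient \<Omega> U D" and t: "test_function \<Omega> \<phi>"
  shows "(LBINT x. U x * along az (\<lambda>i. partial i \<phi>) x) = - (LBINT x. along az D x * \<phi> x)"
proof -
  have U: "L1 U" and D: "\<And>i. L1 (D i)"
    and e: "\<And>i. (LBINT x. U x * partial i \<phi> x) = - (LBINT x. D i x * \<phi> x)"
    using w t by (auto simp: weak_gradient_def)
  note i = integrable_test[OF U t] integrable_test(1)[OF D t]
  have "(LBINT x. U x * along az (\<lambda>i. partial i \<phi>) x) =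
     (LBINT x. of_real (cos az) * (U x * partial 1 \<phi> x) + of_real (sin az) * (U x * partial 2 \<phi> x))"
    by (intro bochner_cong) (auto simp: along_def algebra_simps)
  also have "\<dots> = of_real (cos az) * (LBINT x. U x * partial 1 \<phi> x) + of_real (sin az) * (LBINT x. U x * partial 2 \<phi> x)"
    using i by simp
  also have "\<dots> = - (of_real (cos az) * (LBINT x. D 1 x * \<phi> x) + of_real (sin az) * (LBINT x. D 2 x * \<phi> x))"
    by (simp add: e)
  also have "\<dots> = - (LBINT x. of_real (cos az) * (D 1 x * \<phi> x) + of_real (sin az) * (D 2 x * \<phi> x))"
    using i by simp
  also have "\<dots> = - (LBINT x. along az D x * \<phi> x)"
    by (intro arg_cong[where f=uminus] bochner_cong) (auto simp: along_def algebra_simps)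
  finally show ?thesis .
qed

lemma weak_gradient_of_along:
  assumes w: "\<And>i. weak_gradient \<Omega> (D i) (DD i)"
  shows "weak_gradient \<Omega> (along az D) (\<lambda>j. along az (\<lambda>i. DD i j))"
  unfolding weak_gradient_def
proof (intro conjI allI impI)
  have D: "\<And>i. L1 (D i)" and DD: "\<And>i j. L1 (DD i j)"
    using w by (auto simp: weak_gradient_def)
  show "L1 (along az D)" "\<And>j. L1 (along az (\<lambda>i. DD i j))"
    by (intro integrable_along D DD)+
  fix j \<phi> assume t: "test_function \<Omega> \<phi>"
  have e: "(LBINT x. D i x * partial j \<phi> x) = - (LBINT x. DD i j x * \<phi> x)" for i
    using w[of i] t by (auto simp: weak_gradient_def)
  note i = integrable_test(2)[OF D t] integrable_test(1)[OF DD t]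
  have "(LBINT x. along az D x * partial j \<phi> x) = (LBINT x. of_real (cos az) * (D 1 x * partial j \<phi> x) + of_real (sin az) * (D 2 x * partial j \<phi> x))"
    by (intro bochner_cong) (auto simp: along_def algebra_simps)
  also have "\<dots> = of_real (cos az) * (LBINT x. D 1 x * partial j \<phi> x) + of_real (sin az) * (LBINT x. D 2 x * partial j \<phi> x)"
    using i by simp
  also have "\<dots> = - (of_real (cos az) * (LBINT x. DD 1 j x * \<phi> x) + of_real (sin az) * (LBINT x. DD 2 j x * \<phi> x))"
    by (simp add: e)
  also have "\<dots> = - (LBINT x. of_real (cos az) * (DD 1 j x * \<phi> x) + of_real (sin az) * (DD 2 j x * \<phi> x))"
    using i by simp
  also have "\<dots> = - (LBINT x. along az (\<lambda>i. DD i j) x * \<phi> x)"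
    by (intro arg_cong[where f=uminus] bochner_cong) (auto simp: along_def algebra_simps)
  finally show "(LBINT x. along az D x * partial j \<phi> x) = - (LBINT x. along az (\<lambda>i. DD i j) x * \<phi> x)" .
qed

lemma nn_integral_swap_real:
  fixes f :: "real \<times> real \<Rightarrow> ennreal"
  assumes [measurable]: "f \<in> BM"
  shows "(LNN p. f (prod.swap p)) = (LNN p. f p)"
proof -
  have "prod.swap \<in> borel_measurable (borel :: (real \<times> real) measure)"
    unfolding prod.swap_def by (intro borel_measurable_continuous_onI continuous_intros)
  then have m: "(\<lambda>p. f (prod.swap p)) \<in> BM" by (rule measurable_compose) fact
  have m2: "f \<in> borel_measurable (lborel \<Otimes>\<^sub>M lborel)" by (simp add: lborel_prod)
  show ?thesis unfolding nn_integral_prod_real[OF m] nn_integral_prod_real[OF assms]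
    using lborel_pair.Fubini'[of "\<lambda>x y. f (x, y)"] m2 by simp
qed

lemma AE_swap_real:
  fixes P :: "real \<times> real \<Rightarrow> bool"
  assumes [measurable]: "Measurable.pred borel P" and P: "AE p in lborel. P p"
  shows "AE p in lborel. P (prod.swap p)"
proof -
  have sw[measurable]: "prod.swap \<in> borel_measurable (borel :: (real \<times> real) measure)"
    unfolding prod.swap_def by (intro borel_measurable_continuous_onI continuous_intros)
  let ?f = "\<lambda>p. if P p then 0 else 1 :: ennreal"
  have fm: "?f \<in> BM" by measurable
  have "(LNN p. ?f p) = (\<integral>\<^sup>+p. 0 \<partial>(lborel :: (real \<times> real) measure))"
    by (rule nn_integral_cong_AE) (use P in \<open>eventually_elim, simp\<close>)
  then have "(LNN p. ?f (prod.swap p)) = 0" unfolding nn_integral_swap_real[OF fm] by simp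
  moreover have "(\<lambda>p. ?f (prod.swap p)) \<in> borel_measurable lborel"
    using measurable_compose[OF sw fm] by simp
  ultimately have "AE p in lborel. ?f (prod.swap p) = 0" by (subst (asm) nn_integral_0_iff_AE) auto
  then show ?thesis by eventually_elim (auto split: if_splits)
qed

text \<open>Exchanging the coordinates exchanges the edges, so the trace on the second edge is
  reduced to the first with the order of the angles reversed.\<close>

lemma cone_map_swap: "cone_map b a p = cone_map a b (prod.swap p)"
  by (cases p) (simp add: cone_map_eq add.commute)

lemma norm_cone_map: "norm (cone_map a b (s, t)) \<le> \<bar>s\<bar> + \<bar>t\<bar>"
  unfolding cone_map_eq using norm_triangle_ineq[of "s *\<^sub>R dir a" "t *\<^sub>R dir b"] by simp

lemma cone_directional:
  assumes X: "smooth X"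
  shows "((\<lambda>t. X (cone_map a b (s, t))) has_vector_derivative along b (\<lambda>i. partial i X) (cone_map a b (s, t))) (at t)"
  using directional_derivative[OF X, of "s *\<^sub>R dir a" b t] by (simp add: cone_map_eq along_def)

context corner_domain
begin

text \<open>The change of variables enters as a hypothesis with an unspecified finite constant,
  because the statement is used for both orders of the two angles and the sine is negative in the
  reversed one. The oblique derivative in t is the derivative along the other edge, which converges
  in the mean with the gradient.\<close>

lemma ray_trace:
  assumes cone: "\<And>f. f \<in> BM \<Longrightarrow> (LNN p. f (cone_map a b p)) = C * (LNN x. f x)" "C < \<infinity>"
    and \<delta>: "\<delta> > 0" "\<delta> \<le> h" and Q: "\<And>p. p \<in> {0<..<\<delta>} \<times> {0<..<\<delta>} \<Longrightarrow> cone_map a b p \<in> \<Omega>"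
    and U: "U \<in> BM" and D: "\<And>i. L1 (D i)" and G: "continuous_on UNIV G" "AE p in lborel. p \<in> {0<..<\<delta>} \<times> {0<..<\<delta>} \<longrightarrow> U (cone_map a b p) = G p"
    and \<psi>: "\<And>n. smooth (\<psi> n)" "(\<lambda>n. LNN x. ennreal (norm (ind \<Omega> x *\<^sub>R \<psi> n x - U x))) \<longlonglongrightarrow> 0"
      "\<And>i. (\<lambda>n. LNN x. ennreal (norm (ind \<Omega> x *\<^sub>R partial i (\<psi> n) x - D i x))) \<longlonglongrightarrow> 0"
    and g: "g \<in> BM" "(\<lambda>n. LNN t. ind {0<..<h} t * ennreal (norm (\<psi> n (t *\<^sub>R dir a) - g t))) \<longlonglongrightarrow> 0"
  shows "AE t in lborel. t \<in> {0<..<\<delta>} \<longrightarrow> g t = G (t, 0)"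
proof (rule trace_on_axis[OF \<delta>(1)])
  have [measurable]: "D i \<in> BM" "\<Omega> \<in> sets borel" "\<psi> n \<in> BM" "partial i (\<psi> n) \<in> BM" for i n
    using D \<Omega> \<psi>(1) by (auto intro: smooth_borel smooth_partial)
  note [measurable] = U
  have cc: "continuous_on UNIV (\<lambda>p. X (cone_map a b p))" if "smooth X" for X
    by (rule continuous_on_compose2[OF smooth_cont[OF that] continuous_cone_map]) auto
  show "continuous_on UNIV (\<lambda>p. \<psi> n (cone_map a b p))" for n by (rule cc[OF \<psi>(1)])
  show "continuous_on UNIV (\<lambda>p. along b (\<lambda>i. partial i (\<psi> n)) (cone_map a b p))" for n
    unfolding along_def by (intro continuous_intros cc smooth_partial \<psi>(1))
  show "((\<lambda>t. \<psi> n (cone_map a b (s, t))) has_vector_derivative along b (\<lambda>i. partial i (\<psi> n)) (cone_map a b (s, t))) (at t)" for n s t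
    by (rule cone_directional[OF \<psi>(1)])
  have ia: "L1 (along b D)" by (rule integrable_along[OF D])
  have "(LNN p. ennreal (norm (along b D (cone_map a b p)))) = C * (LNN x. ennreal (norm (along b D x)))"
    by (rule cone(1)) (use ia in measurable)
  also have "\<dots> < \<infinity>" using ia cone(2) by (auto simp: integrable_iff_bounded ennreal_mult_less_top)
  finally show "L1 (\<lambda>p. along b D (cone_map a b p))"
    using measurable_compose[OF borel_cone_map[of a b], of "along b D" borel] ia by (auto simp: integrable_iff_bounded)
  show "g \<in> BM" "continuous_on UNIV G" by (fact g G)+
  have lim: "(\<lambda>n. LNN p. ind ({0<..<\<delta>} \<times> {0<..<\<delta>}) p * ennreal (norm (X n p - Y p))) \<longlonglongrightarrow> 0"
    if Z: "\<And>n. Z n \<in> BM" "(\<lambda>n. LNN x. Z n x) \<longlonglongrightarrow> 0"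
      and le: "\<And>n. AE p in lborel. p \<in> {0<..<\<delta>} \<times> {0<..<\<delta>} \<longrightarrow> ennreal (norm (X n p - Y p)) \<le> Z n (cone_map a b p)" for X Y and Z :: "nat \<Rightarrow> real^2 \<Rightarrow> ennreal"
  proof (rule tendsto_sandwich[of "\<lambda>_. 0"])
    show "\<forall>\<^sub>F n in sequentially. (LNN p. ind ({0<..<\<delta>} \<times> {0<..<\<delta>}) p * ennreal (norm (X n p - Y p))) \<le> C * (LNN x. Z n x)"
    proof (intro always_eventually allI)
      fix n
      have "(LNN p. ind ({0<..<\<delta>} \<times> {0<..<\<delta>}) p * ennreal (norm (X n p - Y p))) \<le> (LNN p. Z n (cone_map a b p))"
        by (rule nn_integral_mono_AE) (use le[of n] in \<open>eventually_elim, auto simp: indicator_def\<close>)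
      also have "\<dots> = C * (LNN x. Z n x)" by (rule cone(1)[OF Z(1)])
      finally show "(LNN p. ind ({0<..<\<delta>} \<times> {0<..<\<delta>}) p * ennreal (norm (X n p - Y p))) \<le> C * (LNN x. Z n x)" .
    qed
    have "(\<lambda>n. C * (LNN x. Z n x)) \<longlonglongrightarrow> C * 0" by (rule ennreal_tendsto_cmult[OF _ Z(2)]) (use cone(2) in \<open>simp add: less_top\<close>)
    then show "(\<lambda>n. C * (LNN x. Z n x)) \<longlonglongrightarrow> 0" by simp
  qed auto
  show "(\<lambda>n. LNN p. ind ({0<..<\<delta>} \<times> {0<..<\<delta>}) p * ennreal (norm (\<psi> n (cone_map a b p) - G p))) \<longlonglongrightarrow> 0"
  proof (rule lim[OF _ \<psi>(2)])
    show "AE p in lborel. p \<in> {0<..<\<delta>} \<times> {0<..<\<delta>} \<longrightarrow> ennreal (norm (\<psi> n (cone_map a b p) - G p)) \<le> ennreal (norm (ind \<Omega> (cone_map a b p) *\<^sub>R \<psi> n (cone_map a b p) - U (cone_map a b p)))" for n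
      using G(2) by eventually_elim (use Q in simp)
  qed measurable
  show "(\<lambda>n. LNN p. ind ({0<..<\<delta>} \<times> {0<..<\<delta>}) p * ennreal (norm (along b (\<lambda>i. partial i (\<psi> n)) (cone_map a b p) - along b D (cone_map a b p)))) \<longlonglongrightarrow> 0"
  proof (rule lim)
    let ?z = "\<lambda>i n x. ennreal (norm (ind \<Omega> x *\<^sub>R partial i (\<psi> n) x - D i x))"
    let ?Z = "\<lambda>n x. ?z 1 n x + ?z 2 n x"
    show "?Z n \<in> BM" for n by measurable
    have "(\<lambda>n. (LNN x. ?z 1 n x) + (LNN x. ?z 2 n x)) \<longlonglongrightarrow> 0 + 0" by (intro tendsto_add \<psi>(3))
    also have "(\<lambda>n. (LNN x. ?z 1 n x) + (LNN x. ?z 2 n x)) = (\<lambda>n. LNN x. ?Z n x)"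
      by (intro ext nn_integral_add[symmetric]) measurable
    finally show "(\<lambda>n. LNN x. ?Z n x) \<longlonglongrightarrow> 0" by simp
    fix n
    have "ennreal (norm (along b (\<lambda>i. partial i (\<psi> n)) (cone_map a b p) - along b D (cone_map a b p))) \<le> ?Z n (cone_map a b p)"
      if p: "p \<in> {0<..<\<delta>} \<times> {0<..<\<delta>}" for p
    proof -
      define x where "x = cone_map a b p"
      have x: "x \<in> \<Omega>" using Q[OF p] by (simp add: x_def)
      let ?e = "\<lambda>i. partial i (\<psi> n) x - D i x"
      have c1: "norm (of_real (cos b) * z) \<le> norm z" "norm (of_real (sin b) * z) \<le> norm z" for z :: complex
        by (simp_all add: norm_mult mult_left_le_one_le)
      have "norm (along b (\<lambda>i. partial i (\<psi> n)) x - along b D x) = norm (of_real (cos b) * ?e 1 + of_real (sin b) * ?e 2)"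
        by (simp add: along_def algebra_simps)
      also have "\<dots> \<le> norm (?e 1) + norm (?e 2)"
        by (rule order_trans[OF norm_triangle_ineq add_mono[OF c1]])
      finally show ?thesis using x by (simp add: x_def ennreal_leI flip: ennreal_plus)
    qed
    then show "AE p in lborel. p \<in> {0<..<\<delta>} \<times> {0<..<\<delta>} \<longrightarrow> ennreal (norm (along b (\<lambda>i. partial i (\<psi> n)) (cone_map a b p) - along b D (cone_map a b p))) \<le> ?Z n (cone_map a b p)"
      by (intro AE_I2) blast
  qed
  show "(\<lambda>n. LNN s. ind {0<..<\<delta>} s * ennreal (norm (\<psi> n (cone_map a b (s, 0)) - g s))) \<longlonglongrightarrow> 0"
  proof (rule tendsto_sandwich[OF _ _ _ g(2), of "\<lambda>_. 0"])
    show "\<forall>\<^sub>F n in sequentially. (LNN s. ind {0<..<\<delta>} s * ennreal (norm (\<psi> n (cone_map a b (s, 0)) - g s))) \<le>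
      (LNN t. ind {0<..<h} t * ennreal (norm (\<psi> n (t *\<^sub>R dir a) - g t)))"
      by (intro always_eventually allI nn_integral_mono) (use \<delta> in \<open>auto simp: cone_map_eq indicator_def\<close>)
  qed auto
qed

end


text \<open>The inverse of \<open>cone_map\<close>. The scalar is multiplied into the normal vector,
  so that each coordinate is literally an inner product, the form over which \<open>smooth1\<close>
  quantifies.\<close>

definition coords :: "real \<Rightarrow> real \<Rightarrow> real^2 \<Rightarrow> real \<times> real" where
  "coords a b x = ((1 / sin (b - a)) *\<^sub>R nrm b \<bullet> x, (- 1 / sin (b - a)) *\<^sub>R nrm a \<bullet> x)"

lemma cone_coords:
  assumes D: "sin (b - a) > 0"
  shows "cone_map a b (coords a b x) = x" "coords a b (cone_map a b p) = p"
proof -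
  let ?S = "sin (b - a)"
  have "(nrm b \<bullet> x) * cos a - (nrm a \<bullet> x) * cos b = x $ 1 * ?S" "(nrm b \<bullet> x) * sin a - (nrm a \<bullet> x) * sin b = x $ 2 * ?S"
    by (simp_all add: inner_2 sin_diff algebra_simps)
  then have "((nrm b \<bullet> x) * cos a - (nrm a \<bullet> x) * cos b) / ?S = x $ 1" "((nrm b \<bullet> x) * sin a - (nrm a \<bullet> x) * sin b) / ?S = x $ 2"
    using D by simp_all
  then show "cone_map a b (coords a b x) = x"
    unfolding coords_def cone_map_eq vec_eq_iff forall_2 by (simp add: diff_divide_distrib)
  show "coords a b (cone_map a b p) = p"
    using D by (cases p) (simp add: coords_def nrm_cone_map)
qed

text \<open>A product test function in oblique coordinates: differentiating along one edge affects a
  single factor, which separates the two variables in the weak formulation.\<close>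

definition tens :: "real \<Rightarrow> real \<Rightarrow> (real \<Rightarrow> real) \<Rightarrow> (real \<Rightarrow> real) \<Rightarrow> real^2 \<Rightarrow> complex" where
  "tens a b f g x = of_real (f ((1 / sin (b - a)) *\<^sub>R nrm b \<bullet> x)) * of_real (g ((- 1 / sin (b - a)) *\<^sub>R nrm a \<bullet> x))"

lemma smooth_tens: "smooth1 f \<Longrightarrow> smooth1 g \<Longrightarrow> smooth (tens a b f g)"
  unfolding tens_def[abs_def] smooth1_def by (intro smooth_mult) (erule allE, assumption)+

lemma tens_eq: "tens a b f g x = of_real (f (fst (coords a b x)) * g (snd (coords a b x)))"
  by (simp add: tens_def coords_def)

lemma tens_cone: "sin (b - a) > 0 \<Longrightarrow> tens a b f g (cone_map a b (s, t)) = of_real (f s * g t)"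
  by (simp only: tens_eq cone_coords fst_conv snd_conv)

lemma DERIV_of_real_vector: "(f has_real_derivative d) (at t) \<Longrightarrow> ((\<lambda>t. complex_of_real (f t)) has_vector_derivative of_real d) (at t)"
  unfolding has_real_derivative_iff_has_vector_derivative by (rule bounded_linear.has_vector_derivative[OF bounded_linear_of_real])

lemma along_tens:
  assumes D: "sin (b - a) > 0" and s: "smooth1 f" "smooth1 g"
  shows "(f has_real_derivative d) (at s) \<Longrightarrow> along a (\<lambda>i. partial i (tens a b f g)) (cone_map a b (s, t)) = of_real (d * g t)"
    and "(g has_real_derivative d) (at t) \<Longrightarrow> along b (\<lambda>i. partial i (tens a b f g)) (cone_map a b (s, t)) = of_real (f s * d)"
proof -
  note X = smooth_tens[OF s, of a b]
  show "along a (\<lambda>i. partial i (tens a b f g)) (cone_map a b (s, t)) = of_real (d * g t)"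
    if d: "(f has_real_derivative d) (at s)"
  proof -
    have "((\<lambda>s. tens a b f g (cone_map b a (t, s))) has_vector_derivative along a (\<lambda>i. partial i (tens a b f g)) (cone_map b a (t, s))) (at s)"
      by (rule cone_directional[OF X])
    then have "((\<lambda>s. complex_of_real (f s * g t)) has_vector_derivative along a (\<lambda>i. partial i (tens a b f g)) (cone_map a b (s, t))) (at s)"
      by (simp only: cone_map_swap[of b a] prod.swap_def fst_conv snd_conv tens_cone[OF D])
    moreover have "((\<lambda>s. complex_of_real (f s * g t)) has_vector_derivative of_real (d * g t)) (at s)"
      by (intro DERIV_of_real_vector DERIV_cmult_right d)
    ultimately show ?thesis by (rule vector_derivative_unique_at)
  qed
  show "along b (\<lambda>i. partial i (tens a b f g)) (cone_map a b (s, t)) = of_real (f s * d)"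
    if d: "(g has_real_derivative d) (at t)"
  proof -
    have "((\<lambda>t. tens a b f g (cone_map a b (s, t))) has_vector_derivative along b (\<lambda>i. partial i (tens a b f g)) (cone_map a b (s, t))) (at t)"
      by (rule cone_directional[OF X])
    then have "((\<lambda>t. complex_of_real (f s * g t)) has_vector_derivative along b (\<lambda>i. partial i (tens a b f g)) (cone_map a b (s, t))) (at t)"
      by (simp only: tens_cone[OF D])
    moreover have "((\<lambda>t. complex_of_real (f s * g t)) has_vector_derivative of_real (f s * d)) (at t)"
      by (intro DERIV_of_real_vector DERIV_cmult d)
    ultimately show ?thesis by (rule vector_derivative_unique_at)
  qed
qed

section \<open>Essential limits at the vertex\<close>

definition ess_lim :: "(real^2) set \<Rightarrow> (real^2 \<Rightarrow> complex) \<Rightarrow> complex \<Rightarrow> bool" where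
  "ess_lim A U c \<longleftrightarrow> (\<forall>e>0. \<exists>r>0. AE x in lborel. x \<in> A \<and> norm x < r \<longrightarrow> norm (U x - c) < e)"

lemma norm_nrm: "norm (nrm az) = 1"
  by (simp add: norm_2)

text \<open>The continuous representative on the square is pulled back by the linear coordinates. A
  point of the cone with norm below \<delta> sin(b - a) has both coordinates between 0 and
  \<delta>.\<close>

lemma ess_lim_cone:
  assumes c: "- pi < a" "a < b" "b < pi" "b - a < pi" and \<delta>: "\<delta> > 0" and U[measurable]: "U \<in> BM"
    and G: "continuous_on UNIV G" "AE p in lborel. p \<in> {0<..<\<delta>} \<times> {0<..<\<delta>} \<longrightarrow> U (cone_map a b p) = G p"
  shows "ess_lim (sector a b) U (G (0, 0))"
  unfolding ess_lim_def
proof (intro allI impI)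
  fix e :: real assume e: "e > 0"
  let ?S = "sin (b - a)"
  have S: "?S > 0" using c by (intro sin_gt_zero) auto
  have cc: "continuous_on UNIV (coords a b)" unfolding coords_def by (intro continuous_intros)
  note [measurable] = borel_measurable_continuous_onI[OF cc] borel_measurable_continuous_onI[OF G(1)]
  have [measurable]: "{0<..<\<delta>} \<times> {0<..<\<delta>} \<in> sets borel" by (intro borel_Times) auto
  have ae: "AE x in lborel. coords a b x \<in> {0<..<\<delta>} \<times> {0<..<\<delta>} \<longrightarrow> U x = G (coords a b x)"
    by (subst AE_cone[OF S], measurable) (use G(2) in \<open>simp only: cone_coords[OF S]\<close>)
  have "continuous_on UNIV (\<lambda>x. G (coords a b x))" by (rule continuous_on_compose2[OF G(1) cc]) auto
  then obtain \<rho> where \<rho>: "\<rho> > 0" "\<And>x. dist x 0 < \<rho> \<Longrightarrow> dist (G (coords a b x)) (G (coords a b 0)) < e"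
    unfolding continuous_on_iff using e by blast
  have c0: "coords a b 0 = (0, 0)" by (simp add: coords_def)
  have co: "coords a b x \<in> {0<..<\<delta>} \<times> {0<..<\<delta>}" if x: "x \<in> sector a b" "norm x < \<delta> * ?S" for x
  proof -
    have n: "0 < nrm b \<bullet> x" "nrm a \<bullet> x < 0" using cone_iff(1)[OF c] x(1) by auto
    have "\<bar>nrm b \<bullet> x\<bar> \<le> norm x" "\<bar>nrm a \<bullet> x\<bar> \<le> norm x"
      using Cauchy_Schwarz_ineq2[of "nrm b" x] Cauchy_Schwarz_ineq2[of "nrm a" x] by (simp_all add: norm_nrm)
    then have "nrm b \<bullet> x < \<delta> * ?S" "- (nrm a \<bullet> x) < \<delta> * ?S" using x(2) by auto
    then show ?thesis using n S by (simp add: coords_def divide_simps)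
  qed
  show "\<exists>r>0. AE x in lborel. x \<in> sector a b \<and> norm x < r \<longrightarrow> norm (U x - G (0, 0)) < e"
  proof (intro exI conjI)
    show "0 < min \<rho> (\<delta> * ?S)" using \<rho> \<delta> S by simp
    show "AE x in lborel. x \<in> sector a b \<and> norm x < min \<rho> (\<delta> * ?S) \<longrightarrow> norm (U x - G (0, 0)) < e"
      using ae
    proof eventually_elim
      case (elim x)
      show ?case
      proof
        assume x: "x \<in> sector a b \<and> norm x < min \<rho> (\<delta> * ?S)"
        then have "U x = G (coords a b x)" using elim co by auto
        then show "norm (U x - G (0, 0)) < e" using \<rho>(2)[of x] x by (simp add: c0 dist_norm)
      qed
    qed
  qed
qed

text \<open>Near the vertex the common subsector has positive measure, so some point would be close
  to both limits.\<close>

lemma ess_lim_unique: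
  assumes l: "ess_lim A U c" "ess_lim B U c'" and s: "sector a b \<subseteq> A \<inter> B" "- pi < a" "a < b" "b < pi"
  shows "c = c'"
proof (rule ccontr)
  assume "c \<noteq> c'"
  then have e: "norm (c - c') / 2 > 0" by simp
  obtain r r' where r: "r > 0" "AE x in lborel. x \<in> A \<and> norm x < r \<longrightarrow> norm (U x - c) < norm (c - c') / 2"
    and r': "r' > 0" "AE x in lborel. x \<in> B \<and> norm x < r' \<longrightarrow> norm (U x - c') < norm (c - c') / 2"
    using l e unfolding ess_lim_def by meson
  define X where "X = sector a b \<inter> ball 0 (min r r')"
  have X: "open X" unfolding X_def by (intro open_Int open_sector s open_ball)
  have "(min r r' / 2) *\<^sub>R dir ((a + b) / 2) \<in> X"
    using r r' s polar_angle_dir[of "min r r' / 2" "(a + b) / 2"] by (auto simp: X_def sector_def)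
  then have "X \<noteq> {}" by blast
  have "AE x in lborel. x \<notin> X"
    using r(2) r'(2)
  proof eventually_elim
    case (elim x)
    show ?case
    proof
      assume "x \<in> X"
      then have "norm (U x - c) < norm (c - c') / 2" "norm (U x - c') < norm (c - c') / 2"
        using elim s(1) by (auto simp: X_def)
      then show False using norm_triangle_ineq4[of "U x - c'" "U x - c"] by simp
    qed
  qed
  then have "X \<in> null_sets lborel" using X by (subst (asm) AE_iff_null_sets[symmetric]) auto
  then have "negligible X" by (simp add: negligible_iff_null_sets null_sets_completionI)
  then show False using open_not_negligible[OF X \<open>X \<noteq> {}\<close>] by blast
qed

lemma ess_lim_Un: "ess_lim A U c \<Longrightarrow> ess_lim B U c \<Longrightarrow> ess_lim (A \<union> B) U c"
  unfolding ess_lim_def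
proof (intro allI impI)
  fix e :: real
  assume "\<forall>e>0. \<exists>r>0. AE x in lborel. x \<in> A \<and> norm x < r \<longrightarrow> norm (U x - c) < e"
    "\<forall>e>0. \<exists>r>0. AE x in lborel. x \<in> B \<and> norm x < r \<longrightarrow> norm (U x - c) < e" "0 < e"
  then obtain r r' where r: "r > 0" "AE x in lborel. x \<in> A \<and> norm x < r \<longrightarrow> norm (U x - c) < e"
    and r': "r' > 0" "AE x in lborel. x \<in> B \<and> norm x < r' \<longrightarrow> norm (U x - c) < e" by meson
  show "\<exists>r>0. AE x in lborel. x \<in> A \<union> B \<and> norm x < r \<longrightarrow> norm (U x - c) < e"
    using r r' by (intro exI[of _ "min r r'"] conjI) (simp, use r(2) r'(2) in \<open>eventually_elim, auto\<close>)
qed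

context corner_domain
begin

text \<open>The support lies in the image of a closed box in the open quadrant with both coordinates
  at most 2 \<delta>. Its points have norm at most 4 \<delta> < h, where the domain coincides with
  the sector.\<close>

lemma tens_test:
  assumes c: "- pi < a" "a < b" "b < pi" "b - a < pi" and sub: "sector a b \<subseteq> sector azm azM" and \<delta>: "4 * \<delta> < h"
    and f: "admissible0 \<delta> f" and g: "admissible0 \<delta> g"
  shows "test_function \<Omega> (tens a b f g)"
proof -
  have S: "sin (b - a) > 0" using c by (intro sin_gt_zero) auto
  obtain a0 where a0: "a0 > 0" "\<And>t. t \<le> a0 \<or> 2 * \<delta> \<le> t \<Longrightarrow> f t = 0" and sf: "smooth1 f" using f by (auto simp: admissible0_def)
  obtain b0 where b0: "b0 > 0" "\<And>t. t \<le> b0 \<or> 2 * \<delta> \<le> t \<Longrightarrow> g t = 0" and sg: "smooth1 g" using g by (auto simp: admissible0_def)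
  show ?thesis
  proof (rule test_functionI[OF smooth_tens[OF sf sg]])
    show "compact (cone_map a b ` (cbox (a0, b0) (2 * \<delta>, 2 * \<delta>)))"
      by (intro compact_continuous_image continuous_cone_map compact_cbox)
    show "cone_map a b ` (cbox (a0, b0) (2 * \<delta>, 2 * \<delta>)) \<subseteq> \<Omega>"
    proof
      fix y assume "y \<in> cone_map a b ` (cbox (a0, b0) (2 * \<delta>, 2 * \<delta>))"
      then obtain p where p: "p \<in> cbox (a0, b0) (2 * \<delta>, 2 * \<delta>)" "y = cone_map a b p" by (rule imageE)
      obtain s t where "p = (s, t)" by force
      with p have y: "y = cone_map a b (s, t)" and st: "(s, t) \<in> cbox (a0, b0) (2 * \<delta>, 2 * \<delta>)" by auto
      then have st': "0 < s" "0 < t" "s \<le> 2 * \<delta>" "t \<le> 2 * \<delta>" using a0 b0 by auto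
      from st' have "cone_map a b (s, t) \<in> sector a b" using cone_map_mem[OF c] by simp
      moreover have "norm (cone_map a b (s, t)) < h" using norm_cone_map[of a b s t] st' \<delta> by simp
      ultimately show "y \<in> \<Omega>" unfolding y using sub mem_iff by blast
    qed
    fix x assume x: "x \<notin> cone_map a b ` (cbox (a0, b0) (2 * \<delta>, 2 * \<delta>))"
    obtain s t where st: "coords a b x = (s, t)" by force
    then have "x = cone_map a b (s, t)" using cone_coords(1)[OF S, of x] by simp
    then have "(s, t) \<notin> cbox (a0, b0) (2 * \<delta>, 2 * \<delta>)" using x by blast
    then have "f s = 0 \<or> g t = 0" using a0(2)[of s] b0(2)[of t] by force
    then show "tens a b f g x = 0" by (auto simp: tens_eq st)
  qed
qed

lemma cone_weak:
  assumes c: "- pi < a" "a < b" "b < pi" "b - a < pi" and sub: "sector a b \<subseteq> sector azm azM" and \<delta>: "4 * \<delta> < h"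
    and w: "weak_gradient \<Omega> U D"
  shows "admissible \<delta> f f' \<Longrightarrow> admissible0 \<delta> g \<Longrightarrow> (LBINT p. U (cone_map a b p) * of_real (f' (fst p) * g (snd p))) =
      - (LBINT p. along a D (cone_map a b p) * of_real (f (fst p) * g (snd p)))"
    and "admissible0 \<delta> f \<Longrightarrow> admissible \<delta> g g' \<Longrightarrow> (LBINT p. U (cone_map a b p) * of_real (f (fst p) * g' (snd p))) =
      - (LBINT p. along b D (cone_map a b p) * of_real (f (fst p) * g (snd p)))"
proof -
  let ?S = "sin (b - a)"
  have S: "?S > 0" using c by (intro sin_gt_zero) auto
  have key: "(LBINT p. U (cone_map a b p) * along az (\<lambda>i. partial i (tens a b f g)) (cone_map a b p)) =
      - (LBINT p. along az D (cone_map a b p) * of_real (f (fst p) * g (snd p)))"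
    if f: "admissible0 \<delta> f" and g: "admissible0 \<delta> g" for az f g
  proof -
    have t: "test_function \<Omega> (tens a b f g)" by (rule tens_test[OF c sub \<delta> f g])
    then have sm: "smooth (tens a b f g)" by (simp add: test_function_def)
    have m[measurable]: "U \<in> BM" "D i \<in> BM" for i
      using w borel_measurable_integrable[of lborel "D i"] unfolding weak_gradient_def by auto
    note [measurable] = smooth_borel[OF sm] smooth_borel[OF smooth_partial[OF sm]]
    have m1: "(\<lambda>x. U x * along az (\<lambda>i. partial i (tens a b f g)) x) \<in> BM"
      "(\<lambda>x. along az D x * tens a b f g x) \<in> BM" unfolding along_def by measurable
    have "?S *\<^sub>R (LBINT p. U (cone_map a b p) * along az (\<lambda>i. partial i (tens a b f g)) (cone_map a b p)) =
      ?S *\<^sub>R - (LBINT p. along az D (cone_map a b p) * tens a b f g (cone_map a b p))"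
      using weak_gradient_along[OF w t, of az] unfolding integral_cone[OF S m1(1)] integral_cone[OF S m1(2)] by simp
    then have "(LBINT p. U (cone_map a b p) * along az (\<lambda>i. partial i (tens a b f g)) (cone_map a b p)) =
      - (LBINT p. along az D (cone_map a b p) * tens a b f g (cone_map a b p))"
      using S by (simp only: scaleR_left_imp_eq[OF less_imp_neq[OF S, symmetric]])
    moreover have "tens a b f g (cone_map a b p) = of_real (f (fst p) * g (snd p))" for p
      using tens_cone[OF S, of f g "fst p" "snd p"] by simp
    ultimately show ?thesis by (simp only:)
  qed
  show "(LBINT p. U (cone_map a b p) * of_real (f' (fst p) * g (snd p))) =
      - (LBINT p. along a D (cone_map a b p) * of_real (f (fst p) * g (snd p)))"
    if f: "admissible \<delta> f f'" and g: "admissible0 \<delta> g"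
  proof -
    have s: "smooth1 f" "smooth1 g" using f g by (auto simp: admissible_def admissible0_def)
    have "along a (\<lambda>i. partial i (tens a b f g)) (cone_map a b p) = of_real (f' (fst p) * g (snd p))" for p
      using along_tens(1)[OF S s, of "f' (fst p)" "fst p" "snd p"] f by (simp add: admissible_def)
    then show ?thesis
      using key[of f g a] f g by (simp only: admissible_def)
  qed
  show "(LBINT p. U (cone_map a b p) * of_real (f (fst p) * g' (snd p))) =
      - (LBINT p. along b D (cone_map a b p) * of_real (f (fst p) * g (snd p)))"
    if f: "admissible0 \<delta> f" and g: "admissible \<delta> g g'"
  proof -
    have s: "smooth1 f" "smooth1 g" using f g by (auto simp: admissible_def admissible0_def)
    have "along b (\<lambda>i. partial i (tens a b f g)) (cone_map a b p) = of_real (f (fst p) * g' (snd p))" for p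
      using along_tens(2)[OF S s, of "g' (snd p)" "snd p" "fst p"] g by (simp add: admissible_def)
    then show ?thesis
      using key[of f g b] f g by (simp only: admissible_def)
  qed
qed

text \<open>In a convex cone the derivative along one edge of the derivative along the other is the
  mixed derivative in oblique coordinates, so U has a representative \<open>G\<close> continuous up
  to both axes. The given approximations have their mean limits on the two edges, and these must be
  the restrictions of \<open>G\<close>. The size h/8 leaves room for the test functions, which reach
  norm h/2.\<close>

lemma cone_trace:
  assumes c: "- pi < a" "a < b" "b < pi" "b - a < pi" and sub: "sector a b \<subseteq> sector azm azM"
    and w: "weak_gradient \<Omega> U D" "\<And>i. weak_gradient \<Omega> (D i) (DD i)"
    and \<psi>: "\<And>n. smooth (\<psi> n)" "(\<lambda>n. LNN x. ennreal (norm (ind \<Omega> x *\<^sub>R \<psi> n x - U x))) \<longlonglongrightarrow> 0"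
      "\<And>i. (\<lambda>n. LNN x. ennreal (norm (ind \<Omega> x *\<^sub>R partial i (\<psi> n) x - D i x))) \<longlonglongrightarrow> 0"
  obtains G where "continuous_on UNIV G" "ess_lim (sector a b) U (G (0, 0))"
    "\<And>g. g \<in> BM \<Longrightarrow> (\<lambda>n. LNN t. ind {0<..<h} t * ennreal (norm (\<psi> n (t *\<^sub>R dir a) - g t))) \<longlonglongrightarrow> 0 \<Longrightarrow>
       AE t in lborel. t \<in> {0<..<h / 8} \<longrightarrow> g t = G (t, 0)"
    "\<And>g. g \<in> BM \<Longrightarrow> (\<lambda>n. LNN t. ind {0<..<h} t * ennreal (norm (\<psi> n (t *\<^sub>R dir b) - g t))) \<longlonglongrightarrow> 0 \<Longrightarrow>
       AE t in lborel. t \<in> {0<..<h / 8} \<longrightarrow> g t = G (0, t)"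
proof -
  let ?S = "sin (b - a)"
  have S: "?S > 0" using c by (intro sin_gt_zero) auto
  define \<delta> where "\<delta> = h / 8"
  have \<delta>: "\<delta> > 0" "4 * \<delta> < h" "\<delta> \<le> h" using h by (auto simp: \<delta>_def)
  have wa: "weak_gradient \<Omega> (along a D) (\<lambda>j. along a (\<lambda>i. DD i j))" by (rule weak_gradient_of_along[OF w(2)])
  have iU: "L1 U" and iD: "\<And>i. L1 (D i)" and iDD: "\<And>i j. L1 (DD i j)"
    using w by (auto simp: weak_gradient_def)
  have ic: "L1 (\<lambda>p. f (cone_map a b p))" if "L1 f" for f :: "real^2 \<Rightarrow> complex"
    using integrable_cone[OF S, of f] that by auto
  obtain G where G: "continuous_on UNIV G" "AE p in lborel. p \<in> {0<..<\<delta>} \<times> {0<..<\<delta>} \<longrightarrow> U (cone_map a b p) = G p"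
  proof (rule mixed_representative[where v="\<lambda>p. U (cone_map a b p)" and vs="\<lambda>p. along a D (cone_map a b p)" and vt="\<lambda>p. along b D (cone_map a b p)"
      and vst="\<lambda>p. along b (\<lambda>j. along a (\<lambda>i. DD i j)) (cone_map a b p)" and \<delta>=\<delta>])
    show "L1 (\<lambda>p. U (cone_map a b p))" "L1 (\<lambda>p. along a D (cone_map a b p))" "L1 (\<lambda>p. along b D (cone_map a b p))"
      "L1 (\<lambda>p. along b (\<lambda>j. along a (\<lambda>i. DD i j)) (cone_map a b p))"
      by (intro ic iU integrable_along iD iDD)+
  qed (use \<delta> cone_weak[OF c sub \<delta>(2) w(1)] cone_weak(2)[OF c sub \<delta>(2) wa] in auto)
  have Um[measurable]: "U \<in> BM" using iU by auto
  note [measurable] = borel_measurable_continuous_onI[OF G(1)]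
  have [measurable]: "{0<..<\<delta>} \<times> {0<..<\<delta>} \<in> sets borel" by (intro borel_Times) auto
  have nn: "(LNN p. f (cone_map a b p)) = ennreal (1 / ?S) * (LNN x. f x)" if "f \<in> BM" for f :: "real^2 \<Rightarrow> ennreal"
    using S unfolding nn_integral_cone[OF S that] mult.assoc[symmetric] by (simp add: ennreal_mult[symmetric])
  have nn': "(LNN p. f (cone_map b a p)) = ennreal (1 / ?S) * (LNN x. f x)" if "f \<in> BM" for f :: "real^2 \<Rightarrow> ennreal"
    unfolding cone_map_swap[of b a] nn[OF that, symmetric]
    by (rule nn_integral_swap_real) (rule measurable_compose[OF borel_cone_map that])
  have Q: "cone_map a b p \<in> \<Omega>" if "p \<in> {0<..<\<delta>} \<times> {0<..<\<delta>}" for p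
  proof -
    obtain s t where p: "p = (s, t)" by force
    have "cone_map a b p \<in> sector a b" using that p cone_map_mem[OF c] by simp
    moreover have "norm (cone_map a b p) < h" using norm_cone_map[of a b s t] that p \<delta> by simp
    ultimately show ?thesis using sub mem_iff by blast
  qed
  have Q': "cone_map b a p \<in> \<Omega>" if "p \<in> {0<..<\<delta>} \<times> {0<..<\<delta>}" for p
    unfolding cone_map_swap[of b a] by (rule Q) (use that in auto)
  have cs: "continuous_on UNIV (\<lambda>p. G (prod.swap p))"
    unfolding prod.swap_def by (rule continuous_on_compose2[OF G(1)]) (auto intro!: continuous_intros)
  have "AE p in lborel. prod.swap p \<in> {0<..<\<delta>} \<times> {0<..<\<delta>} \<longrightarrow> U (cone_map a b (prod.swap p)) = G (prod.swap p)"
    by (rule AE_swap_real[OF _ G(2)]) measurable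
  then have Gs: "AE p in lborel. p \<in> {0<..<\<delta>} \<times> {0<..<\<delta>} \<longrightarrow> U (cone_map b a p) = G (prod.swap p)"
    unfolding cone_map_swap[of b a] by eventually_elim auto
  show ?thesis
  proof (rule that[OF G(1)])
    show "ess_lim (sector a b) U (G (0, 0))" by (rule ess_lim_cone[OF c \<delta>(1) Um G])
    fix g :: "real \<Rightarrow> complex" assume g: "g \<in> BM"
    show "AE t in lborel. t \<in> {0<..<h / 8} \<longrightarrow> g t = G (t, 0)"
      if "(\<lambda>n. LNN t. ind {0<..<h} t * ennreal (norm (\<psi> n (t *\<^sub>R dir a) - g t))) \<longlonglongrightarrow> 0"
      using ray_trace[OF nn _ \<delta>(1,3) Q Um iD G \<psi> g that] by (simp add: \<delta>_def)
    show "AE t in lborel. t \<in> {0<..<h / 8} \<longrightarrow> g t = G (0, t)"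
      if "(\<lambda>n. LNN t. ind {0<..<h} t * ennreal (norm (\<psi> n (t *\<^sub>R dir b) - g t))) \<longlonglongrightarrow> 0"
      using ray_trace[OF nn' _ \<delta>(1,3) Q' Um iD cs Gs \<psi> g that] by (simp add: \<delta>_def)
  qed
qed

end

section \<open>Transmission eigenfunctions near a corner\<close>

lemma rep_cong_AE:
  assumes \<Omega>: "\<Omega> \<in> sets borel" and ae: "AE x in lebesgue_on \<Omega>. f x = g x" and r: "rep \<Omega> g G"
  shows "rep \<Omega> f G"
proof -
  have 1: "AE x in lborel. x \<in> \<Omega> \<longrightarrow> f x = g x" using ae unfolding AE_lebesgue_on_iff[OF \<Omega>] .
  have 2: "AE x in lborel. x \<in> \<Omega> \<longrightarrow> g x = G x" using r by (auto simp: rep_def)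
  have "AE x in lborel. x \<in> \<Omega> \<longrightarrow> f x = G x" using 1 2 by eventually_elim auto
  then show ?thesis using r by (simp add: rep_def)
qed

lemma integrable_L1_limit:
  fixes f :: "'a \<Rightarrow> complex"
  assumes u: "\<And>n. integrable M (u n)" and f[measurable]: "f \<in> borel_measurable M"
    and lim: "(\<lambda>n. \<integral>\<^sup>+x. ennreal (norm (u n x - f x)) \<partial>M) \<longlonglongrightarrow> 0"
  shows "integrable M f"
proof -
  have [measurable]: "u n \<in> borel_measurable M" for n using u by auto
  obtain n where n: "(\<integral>\<^sup>+x. ennreal (norm (u n x - f x)) \<partial>M) < 1"
    using order_tendstoD(2)[OF lim, of 1] by (auto simp: eventually_sequentially)
  have "integrable M (\<lambda>x. u n x - f x)"
    by (rule integrableI_bounded) (measurable, use less_trans[OF n ennreal_one_less_top] in \<open>simp only: infinity_ennreal_def\<close>)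
  from bochner_diff[OF u[of n] this] show ?thesis by simp
qed

lemma integrable_on_bounded_open:
  fixes f :: "real^2 \<Rightarrow> complex"
  assumes "open \<Omega>" "bounded \<Omega>" and c: "continuous_on UNIV f"
  shows "L1 (\<lambda>x. ind \<Omega> x *\<^sub>R f x)"
proof -
  have "L1 (\<lambda>x. ind (closure \<Omega>) x *\<^sub>R f x)"
    by (rule borel_integrable_compact) (use assms in \<open>auto intro: continuous_on_subset[OF c]\<close>)
  from integrable_mult_indicator[OF _ this, of \<Omega>]
  have "L1 (\<lambda>x. ind \<Omega> x *\<^sub>R (ind (closure \<Omega>) x *\<^sub>R f x))"
    using assms by auto
  also have "(\<lambda>x. ind \<Omega> x *\<^sub>R (ind (closure \<Omega>) x *\<^sub>R f x)) = (\<lambda>x. ind \<Omega> x *\<^sub>R f x)"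
    using closure_subset[of \<Omega>] by (auto simp: indicator_def fun_eq_iff)
  finally show ?thesis .
qed

context corner_domain
begin

text \<open>The factor with the frontier makes the function Borel, since g is measurable only there;
  the factor with the interval confines it to the part of the ray that is known to be an
  edge.\<close>

definition edge_value :: "(real^2 \<Rightarrow> complex) \<Rightarrow> real \<Rightarrow> real \<Rightarrow> complex" where
  "edge_value g az t = ind {0<..<h} t *\<^sub>R (ind (frontier \<Omega>) (t *\<^sub>R dir az) *\<^sub>R g (t *\<^sub>R dir az))"

lemma edge_value_borel:
  assumes "g \<in> borel_measurable (surface_measure \<Omega>)"
  shows "edge_value g az \<in> BM"
proof -
  have "(\<lambda>t::real. t *\<^sub>R dir az) \<in> BM" by measurable
  from measurable_compose[OF this surface_measurable[OF assms]]
  have [measurable]: "(\<lambda>t. ind (frontier \<Omega>) (t *\<^sub>R dir az) *\<^sub>R g (t *\<^sub>R dir az)) \<in> BM" .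
  show ?thesis unfolding edge_value_def[abs_def] by measurable
qed

lemma edge_value_eq: "az = azm \<or> az = azM \<Longrightarrow> 0 < t \<Longrightarrow> t < h \<Longrightarrow> edge_value g az t = g (t *\<^sub>R dir az)"
  using edge[of az t] by (auto simp: edge_value_def)

text \<open>One sequence of smooth functions is made to serve everywhere: it converges in the first
  mean to the chosen representatives of u and of its gradient (its own weak derivatives agree with
  them by uniqueness), and on both edges, where the surface measure is arc length.\<close>

lemma trace_data:
  assumes tr: "has_trace \<Omega> u g" and U: "rep \<Omega> u U" and d: "\<And>i. weak_partial \<Omega> i u (d i)" "\<And>i. rep \<Omega> (d i) (D i)"
  obtains \<psi> where "\<And>n::nat. smooth (\<psi> n)" "(\<lambda>n. LNN x. ennreal (norm (ind \<Omega> x *\<^sub>R \<psi> n x - U x))) \<longlonglongrightarrow> 0"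
      "\<And>i. (\<lambda>n. LNN x. ennreal (norm (ind \<Omega> x *\<^sub>R partial i (\<psi> n) x - D i x))) \<longlonglongrightarrow> 0"
      "\<And>az. az = azm \<or> az = azM \<Longrightarrow> (\<lambda>n. LNN t. ind {0<..<h} t * ennreal (norm (\<psi> n (t *\<^sub>R dir az) - edge_value g az t))) \<longlonglongrightarrow> 0"
proof -
  from tr obtain \<psi> where g: "g \<in> borel_measurable (surface_measure \<Omega>)" and sm: "\<And>n::nat. smooth (\<psi> n)"
    and 0: "(\<lambda>n. \<integral>\<^sup>+x. ennreal ((norm (\<psi> n x - u x))\<^sup>2) \<partial>lebesgue_on \<Omega>) \<longlonglongrightarrow> 0"
    and 1: "\<And>i. \<exists>d. weak_partial \<Omega> i u d \<and> square_integrable \<Omega> d \<and>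
           (\<lambda>n. \<integral>\<^sup>+x. ennreal ((norm (partial i (\<psi> n) x - d x))\<^sup>2) \<partial>lebesgue_on \<Omega>) \<longlonglongrightarrow> 0"
    and 2: "(\<lambda>n. \<integral>\<^sup>+x. ennreal ((norm (\<psi> n x - g x))\<^sup>2) \<partial>surface_measure \<Omega>) \<longlonglongrightarrow> 0"
    unfolding has_trace_def by blast
  have \<psi>b[measurable]: "\<psi> n \<in> BM" "partial i (\<psi> n) \<in> BM" for n i
    using smooth_borel[OF sm] smooth_borel[OF smooth_partial[OF sm]] by auto
  show ?thesis
  proof (rule that[OF sm])
    show "(\<lambda>n. LNN x. ennreal (norm (ind \<Omega> x *\<^sub>R \<psi> n x - U x))) \<longlonglongrightarrow> 0"
      by (rule rep_L1_tendsto[OF \<Omega> U \<psi>b(1) 0])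
    fix i :: 2
    obtain d' where d': "weak_partial \<Omega> i u d'" "(\<lambda>n. \<integral>\<^sup>+x. ennreal ((norm (partial i (\<psi> n) x - d' x))\<^sup>2) \<partial>lebesgue_on \<Omega>) \<longlonglongrightarrow> 0"
      using 1 by blast
    have "rep \<Omega> d' (D i)" by (rule rep_cong_AE[OF _ weak_partial_unique[OF \<Omega>(1) d'(1) d(1)] d(2)]) (use \<Omega> in auto)
    from rep_L1_tendsto[OF \<Omega> this \<psi>b(2) d'(2)]
    show "(\<lambda>n. LNN x. ennreal (norm (ind \<Omega> x *\<^sub>R partial i (\<psi> n) x - D i x))) \<longlonglongrightarrow> 0" .
  next
    fix az assume az: "az = azm \<or> az = azM"
    define gB where "gB x = ind (frontier \<Omega>) x *\<^sub>R g x" for x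
    have [measurable]: "gB \<in> BM" unfolding gB_def[abs_def] by (rule surface_measurable[OF g])
    have [measurable]: "edge_value g az \<in> BM" by (rule edge_value_borel[OF g])
    define f where "f n x = ind (ball 0 h) x * ennreal ((norm (\<psi> n x - gB x))\<^sup>2)" for n x
    have fm: "f n \<in> BM" for n
    proof -
      have m: "(\<lambda>x. (norm (\<psi> n x - gB x))\<^sup>2) \<in> BM" using \<psi>b(1)[of n] by measurable
      show ?thesis unfolding f_def[abs_def]
        by (intro borel_measurable_times_ennreal borel_measurable_indicator measurable_compose[OF m measurable_ennreal]) auto
    qed
    have "(\<lambda>n. LNN t. ennreal ((norm (\<psi> n (t *\<^sub>R dir az) - edge_value g az t))\<^sup>2) * ind {0<..<h} t) \<longlonglongrightarrow> 0"
    proof (rule tendsto_sandwich[OF _ _ _ 2, of "\<lambda>_. 0"])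
      show "\<forall>\<^sub>F n in sequentially. (LNN t. ennreal ((norm (\<psi> n (t *\<^sub>R dir az) - edge_value g az t))\<^sup>2) * ind {0<..<h} t) \<le>
         (\<integral>\<^sup>+x. ennreal ((norm (\<psi> n x - g x))\<^sup>2) \<partial>surface_measure \<Omega>)"
      proof (intro always_eventually allI)
        fix n
        have "(LNN t. ennreal ((norm (\<psi> n (t *\<^sub>R dir az) - edge_value g az t))\<^sup>2) * ind {0<..<h} t) = (LNN t. ind {0<..<h} t * f n (t *\<^sub>R dir az))"
          by (intro nn_integral_cong) (auto simp: f_def gB_def edge_value_def indicator_def)
        also have "\<dots> \<le> (LNN t. ind {0<..<h} t * f n (t *\<^sub>R dir azm)) + (LNN t. ind {0<..<h} t * f n (t *\<^sub>R dir azM))"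
          using az by auto
        also have "\<dots> = (\<integral>\<^sup>+x. f n x \<partial>surface_measure \<Omega>)"
          by (rule surface_nn[symmetric, OF fm]) (auto simp: f_def)
        also have "\<dots> \<le> (\<integral>\<^sup>+x. ennreal ((norm (\<psi> n x - g x))\<^sup>2) \<partial>surface_measure \<Omega>)"
          by (rule nn_integral_mono) (auto simp: surface_measure_def space_restrict_space f_def gB_def indicator_def)
        finally show "(LNN t. ennreal ((norm (\<psi> n (t *\<^sub>R dir az) - edge_value g az t))\<^sup>2) * ind {0<..<h} t) \<le>
         (\<integral>\<^sup>+x. ennreal ((norm (\<psi> n x - g x))\<^sup>2) \<partial>surface_measure \<Omega>)" .
      qed
    qed auto
    then have "(\<lambda>n. LNN t. ennreal (norm (\<psi> n (t *\<^sub>R dir az) - edge_value g az t)) * ind {0<..<h} t) \<longlonglongrightarrow> 0"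
      by (rule L2_imp_L1[rotated 3]) (use h in auto)
    then show "(\<lambda>n. LNN t. ind {0<..<h} t * ennreal (norm (\<psi> n (t *\<^sub>R dir az) - edge_value g az t))) \<longlonglongrightarrow> 0"
      by (simp only: mult.commute)
  qed
qed

definition edge_flux :: "(real^2 \<Rightarrow> complex) \<Rightarrow> real \<Rightarrow> (real^2 \<Rightarrow> complex) \<Rightarrow> complex" where
  "edge_flux g az \<phi> = (LBINT t. edge_value g az t * ncomp az (partial 1 \<phi>) (partial 2 \<phi>) (t *\<^sub>R dir az))"

lemma edge_ncomp:
  assumes \<phi>: "smooth \<phi>" "\<And>x. r \<le> norm x \<Longrightarrow> \<phi> x = 0"
  shows "\<exists>C\<ge>0. \<forall>t. norm (ncomp az (partial 1 \<phi>) (partial 2 \<phi>) (t *\<^sub>R dir az)) \<le> C"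
    and "(\<lambda>t. ncomp az (partial 1 \<phi>) (partial 2 \<phi>) (t *\<^sub>R dir az)) \<in> BM"
    and "t > r \<Longrightarrow> ncomp az (partial 1 \<phi>) (partial 2 \<phi>) (t *\<^sub>R dir az) = 0"
proof -
  have cx: "continuous_on UNIV (\<lambda>t::real. X (t *\<^sub>R dir az))" if "smooth X" for X
    by (rule continuous_on_compose2[OF smooth_cont[OF that]]) (auto intro!: continuous_intros)
  have c: "continuous_on UNIV (\<lambda>t. ncomp az (partial 1 \<phi>) (partial 2 \<phi>) (t *\<^sub>R dir az))"
    unfolding ncomp_def by (intro continuous_intros cx smooth_partial \<phi>)
  have z: "ncomp az (partial 1 \<phi>) (partial 2 \<phi>) (t *\<^sub>R dir az) = 0" if "norm t > r" for t :: real
    using partial_outside(1)[of r \<phi> "t *\<^sub>R dir az"] \<phi>(2) that by (simp add: ncomp_def)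
  show "\<exists>C\<ge>0. \<forall>t. norm (ncomp az (partial 1 \<phi>) (partial 2 \<phi>) (t *\<^sub>R dir az)) \<le> C"
    by (rule bounded_cont_support[OF c, of "r + 1"]) (use z in auto)
  show "(\<lambda>t. ncomp az (partial 1 \<phi>) (partial 2 \<phi>) (t *\<^sub>R dir az)) \<in> BM"
    by (rule borel_measurable_continuous_onI[OF c])
  show "t > r \<Longrightarrow> ncomp az (partial 1 \<phi>) (partial 2 \<phi>) (t *\<^sub>R dir az) = 0" using z[of t] by auto
qed

lemma edge_restrict_integrable:
  assumes "smooth X" shows "L1 (\<lambda>t. ind {0<..<h} t *\<^sub>R X (t *\<^sub>R dir az))"
proof -
  have c: "continuous_on UNIV (\<lambda>t::real. X (t *\<^sub>R dir az))"
    by (rule continuous_on_compose2[OF smooth_cont[OF assms]]) (auto intro!: continuous_intros)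
  have "L1 (\<lambda>t. ind {0..h} t *\<^sub>R X (t *\<^sub>R dir az))"
    by (rule borel_integrable_compact) (auto intro: continuous_on_subset[OF c])
  from integrable_mult_indicator[OF _ this, of "{0<..<h}"]
  have "L1 (\<lambda>t. ind {0<..<h} t *\<^sub>R (ind {0..h} t *\<^sub>R X (t *\<^sub>R dir az)))"
    by auto
  also have "(\<lambda>t. ind {0<..<h} t *\<^sub>R (ind {0..h} t *\<^sub>R X (t *\<^sub>R dir az))) = (\<lambda>t. ind {0<..<h} t *\<^sub>R X (t *\<^sub>R dir az))"
    by (auto simp: indicator_def)
  finally show ?thesis .
qed

lemma edge_L1:
  assumes g: "g \<in> borel_measurable (surface_measure \<Omega>)" and sm: "\<And>n::nat. smooth (\<psi> n)"
    and lim: "(\<lambda>n. LNN t. ind {0<..<h} t * ennreal (norm (\<psi> n (t *\<^sub>R dir az) - edge_value g az t))) \<longlonglongrightarrow> 0"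
  shows "(\<lambda>n. LNN t. ennreal (norm (ind {0<..<h} t *\<^sub>R \<psi> n (t *\<^sub>R dir az) - edge_value g az t))) \<longlonglongrightarrow> 0"
    and "L1 (edge_value g az)"
proof -
  have "(\<lambda>n. LNN t. ind {0<..<h} t * ennreal (norm (\<psi> n (t *\<^sub>R dir az) - edge_value g az t))) =
     (\<lambda>n. LNN t. ennreal (norm (ind {0<..<h} t *\<^sub>R \<psi> n (t *\<^sub>R dir az) - edge_value g az t)))"
    by (intro ext nn_integral_cong) (auto simp: indicator_def edge_value_def)
  then show 1: "(\<lambda>n. LNN t. ennreal (norm (ind {0<..<h} t *\<^sub>R \<psi> n (t *\<^sub>R dir az) - edge_value g az t))) \<longlonglongrightarrow> 0"
    using lim by simp
  show "L1 (edge_value g az)"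
    by (rule integrable_L1_limit[OF edge_restrict_integrable[OF sm] _ 1]) (use edge_value_borel[OF g] in simp)
qed

text \<open>Green's formula on the sector holds for the smooth approximations, and every term is a
  mean-convergent factor times a bounded one. In the limit the gradient integral is eliminated by
  the definition of the normal derivative functional, leaving all derivatives on the test
  function.\<close>

lemma trace_green:
  assumes tr: "has_trace \<Omega> u g" and nd: "has_normal_derivative \<Omega> u N" and wl: "weak_laplacian \<Omega> u f"
    and U: "rep \<Omega> u U" "L1 U" and F: "rep \<Omega> f F"
    and \<phi>: "smooth \<phi>" "\<And>x. r \<le> norm x \<Longrightarrow> \<phi> x = 0" and r: "r < h"
  shows "(LBINT x. U x * laplacian \<phi> x) = edge_flux g azm \<phi> - edge_flux g azM \<phi> - N \<phi> + (LBINT x. F x * \<phi> x)"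
    and "az = azm \<or> az = azM \<Longrightarrow> L1 (edge_value g az)" and "L1 F"
proof -
  have \<Omega>b[measurable]: "\<Omega> \<in> sets borel" using \<Omega> by auto
  have g: "g \<in> borel_measurable (surface_measure \<Omega>)" using tr by (simp add: has_trace_def)
  obtain d f' where d: "\<And>i. weak_partial \<Omega> i u (d i)" "\<And>i. square_integrable \<Omega> (d i)" and f': "weak_laplacian \<Omega> u f'" "square_integrable \<Omega> f'"
    and N: "N \<phi> = integral\<^sup>L (lebesgue_on \<Omega>) (\<lambda>x. (\<Sum>i\<in>UNIV. d i x * partial i \<phi> x) + f' x * \<phi> x)"
    using nd \<phi>(1) unfolding has_normal_derivative_def by blast
  have "\<exists>D. rep \<Omega> (d i) D \<and> L1 D" for i using rep_square_integrable[OF \<Omega> d(2)[of i]] by blast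
  then obtain D where D: "\<And>i. rep \<Omega> (d i) (D i)" "\<And>i. L1 (D i)" by metis
  have F': "rep \<Omega> f' F" by (rule rep_cong_AE[OF \<Omega>b weak_laplacian_unique[OF \<Omega>(1) f'(1) wl] F])
  have Fi: "L1 F"
  proof -
    obtain F2 where F2: "rep \<Omega> f' F2" "L1 F2" using rep_square_integrable[OF \<Omega> f'(2)] by blast
    then show ?thesis using rep_integrable[OF \<Omega>b F2(1)] rep_integrable[OF \<Omega>b F'] by simp
  qed
  show "L1 F" by (rule Fi)
  have s: "smooth (partial i \<phi>)" "smooth (laplacian \<phi>)" for i using \<phi>(1) by (auto intro: smooth_partial smooth_laplacian)
  note bm = smooth_borel[OF s(1)] smooth_borel[OF s(2)] smooth_borel[OF \<phi>(1)]
  have z: "partial i \<phi> x = 0" "laplacian \<phi> x = 0" if "r < norm x" for x i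
    using partial_outside[of r \<phi> x] \<phi>(2) that by auto
  have "\<exists>C\<ge>0. \<forall>x. norm (partial i \<phi> x) \<le> C" for i by (rule bounded_cont_support[OF smooth_cont[OF s(1)], of "r + 1"]) (use z in auto)
  then obtain Cp where Cp: "\<And>i x. norm (partial i \<phi> x) \<le> Cp i" by metis
  have "\<exists>C\<ge>0. \<forall>x. norm (laplacian \<phi> x) \<le> C" by (rule bounded_cont_support[OF smooth_cont[OF s(2)], of "r + 1"]) (use z in auto)
  then obtain Cl where Cl: "\<And>x. norm (laplacian \<phi> x) \<le> Cl" by metis
  have "\<exists>C\<ge>0. \<forall>x. norm (\<phi> x) \<le> C" by (rule bounded_cont_support[OF smooth_cont[OF \<phi>(1)], of r]) (use \<phi>(2) in auto)
  then obtain C0 where C0: "\<And>x. norm (\<phi> x) \<le> C0" by metis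
  have iD: "L1 (\<lambda>x. D i x * partial i \<phi> x)" for i by (rule integrable_bounded_mult[OF D(2) bm(1) Cp])
  have iF: "L1 (\<lambda>x. F x * \<phi> x)" by (rule integrable_bounded_mult[OF Fi bm(3) C0])
  have "N \<phi> = (LBINT x. (D 1 x * partial 1 \<phi> x + D 2 x * partial 2 \<phi> x) + F x * \<phi> x)"
    unfolding N sum_2 by (intro rep_integral \<Omega>b rep_add rep_mult D F' bm)
  then have N1: "N \<phi> = (LBINT x. D 1 x * partial 1 \<phi> x) + (LBINT x. D 2 x * partial 2 \<phi> x) + (LBINT x. F x * \<phi> x)"
    using iD iF by simp
  obtain \<psi> where sm: "\<And>n::nat. smooth (\<psi> n)" and \<psi>0: "(\<lambda>n. LNN x. ennreal (norm (ind \<Omega> x *\<^sub>R \<psi> n x - U x))) \<longlonglongrightarrow> 0"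
    and \<psi>1: "\<And>i. (\<lambda>n. LNN x. ennreal (norm (ind \<Omega> x *\<^sub>R partial i (\<psi> n) x - D i x))) \<longlonglongrightarrow> 0"
    and \<psi>2: "\<And>az. az = azm \<or> az = azM \<Longrightarrow> (\<lambda>n. LNN t. ind {0<..<h} t * ennreal (norm (\<psi> n (t *\<^sub>R dir az) - edge_value g az t))) \<longlonglongrightarrow> 0"
    using trace_data[OF tr U(1) d(1) D(1)] by blast
  show "az = azm \<or> az = azM \<Longrightarrow> L1 (edge_value g az)" by (rule edge_L1(2)[OF g sm \<psi>2])
  have iP: "L1 (\<lambda>x. ind \<Omega> x *\<^sub>R \<psi> n x)" "L1 (\<lambda>x. ind \<Omega> x *\<^sub>R partial i (\<psi> n) x)" for n i
    by (intro integrable_on_bounded_open \<Omega> smooth_cont smooth_partial sm)+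
  have flux: "(\<lambda>n. LBINT t. ind {0<..} t *\<^sub>R (\<psi> n (t *\<^sub>R dir az) * ncomp az (partial 1 \<phi>) (partial 2 \<phi>) (t *\<^sub>R dir az))) \<longlonglongrightarrow> edge_flux g az \<phi>"
    if az: "az = azm \<or> az = azM" for az
  proof -
    let ?nc = "\<lambda>t. ncomp az (partial 1 \<phi>) (partial 2 \<phi>) (t *\<^sub>R dir az)"
    obtain C where C: "\<And>t. norm (?nc t) \<le> C" using edge_ncomp(1)[of \<phi> r az, OF \<phi>] by blast
    have "(\<lambda>n. LBINT t. (ind {0<..<h} t *\<^sub>R \<psi> n (t *\<^sub>R dir az)) * ?nc t) \<longlonglongrightarrow> (LBINT t. edge_value g az t * ?nc t)"
      by (rule L1_mult_tendsto[OF edge_restrict_integrable[OF sm] edge_L1(2)[OF g sm \<psi>2[OF az]] _ C edge_L1(1)[OF g sm \<psi>2[OF az]]])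
        (use edge_ncomp(2)[of \<phi> r az, OF \<phi>] in simp)
    moreover have "(LBINT t. ind {0<..} t *\<^sub>R (\<psi> n (t *\<^sub>R dir az) * ?nc t)) = (LBINT t. (ind {0<..<h} t *\<^sub>R \<psi> n (t *\<^sub>R dir az)) * ?nc t)" for n
    proof (rule bochner_cong)
      fix t
      show "ind {0<..} t *\<^sub>R (\<psi> n (t *\<^sub>R dir az) * ?nc t) = (ind {0<..<h} t *\<^sub>R \<psi> n (t *\<^sub>R dir az)) * ?nc t"
        using edge_ncomp(3)[of \<phi> r t az, OF \<phi>] r by (cases "t < h") (auto simp: indicator_def)
    qed simp
    ultimately show ?thesis by (simp add: edge_flux_def)
  qed
  \<comment> \<open>The left side of Green's formula for the n-th approximation, with the sector
    replaced by \<Omega>; inside the support of the test function the two agree.\<close>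
  let ?T = "\<lambda>n. (LBINT x. (ind \<Omega> x *\<^sub>R partial 1 (\<psi> n) x) * partial 1 \<phi> x) + (LBINT x. (ind \<Omega> x *\<^sub>R partial 2 (\<psi> n) x) * partial 2 \<phi> x) +
     (LBINT x. (ind \<Omega> x *\<^sub>R \<psi> n x) * laplacian \<phi> x)"
  have "?T \<longlonglongrightarrow> (LBINT x. D 1 x * partial 1 \<phi> x) + (LBINT x. D 2 x * partial 2 \<phi> x) + (LBINT x. U x * laplacian \<phi> x)"
    by (intro tendsto_add L1_mult_tendsto[OF iP(2) D(2) _ Cp \<psi>1] L1_mult_tendsto[OF iP(1) U(2) _ Cl \<psi>0]) (use bm in simp_all)
  moreover have "?T = (\<lambda>n. (LBINT t. ind {0<..} t *\<^sub>R (\<psi> n (t *\<^sub>R dir azm) * ncomp azm (partial 1 \<phi>) (partial 2 \<phi>) (t *\<^sub>R dir azm))) -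
      (LBINT t. ind {0<..} t *\<^sub>R (\<psi> n (t *\<^sub>R dir azM) * ncomp azM (partial 1 \<phi>) (partial 2 \<phi>) (t *\<^sub>R dir azM))))"
  proof
    fix n
    have i1: "L1 (\<lambda>x. (ind \<Omega> x *\<^sub>R partial i (\<psi> n) x) * partial i \<phi> x)" for i
      by (rule integrable_bounded_mult[OF iP(2) bm(1) Cp])
    have i2: "L1 (\<lambda>x. (ind \<Omega> x *\<^sub>R \<psi> n x) * laplacian \<phi> x)"
      by (rule integrable_bounded_mult[OF iP(1) bm(2) Cl])
    have "?T n = (LBINT x. (ind \<Omega> x *\<^sub>R partial 1 (\<psi> n) x) * partial 1 \<phi> x + (ind \<Omega> x *\<^sub>R partial 2 (\<psi> n) x) * partial 2 \<phi> x +
        (ind \<Omega> x *\<^sub>R \<psi> n x) * laplacian \<phi> x)"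
      using i1[of 1] i1[of 2] i2 by simp
    also have "\<dots> = (LBINT x. ind (sector azm azM) x *\<^sub>R ((\<Sum>i\<in>UNIV. partial i (\<psi> n) x * partial i \<phi> x) + \<psi> n x * laplacian \<phi> x))"
    proof (rule bochner_cong)
      fix x :: "real^2"
      show "(ind \<Omega> x *\<^sub>R partial 1 (\<psi> n) x) * partial 1 \<phi> x + (ind \<Omega> x *\<^sub>R partial 2 (\<psi> n) x) * partial 2 \<phi> x +
        (ind \<Omega> x *\<^sub>R \<psi> n x) * laplacian \<phi> x = ind (sector azm azM) x *\<^sub>R ((\<Sum>i\<in>UNIV. partial i (\<psi> n) x * partial i \<phi> x) + \<psi> n x * laplacian \<phi> x)"
      proof (cases "norm x < h")
        case True
        then have "indicat_real \<Omega> x = ind (sector azm azM) x" using mem_iff by (simp add: indicator_def)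
        then show ?thesis by (simp add: sum_2 scaleR_add_right)
      next
        case False
        then have "r < norm x" using r by simp
        then show ?thesis by (simp add: z sum_2)
      qed
    qed simp
    also have "\<dots> = (LBINT t. ind {0<..} t *\<^sub>R (\<psi> n (t *\<^sub>R dir azm) * ncomp azm (partial 1 \<phi>) (partial 2 \<phi>) (t *\<^sub>R dir azm))) -
      (LBINT t. ind {0<..} t *\<^sub>R (\<psi> n (t *\<^sub>R dir azM) * ncomp azM (partial 1 \<phi>) (partial 2 \<phi>) (t *\<^sub>R dir azM)))"
      by (rule green_sector[OF angles sm \<phi>(1), of h]) (use \<phi>(2) r h in auto)
    finally show "?T n = \<dots>" .
  qed
  ultimately have "(LBINT x. D 1 x * partial 1 \<phi> x) + (LBINT x. D 2 x * partial 2 \<phi> x) + (LBINT x. U x * laplacian \<phi> x) =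
     edge_flux g azm \<phi> - edge_flux g azM \<phi>"
    using tendsto_diff[OF flux[of azm] flux[of azM]] LIMSEQ_unique by fastforce
  then show "(LBINT x. U x * laplacian \<phi> x) = edge_flux g azm \<phi> - edge_flux g azM \<phi> - N \<phi> + (LBINT x. F x * \<phi> x)"
    unfolding N1 by (simp add: algebra_simps)
qed

text \<open>In the difference of the two Green formulas the flux terms cancel because v and w share
  the trace g, and the difference of the normal derivative functionals is the conductive boundary
  term. Only the trace of v, weighted by \<eta>, remains on the edges.\<close>

lemma transmission_identity:
  assumes tr: "has_trace \<Omega> v g" "has_trace \<Omega> w g" and nd: "has_normal_derivative \<Omega> v Nv" "has_normal_derivative \<Omega> w Nw"
    and wl: "weak_laplacian \<Omega> v fv" "weak_laplacian \<Omega> w fw"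
    and jump: "\<And>\<phi>. smooth \<phi> \<Longrightarrow> Nv \<phi> + integral\<^sup>L (surface_measure \<Omega>) (\<lambda>x. \<eta> x * g x * \<phi> x) = Nw \<phi>"
    and \<eta>: "\<eta> \<in> borel_measurable (surface_measure \<Omega>)" "\<And>az t. az = azm \<or> az = azM \<Longrightarrow> norm (edge_value \<eta> az t) \<le> C\<eta>"
    and V: "rep \<Omega> v V" "L1 V" and W: "rep \<Omega> w W" "L1 W"
    and F: "rep \<Omega> fv Fv" "rep \<Omega> fw Fw"
    and \<phi>: "smooth \<phi>" "\<And>x. r \<le> norm x \<Longrightarrow> \<phi> x = 0" and r: "r < h"
  shows "(LBINT x. (V x - W x) * laplacian \<phi> x) = (LBINT x. (Fv x - Fw x) * \<phi> x) +
      (LBINT t. edge_value \<eta> azm t * edge_value g azm t * \<phi> (t *\<^sub>R dir azm)) +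
      (LBINT t. edge_value \<eta> azM t * edge_value g azM t * \<phi> (t *\<^sub>R dir azM))"
proof -
  have g: "g \<in> borel_measurable (surface_measure \<Omega>)" using tr by (simp add: has_trace_def)
  note gv = trace_green[OF tr(1) nd(1) wl(1) V F(1) \<phi> r] and gw = trace_green[OF tr(2) nd(2) wl(2) W F(2) \<phi> r]
  have s: "smooth (laplacian \<phi>)" using \<phi>(1) by (rule smooth_laplacian)
  have "\<exists>C\<ge>0. \<forall>x. norm (laplacian \<phi> x) \<le> C"
    by (rule bounded_cont_support[OF smooth_cont[OF s], of "r + 1"]) (use partial_outside(2)[of r \<phi>] \<phi>(2) in auto)
  then obtain Cl where Cl: "\<And>x. norm (laplacian \<phi> x) \<le> Cl" by metis
  have "\<exists>C\<ge>0. \<forall>x. norm (\<phi> x) \<le> C" by (rule bounded_cont_support[OF smooth_cont[OF \<phi>(1)], of r]) (use \<phi>(2) in auto)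
  then obtain C0 where C0: "\<And>x. norm (\<phi> x) \<le> C0" by metis
  have iL: "L1 (\<lambda>x. V x * laplacian \<phi> x)" "L1 (\<lambda>x. W x * laplacian \<phi> x)"
    by (rule integrable_bounded_mult[OF _ smooth_borel[OF s] Cl], fact)+
  have iF: "L1 (\<lambda>x. Fv x * \<phi> x)" "L1 (\<lambda>x. Fw x * \<phi> x)"
  proof -
    have "L1 Fv" "L1 Fw" using gv(3) gw(3) by blast+
    then show "L1 (\<lambda>x. Fv x * \<phi> x)" "L1 (\<lambda>x. Fw x * \<phi> x)"
      using integrable_bounded_mult[OF _ smooth_borel[OF \<phi>(1)] C0] by blast+
  qed
  define B where "B = (\<lambda>f x. ind (frontier \<Omega>) x *\<^sub>R f x :: complex)"
  have Bm[measurable]: "B \<eta> \<in> BM" "B g \<in> BM"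
    using surface_measurable[OF \<eta>(1)] surface_measurable[OF g] by (simp_all add: B_def)
  have [measurable]: "\<phi> \<in> BM" by (rule smooth_borel[OF \<phi>(1)])
  let ?f = "\<lambda>x. B \<eta> x * B g x * \<phi> x"
  have ev: "ind {0<..<h} t *\<^sub>R ?f (t *\<^sub>R dir az) = edge_value \<eta> az t * edge_value g az t * \<phi> (t *\<^sub>R dir az)" for az t
    by (auto simp: B_def edge_value_def indicator_def)
  have ie: "L1 (\<lambda>t. edge_value \<eta> az t * edge_value g az t * \<phi> (t *\<^sub>R dir az))" if az: "az = azm \<or> az = azM" for az
  proof -
    have [measurable]: "edge_value \<eta> az \<in> BM" by (rule edge_value_borel[OF \<eta>(1)])
    have "L1 (\<lambda>t. edge_value g az t * (edge_value \<eta> az t * \<phi> (t *\<^sub>R dir az)))"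
    proof (rule integrable_bounded_mult)
      show "L1 (edge_value g az)" using gv(2)[OF _ az] by blast
      show "norm (edge_value \<eta> az t * \<phi> (t *\<^sub>R dir az)) \<le> C\<eta> * C0" for t
        unfolding norm_mult by (intro mult_mono \<eta>(2)[OF az] C0 order_trans[OF norm_ge_zero \<eta>(2)[OF az]]) simp
    qed measurable
    then show ?thesis by (simp only: ac_simps)
  qed
  have "Nw \<phi> - Nv \<phi> = integral\<^sup>L (surface_measure \<Omega>) (\<lambda>x. \<eta> x * g x * \<phi> x)"
    using jump[OF \<phi>(1)] by (simp add: algebra_simps)
  also have "\<dots> = integral\<^sup>L (surface_measure \<Omega>) ?f"
    by (intro bochner_cong) (auto simp: surface_measure_def space_restrict_space B_def)
  also have "\<dots> = (LBINT t. ind {0<..<h} t *\<^sub>R ?f (t *\<^sub>R dir azm)) + (LBINT t. ind {0<..<h} t *\<^sub>R ?f (t *\<^sub>R dir azM))"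
  proof (rule surface_int)
    show "?f \<in> BM" by measurable
    show "?f x = 0" if "x \<notin> ball 0 h" for x using that \<phi>(2)[of x] r by simp
  qed (use ie in \<open>simp_all only: ev\<close>, auto)
  finally show ?thesis
    using gv(1) gw(1) iL iF unfolding ev by (simp add: left_diff_distrib)
qed

text \<open>A point value demands a representative that is genuinely continuous at the vertex. The
  essential limit gives countably many estimates, each outside a null set; resetting the function to
  0 on their union makes all of them hold at every point.\<close>

lemma point_value_zero:
  assumes r: "rep \<Omega> f F" and l: "ess_lim (sector azm azM) F 0"
  shows "point_value \<Omega> f 0 0"
proof -
  have "\<exists>\<rho>>0. AE x in lborel. x \<in> sector azm azM \<and> norm x < \<rho> \<longrightarrow> norm (F x - 0) < inverse (real (Suc n))" for n
    using l unfolding ess_lim_def by (elim allE[of _ "inverse (real (Suc n))"]) simp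
  then have "\<exists>\<rho>. \<forall>n. \<rho> n > 0 \<and> (AE x in lborel. x \<in> sector azm azM \<and> norm x < \<rho> n \<longrightarrow> norm (F x - 0) < inverse (real (Suc n)))"
    by (intro choice allI)
  then obtain \<rho> where \<rho>: "\<And>n. \<rho> n > 0" "\<And>n. AE x in lborel. x \<in> sector azm azM \<and> norm x < \<rho> n \<longrightarrow> norm (F x - 0) < inverse (real (Suc n))"
    by blast
  \<comment> \<open>The radius is also kept below h, so that membership in the domain means
    membership in the sector.\<close>
  define good where "good x \<longleftrightarrow> (\<forall>n. x \<in> \<Omega> \<and> norm x < min (\<rho> n) h \<longrightarrow> norm (f x) < inverse (real (Suc n)))" for x
  have fF: "AE x in lborel. x \<in> \<Omega> \<longrightarrow> f x = F x" using r by (auto simp: rep_def)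
  have "AE x in lborel. \<forall>n. x \<in> sector azm azM \<and> norm x < \<rho> n \<longrightarrow> norm (F x - 0) < inverse (real (Suc n))"
    using \<rho>(2) by (subst AE_all_countable) blast
  then have g: "AE x in lborel. good x"
    using fF
  proof eventually_elim
    case (elim x)
    show ?case unfolding good_def
    proof (intro allI impI)
      fix n assume x: "x \<in> \<Omega> \<and> norm x < min (\<rho> n) h"
      then have "x \<in> sector azm azM" using mem_iff[of x] by simp
      then show "norm (f x) < inverse (real (Suc n))" using elim x by simp
    qed
  qed
  define f' where "f' x = (if x \<in> \<Omega> \<and> good x then f x else 0)" for x
  have 0: "0 \<notin> \<Omega>" using vertex \<Omega> by (simp add: frontier_def interior_open)
  have "AE x in lebesgue_on \<Omega>. f' x = f x"
    by (subst AE_lebesgue_on_iff) (use \<Omega> g in \<open>auto simp: f'_def\<close>)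
  moreover have "continuous (at 0 within insert 0 \<Omega>) f'"
    unfolding continuous_within_eps_delta
  proof (intro allI impI)
    fix e :: real assume "0 < e"
    then obtain n where n: "inverse (real (Suc n)) < e" using reals_Archimedean by blast
    show "\<exists>d>0. \<forall>x'\<in>insert 0 \<Omega>. dist x' 0 < d \<longrightarrow> dist (f' x') (f' 0) < e"
    proof (intro exI[of _ "min (\<rho> n) h"] conjI ballI impI)
      show "0 < min (\<rho> n) h" using \<rho>(1) h by simp
      fix x assume x: "x \<in> insert 0 \<Omega>" "dist x 0 < min (\<rho> n) h"
      show "dist (f' x) (f' 0) < e"
      proof (cases "x \<in> \<Omega> \<and> good x")
        case True
        then have "norm (f x) < inverse (real (Suc n))" using x(2) unfolding good_def dist_norm by simp
        then show ?thesis using n 0 True by (simp add: f'_def)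
      next
        case False
        then show ?thesis using \<open>0 < e\<close> 0 by (auto simp: f'_def)
      qed
    qed
  qed
  ultimately show ?thesis unfolding point_value_def using 0 by (intro exI[of _ f']) (simp add: f'_def)
qed

end

lemma holder_on_bounded:
  assumes f: "holder_on \<alpha> S f" and S: "bounded S" and \<alpha>: "\<alpha> > 0"
  shows "\<exists>C\<ge>0. \<forall>x\<in>S. norm (f x) \<le> C"
proof (cases "S = {}")
  case False
  then obtain y where y: "y \<in> S" by blast
  obtain C where C: "\<And>x y. x \<in> S \<Longrightarrow> y \<in> S \<Longrightarrow> norm (f x - f y) \<le> C * dist x y powr \<alpha>" using f unfolding holder_on_def by blast
  obtain B where B: "\<And>x. x \<in> S \<Longrightarrow> norm x \<le> B" using S unfolding bounded_iff by blast
  have "norm (f x) \<le> norm (f y) + \<bar>C\<bar> * (2 * B) powr \<alpha>" if x: "x \<in> S" for x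
  proof -
    have "dist x y \<le> 2 * B" using B[OF x] B[OF y] norm_triangle_ineq4[of x y] by (simp add: dist_norm)
    then have "dist x y powr \<alpha> \<le> (2 * B) powr \<alpha>" using \<alpha> by (intro powr_mono2) auto
    then have "C * dist x y powr \<alpha> \<le> \<bar>C\<bar> * (2 * B) powr \<alpha>" by (intro mult_mono) auto
    then show ?thesis using C[OF x y] norm_triangle_ineq2[of "f x" "f y"] by linarith
  qed
  moreover have "0 \<le> norm (f y) + \<bar>C\<bar> * (2 * B) powr \<alpha>" by simp
  ultimately show ?thesis by blast
qed auto

lemma holder_on_ray:
  assumes f: "holder_on \<alpha> (closure (ray_segment az h)) f" and \<alpha>: "\<alpha> > 0" and h: "h > 0" and az: "- pi < az" "az < pi"
  shows "((\<lambda>t. f (t *\<^sub>R dir az)) \<longlongrightarrow> f 0) (at_right 0)" "\<exists>C\<ge>0. \<forall>t\<in>{0<..<h}. norm (f (t *\<^sub>R dir az)) \<le> C"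
proof -
  have m: "t *\<^sub>R dir az \<in> closure (ray_segment az h)" if "t \<in> {0<..<h}" for t
    using that closure_subset[of "ray_segment az h"] ray_iff[OF az] by (auto simp: ray_segment_def)
  have "0 \<in> closure (closure (ray_segment az h))" unfolding closure_approachable[of _ "closure (ray_segment az h)"]
  proof (intro allI impI)
    fix e :: real assume e: "e > 0"
    have "(min e h / 2) *\<^sub>R dir az \<in> closure (ray_segment az h)" using e h by (intro m) auto
    moreover have "dist ((min e h / 2) *\<^sub>R dir az) 0 < e" using e h by simp
    ultimately show "\<exists>y\<in>closure (ray_segment az h). dist y 0 < e" by blast
  qed
  then have z: "0 \<in> closure (ray_segment az h)" by simp
  obtain C where C: "\<And>x y. x \<in> closure (ray_segment az h) \<Longrightarrow> y \<in> closure (ray_segment az h) \<Longrightarrow> norm (f x - f y) \<le> C * dist x y powr \<alpha>"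
    using f unfolding holder_on_def by blast
  have "((\<lambda>t. f (t *\<^sub>R dir az) - f 0) \<longlongrightarrow> 0) (at_right 0)"
  proof (rule Lim_null_comparison)
    have "\<forall>\<^sub>F t in at_right 0. t \<in> {0<..<h}" using h by (rule eventually_at_right_real)
    then show "\<forall>\<^sub>F t in at_right 0. norm (f (t *\<^sub>R dir az) - f 0) \<le> C * t powr \<alpha>"
    proof eventually_elim
      case (elim t)
      then show ?case using C[OF m[OF elim] z] by simp
    qed
    have "((\<lambda>t. t powr \<alpha>) \<longlongrightarrow> 0) (at_right (0::real))"
      by (rule tendsto_zero_powrI[OF _ tendsto_const _ \<alpha>]) (auto intro!: tendsto_ident_at eventually_at_rightI[of 0 1])
    then have "((\<lambda>t. C * t powr \<alpha>) \<longlongrightarrow> C * 0) (at_right (0::real))" by (rule tendsto_mult_left)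
    then show "((\<lambda>t. C * t powr \<alpha>) \<longlongrightarrow> 0) (at_right (0::real))" by simp
  qed
  then show "((\<lambda>t. f (t *\<^sub>R dir az)) \<longlongrightarrow> f 0) (at_right 0)" by (rule Lim_null[THEN iffD2])
  have "bounded (ray_segment az h)" unfolding ray_segment_def by (rule bounded_subset[OF bounded_ball[of 0 h]]) blast
  then have "bounded (closure (ray_segment az h))" by (rule bounded_closure)
  from holder_on_bounded[OF f this \<alpha>] show "\<exists>C\<ge>0. \<forall>t\<in>{0<..<h}. norm (f (t *\<^sub>R dir az)) \<le> C" using m by blast
qed

lemma sobolev_weak_gradient:
  assumes \<Omega>: "open \<Omega>" "bounded \<Omega>" and s: "sobolev (Suc m) \<Omega> u" and U: "rep \<Omega> u U" "L1 U"
  obtains d D where "weak_gradient \<Omega> U D" "\<And>i. weak_partial \<Omega> i u (d i)" "\<And>i. rep \<Omega> (d i) (D i)" "\<And>i. sobolev m \<Omega> (d i)"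
proof -
  have "\<forall>i. \<exists>p. weak_partial \<Omega> i u (fst p) \<and> sobolev m \<Omega> (fst p) \<and> rep \<Omega> (fst p) (snd p) \<and> L1 (snd p)"
  proof
    fix i
    obtain d where d: "weak_partial \<Omega> i u d" "sobolev m \<Omega> d" using s by auto
    then have "square_integrable \<Omega> d" by (cases m) auto
    then obtain D where "rep \<Omega> d D" "L1 D" by (rule rep_square_integrable[OF \<Omega>])
    then show "\<exists>p. weak_partial \<Omega> i u (fst p) \<and> sobolev m \<Omega> (fst p) \<and> rep \<Omega> (fst p) (snd p) \<and> L1 (snd p)"
      using d by (intro exI[of _ "(d, D)"]) simp
  qed
  from choice[OF this] obtain p where p: "\<And>i. weak_partial \<Omega> i u (fst (p i))" "\<And>i. sobolev m \<Omega> (fst (p i))"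
    "\<And>i. rep \<Omega> (fst (p i)) (snd (p i))" "\<And>i. L1 (snd (p i))" by blast
  show ?thesis by (rule that[OF weak_gradientI[OF \<Omega>(1) U p(3,4,1)] p(1,3,2)])
qed

context corner_domain
begin

lemma ess_lim_sector:
  assumes l: "ess_lim (sector azm az0) U c" "ess_lim (sector az0 azM) U c" and t: "azm < az0" "az0 < azM"
  shows "ess_lim (sector azm azM) U c"
  unfolding ess_lim_def
proof (intro allI impI)
  fix e :: real assume "e > 0"
  then obtain r where r: "r > 0" "AE x in lborel. x \<in> sector azm az0 \<union> sector az0 azM \<and> norm x < r \<longrightarrow> norm (U x - c) < e"
    using ess_lim_Un[OF l] unfolding ess_lim_def by blast
  have ray: "AE x in lborel. x \<notin> ray az0" by (rule ray_null) (use t angles in auto)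
  show "\<exists>r>0. AE x in lborel. x \<in> sector azm azM \<and> norm x < r \<longrightarrow> norm (U x - c) < e"
    by (intro exI[of _ r] conjI r(1)) (use r(2) ray sector_split[OF t] in \<open>eventually_elim, blast\<close>)
qed

lemma edge_integral_eq:
  assumes \<eta>: "\<eta> \<in> borel_measurable (surface_measure \<Omega>)" and g: "g \<in> borel_measurable (surface_measure \<Omega>)"
    and G: "continuous_on UNIV G" and ae: "AE t in lborel. t \<in> {0<..<h / 8} \<longrightarrow> edge_value g az t = G t"
    and \<phi>: "smooth \<phi>" "\<And>x. r \<le> norm x \<Longrightarrow> \<phi> x = 0" and r: "r < \<delta>" "\<delta> \<le> h / 8"
  shows "(LBINT t. edge_value \<eta> az t * edge_value g az t * \<phi> (t *\<^sub>R dir az)) =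
    (LBINT t. ind {0<..} t *\<^sub>R ((ind {0<..<\<delta>} t *\<^sub>R (edge_value \<eta> az t * G t)) * \<phi> (t *\<^sub>R dir az)))"
proof (rule integral_cong_AE)
  note [measurable] = edge_value_borel[OF \<eta>, of az] edge_value_borel[OF g, of az] borel_measurable_continuous_onI[OF G] smooth_borel[OF \<phi>(1)]
  show "(\<lambda>t. edge_value \<eta> az t * edge_value g az t * \<phi> (t *\<^sub>R dir az)) \<in> borel_measurable lborel" by measurable
  show "(\<lambda>t. ind {0<..} t *\<^sub>R ((ind {0<..<\<delta>} t *\<^sub>R (edge_value \<eta> az t * G t)) * \<phi> (t *\<^sub>R dir az))) \<in> borel_measurable lborel" by measurable
  show "AE t in lborel. edge_value \<eta> az t * edge_value g az t * \<phi> (t *\<^sub>R dir az) =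
    ind {0<..} t *\<^sub>R ((ind {0<..<\<delta>} t *\<^sub>R (edge_value \<eta> az t * G t)) * \<phi> (t *\<^sub>R dir az))"
    using ae
  proof eventually_elim
    case (elim t)
    consider "t \<le> 0" | "t \<in> {0<..<\<delta>}" | "\<delta> \<le> t" by force
    then show ?case
    proof cases
      case 1 then show ?thesis by (simp add: edge_value_def)
    next
      case 2
      then have "edge_value g az t = G t" using elim r by auto
      then show ?thesis using 2 by simp
    next
      case 3
      then have "\<phi> (t *\<^sub>R dir az) = 0" using r by (intro \<phi>(2)) simp
      then show ?thesis by simp
    qed
  qed
qed

lemma edge_coefficient_tendsto:
  assumes \<eta>: "((\<lambda>t. \<eta> (t *\<^sub>R dir az)) \<longlongrightarrow> \<eta> 0) (at_right 0)" and az: "az = azm \<or> az = azM"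
    and G: "continuous_on UNIV G" and \<delta>: "0 < \<delta>" "\<delta> \<le> h"
  shows "((\<lambda>t. ind {0<..<\<delta>} t *\<^sub>R (edge_value \<eta> az t * G t)) \<longlongrightarrow> \<eta> 0 * G 0) (at_right 0)"
proof -
  have "(G \<longlongrightarrow> G 0) (at 0 within UNIV)" using G unfolding continuous_on_def by blast
  then have "(G \<longlongrightarrow> G 0) (at_right 0)" by (rule tendsto_within_subset) simp
  then have "((\<lambda>t. \<eta> (t *\<^sub>R dir az) * G t) \<longlongrightarrow> \<eta> 0 * G 0) (at_right 0)" by (rule tendsto_mult[OF \<eta>])
  moreover have "\<forall>\<^sub>F t in at_right 0. \<eta> (t *\<^sub>R dir az) * G t = ind {0<..<\<delta>} t *\<^sub>R (edge_value \<eta> az t * G t)"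
    using eventually_at_right_real[OF \<delta>(1)] by eventually_elim (use \<delta> in \<open>simp add: edge_value_eq[OF az]\<close>)
  ultimately show ?thesis by (rule Lim_transform_eventually)
qed

lemma edge_coefficient_bounded:
  assumes \<eta>: "\<And>t. norm (edge_value \<eta> az t) \<le> C" and G: "continuous_on UNIV G"
  shows "\<exists>K\<ge>0. \<forall>t. norm (ind {0<..<\<delta>} t *\<^sub>R (edge_value \<eta> az t * G t) :: complex) \<le> K"
proof -
  have "bounded (G ` {0..\<delta>})" by (intro compact_imp_bounded compact_continuous_image continuous_on_subset[OF G]) auto
  then obtain B where B: "\<And>t. t \<in> {0..\<delta>} \<Longrightarrow> norm (G t) \<le> B" unfolding bounded_iff by blast
  have C: "C \<ge> 0" using \<eta>[of 0] norm_ge_zero order_trans by blast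
  have "norm (ind {0<..<\<delta>} t *\<^sub>R (edge_value \<eta> az t * G t)) \<le> C * \<bar>B\<bar>" for t
  proof (cases "t \<in> {0<..<\<delta>}")
    case True
    then have "norm (G t) \<le> \<bar>B\<bar>" using B[of t] by auto
    then have "norm (edge_value \<eta> az t) * norm (G t) \<le> C * \<bar>B\<bar>" by (intro mult_mono \<eta> C) auto
    then show ?thesis using True by (simp add: norm_mult)
  next
    case False
    have "0 \<le> C * \<bar>B\<bar>" using C by simp
    with False show ?thesis by simp
  qed
  moreover have "0 \<le> C * \<bar>B\<bar>" using C by simp
  ultimately show ?thesis by blast
qed

text \<open>What has to be manufactured for the abstract corner identity is boundedness of the
  source and a common limit of the two edge densities. Both rest on the continuity of v up to the
  vertex; the equation for w contributes through the bounded product q w.\<close>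

theorem eigenfunctions_vanish_at_corner:
  assumes V: "V \<in> borel_measurable (lebesgue_on \<Omega>)" and \<eta>: "\<eta> \<in> borel_measurable (surface_measure \<Omega>)"
    and v2: "sobolev 2 \<Omega> v" and eig: "conductive_transmission_eigenfunctions \<Omega> k V \<eta> v w" and \<alpha>: "\<alpha> > 0"
    and f: "holder_on \<alpha> (closure (sector_disc azm azM h)) f" "AE x in lebesgue_on (sector_disc azm azM h). (1 + V x) * w x = f x"
    and \<eta>h: "holder_on \<alpha> (closure (ray_segment azm h)) \<eta>" "holder_on \<alpha> (closure (ray_segment azM h)) \<eta>"
    and \<eta>0: "\<eta> 0 \<noteq> 0" and npi: "azM - azm \<noteq> pi"
  shows "point_value \<Omega> v 0 0 \<and> point_value \<Omega> w 0 0"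
proof -
  define kk where "kk = (complex_of_real k)\<^sup>2"
  have \<Omega>b[measurable]: "\<Omega> \<in> sets borel" using \<Omega> by auto
  from eig have wl: "weak_laplacian \<Omega> v (\<lambda>x. - kk * v x)" "weak_laplacian \<Omega> w (\<lambda>x. - kk * (1 + V x) * w x)"
    and w1: "sobolev 1 \<Omega> w" by (simp_all add: conductive_transmission_eigenfunctions_def kk_def)
  from eig obtain g Nv Nw where tr: "has_trace \<Omega> v g" "has_trace \<Omega> w g"
    and nd: "has_normal_derivative \<Omega> v Nv" "has_normal_derivative \<Omega> w Nw"
    and jump: "\<And>\<phi>. smooth \<phi> \<Longrightarrow> Nv \<phi> + integral\<^sup>L (surface_measure \<Omega>) (\<lambda>x. \<eta> x * g x * \<phi> x) = Nw \<phi>"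
    unfolding conductive_transmission_eigenfunctions_def by blast
  have g: "g \<in> borel_measurable (surface_measure \<Omega>)" using tr by (simp add: has_trace_def)
  have v2': "sobolev (Suc (Suc 0)) \<Omega> v" using v2 by (simp only: numeral_2_eq_2)
  then have "square_integrable \<Omega> v" by simp
  then obtain V' where V': "rep \<Omega> v V'" "L1 V'" by (rule rep_square_integrable[OF \<Omega>])
  have wsq: "square_integrable \<Omega> w" using w1 by simp
  then obtain W' where W': "rep \<Omega> w W'" "L1 W'" by (rule rep_square_integrable[OF \<Omega>])
  obtain d D where D: "weak_gradient \<Omega> V' D" "\<And>i. weak_partial \<Omega> i v (d i)" "\<And>i. rep \<Omega> (d i) (D i)" "\<And>i. sobolev (Suc 0) \<Omega> (d i)"
    by (rule sobolev_weak_gradient[OF \<Omega> v2' V'], rule that)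
  have "\<forall>i. \<exists>DD. weak_gradient \<Omega> (D i) DD"
  proof
    fix i
    have "L1 (D i)" using D(1) by (simp add: weak_gradient_def)
    show "\<exists>DD. weak_gradient \<Omega> (D i) DD"
    proof (rule sobolev_weak_gradient[OF \<Omega> D(4) D(3) \<open>L1 (D i)\<close>])
      fix D' assume "weak_gradient \<Omega> (D i) D'"
      then show ?thesis by blast
    qed
  qed
  from choice[OF this] obtain DD where DD: "\<And>i. weak_gradient \<Omega> (D i) (DD i)" by blast
  obtain \<psi> where \<psi>: "\<And>n::nat. smooth (\<psi> n)" "(\<lambda>n. LNN x. ennreal (norm (ind \<Omega> x *\<^sub>R \<psi> n x - V' x))) \<longlonglongrightarrow> 0"
      "\<And>i. (\<lambda>n. LNN x. ennreal (norm (ind \<Omega> x *\<^sub>R partial i (\<psi> n) x - D i x))) \<longlonglongrightarrow> 0"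
    and \<psi>r: "\<And>az. az = azm \<or> az = azM \<Longrightarrow> (\<lambda>n. LNN t. ind {0<..<h} t * ennreal (norm (\<psi> n (t *\<^sub>R dir az) - edge_value g az t))) \<longlonglongrightarrow> 0"
    by (rule trace_data[OF tr(1) V'(1) D(2,3)], rule that)
  \<comment> \<open>The bisector and a quarter of the opening. Besides the two halves of the sector,
    the cone of half-width \<omega> about the bisector is convex and overlaps both.\<close>
  define az0 where "az0 = (azm + azM) / 2"
  define \<omega> where "\<omega> = (azM - azm) / 4"
  have \<omega>: "\<omega> > 0" "azm = az0 - 2 * \<omega>" "azM = az0 + 2 * \<omega>" using angles by (auto simp: az0_def \<omega>_def field_simps)
  have pi: "2 * \<omega> < pi" "- pi < az0" "az0 < pi" using angles \<omega> by linarith+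
  note gb = edge_value_borel[OF g]
  have ca: "azm < az0" "az0 - azm < pi" and cb: "az0 < azM" "azM - az0 < pi"
    and cc: "- pi < az0 - \<omega>" "az0 - \<omega> < az0 + \<omega>" "az0 + \<omega> < pi" "az0 + \<omega> - (az0 - \<omega>) < pi" using angles \<omega> pi by linarith+
  have sa: "sector azm az0 \<subseteq> sector azm azM" and sb: "sector az0 azM \<subseteq> sector azm azM" and sc: "sector (az0 - \<omega>) (az0 + \<omega>) \<subseteq> sector azm azM"
    using \<omega> by (auto simp: sector_def)
  obtain G1 :: "real \<times> real \<Rightarrow> complex" where G1: "continuous_on UNIV G1" "ess_lim (sector azm az0) V' (G1 (0, 0))"
    "AE t in lborel. t \<in> {0<..<h / 8} \<longrightarrow> edge_value g azm t = G1 (t, 0)"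
  proof (rule cone_trace[OF angles(1) ca(1) pi(3) ca(2) sa D(1) DD \<psi>])
    fix G :: "real \<times> real \<Rightarrow> complex" assume G: "continuous_on UNIV G" "ess_lim (sector azm az0) V' (G (0, 0))"
      "\<And>g. g \<in> BM \<Longrightarrow> (\<lambda>n. LNN t. ind {0<..<h} t * ennreal (norm (\<psi> n (t *\<^sub>R dir azm) - g t))) \<longlonglongrightarrow> 0 \<Longrightarrow>
       AE t in lborel. t \<in> {0<..<h / 8} \<longrightarrow> g t = G (t, 0)"
    show thesis by (rule that[OF G(1,2) G(3)[OF gb \<psi>r[OF disjI1[OF refl]]]])
  qed
  obtain G2 :: "real \<times> real \<Rightarrow> complex" where G2: "continuous_on UNIV G2" "ess_lim (sector az0 azM) V' (G2 (0, 0))"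
    "AE t in lborel. t \<in> {0<..<h / 8} \<longrightarrow> edge_value g azM t = G2 (0, t)"
  proof (rule cone_trace[OF pi(2) cb(1) angles(3) cb(2) sb D(1) DD \<psi>])
    fix G :: "real \<times> real \<Rightarrow> complex" assume G: "continuous_on UNIV G" "ess_lim (sector az0 azM) V' (G (0, 0))"
      "\<And>g. g \<in> BM \<Longrightarrow> (\<lambda>n. LNN t. ind {0<..<h} t * ennreal (norm (\<psi> n (t *\<^sub>R dir azM) - g t))) \<longlonglongrightarrow> 0 \<Longrightarrow>
       AE t in lborel. t \<in> {0<..<h / 8} \<longrightarrow> g t = G (0, t)"
    show thesis by (rule that[OF G(1,2) G(3)[OF gb \<psi>r[OF disjI2[OF refl]]]])
  qed
  \<comment> \<open>The halves meet only in a ray, a null set, so nothing yet relates their limits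
    at the vertex. The middle cone shares a sector of positive opening with each of them and forces
    the values to agree.\<close>
  obtain G3 :: "real \<times> real \<Rightarrow> complex" where G3: "ess_lim (sector (az0 - \<omega>) (az0 + \<omega>)) V' (G3 (0, 0))"
  proof (rule cone_trace[OF cc sc D(1) DD \<psi>])
    fix G :: "real \<times> real \<Rightarrow> complex" assume "ess_lim (sector (az0 - \<omega>) (az0 + \<omega>)) V' (G (0, 0))"
    then show thesis by (rule that)
  qed
  define c where "c = G1 (0, 0)"
  have "G1 (0, 0) = G3 (0, 0)"
    by (rule ess_lim_unique[OF G1(2) G3, of "az0 - \<omega>" az0]) (use \<omega> cc pi in \<open>auto simp: sector_def\<close>)
  moreover have "G2 (0, 0) = G3 (0, 0)"
    by (rule ess_lim_unique[OF G2(2) G3, of az0 "az0 + \<omega>"]) (use \<omega> cc pi in \<open>auto simp: sector_def\<close>)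
  ultimately have c: "G1 (0, 0) = c" "G2 (0, 0) = c" by (simp_all add: c_def)
  have Vc: "ess_lim (sector azm azM) V' c" by (rule ess_lim_sector[OF _ _ ca(1) cb(1)]) (use G1(2) G2(2) c in simp_all)
  obtain r0 where r0: "r0 > 0" "AE x in lborel. x \<in> sector azm azM \<and> norm x < r0 \<longrightarrow> norm (V' x - c) < 1"
    using Vc[unfolded ess_lim_def, rule_format, OF zero_less_one] by blast
  \<comment> \<open>Up to h/8 the traces on the edges are known to be continuous; up to
    \<open>r0\<close> the function v is bounded.\<close>
  define \<delta> where "\<delta> = min (h / 8) r0"
  have \<delta>: "\<delta> > 0" "\<delta> \<le> h / 8" "\<delta> \<le> h" "\<delta> \<le> r0" using r0 h by (auto simp: \<delta>_def)
  have Sb[measurable]: "sector azm azM \<in> sets borel" using open_sector[OF angles] by simp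
  have [measurable]: "ball (0::real^2) \<delta> \<in> sets borel" by simp
  have Vm[measurable]: "V' \<in> BM" "W' \<in> BM" using V' W' by auto
  have Fv: "rep \<Omega> (\<lambda>x. - kk * v x) (\<lambda>x. - kk * V' x)" using rep_mult[OF V'(1), of "\<lambda>x. - kk"] by (simp add: mult.commute)
  have "(\<lambda>x. - kk * (1 + V x) * w x) \<in> borel_measurable (lebesgue_on \<Omega>)"
    using V wsq by (auto simp: square_integrable_def intro!: borel_measurable_times borel_measurable_add)
  then obtain Fw where Fw: "rep \<Omega> (\<lambda>x. - kk * (1 + V x) * w x) Fw" using rep_exists[OF \<Omega>b] by blast
  have Fwm[measurable]: "Fw \<in> BM" using Fw by (simp add: rep_def)
  have "bounded (sector_disc azm azM h)" unfolding sector_disc_def by (rule bounded_subset[OF bounded_ball[of 0 h]]) blast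
  from holder_on_bounded[OF f(1) bounded_closure[OF this] \<alpha>]
  obtain Cf where Cf: "Cf \<ge> 0" "\<And>x. x \<in> sector_disc azm azM h \<Longrightarrow> norm (f x) \<le> Cf" using closure_subset by blast
  define K1 where "K1 = norm kk * (norm c + 1) + norm kk * Cf"
  have K1: "K1 \<ge> 0" using Cf by (simp add: K1_def)
  \<comment> \<open>The Laplacian of v - w. Near the vertex its first part is bounded by continuity
    of v, its second part by the Hoelder function that represents q w.\<close>
  define F0 where "F0 x = - kk * V' x - Fw x" for x
  have F0b: "AE x in lborel. x \<in> sector azm azM \<and> norm x < \<delta> \<longrightarrow> norm (F0 x) \<le> K1"
  proof -
    have "sector_disc azm azM h \<in> sets borel" unfolding sector_disc_def using Sb by simp
    from f(2)[unfolded AE_lebesgue_on_iff[OF this]]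
    have 1: "AE x in lborel. x \<in> sector_disc azm azM h \<longrightarrow> (1 + V x) * w x = f x" .
    have 2: "AE x in lborel. x \<in> \<Omega> \<longrightarrow> - kk * (1 + V x) * w x = Fw x" using Fw by (simp add: rep_def)
    show ?thesis using 1 2 r0(2)
    proof eventually_elim
      case (elim x)
      show ?case
      proof
        assume x: "x \<in> sector azm azM \<and> norm x < \<delta>"
        then have sd: "x \<in> sector_disc azm azM h" "x \<in> \<Omega>" using \<delta> mem_iff[of x] by (auto simp: sector_disc_def)
        have "Fw x = - kk * ((1 + V x) * w x)" using elim(2)[rule_format, OF sd(2)] by (simp add: mult.assoc)
        also have "(1 + V x) * w x = f x" using elim(1) sd by simp
        finally have Fwx: "Fw x = - kk * f x" .
        have "norm (V' x - c) < 1" using elim(3) x \<delta> by simp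
        then have "norm (V' x) \<le> norm c + 1" using norm_triangle_ineq2[of "V' x" c] by simp
        then have "norm (kk * V' x) + norm (kk * f x) \<le> K1"
          unfolding K1_def norm_mult using Cf(2)[OF sd(1)] by (intro add_mono mult_left_mono) auto
        then show "norm (F0 x) \<le> K1" using norm_triangle_ineq4[of "- kk * V' x" "Fw x"] by (simp add: F0_def Fwx norm_mult)
      qed
    qed
  qed
  \<comment> \<open>The bound \<open>K1\<close> holds almost everywhere, the abstract identity asks
    for it everywhere; the exceptional null set is cut out.\<close>
  define F where "F x = (if x \<in> sector azm azM \<inter> ball 0 \<delta> \<and> norm (F0 x) \<le> K1 then F0 x else 0)" for x
  have F0m[measurable]: "F0 \<in> BM" unfolding F0_def[abs_def] by measurable
  have Fm: "F \<in> BM" unfolding F_def[abs_def] by measurable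
  define u where "u x = ind (sector azm azM \<inter> ball 0 \<delta>) x *\<^sub>R (V' x - W' x)" for x
  have ui: "L1 u" unfolding u_def[abs_def]
    by (intro integrable_mult_indicator bochner_diff V'(2) W'(2)) (use Sb in auto)
  note \<eta>m = holder_on_ray[OF \<eta>h(1) \<alpha> h angles(1)] and \<eta>M = holder_on_ray[OF \<eta>h(2) \<alpha> h _ angles(3)]
  have am: "azm < pi" "- pi < azM" using angles by auto
  obtain C1 C2 where C12: "C1 \<ge> 0" "\<And>t. t \<in> {0<..<h} \<Longrightarrow> norm (\<eta> (t *\<^sub>R dir azm)) \<le> C1"
    "C2 \<ge> 0" "\<And>t. t \<in> {0<..<h} \<Longrightarrow> norm (\<eta> (t *\<^sub>R dir azM)) \<le> C2"
    using \<eta>m(2)[OF am(1)] \<eta>M(2)[OF am(2)] by blast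
  define C\<eta> where "C\<eta> = max C1 C2"
  have C\<eta>: "norm (edge_value \<eta> az t) \<le> C\<eta>" if az: "az = azm \<or> az = azM" for az t
  proof (cases "t \<in> {0<..<h}")
    case True
    then show ?thesis using edge_value_eq[OF az, of t \<eta>] C12(2,4)[of t] az by (auto simp: C\<eta>_def)
  next
    case False
    then show ?thesis using C12 by (simp add: edge_value_def C\<eta>_def)
  qed
  have cG: "continuous_on UNIV (\<lambda>t. G1 (t, 0))" "continuous_on UNIV (\<lambda>t. G2 (0, t))"
    by (auto intro!: continuous_on_compose2[OF G1(1)] continuous_on_compose2[OF G2(1)] continuous_intros)
  define bm where "bm t = ind {0<..<\<delta>} t *\<^sub>R (edge_value \<eta> azm t * G1 (t, 0))" for t
  define bM where "bM t = ind {0<..<\<delta>} t *\<^sub>R (edge_value \<eta> azM t * G2 (0, t))" for t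
  obtain K2 where K2: "K2 \<ge> 0" "\<And>t. norm (bm t) \<le> K2" unfolding bm_def using edge_coefficient_bounded[OF C\<eta> cG(1), of azm] by blast
  obtain K3 where K3: "K3 \<ge> 0" "\<And>t. norm (bM t) \<le> K3" unfolding bM_def using edge_coefficient_bounded[OF C\<eta> cG(2), of azM] by blast
  define K where "K = K1 + (K2 + K3)"
  \<comment> \<open>The function u is cut off at radius \<delta>, which changes no integral against
    a test function supported in a smaller ball, and it is zero outside the sector by
    construction.\<close>
  interpret I: corner_identity azm azM \<delta> K u F bm bM
  proof
    show "- pi < azm" "azm < azM" "azM < pi" using angles by simp_all
    show "\<delta> > 0" by (rule \<delta>(1))
    show "L1 u" by (rule ui)
    show "F \<in> BM" by (rule Fm)
    show "u x = 0" "F x = 0" if "x \<notin> sector azm azM" for x using that by (simp_all add: u_def F_def)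
    show "norm (F x) \<le> K" for x using K1 K2(1) K3(1) by (auto simp: F_def K_def)
    show "norm (bm t) \<le> K" "norm (bM t) \<le> K" for t using K1 K2(1) K2(2)[of t] K3(1) K3(2)[of t] by (simp_all add: K_def)
    note [measurable] = edge_value_borel[OF \<eta>, of azm] edge_value_borel[OF \<eta>, of azM] borel_measurable_continuous_onI[OF cG(1)] borel_measurable_continuous_onI[OF cG(2)]
    show "bm \<in> BM" "bM \<in> BM" unfolding bm_def[abs_def] bM_def[abs_def] by measurable
    fix \<phi> :: "real^2 \<Rightarrow> complex" and r assume \<phi>: "smooth \<phi>" "\<And>x. r \<le> norm x \<Longrightarrow> \<phi> x = 0" and r: "r < \<delta>"
    have rh: "r < h" using r \<delta> by simp
    have "(LBINT x. u x * laplacian \<phi> x) = (LBINT x. (V' x - W' x) * laplacian \<phi> x)"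
    proof (rule bochner_cong)
      fix x :: "real^2"
      show "u x * laplacian \<phi> x = (V' x - W' x) * laplacian \<phi> x"
      proof (cases "r < norm x")
        case True
        then have "laplacian \<phi> x = 0" using partial_outside(2)[of r \<phi> x] \<phi>(2) by blast
        then show ?thesis by simp
      next
        case False
        then have nx: "norm x < \<delta>" "norm x < h" using r rh by auto
        show ?thesis
        proof (cases "x \<in> sector azm azM")
          case True then show ?thesis using nx by (simp add: u_def)
        next
          case False
          then have "x \<notin> \<Omega>" using mem_iff nx by blast
          then have "V' x = 0" "W' x = 0" using V'(1) W'(1) by (simp_all add: rep_def)
          then show ?thesis using False by (simp add: u_def)
        qed
      qed
    qed simp
    also have "\<dots> = (LBINT x. (- kk * V' x - Fw x) * \<phi> x) +
      (LBINT t. edge_value \<eta> azm t * edge_value g azm t * \<phi> (t *\<^sub>R dir azm)) +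
      (LBINT t. edge_value \<eta> azM t * edge_value g azM t * \<phi> (t *\<^sub>R dir azM))"
      by (rule transmission_identity[OF tr nd wl jump \<eta> C\<eta> V' W' Fv Fw \<phi> rh])
    also have "(LBINT x. (- kk * V' x - Fw x) * \<phi> x) = (LBINT x. F x * \<phi> x)"
    proof (rule integral_cong_AE)
      note [measurable] = smooth_borel[OF \<phi>(1)] Fm
      show "(\<lambda>x. (- kk * V' x - Fw x) * \<phi> x) \<in> borel_measurable lborel" "(\<lambda>x. F x * \<phi> x) \<in> borel_measurable lborel" by measurable
      show "AE x in lborel. (- kk * V' x - Fw x) * \<phi> x = F x * \<phi> x"
        using F0b
      proof eventually_elim
        case (elim x)
        show ?case
        proof (cases "norm x < \<delta>")
          case True
          show ?thesis
          proof (cases "x \<in> sector azm azM")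
            case x: True
            then have "norm (F0 x) \<le> K1" using elim True by simp
            then have "F x = F0 x" using True x by (simp add: F_def)
            then show ?thesis by (simp add: F0_def)
          next
            case x: False
            have "x \<notin> \<Omega>" using mem_iff[of x] True \<delta> x by simp
            then have "V' x = 0" "Fw x = 0" using V'(1) Fw by (simp_all add: rep_def)
            then show ?thesis using x by (simp add: F_def)
          qed
        next
          case False
          then have "\<phi> x = 0" using r by (intro \<phi>(2)) simp
          then show ?thesis by simp
        qed
      qed
    qed
    also have "(LBINT t. edge_value \<eta> azm t * edge_value g azm t * \<phi> (t *\<^sub>R dir azm)) = (LBINT t. ind {0<..} t *\<^sub>R (bm t * \<phi> (t *\<^sub>R dir azm)))"
      unfolding bm_def by (rule edge_integral_eq[OF \<eta> g cG(1) G1(3) \<phi> r \<delta>(2)])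
    also have "(LBINT t. edge_value \<eta> azM t * edge_value g azM t * \<phi> (t *\<^sub>R dir azM)) = (LBINT t. ind {0<..} t *\<^sub>R (bM t * \<phi> (t *\<^sub>R dir azM)))"
      unfolding bM_def by (rule edge_integral_eq[OF \<eta> g cG(2) G2(3) \<phi> r \<delta>(2)])
    finally show "(LBINT x. u x * laplacian \<phi> x) = (LBINT x. F x * \<phi> x) +
        (LBINT t. ind {0<..} t *\<^sub>R (bm t * \<phi> (t *\<^sub>R dir azm))) +
        (LBINT t. ind {0<..} t *\<^sub>R (bM t * \<phi> (t *\<^sub>R dir azM)))" .
  qed
  \<comment> \<open>On each edge \<eta> tends to its vertex value and the trace of v to
    \<open>c\<close>, the same number on both, so the vertex argument applies with \<beta> =
    \<eta>(0) c.\<close>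
  have "(bm \<longlongrightarrow> \<eta> 0 * c) (at_right 0)"
    unfolding bm_def[abs_def] c(1)[symmetric] by (rule edge_coefficient_tendsto[OF \<eta>m(1)[OF am(1)] _ cG(1) \<delta>(1,3)]) simp
  moreover have "(bM \<longlongrightarrow> \<eta> 0 * c) (at_right 0)"
    unfolding bM_def[abs_def] c(2)[symmetric] by (rule edge_coefficient_tendsto[OF \<eta>M(1)[OF am(2)] _ cG(2) \<delta>(1,3)]) simp
  ultimately have "\<eta> 0 * c = 0" by (rule I.vertex_coefficient_zero[OF _ _ npi])
  then have c0: "c = 0" using \<eta>0 by simp
  have V0: "ess_lim (sector azm azM) V' 0" using Vc c0 by simp
  obtain C r where C: "r > 0" "AE x in lborel. norm x < r \<longrightarrow> norm (u x) \<le> C * sqrt (norm x)"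
    using I.u_vanishes_at_vertex by blast
  \<comment> \<open>On the sector w = v - u, and both terms are small near the vertex: the first by
    its essential limit, the second by the square-root decay.\<close>
  have W0: "ess_lim (sector azm azM) W' 0"
    unfolding ess_lim_def
  proof (intro allI impI)
    fix e :: real assume e: "e > 0"
    obtain r1 where r1: "r1 > 0" "AE x in lborel. x \<in> sector azm azM \<and> norm x < r1 \<longrightarrow> norm (V' x - 0) < e / 2"
      using V0[unfolded ess_lim_def, rule_format, OF half_gt_zero[OF e]] by blast
    \<comment> \<open>Chosen so that |C| s < e/2 even if C = 0; the radius s^2 is what the square
      root in the decay requires.\<close>
    define s where "s = e / 2 / (\<bar>C\<bar> + 1)"
    have s: "s > 0" using e by (simp add: s_def)
    have Cs: "\<bar>C\<bar> * s < e / 2"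
    proof -
      have "\<bar>C\<bar> + 1 \<noteq> 0" by linarith
      from nonzero_eq_divide_eq[OF this, THEN iffD1, OF s_def] have "s * (\<bar>C\<bar> + 1) = e / 2" .
      then show ?thesis using s by (simp add: algebra_simps)
    qed
    show "\<exists>r>0. AE x in lborel. x \<in> sector azm azM \<and> norm x < r \<longrightarrow> norm (W' x - 0) < e"
    proof (intro exI conjI)
      show "0 < min (min r1 r) (min \<delta> (s\<^sup>2))" using r1 C(1) \<delta>(1) s by simp
      show "AE x in lborel. x \<in> sector azm azM \<and> norm x < min (min r1 r) (min \<delta> (s\<^sup>2)) \<longrightarrow> norm (W' x - 0) < e"
        using r1(2) C(2)
      proof eventually_elim
        case (elim x)
        show ?case
        proof
          assume x: "x \<in> sector azm azM \<and> norm x < min (min r1 r) (min \<delta> (s\<^sup>2))"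
          then have "u x = V' x - W' x" by (simp add: u_def)
          moreover have "norm (V' x) < e / 2" using elim(1) x by simp
          moreover have "norm (u x) < e / 2"
          proof -
            have "sqrt (norm x) \<le> s" using x s by (intro real_le_lsqrt) auto
            then have "C * sqrt (norm x) \<le> \<bar>C\<bar> * s" by (intro mult_mono) auto
            moreover have "norm (u x) \<le> C * sqrt (norm x)" using elim(2) x by simp
            ultimately show ?thesis using Cs by linarith
          qed
          ultimately show "norm (W' x - 0) < e" using norm_triangle_ineq4[of "V' x" "u x"] by simp
        qed
      qed
    qed
  qed
  show ?thesis using point_value_zero[OF V'(1) V0] point_value_zero[OF W'(1) W0] by blast
qed

end

theorem theorem2p2:
  fixes \<Omega> :: "(real^2) set"
    and V \<eta> v w :: "real^2 \<Rightarrow> complex"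
    and k h \<alpha> \<theta>\<^sub>m \<theta>\<^sub>M :: real
  assumes "bounded_lipschitz_domain \<Omega>"
    and "essentially_bounded (lebesgue_on \<Omega>) V"
    and "essentially_bounded (surface_measure \<Omega>) \<eta>"
    and "k > 0"
    and "sobolev 2 \<Omega> v"
    and "sobolev 1 \<Omega> w"
    and "conductive_transmission_eigenfunctions \<Omega> k V \<eta> v w"
    and "0 \<in> frontier \<Omega>"
    and "h > 0"
    and "\<Omega> \<inter> ball 0 h = sector_disc \<theta>\<^sub>m \<theta>\<^sub>M h"
    and "0 < \<alpha>" "\<alpha> < 1"
    and "\<exists>f. holder_on \<alpha> (closure (sector_disc \<theta>\<^sub>m \<theta>\<^sub>M h)) f \<and>
           (AE x in lebesgue_on (sector_disc \<theta>\<^sub>m \<theta>\<^sub>M h). (1 + V x) * w x = f x)"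
    and "holder_on \<alpha> (closure (ray_segment \<theta>\<^sub>M h)) \<eta>"
    and "holder_on \<alpha> (closure (ray_segment \<theta>\<^sub>m h)) \<eta>"
    and "sobolev 2 (interior (sector_annulus \<theta>\<^sub>m \<theta>\<^sub>M h)) (\<lambda>x. v x - w x)"
    and "\<eta> 0 \<noteq> 0"
    and "- pi < \<theta>\<^sub>m" "\<theta>\<^sub>m < \<theta>\<^sub>M" "\<theta>\<^sub>M < pi"
    and "\<theta>\<^sub>M - \<theta>\<^sub>m \<noteq> pi"
  shows "point_value \<Omega> v 0 0 \<and> point_value \<Omega> w 0 0"
proof -
  have \<Omega>: "open \<Omega>" "bounded \<Omega>" using assms(1) by (auto simp: bounded_lipschitz_domain_def)
  interpret corner_domain \<Omega> \<theta>\<^sub>m \<theta>\<^sub>M h by (rule corner_domain.intro; fact)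
  obtain f where "holder_on \<alpha> (closure (sector_disc \<theta>\<^sub>m \<theta>\<^sub>M h)) f"
    "AE x in lebesgue_on (sector_disc \<theta>\<^sub>m \<theta>\<^sub>M h). (1 + V x) * w x = f x" using assms(13) by blast
  moreover have "V \<in> borel_measurable (lebesgue_on \<Omega>)" "\<eta> \<in> borel_measurable (surface_measure \<Omega>)"
    using assms(2,3) by (simp_all add: essentially_bounded_def)
  ultimately show ?thesis
    using assms by (intro eigenfunctions_vanish_at_corner[of V \<eta> v k w \<alpha> f])
qed

end
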